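(* Let $N,M,L\in\mathbb{Z}_{\ge 0}$, let $\vec c=(3^N1^M2^L)$ be the sequence consisting of $N$ entries $3$, then $M$ entries $1$, then $L$ entries $2$, and assume $q_{\vec c}:=q_3^Nq_1^Mq_2^L\neq 1$. Let $\vec u=(u_1,\dots,u_{N+M+L})\in(\mathbb{C}\setminus\{0\})^{N+M+L}$, and let $\lambda$ be a partition of $k$. Then $$\lim_{\xi\to t^{-1}}\widetilde\Psi^{(q,\xi)}_\lambda\Big(\mathcal N_\lambda(z_1,\dots,z_k)\prod_{1\le i<j\le k}f^{\vec c}_{11}\Big(\frac{z_j}{z_i}\Big)\,\langle 0|\widetilde T^{\vec c,\vec u}_1(z_1)\cdots\widetilde T^{\vec c,\vec u}_1(z_k)|0\rangle\Big)$$ $$=\mathfrak{QC}_\lambda\big(u_1,\dots,u_N;\;q^{-\frac12}t^{-\frac12}u_{N+1},\dots,q^{-\frac12}t^{-\frac12}u_{N+M};\;q^{\frac12}t^{-1}u_{N+M+1},\dots,q^{\frac12}t^{-1}u_{N+M+L};\,q,t\big),$$ where $\mathfrak{QC}_\lambda$ is the quantum corner polynomial.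
   Context: **Parameters.** $q,t$ are nonzero complex numbers such that $q^at^b=1$ with $a,b\in\mathbb Z$ only if $a=b=0$. Put $q_1=q$, $q_2=q^{-1}t$, $q_3=t^{-1}$, $\kappa_n=(q_1^n-1)(q_2^n-1)(q_3^n-1)$. Fractional powers are fixed with $q_1^{1/2}=q^{1/2}$, $q_2^{1/2}=q^{-1/2}t^{1/2}$, $q_3^{1/2}=t^{-1/2}$ (similarly for fourth roots). Empty sums are $0$, empty products are $1$. **Currents.** For $i\in\{1,2,3\}$ let $\mathcal B^{(i)}$ be the Heisenberg algebra generated by $a^{(i)}_n$ ($n\in\mathbb Z$) with $[a^{(i)}_n,a^{(i)}_m]=\frac{n}{\kappa_n}(q_i^{n/2}-q_i^{-n/2})\delta_{n+m,0}a_0^{(i)}$, and $\mathcal H^{(i)}$ its Fock module generated by a vacuum killed by all $a^{(i)}_n$, $n\ge1$, on which $a_0^{(i)}=1$. Let $\vec c=(c_1,\dots,c_n)\in\{1,2,3\}^n$, $q_{\vec c}=\prod_jq_{c_j}\ne1$, $q_{\vec c}^{1/2}=\prod_j q_{c_j}^{1/2}$. On $\mathcal H^{(c_1)}\otimes\cdots\otimes\mathcal H^{(c_n)}$ let $a^{[j]}_r$ be $a^{(c_j)}_r$ acting on the $j$-th factor, $|0\rangle$ the tensor product of vacua, $\langle0|$ the dual vacuum ($\langle0|a^{[j]}_{-r}=0$ for $r\ge1$, $\langle0|0\rangle=1$). For $r\ge1$ let $$\widetilde b_{\pm r}=\frac{\kappa_r}{r}\sum_{j=1}^n q_{c_j}^{-r/4}\Big(\prod_{m=j+1}^{n}q_{c_m}^{-r/2}\Big)a^{[j]}_{\pm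 r}$$ (the images, in the tensor product of horizontal Fock representations of the quantum toroidal $\mathfrak{gl}_1$ algebra, of the modes of the Cartan currents), and $$\alpha(z)=\exp\Big(-\sum_{r\ge1}\frac{\widetilde b_{-r}z^r}{q_{\vec c}^{r/2}-q_{\vec c}^{-r/2}}\Big),\qquad \beta(z)=\exp\Big(\sum_{r\ge1}\frac{\widetilde b_{r}z^{-r}}{q_{\vec c}^{r/2}-q_{\vec c}^{-r/2}}\Big).$$ Let $$\varphi^{(i)}(z)=\exp\Big(-\sum_{n\ge1}\frac{\kappa_n}{n}q_i^{-n/4}a^{(i)}_{-n}z^n\Big),$$ $$\eta^{(i)}(z)=\exp\Big(\sum_{n\ge1}\frac{\kappa_n}{n}\frac{q_i^{-n/4}}{q_i^{n/2}-q_i^{-n/2}}a^{(i)}_{-n}z^n\Big)\exp\Big(-\sum_{n\ge1}\frac{\kappa_n}{n}\frac{q_i^{n/4}}{q_i^n-1}a^{(i)}_nz^{-n}\Big),$$ $$\Lambda_j(z)=u_j\,\varphi^{(c_1)}(q_{c_1}^{1/2}z)\otimes\cdots\otimes\varphi^{(c_{j-1})}(q_{c_1}^{1/2}\cdots q_{c_{j-1}}^{1/2}z)\otimes\eta^{(c_j)}(q_{c_1}^{1/2}\cdots q_{c_{j-1}}^{1/2}z)\otimes1\otimes\cdots\otimes1,$$ $\widetilde\Lambda^{\vec c,\vec u}_j(z)=\alpha(z)\Lambda_j(z)\beta(z)$, and $$\widetilde T_1^{\vec c,\vec u}(z)=\sum_{j=1}^n\frac{q_{c_j}^{1/2}-q_{c_j}^{-1/2}}{q_3^{1/2}-q_3^{-1/2}}\,\widetilde\Lambda_j^{\vec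 c,\vec u}(z),$$ the first generating current of the quantum corner VOA $q\widetilde Y_{M,L,N}$ when $\vec c=(3^N1^M2^L)$. Further $$f^{\vec c}_{11}(z)=\exp\Big[\sum_{k\ge1}\frac{z^k}{k}\big(q_{\vec c}^{k/2}q_3^{-k/2}-q_{\vec c}^{-k/2}q_3^{k/2}\big)\frac{(q_1^{k/2}-q_1^{-k/2})(q_2^{k/2}-q_2^{-k/2})}{q_{\vec c}^{k/2}-q_{\vec c}^{-k/2}}\Big].$$ The product of the $f_{11}^{\vec c}(z_j/z_i)$ and the vacuum expectation value is the expansion (in powers of $z_j/z_i$, $i<j$) of a rational function of $z_1,\dots,z_k$, and is regarded as that rational function. **Partitions.** A partition $\lambda=(\lambda_1\ge\lambda_2\ge\cdots)$ has $\ell(\lambda)$ nonzero parts and size $|\lambda|=\sum\lambda_i$; it is identified with its Young diagram ($\lambda_i$ boxes in row $i$). $\lambda'$ is the transpose; for a box $s=(i,j)$, $a_\lambda(s)=\lambda_i-j$, $\ell_\lambda(s)=\lambda'_j-i$. **Normalization and specialization.** $\Delta(z)=\frac{(1-q_1q_3^{1/2}z)(1-q_1^{-1}q_3^{-1/2}z)}{(1-q_3^{1/2}z)(1-q_3^{-1/2}z)}$; $I^{(c)}=\{\lambda_1+\dots+\lambda_{c-1}+1,\dots,\lambda_1+\dots+\lambda_c\}$ and $\mathcal N_\lambda(z_1,\dots,z_k)=\prod_{1\le c<d\le\ell(\lambda)}\prod_{i\in I^{(c)},\,j\in I^{(d)}}\Delta(q_3^{-1/2}z_j/z_i)^{-1}$.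 $\widetilde\Psi^{(q,\xi)}_\lambda$ substitutes into a rational function of $z_1,\dots,z_k$ the values $y,qy,\dots,q^{\lambda_1-1}y;\ \xi y,q\xi y,\dots,q^{\lambda_2-1}\xi y;\ \dots;\ \xi^{\ell(\lambda)-1}y,\dots,q^{\lambda_{\ell(\lambda)}-1}\xi^{\ell(\lambda)-1}y$ (in this order), giving a rational function of $\xi,y$. **Tritableaux.** A reverse semi-standard Young tritableau (reverse SSYTT) of type $(N,M,L)$ and shape $\lambda$ is a filling of the boxes of $\lambda$ by elements of $\{1,\dots,N+M+L\}$ (ordinary numbers: $1,\dots,N$; super: $N+1,\dots,N+M$; hyper: $N+M+1,\dots,N+M+L$) such that entries weakly decrease left to right in rows and top to bottom in columns, ordinary numbers strictly decrease down each column, and super numbers strictly decrease along each row. The set of these is $\mathrm{RSSYTT}(N,M,L;\lambda)$. $T_0,T_1,T_2$ are the subdiagrams of $T$ of ordinary, super, hyper entries; $\mathrm{sh}$ denotes shape, $|\cdot|$ number of boxes; $\mathrm{sh}(T_2)$ and $\mathrm{sh}(T_1\sqcup T_2)$ are partitions. $\theta_{\alpha,\beta}$ is the number of boxes in row $\alpha$ of $T$ with entry $\beta$; $\ell(T_2)$ is the number of rows of $T_2$. For $N+M+1\le d\le N+M+L$, $T^{(d)}$ is the partition formed by boxes of $T$ with entries $\ge d$, $T^{(d)}_\zeta$ its $\zeta$-th part, and $T^{(N+M+L+1)}=\emptyset$. **Weights.** $f_{q,t}(u)=(tu;q)_\infty/(qu;q)_\infty$, $(x;q)_\infty=\prod_{i\ge0}(1-xq^i)$;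 only ratios $f_{q,t}(q^nu)/f_{q,t}(u)=\prod_{i=0}^{n-1}\frac{1-q^{i+1}u}{1-tq^iu}$ ($n\ge0$) occur, and they are read as these finite products. For $\mu\subseteq\lambda$, $$\mathfrak C_{\lambda/\mu}(q,t)=\prod_{1\le i\le j\le\ell(\mu)}\frac{f_{q,t}(t^{j-i}q^{\mu_i-\mu_j})f_{q,t}(t^{j-i}q^{\lambda_i-\mu_{j+1}})}{f_{q,t}(t^{j-i}q^{\lambda_i-\mu_j})f_{q,t}(t^{j-i}q^{\mu_i-\mu_{j+1}})},\quad \psi_{\lambda/\mu}(q,t)=\prod_{1\le i\le j\le\ell(\mu)}\frac{f_{q,t}(q^{\mu_i-\mu_j}t^{j-i})f_{q,t}(q^{\lambda_i-\lambda_{j+1}}t^{j-i})}{f_{q,t}(q^{\lambda_i-\mu_j}t^{j-i})f_{q,t}(q^{\mu_i-\lambda_{j+1}}t^{j-i})}.$$ $\psi_{T_0}(q,t)=\prod_{k=1}^N\psi_{\nu^{(k)}/\nu^{(k+1)}}(q,t)$, where $\nu^{(k)}$ is the partition of boxes of $T$ with entry $\ge k$; $\psi_{T_1'}(t,q)=\prod_{k=N+1}^{N+M}\psi_{(\nu^{(k)})'/(\nu^{(k+1)})'}(t,q)$ (roles of $q$ and $t$ interchanged in $\psi$). $H(\mu,q,t)=\prod_{s\in\mu}(q^{a_\mu(s)+1}-t^{\ell_\mu(s)})$. $$\mathcal A_2(T;q,t)=\prod_{d=N+M+1}^{N+M+L}\mathfrak C_{T^{(d)}/T^{(d+1)}}(q,t)\prod_{\zeta=1}^{\ell(T_2)}\prod_{d=N+M+1}^{N+M+L}\prod_{j=1}^{\theta_{\zeta,d}-1}\frac{(1-qt^{-1}q^j)(1-t)}{(1-qt^{-1})(1-tq^j)}$$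 $$\times\prod_{d=N+M+1}^{N+M+L}\prod_{\zeta=1}^{\ell(T_2)}\prod_{\tau=\zeta+1}^{\ell(T_2)}\prod_{\alpha=0}^{\theta_{\zeta,d}-1}\frac{(1-t^{\tau-\zeta+1}q^{T^{(d+1)}_\zeta+\alpha-T^{(d)}_\tau})(1-t^{\tau-\zeta}q^{T^{(d+1)}_\zeta+\alpha-T^{(d+1)}_\tau})}{(1-t^{\tau-\zeta}q^{T^{(d+1)}_\zeta+\alpha-T^{(d)}_\tau})(1-t^{\tau-\zeta+1}q^{T^{(d+1)}_\zeta+\alpha-T^{(d+1)}_\tau})}.$$ $$R_T(q,t)=\mathcal A_2(T;q,t)\,\psi_{T_1'}(t,q)\,\psi_{T_0}(q,t)\,\frac{H(\mathrm{sh}(T_1\sqcup T_2),q,t^{-1})}{H(\mathrm{sh}(T_1\sqcup T_2)',t^{-1},q)}\prod_{\square\in\mathrm{sh}(T_2)}\frac{(t^{-1})^{\ell_{\mathrm{sh}(T_2)}(\square)+1}-q^{a_{\mathrm{sh}(T_2)}(\square)}}{q^{a_{\mathrm{sh}(T_2)}(\square)+1}-(t^{-1})^{\ell_{\mathrm{sh}(T_2)}(\square)}}\Big(\frac{q^{-1}t-1}{t^{-1}-1}\Big)^{|T_2|}.$$ **Quantum corner polynomial.** $\mathfrak{QC}_\lambda(x_1,\dots,x_N;y_1,\dots,y_M;w_1,\dots,w_L;q,t)=\sum_{T\in\mathrm{RSSYTT}(N,M,L;\lambda)}R_T(q,t)\,x_T$, where $x_T$ is the product over all boxes of $T$ of $x_{\text{entry}}$,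 with $x_{N+i}=y_i$, $x_{N+M+j}=w_j$. *)

theory Defs
  imports
    Complex_Main
    "HOL-Library.FuncSet"
    "HOL-Library.Poly_Mapping"
    "HOL-Computational_Algebra.Formal_Power_Series"
    "HOL-Computational_Algebra.Fraction_Field"
begin

section \<open>Fock space\<close>

text \<open>
  The tensor product of the Fock modules is realised as the polynomial ring in the variables
  \<open>x (j, r)\<close> (\<open>j\<close> the tensor factor, \<open>r \<ge> 1\<close>), where \<open>x (j, r)\<close> stands for the operator with
  mode \<open>- r\<close> of the \<open>j\<close>-th factor applied to the vacuum \<open>1\<close>. Creation operators are multiplications,
  annihilation operators are multiples of partial derivatives, see \<open>heis\<close> and
  \<open>heis_commutator\<close> below. Variables with \<open>j\<close> outside the range of factors are never touched.
\<close>

type_synonym fock = "((nat \<times> nat) \<Rightarrow>\<^sub>0 nat) \<Rightarrow>\<^sub>0 complex"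

definition fock_scale :: "complex \<Rightarrow> fock \<Rightarrow> fock" where
  "fock_scale a v = Poly_Mapping.single 0 a * v"

definition fock_mult :: "nat \<times> nat \<Rightarrow> fock \<Rightarrow> fock" where
  "fock_mult x v = Poly_Mapping.single (Poly_Mapping.single x 1) 1 * v"

definition fock_deriv :: "nat \<times> nat \<Rightarrow> fock \<Rightarrow> fock" where
  "fock_deriv x v = (\<Sum>m\<in>Poly_Mapping.keys v.
     Poly_Mapping.single (m - Poly_Mapping.single x 1)
       (of_nat (Poly_Mapping.lookup m x) * Poly_Mapping.lookup v m))"

definition vacuum :: fock where
  "vacuum = 1"

definition dual_vacuum :: "fock \<Rightarrow> complex" where
  "dual_vacuum v = Poly_Mapping.lookup v 0"


lemma lookup_fock_scale: "Poly_Mapping.lookup (fock_scale a v) m = a * Poly_Mapping.lookup v m"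
  unfolding fock_scale_def mult_map_scale_conv_mult[symmetric]
  by (auto simp: Poly_Mapping.map.rep_eq when_def)

lemma lookup_fock_deriv:
  "Poly_Mapping.lookup (fock_deriv x v) m =
     of_nat (Poly_Mapping.lookup m x + 1) * Poly_Mapping.lookup v (m + Poly_Mapping.single x 1)"
proof -
  let ?e = "Poly_Mapping.single x (1::nat)"
  have eq: "n - ?e = m \<longleftrightarrow> n = m + ?e" if "Poly_Mapping.lookup n x > 0" for n
  proof
    assume "n - ?e = m"
    then have "Poly_Mapping.lookup m k = Poly_Mapping.lookup n k - Poly_Mapping.lookup ?e k" for k
      by (metis lookup_minus)
    then show "n = m + ?e"
      using that by (intro poly_mapping_eqI) (auto simp: lookup_add lookup_single when_def)
  qed simp
  have "Poly_Mapping.lookup (fock_deriv x v) m =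
    (\<Sum>n\<in>Poly_Mapping.keys v.
       if n = m + ?e then of_nat (Poly_Mapping.lookup n x) * Poly_Mapping.lookup v n else 0)"
    unfolding fock_deriv_def lookup_sum
  proof (rule sum.cong[OF refl])
    fix n
    show "Poly_Mapping.lookup (Poly_Mapping.single (n - ?e)
            (of_nat (Poly_Mapping.lookup n x) * Poly_Mapping.lookup v n)) m =
          (if n = m + ?e then of_nat (Poly_Mapping.lookup n x) * Poly_Mapping.lookup v n else 0)"
      using eq[of n] by (cases "Poly_Mapping.lookup n x > 0") (auto simp: lookup_single when_def)
  qed
  also have "\<dots> = of_nat (Poly_Mapping.lookup m x + 1) * Poly_Mapping.lookup v (m + ?e)"
    by (simp add: lookup_add in_keys_iff)
  finally show ?thesis .
qed

lemma lookup_fock_mult: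
  "Poly_Mapping.lookup (fock_mult x v) m =
     (if Poly_Mapping.lookup m x > 0
      then Poly_Mapping.lookup v (m - Poly_Mapping.single x 1) else 0)"
proof -
  let ?e = "Poly_Mapping.single x (1::nat)"
  have eq: "m = ?e + n \<longleftrightarrow> Poly_Mapping.lookup m x > 0 \<and> n = m - ?e" for n
  proof
    assume "Poly_Mapping.lookup m x > 0 \<and> n = m - ?e"
    then show "m = ?e + n"
      by (intro poly_mapping_eqI) (auto simp: lookup_add lookup_minus lookup_single when_def)
  qed (auto simp: lookup_add)
  have "Poly_Mapping.lookup (fock_mult x v) m =
     Sum_any (\<lambda>n. Poly_Mapping.lookup v n when m = ?e + n)"
    unfolding fock_mult_def lookup_mult lookup_single
    by (simp add: when_mult)
  also have "\<dots> = (if Poly_Mapping.lookup m x > 0 then Poly_Mapping.lookup v (m - ?e) else 0)"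
    unfolding eq by (cases "Poly_Mapping.lookup m x > 0") simp_all
  finally show ?thesis .
qed

lemma fock_deriv_fock_mult:
  "fock_deriv x (fock_mult y v) = fock_mult y (fock_deriv x v) + (if x = y then v else 0)"
proof (rule poly_mapping_eqI)
  fix m
  let ?ex = "Poly_Mapping.single x (1::nat)" and ?ey = "Poly_Mapping.single y (1::nat)"
  have "m + ?ex - ?ey = m - ?ey + ?ex" if "Poly_Mapping.lookup m y > 0"
    using that
    by (intro poly_mapping_eqI) (auto simp: lookup_add lookup_minus lookup_single when_def)
  then show "Poly_Mapping.lookup (fock_deriv x (fock_mult y v)) m =
      Poly_Mapping.lookup (fock_mult y (fock_deriv x v) + (if x = y then v else 0)) m"
    by (auto simp: lookup_fock_deriv lookup_fock_mult lookup_add lookup_minus lookup_single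
          when_def algebra_simps of_nat_diff)
qed

lemma fock_deriv_commute: "fock_deriv x (fock_deriv y v) = fock_deriv y (fock_deriv x v)"
  by (rule poly_mapping_eqI)
    (auto simp: lookup_fock_deriv lookup_add lookup_single when_def ac_simps)

lemma fock_mult_commute: "fock_mult x (fock_mult y v) = fock_mult y (fock_mult x v)"
  by (simp add: fock_mult_def mult.left_commute)

lemma fock_deriv_scale: "fock_deriv x (fock_scale a v) = fock_scale a (fock_deriv x v)"
  by (rule poly_mapping_eqI) (simp add: lookup_fock_deriv lookup_fock_scale)

lemma fock_mult_scale: "fock_mult x (fock_scale a v) = fock_scale a (fock_mult x v)"
  by (simp add: fock_mult_def fock_scale_def mult.left_commute)


section \<open>Formal currents\<close>

text \<open>
  An operator-valued formal distribution \<open>A(z)\<close> is given by its modes: \<open>A m\<close> is the coefficient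
  of \<open>z\<close> to the power \<open>m\<close>. All products formed below are locally finite: applied to a fixed vector,
  only finitely many summands of \<open>cur_mult\<close> are nonzero (which is what \<open>Sum_any\<close> requires).
\<close>

type_synonym current = "int \<Rightarrow> fock \<Rightarrow> fock"

definition cur_mult :: "current \<Rightarrow> current \<Rightarrow> current" where
  "cur_mult A B = (\<lambda>m v. Sum_any (\<lambda>p. A (m - p) (B p v)))"

definition cur_smult :: "complex \<Rightarrow> current \<Rightarrow> current" where
  "cur_smult a A = (\<lambda>m v. fock_scale a (A m v))"

text \<open>\<open>cur_subst a A\<close> is \<open>A(a z)\<close>.\<close>

definition cur_subst :: "complex \<Rightarrow> current \<Rightarrow> current" where
  "cur_subst a A = (\<lambda>m v. fock_scale (a powi m) (A m v))"

text \<open>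
  \<open>cur_exp \<sigma> X\<close> with \<open>\<sigma> \<in> {1, -1}\<close> is the exponential of the sum of \<open>X r\<close> times \<open>z\<close> to the power
  \<open>\<sigma> r\<close> over \<open>r \<ge> 1\<close>: the \<open>l\<close>-th power of that sum, divided by \<open>l!\<close>, is expanded into words
  \<open>[r\<^sub>1, \<dots>, r\<^sub>l]\<close>.
\<close>

definition cur_exp :: "int \<Rightarrow> (nat \<Rightarrow> fock \<Rightarrow> fock) \<Rightarrow> current" where
  "cur_exp \<sigma> X = (\<lambda>m v.
     \<Sum>rs | (\<forall>r\<in>set rs. 1 \<le> r) \<and> \<sigma> * int (sum_list rs) = m.
       fock_scale (1 / fact (length rs)) (foldr X rs v))"


section \<open>Parameters, Heisenberg operators and the first generating current\<close>

text \<open>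
  \<open>q4\<close> and \<open>t4\<close> are the chosen fourth roots of \<open>q\<close> and \<open>t\<close>; they determine all fractional powers.
  \<open>qpow i r\<close> is \<open>q\<^sub>i\<close> to the power \<open>r/4\<close>.
\<close>

context
  fixes q4 t4 :: complex
begin

definition qpow :: "nat \<Rightarrow> int \<Rightarrow> complex" where
  "qpow i r = (if i = 1 then q4 else if i = 2 then inverse q4 * t4 else inverse t4) powi r"

definition kappa :: "int \<Rightarrow> complex" where
  "kappa n = (\<Prod>i\<in>{1,2,3}. qpow i (4 * n) - 1)"

context
  fixes cs :: "nat list"
begin

definition colour :: "nat \<Rightarrow> nat" where
  "colour j = cs ! (j - 1)"

definition heis_coeff :: "nat \<Rightarrow> int \<Rightarrow> complex" where
  "heis_coeff i n = of_int n / kappa n * (qpow i (2 * n) - qpow i (- 2 * n))"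

text \<open>\<open>heis j n\<close> is the mode \<open>n\<close> of the Heisenberg algebra of colour \<open>c\<^sub>j\<close> acting on the factor \<open>j\<close>.\<close>

definition heis :: "nat \<Rightarrow> int \<Rightarrow> fock \<Rightarrow> fock" where
  "heis j n v =
     (if n < 0 then fock_mult (j, nat (- n)) v
      else if n = 0 then v
      else fock_scale (heis_coeff (colour j) n) (fock_deriv (j, nat n) v))"

lemma kappa_minus:
  assumes "q4 \<noteq> 0" "t4 \<noteq> 0"
  shows "kappa (- n) = - kappa n"
proof -
  define a b where "a = q4 powi (4 * n)" and "b = t4 powi (4 * n)"
  have nz: "a \<noteq> 0" "b \<noteq> 0"
    using assms by (simp_all add: a_def b_def)
  have pos: "qpow 1 (4 * n) = a" "qpow 2 (4 * n) = b / a" "qpow 3 (4 * n) = 1 / b"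
    by (simp_all add: qpow_def a_def b_def power_int_mult_distrib power_int_inverse
        inverse_eq_divide power_int_divide_distrib)
  have inv: "qpow i (4 * - n) = inverse (qpow i (4 * n))" for i
    by (simp add: qpow_def power_int_minus)
  have "kappa n = (a - 1) * ((b / a - 1) * (1 / b - 1))"
    unfolding kappa_def by (simp add: pos[simplified])
  moreover have "kappa (- n) = (1 / a - 1) * ((a / b - 1) * (b - 1))"
    unfolding kappa_def inv by (simp add: pos[simplified] inverse_eq_divide)
  moreover have "(1 / a - 1) * ((a / b - 1) * (b - 1)) = - ((a - 1) * ((b / a - 1) * (1 / b - 1)))"
    using nz by (simp add: field_simps)
  ultimately show ?thesis by simp
qed

lemma heis_commutator:
  assumes "q4 \<noteq> 0" "t4 \<noteq> 0"
  shows "heis j n (heis l m v) - heis l m (heis j n v) =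
     (if j = l \<and> n + m = 0 then fock_scale (heis_coeff (colour j) n) (heis j 0 v) else 0)"
proof -
  have neg: "heis_coeff i (- a) = - heis_coeff i a" for i a
    using kappa_minus[OF assms, of a] by (simp add: heis_coeff_def mult.commute) (simp add: algebra_simps diff_divide_distrib)
  have add: "fock_scale a (v + w) = fock_scale a v + fock_scale a w" for a v w
    by (simp add: fock_scale_def distrib_left)
  have comm: "fock_scale a (fock_scale b v) = fock_scale b (fock_scale a v)" for a b v
    by (simp add: fock_scale_def mult.left_commute)
  have uminus: "fock_scale (- a) v = - fock_scale a v" for a v
    by (simp add: fock_scale_def single_uminus)
  have zero: "heis_coeff i 0 = 0" "fock_scale 0 v = 0" "fock_scale a 0 = 0" for i v a
    by (simp_all add: heis_coeff_def fock_scale_def)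
  consider "n < 0" "m < 0" | "n < 0" "m = 0" | "n < 0" "m > 0" | "n = 0" | "n > 0" "m < 0"
    | "n > 0" "m = 0" | "n > 0" "m > 0" by linarith
  then show ?thesis
  proof cases
    case 3
    have "n + m = 0 \<longleftrightarrow> nat m = nat (- n)" using 3 by linarith
    moreover have "heis_coeff i n = - heis_coeff i m" if "n + m = 0" for i
      using neg[of i m] that by (simp add: add_eq_0_iff2)
    ultimately show ?thesis using 3
      by (auto simp: heis_def fock_mult_scale fock_deriv_fock_mult add uminus zero)
  next
    case 5
    have "n + m = 0 \<longleftrightarrow> nat n = nat (- m)" using 5 by linarith
    then show ?thesis using 5
      by (auto simp: heis_def fock_mult_scale fock_deriv_fock_mult add zero)
  next
    case 7
    then show ?thesis
      by (simp add: heis_def fock_deriv_scale fock_deriv_commute comm)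
  qed (auto simp: heis_def fock_mult_commute zero)
qed

lemma heis_vacuum: "n > 0 \<Longrightarrow> heis j n vacuum = 0"
  by (simp add: heis_def vacuum_def fock_deriv_def fock_scale_def)

lemma dual_vacuum_heis: "n < 0 \<Longrightarrow> dual_vacuum (heis j n v) = 0"
  by (simp add: heis_def dual_vacuum_def lookup_fock_mult)

text \<open>\<open>qc_pow r\<close> is \<open>q\<^sub>c\<close> (for the whole colour vector \<open>c\<close>) to the power \<open>r/2\<close>.\<close>

definition qc_pow :: "int \<Rightarrow> complex" where
  "qc_pow r = (\<Prod>j=1..length cs. qpow (colour j) (2 * r))"

text \<open>\<open>b_tilde r\<close> for \<open>r \<noteq> 0\<close>; the coefficients depend on \<open>\<bar>r\<bar>\<close> only.\<close>

definition b_tilde :: "int \<Rightarrow> fock \<Rightarrow> fock" where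
  "b_tilde r v = (\<Sum>j=1..length cs.
     fock_scale (kappa \<bar>r\<bar> / of_int \<bar>r\<bar> * qpow (colour j) (- \<bar>r\<bar>)
                  * (\<Prod>m=j+1..length cs. qpow (colour m) (- 2 * \<bar>r\<bar>)))
       (heis j r v))"

definition alpha_cur :: current where
  "alpha_cur = cur_exp 1 (\<lambda>r v.
     fock_scale (- 1 / (qc_pow (int r) - qc_pow (- int r))) (b_tilde (- int r) v))"

definition beta_cur :: current where
  "beta_cur = cur_exp (-1) (\<lambda>r v.
     fock_scale (1 / (qc_pow (int r) - qc_pow (- int r))) (b_tilde (int r) v))"

definition phi_cur :: "nat \<Rightarrow> current" where
  "phi_cur j = cur_exp 1 (\<lambda>r v.
     fock_scale (- (kappa (int r) / of_nat r * qpow (colour j) (- int r))) (heis j (- int r) v))"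

definition eta_cur :: "nat \<Rightarrow> current" where
  "eta_cur j = cur_mult
     (cur_exp 1 (\<lambda>r v.
        fock_scale (kappa (int r) / of_nat r *
            (qpow (colour j) (- int r)
              / (qpow (colour j) (2 * int r) - qpow (colour j) (- 2 * int r))))
          (heis j (- int r) v)))
     (cur_exp (-1) (\<lambda>r v.
        fock_scale (- (kappa (int r) / of_nat r *
            (qpow (colour j) (int r) / (qpow (colour j) (4 * int r) - 1))))
          (heis j (int r) v)))"

text \<open>The product of the square roots of \<open>q\<close> of colours \<open>c\<^sub>1, \<dots>, c\<^sub>j\<close>.\<close>

definition shift_arg :: "nat \<Rightarrow> complex" where
  "shift_arg j = (\<Prod>m=1..j. qpow (colour m) 2)"

context
  fixes u :: "nat \<Rightarrow> complex"
begin

definition Lambda_cur :: "nat \<Rightarrow> current" where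
  "Lambda_cur j = cur_smult (u j)
     (foldr cur_mult (map (\<lambda>l. cur_subst (shift_arg l) (phi_cur l)) [1..<j])
        (cur_subst (shift_arg (j - 1)) (eta_cur j)))"

definition Lambda_tilde :: "nat \<Rightarrow> current" where
  "Lambda_tilde j = cur_mult alpha_cur (cur_mult (Lambda_cur j) beta_cur)"

definition T1_tilde :: current where
  "T1_tilde m v = (\<Sum>j=1..length cs.
     fock_scale ((qpow (colour j) 2 - qpow (colour j) (- 2)) / (qpow 3 2 - qpow 3 (- 2)))
       (Lambda_tilde j m v))"

text \<open>
  Coefficient of the monomial with exponent vector \<open>m\<close> (exponent \<open>m i\<close> of \<open>z\<^sub>i\<close>, \<open>1 \<le> i \<le> k\<close>) in
  the vacuum expectation value of \<open>k\<close> currents. It is nonzero only for monomials in the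
  \<open>z\<^sub>j / z\<^sub>i\<close>, \<open>i < j\<close>.
\<close>

definition vev :: "nat \<Rightarrow> (nat \<Rightarrow> int) \<Rightarrow> complex" where
  "vev k m = (if \<forall>i. i \<notin> {1..k} \<longrightarrow> m i = 0
     then dual_vacuum (foldr (\<lambda>i. T1_tilde (m i)) [1..<Suc k] vacuum) else 0)"

end

definition f11 :: "complex fps" where
  "f11 = fps_exp 1 oo Abs_fps (\<lambda>k. if k = 0 then 0 else
     1 / of_nat k *
     (qc_pow (int k) * qpow 3 (- 2 * int k) - qc_pow (- int k) * qpow 3 (2 * int k)) *
     ((qpow 1 (2 * int k) - qpow 1 (- 2 * int k)) * (qpow 2 (2 * int k) - qpow 2 (- 2 * int k))
        / (qc_pow (int k) - qc_pow (- int k))))"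

text \<open>
  Product of all \<open>f11 (z\<^sub>j / z\<^sub>i)\<close>, \<open>i < j\<close>, with the vacuum expectation value, as a formal series:
  \<open>e (i, j)\<close> is the power of \<open>z\<^sub>j / z\<^sub>i\<close> contributed by the factor of \<open>(i, j)\<close>. For fixed \<open>m\<close>
  only finitely many \<open>e\<close> contribute.
\<close>

definition corr_series :: "(nat \<Rightarrow> complex) \<Rightarrow> nat \<Rightarrow> (nat \<Rightarrow> int) \<Rightarrow> complex" where
  "corr_series u k m =
     (let pairs = {(i, j). 1 \<le> i \<and> i < j \<and> j \<le> k} in
      Sum_any (\<lambda>e :: nat \<times> nat \<Rightarrow> nat.
        if e \<in> pairs \<rightarrow>\<^sub>E UNIV then
          (\<Prod>x\<in>pairs. fps_nth f11 (e x)) *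
          vev u k (\<lambda>l. m l - (\<Sum>(i, j)\<in>pairs. int (e (i, j)) * (of_bool (l = j) - of_bool (l = i))))
        else 0))"

end

end


section \<open>Rational functions\<close>

text \<open>
  Rational functions in countably many variables indexed by \<open>nat\<close>. Functions of
  \<open>z\<^sub>1, \<dots>, z\<^sub>k\<close> use the variables \<open>1, \<dots>, k\<close>; functions of \<open>\<xi>, y\<close> use the variables \<open>0\<close> and \<open>1\<close>.
\<close>

type_synonym mpol = "(nat \<Rightarrow>\<^sub>0 nat) \<Rightarrow>\<^sub>0 complex"
type_synonym ratfun = "mpol fract"

definition rf_const :: "complex \<Rightarrow> ratfun" where
  "rf_const a = Fraction_Field.Fract (Poly_Mapping.single 0 a) 1"

definition rf_var :: "nat \<Rightarrow> ratfun" where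
  "rf_var i = Fraction_Field.Fract (Poly_Mapping.single (Poly_Mapping.single i 1) 1) 1"

text \<open>
  \<open>F\<close> is the expansion of \<open>P / Q\<close> iff \<open>Q F = P\<close> as formal series. The series considered here are
  supported on monomials in the \<open>z\<^sub>j / z\<^sub>i\<close> (\<open>i < j\<close>), so multiplication by \<open>Q \<noteq> 0\<close> is injective on
  them and the expansion is the one in powers of \<open>z\<^sub>j / z\<^sub>i\<close>, \<open>i < j\<close>.
\<close>

definition is_expansion :: "((nat \<Rightarrow> int) \<Rightarrow> complex) \<Rightarrow> ratfun \<Rightarrow> bool" where
  "is_expansion F R \<longleftrightarrow> (\<exists>P Q. Q \<noteq> 0 \<and> R = Fraction_Field.Fract P Q \<and>
     (\<forall>m. (\<Sum>n\<in>Poly_Mapping.keys Q.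
             Poly_Mapping.lookup Q n * F (\<lambda>i. m i - int (Poly_Mapping.lookup n i)))
        = (\<Sum>n\<in>Poly_Mapping.keys P.
             if m = (\<lambda>i. int (Poly_Mapping.lookup n i)) then Poly_Mapping.lookup P n else 0)))"

definition rational_of :: "((nat \<Rightarrow> int) \<Rightarrow> complex) \<Rightarrow> ratfun" where
  "rational_of F = (THE R. is_expansion F R)"

text \<open>
  Substitution of elements \<open>p i\<close> of a field into a rational function, coefficients being mapped
  by the embedding \<open>emb\<close>; it makes sense if the denominator of some representation does not vanish.
\<close>

definition mpol_subst :: "(complex \<Rightarrow> 'f :: field) \<Rightarrow> (nat \<Rightarrow> 'f) \<Rightarrow> mpol \<Rightarrow> 'f" where
  "mpol_subst emb p P = (\<Sum>n\<in>Poly_Mapping.keys P. emb (Poly_Mapping.lookup P n) *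
     (\<Prod>i\<in>Poly_Mapping.keys n. p i ^ Poly_Mapping.lookup n i))"

definition rf_subst :: "(complex \<Rightarrow> 'f :: field) \<Rightarrow> (nat \<Rightarrow> 'f) \<Rightarrow> ratfun \<Rightarrow> 'f" where
  "rf_subst emb p R = (THE S. \<exists>P Q. R = Fraction_Field.Fract P Q \<and>
     mpol_subst emb p Q \<noteq> 0 \<and> S = mpol_subst emb p P / mpol_subst emb p Q)"

text \<open>Value at a point \<open>(\<xi>, y)\<close>.\<close>

definition rf_eval2 :: "ratfun \<Rightarrow> complex \<Rightarrow> complex \<Rightarrow> complex" where
  "rf_eval2 R \<xi> y = rf_subst (\<lambda>a. a) (\<lambda>i. if i = 0 then \<xi> else if i = 1 then y else 0) R"


section \<open>Partitions\<close>

text \<open>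
  A partition is a function \<open>lam\<close> with parts \<open>lam 1 \<ge> lam 2 \<ge> \<dots>\<close>; the value at \<open>0\<close> is irrelevant.
\<close>

definition is_partition :: "(nat \<Rightarrow> nat) \<Rightarrow> bool" where
  "is_partition lam \<longleftrightarrow> (\<forall>i\<ge>1. lam (Suc i) \<le> lam i) \<and> finite {i. 1 \<le> i \<and> 0 < lam i}"

definition plength :: "(nat \<Rightarrow> nat) \<Rightarrow> nat" where
  "plength lam = card {i. 1 \<le> i \<and> 0 < lam i}"

definition psize :: "(nat \<Rightarrow> nat) \<Rightarrow> nat" where
  "psize lam = (\<Sum>i=1..plength lam. lam i)"

definition ptranspose :: "(nat \<Rightarrow> nat) \<Rightarrow> nat \<Rightarrow> nat" where
  "ptranspose lam j = card {i. 1 \<le> i \<and> j \<le> lam i}"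

definition diagram :: "(nat \<Rightarrow> nat) \<Rightarrow> (nat \<times> nat) set" where
  "diagram lam = {(i, j). 1 \<le> i \<and> 1 \<le> j \<and> j \<le> lam i}"

text \<open>For boxes inside the diagram the subtractions below do not truncate.\<close>

definition arm :: "(nat \<Rightarrow> nat) \<Rightarrow> nat \<times> nat \<Rightarrow> nat" where
  "arm lam b = lam (fst b) - snd b"

definition leg :: "(nat \<Rightarrow> nat) \<Rightarrow> nat \<times> nat \<Rightarrow> nat" where
  "leg lam b = ptranspose lam (snd b) - fst b"


section \<open>Normalization and specialization\<close>

definition Delta :: "complex \<Rightarrow> complex \<Rightarrow> ratfun \<Rightarrow> ratfun" where
  "Delta q4 t4 z =
     (let a = qpow q4 t4 1 4 * qpow q4 t4 3 2; h = qpow q4 t4 3 2 in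
      ((1 - rf_const a * z) * (1 - rf_const (inverse a) * z))
      / ((1 - rf_const h * z) * (1 - rf_const (inverse h) * z)))"

definition block :: "(nat \<Rightarrow> nat) \<Rightarrow> nat \<Rightarrow> nat set" where
  "block lam c = {(\<Sum>d\<in>{1..<c}. lam d) + 1 .. (\<Sum>d\<in>{1..c}. lam d)}"

definition Norm_factor :: "complex \<Rightarrow> complex \<Rightarrow> (nat \<Rightarrow> nat) \<Rightarrow> ratfun" where
  "Norm_factor q4 t4 lam =
     (\<Prod>(c, d)\<in>{(c, d). 1 \<le> c \<and> c < d \<and> d \<le> plength lam}.
        \<Prod>i\<in>block lam c. \<Prod>j\<in>block lam d.
          inverse (Delta q4 t4 (rf_const (qpow q4 t4 3 (- 2)) * (rf_var j / rf_var i))))"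

text \<open>The list of values \<open>y, q y, \<dots>; \<xi> y, q \<xi> y, \<dots>; \<dots>\<close> as rational functions of \<open>\<xi>, y\<close>.\<close>

definition spec_list :: "complex \<Rightarrow> (nat \<Rightarrow> nat) \<Rightarrow> ratfun list" where
  "spec_list q lam = concat (map (\<lambda>c. map (\<lambda>a. rf_const (q ^ a) * rf_var 0 ^ (c - 1) * rf_var 1)
     [0..<lam c]) [1..<Suc (plength lam)])"

definition Psi_tilde :: "complex \<Rightarrow> (nat \<Rightarrow> nat) \<Rightarrow> ratfun \<Rightarrow> ratfun" where
  "Psi_tilde q lam R =
     rf_subst rf_const (\<lambda>i. if i \<in> {1..psize lam} then spec_list q lam ! (i - 1) else 0) R"


section \<open>Tritableaux and the quantum corner polynomial\<close>

definition RSSYTT :: "nat \<Rightarrow> nat \<Rightarrow> nat \<Rightarrow> (nat \<Rightarrow> nat) \<Rightarrow> (nat \<times> nat \<Rightarrow> nat) set" where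
  "RSSYTT N M L lam = {T \<in> diagram lam \<rightarrow>\<^sub>E {1..N+M+L}.
     (\<forall>i j j'. (i, j) \<in> diagram lam \<and> (i, j') \<in> diagram lam \<and> j < j' \<longrightarrow> T (i, j') \<le> T (i, j)) \<and>
     (\<forall>i i' j. (i, j) \<in> diagram lam \<and> (i', j) \<in> diagram lam \<and> i < i' \<longrightarrow> T (i', j) \<le> T (i, j)) \<and>
     (\<forall>i i' j. (i, j) \<in> diagram lam \<and> (i', j) \<in> diagram lam \<and> i < i' \<and>
        T (i, j) \<in> {1..N} \<and> T (i', j) \<in> {1..N} \<longrightarrow> T (i', j) < T (i, j)) \<and>
     (\<forall>i j j'. (i, j) \<in> diagram lam \<and> (i, j') \<in> diagram lam \<and> j < j' \<and>
        T (i, j) \<in> {N+1..N+M} \<and> T (i, j') \<in> {N+1..N+M} \<longrightarrow> T (i, j') < T (i, j))}"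

text \<open>
  \<open>sub_shape lam T d\<close> is the partition of the boxes of \<open>T\<close> with entries \<open>\<ge> d\<close>. The shapes of
  \<open>T\<^sub>2\<close> and of the union of \<open>T\<^sub>1\<close> and \<open>T\<^sub>2\<close> are the cases \<open>d = N + M + 1\<close> and \<open>d = N + 1\<close>.
\<close>

definition sub_shape :: "(nat \<Rightarrow> nat) \<Rightarrow> (nat \<times> nat \<Rightarrow> nat) \<Rightarrow> nat \<Rightarrow> nat \<Rightarrow> nat" where
  "sub_shape lam T d i = card {j. (i, j) \<in> diagram lam \<and> d \<le> T (i, j)}"

definition theta :: "(nat \<Rightarrow> nat) \<Rightarrow> (nat \<times> nat \<Rightarrow> nat) \<Rightarrow> nat \<Rightarrow> nat \<Rightarrow> nat" where
  "theta lam T a b = card {j. (a, j) \<in> diagram lam \<and> T (a, j) = b}"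

text \<open>
  \<open>f_ratio q t u a b\<close> is the quotient of \<open>f\<close> at \<open>q\<^sup>a u\<close> by \<open>f\<close> at \<open>q\<^sup>b u\<close>, read as a finite product.
\<close>

definition f_ratio :: "complex \<Rightarrow> complex \<Rightarrow> complex \<Rightarrow> int \<Rightarrow> int \<Rightarrow> complex" where
  "f_ratio q t u a b =
     (if b \<le> a
      then (\<Prod>i<nat (a - b). (1 - q ^ (i + 1) * (q powi b * u)) / (1 - t * q ^ i * (q powi b * u)))
      else inverse
        (\<Prod>i<nat (b - a). (1 - q ^ (i + 1) * (q powi a * u)) / (1 - t * q ^ i * (q powi a * u))))"

definition C_skew :: "complex \<Rightarrow> complex \<Rightarrow> (nat \<Rightarrow> nat) \<Rightarrow> (nat \<Rightarrow> nat) \<Rightarrow> complex" where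
  "C_skew q t lam mu = (\<Prod>(i, j)\<in>{(i, j). 1 \<le> i \<and> i \<le> j \<and> j \<le> plength mu}.
     f_ratio q t (t ^ (j - i)) (int (mu i) - int (mu j)) (int (lam i) - int (mu j)) *
     f_ratio q t (t ^ (j - i)) (int (lam i) - int (mu (j + 1))) (int (mu i) - int (mu (j + 1))))"

definition psi_skew :: "complex \<Rightarrow> complex \<Rightarrow> (nat \<Rightarrow> nat) \<Rightarrow> (nat \<Rightarrow> nat) \<Rightarrow> complex" where
  "psi_skew q t lam mu = (\<Prod>(i, j)\<in>{(i, j). 1 \<le> i \<and> i \<le> j \<and> j \<le> plength mu}.
     f_ratio q t (t ^ (j - i)) (int (mu i) - int (mu j)) (int (lam i) - int (mu j)) *
     f_ratio q t (t ^ (j - i)) (int (lam i) - int (lam (j + 1))) (int (mu i) - int (lam (j + 1))))"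

definition psi_T0 :: "complex \<Rightarrow> complex \<Rightarrow> nat \<Rightarrow> (nat \<Rightarrow> nat) \<Rightarrow> (nat \<times> nat \<Rightarrow> nat) \<Rightarrow> complex" where
  "psi_T0 q t N lam T = (\<Prod>k=1..N. psi_skew q t (sub_shape lam T k) (sub_shape lam T (k + 1)))"

definition psi_T1' ::
  "complex \<Rightarrow> complex \<Rightarrow> nat \<Rightarrow> nat \<Rightarrow> (nat \<Rightarrow> nat) \<Rightarrow> (nat \<times> nat \<Rightarrow> nat) \<Rightarrow> complex" where
  "psi_T1' a b N M lam T = (\<Prod>k=N+1..N+M.
     psi_skew a b (ptranspose (sub_shape lam T k)) (ptranspose (sub_shape lam T (k + 1))))"

definition H_hook :: "(nat \<Rightarrow> nat) \<Rightarrow> complex \<Rightarrow> complex \<Rightarrow> complex" where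
  "H_hook mu q t = (\<Prod>b\<in>diagram mu. q ^ (arm mu b + 1) - t ^ leg mu b)"

definition A2_weight ::
  "complex \<Rightarrow> complex \<Rightarrow> nat \<Rightarrow> nat \<Rightarrow> nat \<Rightarrow> (nat \<Rightarrow> nat) \<Rightarrow> (nat \<times> nat \<Rightarrow> nat) \<Rightarrow> complex" where
  "A2_weight q t N M L lam T =
     (let hyper = {N+M+1..N+M+L};
          S = sub_shape lam T;
          l2 = plength (S (N+M+1));
          E = (\<lambda>d z a d' tau. q powi (int (S (d+1) z) + int a - int (S d' tau)))
      in
      (\<Prod>d\<in>hyper. C_skew q t (S d) (S (d+1))) *
      (\<Prod>z=1..l2. \<Prod>d\<in>hyper. \<Prod>j=1..theta lam T z d - 1.
         ((1 - q * inverse t * q ^ j) * (1 - t)) / ((1 - q * inverse t) * (1 - t * q ^ j))) *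
      (\<Prod>d\<in>hyper. \<Prod>z=1..l2. \<Prod>tau=z+1..l2. \<Prod>a<theta lam T z d.
         ((1 - t ^ (tau - z + 1) * E d z a d tau) * (1 - t ^ (tau - z) * E d z a (d+1) tau)) /
         ((1 - t ^ (tau - z) * E d z a d tau) * (1 - t ^ (tau - z + 1) * E d z a (d+1) tau))))"

definition R_weight ::
  "complex \<Rightarrow> complex \<Rightarrow> nat \<Rightarrow> nat \<Rightarrow> nat \<Rightarrow> (nat \<Rightarrow> nat) \<Rightarrow> (nat \<times> nat \<Rightarrow> nat) \<Rightarrow> complex" where
  "R_weight q t N M L lam T =
     (let sh12 = sub_shape lam T (N+1); sh2 = sub_shape lam T (N+M+1) in
      A2_weight q t N M L lam T * psi_T1' t q N M lam T * psi_T0 q t N lam T *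
      (H_hook sh12 q (inverse t) / H_hook (ptranspose sh12) (inverse t) q) *
      (\<Prod>b\<in>diagram sh2. (inverse t ^ (leg sh2 b + 1) - q ^ arm sh2 b) /
                          (q ^ (arm sh2 b + 1) - inverse t ^ leg sh2 b)) *
      ((inverse q * t - 1) / (inverse t - 1)) ^ psize sh2)"

definition QC_poly ::
  "nat \<Rightarrow> nat \<Rightarrow> nat \<Rightarrow> (nat \<Rightarrow> nat) \<Rightarrow> (nat \<Rightarrow> complex) \<Rightarrow> (nat \<Rightarrow> complex) \<Rightarrow> (nat \<Rightarrow> complex)
     \<Rightarrow> complex \<Rightarrow> complex \<Rightarrow> complex" where
  "QC_poly N M L lam x y w q t = (\<Sum>T\<in>RSSYTT N M L lam. R_weight q t N M L lam T *
     (\<Prod>b\<in>diagram lam. if T b \<le> N then x (T b)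
                         else if T b \<le> N + M then y (T b - N) else w (T b - (N + M))))"

end

theory Submission
  imports Defs
begin

text \<open>
  The currents \<open>Lambda_tilde j\<close> are exponentials in the Heisenberg modes, so the correlation function
  is a sum over all maps from \<open>{1..k}\<close> to the colours of products of pair contractions. Together with
  \<open>f11\<close>, every pair contributes a ratio of three linear factors in \<open>z\<^sub>j / z\<^sub>i\<close>, and after the
  specialization the maps become fillings of the diagram of \<open>\<lambda>\<close>.

  As \<open>\<xi>\<close> tends to \<open>1 / t\<close>, a filling whose rows violate the tableau conditions contributes zero for
  all \<open>\<xi>\<close>; the contribution of any other one is a regular function times a power of \<open>1 - t \<xi>\<close>, whose
  exponent is the number of vertically adjacent boxes violating the column conditions minus the number
  of certain diagonally adjacent boxes. Every such diagonal pair shares its lower box with a violating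
  vertical pair, and a leftmost violating pair is not reached in this way: only tritableaux survive.

  For a tritableau the limits of the pair factors are collected by the entry of one of the two
  boxes. For each entry they telescope along the rows of the corresponding strip to one of \<open>psi_skew\<close>,
  its transposed version together with a quotient of hook products, or the factors of \<open>A2_weight\<close>.
\<close>

section \<open>Exponential power series\<close>

text \<open>The rational function is given only through its expansion, so relations are proved for
  modes and formal series until every pair factor is a quotient of linear polynomials. Two
  cancellations make this possible. \<open>beta_cur\<close> contracts trivially with every dressed
  current, by a telescoping sum over the tensor factors. What \<open>alpha_cur\<close> adds in
  degree r depends on the colours only through q_c, as a term in 1 / (q_c^r - 1), and
  \<open>f11\<close> is built to remove exactly this term. The rest is a polynomial in the r-th
  powers of q_1, q_2, q_3, and q_1 q_2 q_3 = 1 turns it into a signed sum of six r-th powers: three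
  linear factors over three.

  At its shifted argument, \<open>Delta\<close> equals the pair factor of a box with a later box of
  smaller entry. Dividing by it across rows makes such pairs contribute exactly 1, so only lower
  boxes whose entry is at least that of the upper box matter. At \<xi> = 1 / t the only linear
  factor that can vanish across rows is 1 - t \<xi>: in numerators for vertical neighbours, in
  denominators for diagonal ones.\<close>

definition exp_series :: "(nat \<Rightarrow> complex) \<Rightarrow> complex fps" where
  "exp_series s = fps_exp 1 oo Abs_fps (\<lambda>r. if r = 0 then 0 else s r)"

lemma exp_series_nth_0 [simp]: "fps_nth (exp_series s) 0 = 1"
  by (simp add: exp_series_def)

lemma exp_series_deriv:
  "fps_deriv (exp_series s) = fps_deriv (Abs_fps (\<lambda>r. if r = 0 then 0 else s r)) * exp_series s"
  unfolding exp_series_def by (subst fps_compose_deriv) (simp_all add: mult.commute)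

lemma exp_series_cong: "(\<And>r. r \<ge> 1 \<Longrightarrow> s r = s' r) \<Longrightarrow> exp_series s = exp_series s'"
  unfolding exp_series_def by (intro arg_cong[where f = "\<lambda>f. fps_exp 1 oo f"] fps_ext) simp

lemma fps_deriv_recurrence:
  fixes F L :: "complex fps"
  assumes "fps_deriv F = fps_deriv L * F" "fps_nth L 0 = 0"
  shows "of_nat n * fps_nth F n = (\<Sum>r=1..n. of_nat r * fps_nth L r * fps_nth F (n - r))"
proof (cases n)
  case (Suc n')
  have "of_nat n * fps_nth F n = fps_nth (fps_deriv F) n'"
    by (simp add: Suc)
  also have "\<dots> = (\<Sum>i=0..n'. of_nat (Suc i) * fps_nth L (Suc i) * fps_nth F (n' - i))"
    unfolding assms(1) fps_mult_nth by (intro sum.cong) (simp_all del: of_nat_Suc)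
  also have "\<dots> = (\<Sum>r=Suc 0..Suc n'. of_nat r * fps_nth L r * fps_nth F (Suc n' - r))"
    unfolding sum.shift_bounds_cl_Suc_ivl by simp
  finally show ?thesis using Suc by simp
qed simp

lemma exp_series_rec:
  "of_nat n * fps_nth (exp_series s) n =
     (\<Sum>r=1..n. of_nat r * s r * fps_nth (exp_series s) (n - r))"
  by (subst fps_deriv_recurrence[OF exp_series_deriv]) (auto intro!: sum.cong)

text \<open>Division by n makes the recurrence determine each coefficient from the earlier ones.
  Both the rescaling rule and uniqueness for the differential equation are reduced to this.\<close>

lemma exp_series_unique_rec:
  assumes 0: "fps_nth F 0 = 1"
    and rec: "\<And>n. of_nat n * fps_nth F n = (\<Sum>r=1..n. of_nat r * s r * fps_nth F (n - r))"
  shows "F = exp_series s"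
proof (rule fps_ext)
  fix n show "fps_nth F n = fps_nth (exp_series s) n"
  proof (induction n rule: less_induct)
    case (less n)
    show ?case
    proof (cases "n = 0")
      case False
      have "of_nat n * fps_nth F n = of_nat n * fps_nth (exp_series s) n"
        unfolding rec exp_series_rec using less by (intro sum.cong) auto
      then show ?thesis using False by simp
    qed (simp add: 0)
  qed
qed

lemma exp_series_unique:
  assumes "fps_nth F 0 = 1"
    and "fps_deriv F = fps_deriv (Abs_fps (\<lambda>r. if r = 0 then 0 else s r)) * F"
  shows "F = exp_series s"
  using assms(1)
  by (rule exp_series_unique_rec, subst fps_deriv_recurrence[OF assms(2)]) (auto intro!: sum.cong)

lemma exp_series_add: "exp_series (\<lambda>r. s r + s' r) = exp_series s * exp_series s'"
proof (rule exp_series_unique[symmetric])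
  have *: "Abs_fps (\<lambda>r. if r = 0 then 0 else s r + s' r) =
      Abs_fps (\<lambda>r. if r = 0 then 0 else s r) + Abs_fps (\<lambda>r. if r = 0 then 0 else s' r)"
    by (rule fps_ext) simp
  show "fps_deriv (exp_series s * exp_series s') =
      fps_deriv (Abs_fps (\<lambda>r. if r = 0 then 0 else s r + s' r)) * (exp_series s * exp_series s')"
    unfolding * by (simp add: exp_series_deriv algebra_simps del: fps_deriv_mult add: fps_deriv_mult)
qed simp

lemma exp_series_zero [simp]: "exp_series (\<lambda>r. 0) = 1"
  by (rule exp_series_unique[symmetric]) (simp_all add: fps_eq_iff)

lemma exp_series_scale:
  "fps_nth (exp_series (\<lambda>r. c ^ r * s r)) n = c ^ n * fps_nth (exp_series s) n"
proof -
  have "Abs_fps (\<lambda>n. c ^ n * fps_nth (exp_series s) n) = exp_series (\<lambda>r. c ^ r * s r)"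
  proof (rule exp_series_unique_rec)
    fix n
    have "of_nat n * fps_nth (Abs_fps (\<lambda>n. c ^ n * fps_nth (exp_series s) n)) n =
        c ^ n * (of_nat n * fps_nth (exp_series s) n)"
      by simp
    also have "\<dots> = (\<Sum>r=1..n. of_nat r * (c ^ r * s r) * (c ^ (n - r) * fps_nth (exp_series s) (n - r)))"
      unfolding exp_series_rec sum_distrib_left
      by (intro sum.cong) (auto simp: power_add[symmetric] mult_ac)
    finally show "of_nat n * fps_nth (Abs_fps (\<lambda>n. c ^ n * fps_nth (exp_series s) n)) n =
        (\<Sum>r=1..n. of_nat r * (c ^ r * s r) * fps_nth (Abs_fps (\<lambda>n. c ^ n * fps_nth (exp_series s) n)) (n - r))"
      by simp
  qed simp
  then show ?thesis by (metis fps_nth_Abs_fps)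
qed

section \<open>Exponentials that are rational functions\<close>

definition linear_fps :: "complex list \<Rightarrow> complex fps" where
  "linear_fps as = prod_list (map (\<lambda>a. 1 - fps_const a * fps_X) as)"

lemma linear_fps_simps [simp]:
  "linear_fps [] = 1" "linear_fps (a # as) = (1 - fps_const a * fps_X) * linear_fps as"
  by (simp_all add: linear_fps_def)

text \<open>The exponent is - log (1 - c X). Its derivative is the geometric series
  \<open>?G\<close>, so the product has derivative 0 and constant term 1.\<close>

lemma exp_series_geometric: "(1 - fps_const c * fps_X) * exp_series (\<lambda>r. c ^ r / of_nat r) = 1"
proof -
  let ?E = "exp_series (\<lambda>r. c ^ r / of_nat r)"
  let ?G = "Abs_fps (\<lambda>r. c ^ Suc r)"
  have geo: "(1 - fps_const c * fps_X) * ?G = fps_const c"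
  proof (rule fps_ext)
    fix n show "fps_nth ((1 - fps_const c * fps_X) * ?G) n = fps_nth (fps_const c) n"
      by (cases n) (simp_all add: left_diff_distrib mult.assoc)
  qed
  have d: "fps_deriv ?E = ?G * ?E"
    unfolding exp_series_deriv by (intro arg_cong[where f = "\<lambda>x. x * ?E"] fps_ext) (simp del: of_nat_Suc)
  have "fps_deriv ((1 - fps_const c * fps_X) * ?E) =
      ((1 - fps_const c * fps_X) * ?G - fps_const c) * ?E"
    by (simp add: d algebra_simps)
  also have "\<dots> = 0" by (simp only: geo) simp
  finally have "fps_deriv ((1 - fps_const c * fps_X) * ?E) = fps_deriv 1" by simp
  then show ?thesis unfolding fps_deriv_eq_iff by simp
qed

lemma exp_series_linear_fps:
  "linear_fps bs * exp_series (\<lambda>r. (\<Sum>b\<leftarrow>bs. b ^ r / of_nat r)) = 1"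
proof (induction bs)
  case (Cons b bs)
  have "linear_fps (b # bs) * exp_series (\<lambda>r. (\<Sum>b\<leftarrow>b # bs. b ^ r / of_nat r)) =
     ((1 - fps_const b * fps_X) * exp_series (\<lambda>r. b ^ r / of_nat r)) *
     (linear_fps bs * exp_series (\<lambda>r. (\<Sum>b\<leftarrow>bs. b ^ r / of_nat r)))"
    by (simp add: exp_series_add mult_ac)
  then show ?case by (simp only: Cons exp_series_geometric) simp
qed simp

text \<open>An exponent made of power sums divided by r is the logarithm of a quotient of products
  of linear polynomials. This is the way contractions become rational; the denominator stands on the
  left so that everything remains a power series.\<close>

lemma exp_series_rational:
  assumes "\<And>r. r \<ge> 1 \<Longrightarrow>
    s r = (\<Sum>b\<leftarrow>bs. b ^ r / of_nat r) - (\<Sum>a\<leftarrow>as. a ^ r / of_nat r)"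
  shows "linear_fps bs * exp_series s = linear_fps as"
proof -
  have "linear_fps bs * exp_series s =
      (linear_fps as * exp_series (\<lambda>r. (\<Sum>a\<leftarrow>as. a ^ r / of_nat r))) * (linear_fps bs * exp_series s)"
    by (simp add: exp_series_linear_fps)
  also have "\<dots> = linear_fps as * (linear_fps bs *
      (exp_series (\<lambda>r. (\<Sum>a\<leftarrow>as. a ^ r / of_nat r)) * exp_series s))"
    by (simp add: mult_ac)
  also have "exp_series (\<lambda>r. (\<Sum>a\<leftarrow>as. a ^ r / of_nat r)) * exp_series s =
      exp_series (\<lambda>r. (\<Sum>b\<leftarrow>bs. b ^ r / of_nat r))"
    unfolding exp_series_add[symmetric] by (rule exp_series_cong) (simp add: assms)
  finally show ?thesis by (simp add: exp_series_linear_fps)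
qed

section \<open>Exchange relations between currents\<close>

lemma fock_scale_simps [simp]:
  "fock_scale a 0 = 0" "fock_scale 0 v = 0" "fock_scale 1 v = v"
  "fock_scale a (fock_scale b v) = fock_scale (a * b) v"
  by (simp_all add: fock_scale_def mult_single mult.assoc[symmetric])

lemma fock_scale_add: "fock_scale a (v + w) = fock_scale a v + fock_scale a w"
  by (simp add: fock_scale_def distrib_left)

lemma fock_scale_add_left: "fock_scale (a + b) v = fock_scale a v + fock_scale b v"
  by (simp add: fock_scale_def single_add distrib_right)

lemma fock_scale_sum: "fock_scale a (sum f A) = (\<Sum>x\<in>A. fock_scale a (f x))"
  by (simp add: fock_scale_def sum_distrib_left)

lemma fock_scale_sum_left: "fock_scale (sum f A) v = (\<Sum>x\<in>A. fock_scale (f x) v)"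
  by (induction A rule: infinite_finite_induct) (simp_all add: fock_scale_add_left)

lemma fock_scale_cancel: "a \<noteq> 0 \<Longrightarrow> fock_scale a v = fock_scale a w \<Longrightarrow> v = w"
  by (metis fock_scale_simps(3,4) left_inverse)

section \<open>Linear operators and functionals on Fock space\<close>

definition linear_op :: "(fock \<Rightarrow> fock) \<Rightarrow> bool" where
  "linear_op f \<longleftrightarrow> (\<forall>v w. f (v + w) = f v + f w) \<and> (\<forall>a v. f (fock_scale a v) = fock_scale a (f v))"

lemma linear_opD:
  assumes "linear_op f"
  shows "f (v + w) = f v + f w" "f (fock_scale a v) = fock_scale a (f v)"
  using assms by (auto simp: linear_op_def)

lemma linear_op_0: "linear_op f \<Longrightarrow> f 0 = 0"
  using linear_opD(1)[of f 0 0] by simp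

lemma linear_op_sum: "linear_op f \<Longrightarrow> f (sum g A) = (\<Sum>x\<in>A. f (g x))"
  by (induction A rule: infinite_finite_induct) (simp_all add: linear_op_0 linear_opD)

lemma linear_op_Sum_any:
  assumes "linear_op f" "finite {x. g x \<noteq> 0}"
  shows "f (Sum_any g) = Sum_any (\<lambda>x. f (g x))"
  unfolding Sum_any.expand_set[of g] linear_op_sum[OF assms(1)]
  by (rule Sum_any.expand_superset[symmetric]) (use assms in \<open>auto simp: linear_op_0\<close>)

lemma linear_op_id: "linear_op (\<lambda>v. v)"
  by (simp add: linear_op_def)

lemma linear_op_zero: "linear_op (\<lambda>v. 0)"
  by (simp add: linear_op_def)

lemma linear_op_scale: "linear_op f \<Longrightarrow> linear_op (\<lambda>v. fock_scale a (f v))"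
  by (simp add: linear_op_def fock_scale_add mult.commute)

lemma linear_op_sumI: "(\<And>x. x \<in> A \<Longrightarrow> linear_op (f x)) \<Longrightarrow> linear_op (\<lambda>v. \<Sum>x\<in>A. f x v)"
  by (simp add: linear_op_def sum.distrib fock_scale_sum)

lemma linear_op_foldr: "(\<And>x. x \<in> set xs \<Longrightarrow> linear_op (f x)) \<Longrightarrow> linear_op (foldr f xs)"
  by (induction xs) (simp_all add: linear_op_def)

definition linear_dual :: "(fock \<Rightarrow> complex) \<Rightarrow> bool" where
  "linear_dual f \<longleftrightarrow> (\<forall>v w. f (v + w) = f v + f w) \<and> (\<forall>a v. f (fock_scale a v) = a * f v)"

lemma linear_dualD:
  assumes "linear_dual f"
  shows "f (v + w) = f v + f w" "f (fock_scale a v) = a * f v"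
  using assms by (auto simp: linear_dual_def)

lemma linear_dual_0: "linear_dual f \<Longrightarrow> f 0 = 0"
  using linear_dualD(1)[of f 0 0] by simp

lemma linear_dual_sum: "linear_dual f \<Longrightarrow> f (sum g A) = (\<Sum>x\<in>A. f (g x))"
  by (induction A rule: infinite_finite_induct) (simp_all add: linear_dual_0 linear_dualD)

lemma linear_dual_vacuum: "linear_dual dual_vacuum"
  by (simp add: linear_dual_def dual_vacuum_def lookup_add lookup_fock_scale)

section \<open>Exponentials of commuting operators, degree by degree\<close>

definition compositions :: "nat \<Rightarrow> nat list set" where
  "compositions n = {rs. (\<forall>r\<in>set rs. 1 \<le> r) \<and> sum_list rs = n}"

text \<open>The part of degree n of the exponential: \<open>cur_exp\<close> equals it in the modes
  of one sign and is zero in the others.\<close>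

definition op_exp :: "(nat \<Rightarrow> fock \<Rightarrow> fock) \<Rightarrow> nat \<Rightarrow> fock \<Rightarrow> fock" where
  "op_exp X n v = (\<Sum>rs\<in>compositions n. fock_scale (1 / fact (length rs)) (foldr X rs v))"

lemma length_le_sum_list: "(\<forall>r\<in>set rs. (1::nat) \<le> r) \<Longrightarrow> length rs \<le> sum_list rs"
  by (induction rs) auto

lemma finite_compositions: "finite (compositions n)"
proof (rule finite_subset)
  show "compositions n \<subseteq> {rs. set rs \<subseteq> {..n} \<and> length rs \<le> n}"
    using length_le_sum_list member_le_sum_list by (fastforce simp: compositions_def)
qed (simp add: finite_lists_length_le)

lemma cur_exp_pos:
  "cur_exp 1 X m = (if m < 0 then (\<lambda>_. 0) else op_exp X (nat m))"
proof -
  have "{rs. (\<forall>r\<in>set rs. 1 \<le> r) \<and> 1 * int (sum_list rs) = m} =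
      (if m < 0 then {} else compositions (nat m))"
    by (auto simp: compositions_def)
  then show ?thesis unfolding cur_exp_def op_exp_def by auto
qed

lemma cur_exp_neg:
  "cur_exp (-1) X m = (if m > 0 then (\<lambda>_. 0) else op_exp X (nat (- m)))"
proof -
  have "{rs. (\<forall>r\<in>set rs. 1 \<le> r) \<and> -1 * int (sum_list rs) = m} =
      (if m > 0 then {} else compositions (nat (- m)))"
    by (auto simp: compositions_def)
  then show ?thesis unfolding cur_exp_def op_exp_def by auto
qed

lemma linear_op_op_exp: "(\<And>r. linear_op (X r)) \<Longrightarrow> linear_op (op_exp X n)"
  unfolding op_exp_def by (intro linear_op_sumI linear_op_scale linear_op_foldr)

lemma compositions_0: "compositions 0 = {[]}"
proof -
  have "rs = []" if "rs \<in> compositions 0" for rs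
    using that by (cases rs) (auto simp: compositions_def)
  then show ?thesis by (auto simp: compositions_def)
qed

lemma op_exp_0 [simp]: "op_exp X 0 v = v"
  by (simp add: op_exp_def compositions_0)

context
  fixes X :: "nat \<Rightarrow> fock \<Rightarrow> fock"
  assumes lin: "\<And>r. linear_op (X r)"
begin

text \<open>Fixing the word length l isolates the l-th power of the sum of all X r, so that the
  factorials can be treated separately.\<close>

private definition words :: "nat \<Rightarrow> nat \<Rightarrow> fock \<Rightarrow> fock" where
  "words l n v = (\<Sum>rs\<in>{rs \<in> compositions n. length rs = l}. foldr X rs v)"

private lemma words_Suc: "words (Suc l) n v = (\<Sum>r=1..n. X r (words l (n - r) v))"
proof -
  have "words (Suc l) n v =
      (\<Sum>(r, rs)\<in>(SIGMA r:{1..n}. {rs \<in> compositions (n - r). length rs = l}). X r (foldr X rs v))"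
    unfolding words_def
  proof (rule sum.reindex_bij_witness[where j = "\<lambda>rs. (hd rs, tl rs)" and i = "\<lambda>(r, rs). r # rs"])
    fix rs assume "rs \<in> {rs \<in> compositions n. length rs = Suc l}"
    then show "(hd rs, tl rs) \<in> (SIGMA r:{1..n}. {rs \<in> compositions (n - r). length rs = l})"
      by (cases rs) (auto simp: compositions_def)
  next
    fix b assume "b \<in> (SIGMA r:{1..n}. {rs \<in> compositions (n - r). length rs = l})"
    then show "(case b of (r, rs) \<Rightarrow> r # rs) \<in> {rs \<in> compositions n. length rs = Suc l}"
      by (auto simp: compositions_def)
  next
    fix rs assume "rs \<in> {rs \<in> compositions n. length rs = Suc l}"
    then show "(case (hd rs, tl rs) of (r, rs) \<Rightarrow> X r (foldr X rs v)) = foldr X rs v"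
      by (cases rs) auto
  qed (auto simp: length_Suc_conv)
  also have "\<dots> = (\<Sum>r=1..n. X r (words l (n - r) v))"
    unfolding words_def linear_op_sum[OF lin]
    by (subst sum.Sigma) (auto simp: finite_compositions)
  finally show ?thesis .
qed

private lemma op_exp_words:
  assumes "n \<le> k" shows "op_exp X n v = (\<Sum>l\<le>k. fock_scale (1 / fact l) (words l n v))"
proof -
  have "op_exp X n v = (\<Sum>l\<le>k. \<Sum>rs\<in>{rs \<in> compositions n. length rs = l}.
      fock_scale (1 / fact (length rs)) (foldr X rs v))"
    unfolding op_exp_def
  proof (rule sum.group[symmetric])
    show "length ` compositions n \<subseteq> {..k}"
      using length_le_sum_list assms by (force simp: compositions_def)
  qed (simp_all add: finite_compositions)
  also have "\<dots> = (\<Sum>l\<le>k. fock_scale (1 / fact l) (words l n v))"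
    unfolding words_def fock_scale_sum by (intro sum.cong) auto
  finally show ?thesis .
qed

lemma foldr_commute:
  assumes "linear_op Y" "\<And>r v. r \<in> set rs \<Longrightarrow> Y (X r v) = X r (Y v)"
  shows "Y (foldr X rs v) = foldr X rs (Y v)"
  using assms(2) by (induction rs) auto

lemma op_exp_commute:
  assumes "linear_op Y" "\<And>r v. r \<ge> 1 \<Longrightarrow> Y (X r v) = X r (Y v)"
  shows "Y (op_exp X n v) = op_exp X n (Y v)"
  unfolding op_exp_def linear_op_sum[OF assms(1)]
  by (intro sum.cong refl)
    (auto simp: linear_opD[OF assms(1)] compositions_def intro!: foldr_commute assms arg_cong2[where f =
        fock_scale])

text \<open>This is z d/dz exp X(z) = (z d/dz X(z)) exp X(z) read off in degree n, which holds
  because the X r commute. With it, operator exponentials can be handled by induction on the degree,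
  like the scalar ones in \<open>exp_series_rec\<close>.\<close>

lemma op_exp_rec:
  assumes comm: "\<And>r s v. X r (X s v) = X s (X r v)"
  shows "fock_scale (of_nat n) (op_exp X n v) =
     (\<Sum>r=1..n. fock_scale (of_nat r) (X r (op_exp X (n - r) v)))"
proof -
  \<comment> \<open>The weight n of a word of l + 1 letters is the sum of its letters, and by
    commutativity every position contributes as much as the first one.\<close>
  have len: "fock_scale (of_nat n) (words (Suc l) n v) =
      fock_scale (of_nat (Suc l)) (\<Sum>r=1..n. fock_scale (of_nat r) (X r (words l (n - r) v)))" for l n
  proof (induction l arbitrary: n)
    case 0
    have "words 0 m v = (if m = 0 then v else 0)" for m
    proof -
      have "{rs \<in> compositions m. length rs = 0} = (if m = 0 then {[]} else {})"
        by (auto simp: compositions_def)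
      then show ?thesis by (simp add: words_def)
    qed
    then have *: "words (Suc 0) n v = (if n = 0 then 0 else X n v)"
        "(\<Sum>r=1..n. fock_scale (of_nat r) (X r (words 0 (n - r) v))) =
         (if n = 0 then 0 else fock_scale (of_nat n) (X n v))"
    proof -
      assume w: "\<And>m. words 0 m v = (if m = 0 then v else 0)"
      have "(\<Sum>r=1..n. f r (X r (if n - r = 0 then v else 0))) =
         (if n = 0 then 0 else f n (X n v))" if "\<And>r. f r 0 = 0" for f :: "nat \<Rightarrow> fock \<Rightarrow> fock"
      proof (cases "n = 0")
        case False
        then have "{1..n} = insert n {1..<n}" by auto
        then show ?thesis using False by (simp add: that linear_op_0[OF lin])
      qed simp
      from this[of "\<lambda>_ v. v"] this[of "\<lambda>r. fock_scale (of_nat r)"]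
      show "words (Suc 0) n v = (if n = 0 then 0 else X n v)"
        "(\<Sum>r=1..n. fock_scale (of_nat r) (X r (words 0 (n - r) v))) =
         (if n = 0 then 0 else fock_scale (of_nat n) (X n v))"
        unfolding words_Suc w by auto
    qed
    show ?case unfolding * by simp
  next
    case (Suc l)
    let ?S = "\<lambda>r. \<Sum>s=1..n-r. fock_scale (of_nat s) (X s (words l (n - r - s) v))"
    \<comment> \<open>Split n = r + (n - r), where r is the first letter. The first summand is
      already in the desired form; the second one is treated by the induction hypothesis, after
      which the two leading letters are exchanged.\<close>
    have "fock_scale (of_nat n) (words (Suc (Suc l)) n v) =
        (\<Sum>r=1..n. fock_scale (of_nat r) (X r (words (Suc l) (n - r) v)) +
          X r (fock_scale (of_nat (n - r)) (words (Suc l) (n - r) v)))"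
      unfolding words_Suc[of "Suc l"] fock_scale_sum
      by (intro sum.cong refl)
        (auto simp: linear_opD[OF lin] fock_scale_add_left[symmetric] of_nat_add[symmetric] simp del:
            of_nat_add)
    also have "\<dots> = (\<Sum>r=1..n. fock_scale (of_nat r) (X r (words (Suc l) (n - r) v))) +
        fock_scale (of_nat (Suc l)) (\<Sum>r=1..n. X r (?S r))"
      unfolding Suc.IH linear_opD(2)[OF lin] sum.distrib fock_scale_sum[of _ _ "{1..n}"] ..
    also have "(\<Sum>r=1..n. X r (?S r)) =
        (\<Sum>r=1..n. \<Sum>s=1..n-r. fock_scale (of_nat s) (X s (X r (words l (n - r - s) v))))"
      by (simp add: linear_op_sum[OF lin] linear_opD[OF lin] comm)
    also have "\<dots> = (\<Sum>s=1..n. \<Sum>r=1..n-s. fock_scale (of_nat s) (X s (X r (words l (n - s - r) v))))"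
      by (subst sum.Sigma, simp, simp, subst sum.Sigma, simp, simp)
        (rule sum.reindex_bij_witness[where j = "\<lambda>(r, s). (s, r)" and i = "\<lambda>(r, s). (s, r)"],
         auto simp: add.commute)
    also have "\<dots> = (\<Sum>s=1..n. fock_scale (of_nat s) (X s (words (Suc l) (n - s) v)))"
      unfolding words_Suc by (simp add: linear_op_sum[OF lin] fock_scale_sum)
    finally show ?case
      unfolding of_nat_Suc[of "Suc l"] fock_scale_add_left by (simp del: of_nat_Suc)
  qed
  have "fock_scale (of_nat n) (op_exp X n v) =
      (\<Sum>l\<le>Suc n. fock_scale (1 / fact l) (fock_scale (of_nat n) (words l n v)))"
    by (simp add: op_exp_words[of n "Suc n"] fock_scale_sum fock_scale_add mult.commute)
  also have "\<dots> = fock_scale (of_nat n) (words 0 n v) +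
      (\<Sum>l\<le>n. fock_scale (1 / fact (Suc l)) (fock_scale (of_nat n) (words (Suc l) n v)))"
    by (subst sum.atMost_Suc_shift) simp
  also have "fock_scale (of_nat n) (words 0 n v) = 0"
  proof -
    have "{rs \<in> compositions n. length rs = 0} = (if n = 0 then {[]} else {})"
      by (auto simp: compositions_def)
    then show ?thesis by (simp add: words_def)
  qed
  also have "(\<Sum>l\<le>n. fock_scale (1 / fact (Suc l)) (fock_scale (of_nat n) (words (Suc l) n v))) =
      (\<Sum>l\<le>n. \<Sum>r=1..n. fock_scale (of_nat r) (X r (fock_scale (1 / fact l) (words l (n - r) v))))"
    unfolding len fock_scale_sum
    by (intro sum.cong refl) (simp_all add: linear_opD[OF lin] mult_ac del: of_nat_Suc)
  also have "\<dots> = (\<Sum>r=1..n. fock_scale (of_nat r) (X r (op_exp X (n - r) v)))"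
    by (subst sum.swap) (simp add: op_exp_words[of _ n] linear_op_sum[OF lin] fock_scale_sum)
  finally show ?thesis by simp
qed

end

lemma sum_triangle_swap:
  fixes g :: "nat \<Rightarrow> nat \<Rightarrow> 'a :: comm_monoid_add"
  shows "(\<Sum>r=1..n. \<Sum>e\<le>n-r. g r e) = (\<Sum>e\<le>n. \<Sum>r=1..n-e. g r e)"
  by (subst sum.Sigma, simp, simp, subst sum.Sigma, simp, simp)
    (rule sum.reindex_bij_witness[where j = "\<lambda>(r, e). (e, r)" and i = "\<lambda>(e, r). (r, e)"], auto)

lemma sum_triangle_diag:
  fixes g :: "nat \<Rightarrow> nat \<Rightarrow> 'a :: comm_monoid_add"
  shows "(\<Sum>r=1..n. \<Sum>e\<le>n-r. g r e) = (\<Sum>f\<le>n. \<Sum>r=1..f. g r (f - r))"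
  by (subst sum.Sigma, simp, simp, subst sum.Sigma, simp, simp)
    (rule sum.reindex_bij_witness[where j = "\<lambda>(r, e). (r + e, r)" and i = "\<lambda>(f, r). (r, f - r)"], auto)

lemma sum_triangle_swap0:
  fixes g :: "nat \<Rightarrow> nat \<Rightarrow> 'a :: comm_monoid_add"
  shows "(\<Sum>r\<le>n. \<Sum>e\<le>n-r. g r e) = (\<Sum>e\<le>n. \<Sum>r\<le>n-e. g r e)"
  by (subst sum.Sigma, simp, simp, subst sum.Sigma, simp, simp)
    (rule sum.reindex_bij_witness[where j = "\<lambda>(r, e). (e, r)" and i = "\<lambda>(e, r). (r, e)"], auto)

lemma sum_triangle_diag0:
  fixes g :: "nat \<Rightarrow> nat \<Rightarrow> 'a :: comm_monoid_add"
  shows "(\<Sum>r\<le>n. \<Sum>e\<le>n-r. g r e) = (\<Sum>f\<le>n. \<Sum>r\<le>f. g r (f - r))"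
  by (subst sum.Sigma, simp, simp, subst sum.Sigma, simp, simp)
    (rule sum.reindex_bij_witness[where j = "\<lambda>(r, e). (r + e, r)" and i = "\<lambda>(f, r). (r, f - r)"], auto)

lemma Sum_any_sum:
  assumes "finite S" "\<And>e. e \<in> S \<Longrightarrow> finite {p. g e p \<noteq> 0}"
  shows "Sum_any (\<lambda>p. \<Sum>e\<in>S. g e p) = (\<Sum>e\<in>S. Sum_any (g e))"
  using assms
proof (induction S rule: finite_induct)
  case (insert x S)
  have "finite (\<Union>e\<in>S. {p. g e p \<noteq> 0})" using insert by auto
  then have "finite {p. (\<Sum>e\<in>S. g e p) \<noteq> 0}"
    by (rule finite_subset[rotated]) (auto dest: sum.not_neutral_contains_not_neutral)
  with insert show ?case by (simp add: Sum_any.distrib)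
qed simp

lemma Sum_any_shift: "Sum_any (\<lambda>p. g (p + c)) = Sum_any g" for c :: int
  by (rule Sum_any.reindex_cong[symmetric, where l = "\<lambda>p. p + c"])
    (auto intro!: inj_onI bij_betw_imp_surj bij_betw_byWitness[where f' = "\<lambda>p. p - c"])

section \<open>Creation currents, annihilation currents and exchange relations\<close>

definition annihilation :: "current \<Rightarrow> bool" where
  "annihilation A \<longleftrightarrow> (\<forall>m. linear_op (A m)) \<and> (\<forall>m>0. \<forall>v. A m v = 0) \<and>
     (\<forall>v. \<exists>B. \<forall>m<B. A m v = 0) \<and> (\<forall>m. A m vacuum = (if m = 0 then vacuum else 0))"

definition creation :: "current \<Rightarrow> bool" where
  "creation C \<longleftrightarrow> (\<forall>m. linear_op (C m)) \<and> (\<forall>m<0. \<forall>v. C m v = 0) \<and>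
     (\<forall>m v. dual_vacuum (C m v) = (if m = 0 then dual_vacuum v else 0))"

text \<open>Modes bounded below on each vector: this is what makes a product with a creation current
  on the left, or with an annihilation current on the right, locally finite, and it is inherited by
  such products.\<close>

definition field_cur :: "current \<Rightarrow> bool" where
  "field_cur V \<longleftrightarrow> (\<forall>m. linear_op (V m)) \<and> (\<forall>v. \<exists>B. \<forall>m<B. V m v = 0)"

definition locally_finite :: "current \<Rightarrow> current \<Rightarrow> bool" where
  "locally_finite V W \<longleftrightarrow> (\<forall>m v. finite {p. V (m - p) (W p v) \<noteq> 0})"

text \<open>The mode form of A(w) V(z) = exp (sum of s r (z / w)^r) V(z) A(w). It is meant for
  annihilation currents A, whose modes of positive index vanish; hence the modes - n on the left and
  the bound e \<le> n on the right.\<close>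

definition exchange :: "current \<Rightarrow> current \<Rightarrow> (nat \<Rightarrow> complex) \<Rightarrow> bool" where
  "exchange A V s \<longleftrightarrow> (\<forall>n m v. A (- int n) (V m v) =
     (\<Sum>e\<le>n. fock_scale (fps_nth (exp_series s) e) (V (m - int e) (A (int e - int n) v))))"

lemma creation_field: "creation C \<Longrightarrow> field_cur C"
  unfolding creation_def field_cur_def by blast

lemma annihilation_field: "annihilation A \<Longrightarrow> field_cur A"
  unfolding annihilation_def field_cur_def by blast

lemma field_linear: "field_cur V \<Longrightarrow> linear_op (V m)"
  by (simp add: field_cur_def)

lemma locally_finite_creation:
  assumes "creation C" "field_cur W"
  shows "locally_finite C W"
  unfolding locally_finite_def
proof (intro allI)
  fix m v
  obtain B where B: "\<And>p. p < B \<Longrightarrow> W p v = 0" using assms unfolding field_cur_def by blast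
  have "p \<in> {B..m}" if "C (m - p) (W p v) \<noteq> 0" for p
  proof -
    have "W p v \<noteq> 0" using that linear_op_0[of "C (m - p)"] assms(1) by (auto simp: creation_def)
    moreover have "\<not> m - p < 0" using that assms(1) by (auto simp: creation_def)
    ultimately show ?thesis using B[of p] by force
  qed
  then have "{p. C (m - p) (W p v) \<noteq> 0} \<subseteq> {B..m}" by blast
  then show "finite {p. C (m - p) (W p v) \<noteq> 0}" using finite_subset by blast
qed

lemma locally_finite_annihilation:
  assumes "field_cur V" "annihilation A"
  shows "locally_finite V A"
  unfolding locally_finite_def
proof (intro allI)
  fix m v
  obtain B where B: "\<And>p. p < B \<Longrightarrow> A p v = 0" using assms unfolding annihilation_def by blast
  have "p \<in> {B..0}" if "V (m - p) (A p v) \<noteq> 0" for p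
  proof -
    have "A p v \<noteq> 0" using that assms(1) linear_op_0[of "V (m - p)"] by (auto simp: field_cur_def)
    then show ?thesis using B[of p] assms(2) unfolding annihilation_def
      by (meson atLeastAtMost_iff not_le)
  qed
  then have "{p. V (m - p) (A p v) \<noteq> 0} \<subseteq> {B..0}" by blast
  then show "finite {p. V (m - p) (A p v) \<noteq> 0}" using finite_subset by blast
qed

lemma linear_op_cur_mult:
  assumes "locally_finite V W" "field_cur V" "field_cur W"
  shows "linear_op (cur_mult V W m)"
proof -
  have fin: "finite {p. V (m - p) (W p v) \<noteq> 0}" for v
    using assms(1) by (simp add: locally_finite_def)
  show ?thesis
    unfolding linear_op_def cur_mult_def
    using fin linear_op_Sum_any[OF linear_op_scale[OF linear_op_id] fin]
    by (auto simp: linear_opD[OF field_linear] assms Sum_any.distrib)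
qed

lemma field_cur_mult_creation:
  assumes "creation C" "field_cur W"
  shows "field_cur (cur_mult C W)"
  unfolding field_cur_def
proof (intro conjI allI)
  show "linear_op (cur_mult C W m)" for m
    using assms by (intro linear_op_cur_mult locally_finite_creation) (simp_all add: creation_field)
  fix v
  obtain B where B: "\<And>p. p < B \<Longrightarrow> W p v = 0" using assms unfolding field_cur_def by blast
  have "C (m - p) (W p v) = 0" if "m < B" for m p
  proof (cases "p < B")
    case True
    then show ?thesis using B linear_op_0[of "C (m - p)"] assms(1) by (simp add: creation_def)
  next
    case False
    then show ?thesis using assms(1) that by (simp add: creation_def)
  qed
  then show "\<exists>B. \<forall>m<B. cur_mult C W m v = 0" by (intro exI[of _ B]) (simp add: cur_mult_def)
qed

lemma field_cur_mult_annihilation: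
  assumes "field_cur V" "annihilation A"
  shows "field_cur (cur_mult V A)"
  unfolding field_cur_def
proof (intro conjI allI)
  show "linear_op (cur_mult V A m)" for m
    using assms by (intro linear_op_cur_mult locally_finite_annihilation) (simp_all add: annihilation_field)
  fix v
  obtain B where B: "\<And>p. p < B \<Longrightarrow> A p v = 0" using assms unfolding annihilation_def by blast
  have "\<forall>p. \<exists>B'. \<forall>m<B'. V m (A p v) = 0" using assms(1) by (auto simp: field_cur_def)
  then obtain b where b: "\<And>p m. m < b p \<Longrightarrow> V m (A p v) = 0" by metis
  \<comment> \<open>The bound for V depends on the vector \<open>A p v\<close>, but only the
    finitely many p from B to 0 can give a nonzero vector.\<close>
  define B' where "B' = Min (insert 0 ((\<lambda>p. b p + p) ` {B..0}))"
  have "V (m - p) (A p v) = 0" if "m < B'" for m p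
  proof (cases "p \<in> {B..0}")
    case True
    then have "B' \<le> b p + p" unfolding B'_def by (intro Min_le) auto
    then show ?thesis using that by (intro b) simp
  next
    case False
    then have "A p v = 0" using B[of p] assms(2) unfolding annihilation_def
      by (meson atLeastAtMost_iff not_le)
    then show ?thesis using assms(1) linear_op_0[of "V (m - p)"] by (simp add: field_cur_def)
  qed
  then show "\<exists>B. \<forall>m<B. cur_mult V A m v = 0" by (intro exI[of _ B']) (simp add: cur_mult_def)
qed

lemma cur_mult_annihilation:
  assumes "annihilation A" "annihilation A'"
  shows "cur_mult A A' (- int n) v = (\<Sum>p\<le>n. A (int p - int n) (A' (- int p) v))"
proof -
  have "cur_mult A A' (- int n) v = (\<Sum>p\<in>{- int n..0}. A (- int n - p) (A' p v))"
    unfolding cur_mult_def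
  proof (rule Sum_any.expand_superset)
    show "{p. A (- int n - p) (A' p v) \<noteq> 0} \<subseteq> {- int n..0}"
    proof
      fix p assume "p \<in> {p. A (- int n - p) (A' p v) \<noteq> 0}"
      then have *: "A (- int n - p) (A' p v) \<noteq> 0" by simp
      have "\<not> - int n - p > 0" using * assms(1) by (auto simp: annihilation_def)
      moreover have "A' p v \<noteq> 0"
        using * linear_op_0[of "A (- int n - p)"] assms(1) by (auto simp: annihilation_def)
      then have "\<not> p > 0" using assms(2) by (auto simp: annihilation_def)
      ultimately show "p \<in> {- int n..0}" by simp
    qed
  qed simp
  also have "\<dots> = (\<Sum>p\<le>n. A (int p - int n) (A' (- int p) v))"
    by (rule sum.reindex_bij_witness[where j = "\<lambda>p. nat (- p)" and i = "\<lambda>p. - int p"])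
      (auto intro!: fun_cong[OF arg_cong[where f = A]])
  finally show ?thesis .
qed

lemma cur_mult_annihilation_pos:
  assumes "annihilation A" "annihilation A'" "m > 0"
  shows "cur_mult A A' m v = 0"
proof -
  have "A (m - p) (A' p v) = 0" for p
    using assms linear_op_0 unfolding annihilation_def
    by (cases "p > 0") auto
  then show ?thesis by (simp add: cur_mult_def)
qed

lemma annihilation_mult:
  assumes "annihilation A" "annihilation A'"
  shows "annihilation (cur_mult A A')"
proof -
  have F: "field_cur (cur_mult A A')"
    using assms by (intro field_cur_mult_annihilation) (simp_all add: annihilation_field)
  have "cur_mult A A' m vacuum = (if m = 0 then vacuum else 0)" for m
  proof (cases "m \<le> 0")
    case True
    then obtain n where n: "m = - int n" by (metis nonneg_int_cases neg_0_le_iff_le minus_minus)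
    have "A (int p - int n) (A' (- int p) vacuum) = (if p = 0 then A (- int n) vacuum else 0)" for p
      using assms linear_op_0 by (auto simp: annihilation_def)
    then show ?thesis
      using assms(1) unfolding n cur_mult_annihilation[OF assms] by (auto simp: annihilation_def)
  qed (simp add: cur_mult_annihilation_pos assms)
  then show ?thesis
    using F cur_mult_annihilation_pos[OF assms] by (auto simp: annihilation_def field_cur_def)
qed

text \<open>A passes V and then W, and the two scalar exponentials multiply;
  \<open>exp_series_add\<close> turns this product into the sum of the exponents.\<close>

lemma exchange_mult_right:
  assumes V: "exchange A V s" and W: "exchange A W s'" and A: "annihilation A"
    and lf: "locally_finite V W" and F: "field_cur V"
  shows "exchange A (cur_mult V W) (\<lambda>r. s r + s' r)"
  unfolding exchange_def
proof (intro allI)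
  fix n m v
  let ?a = "fps_nth (exp_series s)" and ?b = "fps_nth (exp_series s')"
  have fin: "finite {p. V (m - p) (W p v) \<noteq> 0}" for m v
    using lf by (simp add: locally_finite_def)
  have lin: "linear_op (A p)" for p using A by (simp add: annihilation_def)
  have lV: "linear_op (V p)" for p using F by (simp add: field_cur_def)
  \<comment> \<open>The summand after A has passed both factors, with degrees e and f used up by the
    two exchanges. The mode of W is p - f, which is undone by a shift of the summation index at the
    end.\<close>
  define h where "h e f p = fock_scale (?a e * ?b f) (V (m - int (e + f) - (p - int f))
      (W (p - int f) (A (int (e + f) - int n) v)))" for e f p
  have fin_h: "finite {p. h e f p \<noteq> 0}" for e f
  proof -
    have "{p. h e f p \<noteq> 0} \<subseteq> (\<lambda>p. p + int f) ` {p. V (m - int (e + f) - p) (W p (A (int (e + f) - int n)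
        v)) \<noteq> 0}"
    proof
      fix p assume "p \<in> {p. h e f p \<noteq> 0}"
      then have "V (m - int (e + f) - (p - int f)) (W (p - int f) (A (int (e + f) - int n) v)) \<noteq> 0"
        by (auto simp: h_def)
      then show "p \<in> (\<lambda>p. p + int f) ` {p. V (m - int (e + f) - p) (W p (A (int (e + f) - int n) v)) \<noteq> 0}"
        by (intro image_eqI[where x = "p - int f"]) auto
    qed
    then show ?thesis using fin finite_surj by blast
  qed
  have "A (- int n) (cur_mult V W m v) = Sum_any (\<lambda>p. A (- int n) (V (m - p) (W p v)))"
    unfolding cur_mult_def by (rule linear_op_Sum_any[OF lin fin])
  also have "(\<lambda>p. A (- int n) (V (m - p) (W p v))) = (\<lambda>p. \<Sum>e\<le>n. \<Sum>f\<le>n-e. h e f p)"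
  proof
    fix p
    have "A (- int n) (V (m - p) (W p v)) =
        (\<Sum>e\<le>n. fock_scale (?a e) (V (m - p - int e) (A (- int (n - e)) (W p v))))"
      using V[unfolded exchange_def, rule_format, of n "m - p" "W p v"]
      by (auto intro!: sum.cong simp: of_nat_diff)
    also have "\<dots> = (\<Sum>e\<le>n. \<Sum>f\<le>n-e. h e f p)"
      unfolding W[unfolded exchange_def, rule_format] linear_op_sum[OF lV] linear_opD(2)[OF lV] fock_scale_sum
      by (intro sum.cong refl) (auto simp: h_def of_nat_diff algebra_simps)
    finally show "A (- int n) (V (m - p) (W p v)) = (\<Sum>e\<le>n. \<Sum>f\<le>n-e. h e f p)" .
  qed
  also have "Sum_any (\<lambda>p. \<Sum>e\<le>n. \<Sum>f\<le>n-e. h e f p) = (\<Sum>e\<le>n. \<Sum>f\<le>n-e. Sum_any (h e f))"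
  proof -
    have "finite {p. (\<Sum>f\<le>n-e. h e f p) \<noteq> 0}" for e
    proof (rule finite_subset)
      show "{p. (\<Sum>f\<le>n-e. h e f p) \<noteq> 0} \<subseteq> (\<Union>f\<in>{..n-e}. {p. h e f p \<noteq> 0})"
        by (auto dest: sum.not_neutral_contains_not_neutral)
    qed (use fin_h in auto)
    then show ?thesis using fin_h by (simp add: Sum_any_sum)
  qed
  also have "\<dots> = (\<Sum>e\<le>n. \<Sum>f\<le>n-e. fock_scale (?a e * ?b f)
      (cur_mult V W (m - int (e + f)) (A (int (e + f) - int n) v)))"
  proof (intro sum.cong refl)
    fix e f
    show "Sum_any (h e f) =
        fock_scale (?a e * ?b f) (cur_mult V W (m - int (e + f)) (A (int (e + f) - int n) v))"
      unfolding cur_mult_def linear_op_Sum_any[OF linear_op_scale[OF linear_op_id] fin]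
      unfolding Sum_any_shift[where c = "- int f", symmetric,
          where g = "\<lambda>p. fock_scale (?a e * ?b f) (V (m - int (e + f) - p) (W p (A (int (e + f) - int n) v)))"]
      by (rule Sum_any.cong) (simp add: h_def)
  qed
  also have "\<dots> = (\<Sum>g\<le>n. \<Sum>e\<le>g. fock_scale (?a e * ?b (g - e)) (cur_mult V W (m - int g) (A (int g - int n) v)))"
    by (subst sum_triangle_diag0) (auto intro!: sum.cong)
  also have "\<dots> = (\<Sum>g\<le>n. fock_scale (fps_nth (exp_series (\<lambda>r. s r + s' r)) g)
      (cur_mult V W (m - int g) (A (int g - int n) v)))"
    unfolding exp_series_add fps_mult_nth fock_scale_sum_left by (simp add: atMost_atLeast0)
  finally show "A (- int n) (cur_mult V W m v) = \<dots>" .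
qed

text \<open>V is passed first by A', which stands next to it, and then by A; again the exponents
  add.\<close>

lemma exchange_mult_left:
  assumes AV: "exchange A V s" and A'V: "exchange A' V s'" and A: "annihilation A" and A': "annihilation A'"
    and F: "field_cur V"
  shows "exchange (cur_mult A A') V (\<lambda>r. s r + s' r)"
  unfolding exchange_def
proof (intro allI)
  fix n m v
  let ?a = "fps_nth (exp_series s)" and ?b = "fps_nth (exp_series s')"
  have lA: "linear_op (A p)" for p using A by (simp add: annihilation_def)
  have lV: "linear_op (V p)" for p using F by (simp add: field_cur_def)
  define h where "h g f p = fock_scale (?a (g - f) * ?b f)
      (V (m - int g) (A (int g + int p - int n) (A' (- int p) v)))" for g f p
  have "cur_mult A A' (- int n) (V m v) = (\<Sum>p\<le>n. A (- int (n - p)) (A' (- int p) (V m v)))"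
    unfolding cur_mult_annihilation[OF A A'] by (auto intro!: sum.cong simp: of_nat_diff)
  also have "\<dots> = (\<Sum>p\<le>n. \<Sum>f\<le>p. \<Sum>e\<le>n-p. h (e + f) f (p - f))"
    unfolding A'V[unfolded exchange_def, rule_format] linear_op_sum[OF lA] linear_opD(2)[OF lA]
      AV[unfolded exchange_def, rule_format] fock_scale_sum
    by (intro sum.cong refl) (auto simp: h_def of_nat_diff algebra_simps)
  also have "\<dots> = (\<Sum>f\<le>n. \<Sum>p\<le>n-f. \<Sum>e\<le>n-f-p. h (e + f) f p)"
  proof -
    have "(\<Sum>p\<le>n. \<Sum>f\<le>p. G p f) = (\<Sum>f\<le>n. \<Sum>p\<le>n-f. G (p + f) f)" for G :: "nat \<Rightarrow> nat \<Rightarrow> fock"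
      by (subst sum_triangle_diag0) (auto intro!: sum.cong)
    then show ?thesis by (simp add: add.commute)
  qed
  also have "\<dots> = (\<Sum>f\<le>n. \<Sum>e\<le>n-f. \<Sum>p\<le>n-f-e. h (e + f) f p)"
    by (subst sum_triangle_swap0) rule
  also have "\<dots> = (\<Sum>g\<le>n. \<Sum>f\<le>g. \<Sum>p\<le>n-g. h g f p)"
    by (subst sum_triangle_diag0) (auto intro!: sum.cong)
  also have "\<dots> = (\<Sum>g\<le>n. \<Sum>f\<le>g. fock_scale (?b f * ?a (g - f)) (V (m - int g) (cur_mult A A' (int g - int n) v)))"
  proof (intro sum.cong refl)
    fix g f assume "g \<in> {..n}"
    then have *: "cur_mult A A' (int g - int n) v = (\<Sum>p\<le>n-g. A (int g + int p - int n) (A' (- int p) v))"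
    proof -
      have *: "int p - int (n - g) = int g + int p - int n" "- int (n - g) = int g - int n" for p
        using \<open>g \<in> _\<close> by auto
      show ?thesis using cur_mult_annihilation[OF A A', of "n - g" v] by (simp only: *)
    qed
    then show "(\<Sum>p\<le>n-g. h g f p) = fock_scale (?b f * ?a (g - f)) (V (m - int g) (cur_mult A A' (int g -
        int n) v))"
      unfolding * linear_op_sum[OF lV] fock_scale_sum h_def by (simp add: mult.commute)
  qed
  also have "\<dots> = (\<Sum>g\<le>n. fock_scale (fps_nth (exp_series (\<lambda>r. s r + s' r)) g) (V (m - int g) (cur_mult A
      A' (int g - int n) v)))"
    unfolding exp_series_add mult.commute[of "exp_series s"] fps_mult_nth fock_scale_sum_left by (simp
        add: atMost_atLeast0)
  finally show "cur_mult A A' (- int n) (V m v) = \<dots>" .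
qed

text \<open>Replacing z by c z multiplies (z / w)^r by c^r; rescaling w, as in
  \<open>exchange_subst_left\<close>, divides by it.\<close>

lemma exchange_subst_right:
  assumes AV: "exchange A V s" and A: "annihilation A" and F: "field_cur V" and c: "c \<noteq> 0"
  shows "exchange A (cur_subst c V) (\<lambda>r. c ^ r * s r)"
proof -
  have lA: "linear_op (A p)" for p using A by (simp add: annihilation_def)
  show ?thesis
    unfolding exchange_def cur_subst_def linear_opD(2)[OF lA] AV[unfolded exchange_def, rule_format]
        fock_scale_sum
      exp_series_scale
    by (intro allI sum.cong refl) (simp add: power_int_diff c mult.commute)
qed

lemma exchange_subst_left:
  assumes AV: "exchange A V s" and F: "field_cur V" and c: "c \<noteq> 0"
  shows "exchange (cur_subst c A) V (\<lambda>r. inverse c ^ r * s r)"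
proof -
  have lV: "linear_op (V p)" for p using F by (simp add: field_cur_def)
  show ?thesis
    unfolding exchange_def cur_subst_def AV[unfolded exchange_def, rule_format] fock_scale_sum
      exp_series_scale
  proof (intro allI sum.cong refl)
    fix n m v e
    have "c powi (- int n) * a = inverse c ^ e * a * c powi (int e - int n)" for a
      by (simp add: power_int_diff power_int_minus c field_simps)
    then show "fock_scale (c powi - int n) (fock_scale (fps_nth (exp_series s) e) (V (m - int e) (A (int
        e - int n) v))) =
        fock_scale (inverse c ^ e * fps_nth (exp_series s) e)
          (V (m - int e) (fock_scale (c powi (int e - int n)) (A (int e - int n) v)))"
      by (simp only: linear_opD(2)[OF lV] fock_scale_simps(4))
  qed
qed

lemma exchange_smult_right:
  assumes AV: "exchange A V s" and A: "annihilation A"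
  shows "exchange A (cur_smult c V) s"
proof -
  have lA: "linear_op (A p)" for p using A by (simp add: annihilation_def)
  show ?thesis
    unfolding exchange_def cur_smult_def linear_opD(2)[OF lA] AV[unfolded exchange_def, rule_format]
        fock_scale_sum
    by (intro allI sum.cong refl) (simp add: mult.commute)
qed

lemma exchange_commuting:
  assumes "\<And>n m v. A (- int n) (V m v) = V m (A (- int n) v)"
  shows "exchange A V (\<lambda>r. 0)"
  unfolding exchange_def exp_series_zero
proof (intro allI)
  fix n m v
  have "(\<Sum>e\<le>n. fock_scale (fps_nth 1 e) (V (m - int e) (A (int e - int n) v))) =
      (\<Sum>e\<le>n. if e = 0 then V m (A (- int n) v) else 0)"
    by (intro sum.cong) auto
  then show "A (- int n) (V m v) = (\<Sum>e\<le>n. fock_scale (fps_nth 1 e) (V (m - int e) (A (int e - int n) v)))"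
    using assms by simp
qed

text \<open>The Weyl form of the commutation relations: since X r and Y r' commute up to a scalar,
  their exponentials exchange up to the exponential of these scalars. The proof goes degree by
  degree with \<open>op_exp_rec\<close>, first for a single X r against the exponential of Y and
  then for the exponential of X.\<close>

lemma exchange_exp:
  assumes lX: "\<And>r. linear_op (X r)" and lY: "\<And>r. linear_op (Y r)"
    and cX: "\<And>r s v. X r (X s v) = X s (X r v)" and cY: "\<And>r s v. Y r (Y s v) = Y s (Y r v)"
    and comm: "\<And>r r' v. r \<ge> 1 \<Longrightarrow> r' \<ge> 1 \<Longrightarrow>
      X r (Y r' v) = Y r' (X r v) + (if r = r' then fock_scale (s r) v else 0)"
  shows "exchange (cur_exp (-1) X) (cur_exp 1 Y) s"
proof -
  have recX: "fock_scale (of_nat n) (op_exp X n v) =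
      (\<Sum>r=1..n. fock_scale (of_nat r) (X r (op_exp X (n - r) v)))" for n v
    by (rule op_exp_rec) (use lX cX in auto)
  have recY: "fock_scale (of_nat n) (op_exp Y n v) =
      (\<Sum>r=1..n. fock_scale (of_nat r) (Y r (op_exp Y (n - r) v)))" for n v
    by (rule op_exp_rec) (use lY cY in auto)
  have XE: "X r (op_exp X n v) = op_exp X n (X r v)" for r n v
    by (rule op_exp_commute) (use lX cX in auto)
  \<comment> \<open>Commuting X r past the exponential of Y multiplies it by s r z^r. Here this is
    stated in degree m and proved after multiplication by m.\<close>
  have *: "X r (op_exp Y m v) = op_exp Y m (X r v) +
      (if r \<le> m then fock_scale (s r) (op_exp Y (m - r) v) else 0)" if r: "r \<ge> 1" for r m v
  proof (induction m rule: less_induct)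
    case (less m)
    show ?case
    proof (cases "m = 0")
      case False
      have "fock_scale (of_nat m) (X r (op_exp Y m v)) =
          (\<Sum>k=1..m. fock_scale (of_nat k) (X r (Y k (op_exp Y (m - k) v))))"
        unfolding linear_opD(2)[OF lX, symmetric] recY linear_op_sum[OF lX] ..
      also have "\<dots> = (\<Sum>k=1..m. fock_scale (of_nat k) (Y k (op_exp Y (m - k) (X r v))) +
          (if k \<le> m - r \<and> r \<le> m then fock_scale (s r) (fock_scale (of_nat k) (Y k (op_exp Y (m - r - k)
              v))) else 0) +
          (if k = r then fock_scale (of_nat r * s r) (op_exp Y (m - r) v) else 0))"
      proof (intro sum.cong refl)
        fix k assume k: "k \<in> {1..m}"
        then have le: "r \<le> m - k \<longleftrightarrow> k \<le> m - r \<and> r \<le> m" by auto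
        have dd: "m - k - r = m - r - k" by auto
        show "fock_scale (of_nat k) (X r (Y k (op_exp Y (m - k) v))) =
          fock_scale (of_nat k) (Y k (op_exp Y (m - k) (X r v))) +
          (if k \<le> m - r \<and> r \<le> m then fock_scale (s r) (fock_scale (of_nat k) (Y k (op_exp Y (m - r - k)
              v))) else 0) +
          (if k = r then fock_scale (of_nat r * s r) (op_exp Y (m - r) v) else 0)"
          using k r
          by (auto simp: comm less linear_opD[OF lY] fock_scale_add le dd linear_op_0[OF lY]
              mult.commute simp del: diff_diff_left)
      qed
      also have "\<dots> = fock_scale (of_nat m) (op_exp Y m (X r v)) +
          (if r \<le> m then fock_scale (s r) (\<Sum>k=1..m-r. fock_scale (of_nat k) (Y k (op_exp Y (m - r - k)
              v))) else 0) +
          (if r \<le> m then fock_scale (of_nat r * s r) (op_exp Y (m - r) v) else 0)"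
      proof -
        have "(\<Sum>k=1..m. if k \<le> m - r \<and> r \<le> m then g k else 0) = (if r \<le> m then \<Sum>k=1..m-r. g k else 0)"
          for g :: "nat \<Rightarrow> fock"
          by (auto intro!: sum.mono_neutral_cong_right)
        then show ?thesis
          unfolding sum.distrib recY fock_scale_sum using r by (simp add: sum.delta)
      qed
      also have "\<dots> = fock_scale (of_nat m) (op_exp Y m (X r v) +
          (if r \<le> m then fock_scale (s r) (op_exp Y (m - r) v) else 0))"
        unfolding recY[symmetric]
        by (auto simp: fock_scale_add fock_scale_add_left[symmetric] algebra_simps of_nat_diff)
      finally show ?thesis by (rule fock_scale_cancel[rotated]) (use False in simp)
    qed (use r in simp)
  qed
  define V where "V = cur_exp 1 Y"
  have VX: "X r (V m v) = V m (X r v) + fock_scale (s r) (V (m - int r) v)" if "r \<ge> 1" for r m v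
  proof (cases "m < 0")
    case False
    have "nat (m - int r) = nat m - r" by simp
    then show ?thesis
      using False *[OF that, of "nat m" v] by (auto simp: V_def cur_exp_pos nat_le_iff)
  qed (simp add: V_def cur_exp_pos linear_op_0[OF lX])
  have lV: "linear_op (V m)" for m
    by (simp add: V_def cur_exp_pos linear_op_zero linear_op_op_exp[OF lY])
  let ?E = "fps_nth (exp_series s)"
  \<comment> \<open>After multiplication by n the claim splits along n = (n - e) + e: the part n - e
    is the recurrence for X, the part e is the recurrence for the scalar series.\<close>
  have main: "op_exp X n (V m v) = (\<Sum>e\<le>n. fock_scale (?E e) (V (m - int e) (op_exp X (n - e) v)))" for n m v
  proof (induction n arbitrary: m v rule: less_induct)
    case (less n)
    show ?case
    proof (cases "n = 0")
      case False
      have "fock_scale (of_nat n) (op_exp X n (V m v)) =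
          (\<Sum>r=1..n. fock_scale (of_nat r) (op_exp X (n - r) (X r (V m v))))"
        unfolding recX XE ..
      also have "\<dots> = (\<Sum>r=1..n. fock_scale (of_nat r) (op_exp X (n - r) (V m (X r v))) +
          fock_scale (of_nat r * s r) (op_exp X (n - r) (V (m - int r) v)))"
        by (intro sum.cong refl)
          (simp add: VX linear_opD[OF linear_op_op_exp[OF lX]] fock_scale_add)
      also have "\<dots> = (\<Sum>r=1..n. \<Sum>e\<le>n-r. fock_scale (of_nat r * ?E e) (V (m - int e) (X r (op_exp X (n - e
          - r) v)))) +
          (\<Sum>r=1..n. \<Sum>e\<le>n-r. fock_scale (of_nat r * s r * ?E e) (V (m - int (r + e)) (op_exp X (n - (r +
              e)) v)))"
      proof (subst sum.distrib[symmetric], intro sum.cong refl)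
        fix r assume "r \<in> {1..n}"
        then have IH: "op_exp X (n - r) (V m w) =
            (\<Sum>e\<le>n-r. fock_scale (?E e) (V (m - int e) (op_exp X (n - r - e) w)))" for m w
          by (intro less) auto
        have "fock_scale (of_nat r) (op_exp X (n - r) (V m (X r v))) =
            (\<Sum>e\<le>n-r. fock_scale (of_nat r * ?E e) (V (m - int e) (X r (op_exp X (n - e - r) v))))"
          unfolding IH fock_scale_sum fock_scale_simps(4) XE
          by (intro sum.cong refl) (simp only: diff_diff_left add.commute)
        moreover have "fock_scale (of_nat r * s r) (op_exp X (n - r) (V (m - int r) v)) =
            (\<Sum>e\<le>n-r. fock_scale (of_nat r * s r * ?E e) (V (m - int (r + e)) (op_exp X (n - (r + e)) v)))"
          unfolding IH fock_scale_sum fock_scale_simps(4)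
          by (intro sum.cong refl) (simp only: diff_diff_left diff_diff_eq of_nat_add)
        ultimately show "fock_scale (of_nat r) (op_exp X (n - r) (V m (X r v))) +
            fock_scale (of_nat r * s r) (op_exp X (n - r) (V (m - int r) v)) =
            (\<Sum>e\<le>n-r. fock_scale (of_nat r * ?E e) (V (m - int e) (X r (op_exp X (n - e - r) v)))) +
            (\<Sum>e\<le>n-r. fock_scale (of_nat r * s r * ?E e) (V (m - int (r + e)) (op_exp X (n - (r + e)) v)))"
          by simp
      qed
      also have "(\<Sum>r=1..n. \<Sum>e\<le>n-r. fock_scale (of_nat r * ?E e) (V (m - int e) (X r (op_exp X (n - e -
          r) v)))) =
          (\<Sum>e\<le>n. fock_scale (of_nat (n - e) * ?E e) (V (m - int e) (op_exp X (n - e) v)))"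
      proof (subst sum_triangle_swap, intro sum.cong refl)
        fix e assume "e \<in> {..n}"
        have "(\<Sum>r=1..n-e. fock_scale (of_nat r * ?E e) (V (m - int e) (X r (op_exp X (n - e - r) v)))) =
            fock_scale (?E e) (V (m - int e) (\<Sum>r=1..n-e. fock_scale (of_nat r) (X r (op_exp X (n - e - r) v))))"
          by (simp only: linear_op_sum[OF lV] linear_opD(2)[OF lV] fock_scale_sum fock_scale_simps(4)
              mult.commute)
        also have "\<dots> = fock_scale (of_nat (n - e) * ?E e) (V (m - int e) (op_exp X (n - e) v))"
          by (simp only: recX[symmetric] linear_opD(2)[OF lV] fock_scale_simps(4) mult.commute)
        finally show "(\<Sum>r=1..n-e. fock_scale (of_nat r * ?E e) (V (m - int e) (X r (op_exp X (n - e - r)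
            v)))) = \<dots>" .
      qed
      also have "(\<Sum>r=1..n. \<Sum>e\<le>n-r. fock_scale (of_nat r * s r * ?E e) (V (m - int (r + e)) (op_exp X (n
          - (r + e)) v))) =
          (\<Sum>f\<le>n. fock_scale (of_nat f * ?E f) (V (m - int f) (op_exp X (n - f) v)))"
        by (subst sum_triangle_diag, subst exp_series_rec, subst fock_scale_sum_left)
          (intro sum.cong refl, auto)
      also have "(\<Sum>e\<le>n. fock_scale (of_nat (n - e) * ?E e) (V (m - int e) (op_exp X (n - e) v))) +
          (\<Sum>f\<le>n. fock_scale (of_nat f * ?E f) (V (m - int f) (op_exp X (n - f) v))) =
          fock_scale (of_nat n) (\<Sum>e\<le>n. fock_scale (?E e) (V (m - int e) (op_exp X (n - e) v)))"
        unfolding sum.distrib[symmetric] fock_scale_sum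
        by (intro sum.cong refl) (simp add: fock_scale_add_left[symmetric] algebra_simps of_nat_diff)
      finally show ?thesis by (rule fock_scale_cancel[rotated]) (use False in simp)
    qed simp
  qed
  show ?thesis
    unfolding exchange_def V_def[symmetric] cur_exp_neg
    using main by (auto intro!: sum.cong simp: nat_diff_distrib')
qed

lemma exchange_cong:
  assumes "exchange A V s" "\<And>r. r \<ge> 1 \<Longrightarrow> s r = s' r"
  shows "exchange A V s'"
  using assms(1) exp_series_cong[of s s'] assms(2) by (simp add: exchange_def)

section \<open>Matrix elements with the left vacuum\<close>

lemma linear_dual_Sum_any:
  assumes "linear_dual f" "finite {x. g x \<noteq> 0}"
  shows "f (Sum_any g) = Sum_any (\<lambda>x. f (g x))"
  unfolding Sum_any.expand_set[of g] linear_dual_sum[OF assms(1)]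
  by (rule Sum_any.expand_superset[symmetric]) (use assms in \<open>auto simp: linear_dual_0\<close>)

text \<open>The left vacuum kills all modes of C except mode 0, on which it is preserved; only p = m
  survives in the convolution.\<close>

lemma dual_vacuum_cur_mult_creation:
  assumes "creation C" "field_cur W"
  shows "dual_vacuum (cur_mult C W m v) = dual_vacuum (W m v)"
proof -
  have fin: "finite {p. C (m - p) (W p v) \<noteq> 0}"
    using locally_finite_creation[OF assms] by (simp add: locally_finite_def)
  have "dual_vacuum (cur_mult C W m v) = Sum_any (\<lambda>p. if p = m then dual_vacuum (W p v) else 0)"
    using assms(1) unfolding cur_mult_def linear_dual_Sum_any[OF linear_dual_vacuum fin]
    by (intro Sum_any.cong) (auto simp: creation_def)
  then show ?thesis by simp
qed

text \<open>Allows a current to be replaced, in front of an annihilation current, by one with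
  proportional left vacuum functionals. This is how the creation parts of
  \<open>Lambda_tilde\<close> are dropped.\<close>

lemma dual_vacuum_cur_mult_annihilation:
  assumes "field_cur V" "field_cur V'" "annihilation A"
    and "\<And>p w. dual_vacuum (V p w) = u * dual_vacuum (V' p w)"
  shows "dual_vacuum (cur_mult V A m v) = u * dual_vacuum (cur_mult V' A m v)"
proof -
  have fin: "finite {p. V (m - p) (A p v) \<noteq> 0}" "finite {p. V' (m - p) (A p v) \<noteq> 0}"
    using assms locally_finite_annihilation by (simp_all add: locally_finite_def)
  have "finite {p. dual_vacuum (V' (m - p) (A p v)) \<noteq> 0}"
    by (rule finite_subset[OF _ fin(2)]) (auto simp: linear_dual_0[OF linear_dual_vacuum])
  then show ?thesis
    unfolding cur_mult_def linear_dual_Sum_any[OF linear_dual_vacuum fin(1)]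
      linear_dual_Sum_any[OF linear_dual_vacuum fin(2)] assms(4)
    by (rule Sum_any_right_distrib[symmetric])
qed

lemma cur_subst_mult:
  assumes "locally_finite A B" "\<And>m. linear_op (A m)" "c \<noteq> 0"
  shows "cur_subst c (cur_mult A B) = cur_mult (cur_subst c A) (cur_subst c B)"
proof (intro ext)
  fix m v
  have fin: "finite {p. A (m - p) (B p v) \<noteq> 0}" using assms by (simp add: locally_finite_def)
  show "cur_subst c (cur_mult A B) m v = cur_mult (cur_subst c A) (cur_subst c B) m v"
    unfolding cur_subst_def cur_mult_def linear_op_Sum_any[OF linear_op_scale[OF linear_op_id] fin]
    by (intro Sum_any.cong) (simp add: linear_opD[OF assms(2)] power_int_add[symmetric] assms(3))
qed

lemma creation_subst: "creation C \<Longrightarrow> creation (cur_subst c C)"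
  unfolding creation_def cur_subst_def
  by (auto simp: linear_op_scale linear_dualD[OF linear_dual_vacuum])

lemma annihilation_subst: "annihilation A \<Longrightarrow> annihilation (cur_subst c A)"
  unfolding annihilation_def cur_subst_def
  by (intro conjI allI impI linear_op_scale) (auto, metis fock_scale_simps(1))

lemma field_cur_smult: "field_cur V \<Longrightarrow> field_cur (cur_smult c V)"
  unfolding field_cur_def cur_smult_def
  by (intro conjI allI linear_op_scale) (auto, metis fock_scale_simps(1))

context
  fixes X :: "nat \<Rightarrow> current" and W :: current
  assumes C: "\<And>l. creation (X l)" and W: "field_cur W"
begin

lemma field_cur_foldr: "field_cur (foldr cur_mult (map X ls) W)"
  by (induction ls) (simp_all add: W C field_cur_mult_creation)

lemma dual_vacuum_foldr: "dual_vacuum (foldr cur_mult (map X ls) W m v) = dual_vacuum (W m v)"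
  by (induction ls) (simp_all add: dual_vacuum_cur_mult_creation C field_cur_foldr)

lemma exchange_foldr:
  assumes "annihilation A" "\<And>l. l \<in> set ls \<Longrightarrow> exchange A (X l) (s l)" "exchange A W s'"
  shows "exchange A (foldr cur_mult (map X ls) W) (\<lambda>r. (\<Sum>l\<leftarrow>ls. s l r) + s' r)"
  using assms(2)
proof (induction ls)
  case (Cons l ls)
  have "exchange A (X l) (s l)" by (rule Cons.prems) simp
  moreover have "exchange A (foldr cur_mult (map X ls) W) (\<lambda>r. (\<Sum>l\<leftarrow>ls. s l r) + s' r)"
    by (rule Cons.IH) (simp add: Cons.prems)
  ultimately have "exchange A (cur_mult (X l) (foldr cur_mult (map X ls) W)) (\<lambda>r. s l r + ((\<Sum>l\<leftarrow>ls. s l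
      r) + s' r))"
    using assms(1) locally_finite_creation[OF C field_cur_foldr] creation_field[OF C]
    by (rule exchange_mult_right)
  then show ?case by (simp add: add.assoc)
qed (simp add: assms)

end

section \<open>Degree in Fock space\<close>

definition fock_weight :: "((nat \<times> nat) \<Rightarrow>\<^sub>0 nat) \<Rightarrow> nat" where
  "fock_weight m = Sum_any (\<lambda>x. Poly_Mapping.lookup m x * snd x)"

lemma fock_weight_add_single: "fock_weight (m + Poly_Mapping.single x 1) = fock_weight m + snd x"
proof -
  have "finite {y. Poly_Mapping.lookup m y * snd y \<noteq> 0}"
    by (rule finite_subset[OF _ finite_keys[of m]]) (auto simp: in_keys_iff)
  moreover have "{y. ((1 :: nat) when x = y) * snd y \<noteq> 0} \<subseteq> {x}"
    by (auto simp: when_def split: if_splits)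
  then have "finite {y. ((1 :: nat) when x = y) * snd y \<noteq> 0}" by (rule finite_subset) simp
  ultimately have "fock_weight (m + Poly_Mapping.single x 1) =
      fock_weight m + Sum_any (\<lambda>y. ((1 :: nat) when x = y) * snd y)"
    by (simp add: fock_weight_def lookup_add lookup_single distrib_right Sum_any.distrib)
  also have "Sum_any (\<lambda>y. ((1 :: nat) when x = y) * snd y) = snd x"
    by (simp add: when_mult)
  finally show ?thesis .
qed

text \<open>The bound is strict so that the bound 0 forces the zero vector; truncated subtraction in
  the estimates is then harmless. The degree serves to show that only finitely many modes of an
  annihilation exponential act on a given vector.\<close>

definition degree_below :: "nat \<Rightarrow> fock \<Rightarrow> bool" where
  "degree_below B v \<longleftrightarrow> (\<forall>m. Poly_Mapping.lookup v m \<noteq> 0 \<longrightarrow> fock_weight m < B)"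

lemma degree_below_exists: "\<exists>B. degree_below B v"
proof -
  have "degree_below (Suc (\<Sum>m\<in>Poly_Mapping.keys v. fock_weight m)) v"
    unfolding degree_below_def using member_le_sum[of _ "Poly_Mapping.keys v" fock_weight]
    by (auto simp: in_keys_iff less_Suc_eq_le)
  then show ?thesis ..
qed

lemma degree_below_0: "degree_below 0 v \<Longrightarrow> v = 0"
  by (rule poly_mapping_eqI) (auto simp: degree_below_def)

lemma degree_below_deriv: "degree_below B v \<Longrightarrow> degree_below (B - snd x) (fock_deriv x v)"
  unfolding degree_below_def lookup_fock_deriv
  by (metis add_diff_cancel_right' diff_less_mono fock_weight_add_single le_add2 mult_eq_0_iff)

lemma degree_below_scale: "degree_below B v \<Longrightarrow> degree_below B (fock_scale a v)"
  by (auto simp: degree_below_def lookup_fock_scale)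

lemma degree_below_sum: "(\<And>x. x \<in> A \<Longrightarrow> degree_below B (f x)) \<Longrightarrow> degree_below B (sum f A)"
  unfolding degree_below_def lookup_sum by (meson sum.not_neutral_contains_not_neutral)

section \<open>Currents of the corner algebra\<close>

locale corner =
  fixes q t q4 t4 :: complex and cs :: "nat list"
  assumes q0: "q \<noteq> 0" and t0: "t \<noteq> 0"
    and generic: "\<And>a b :: int. q powi a * t powi b = 1 \<Longrightarrow> a = 0 \<and> b = 0"
    and roots: "q4 ^ 4 = q" "t4 ^ 4 = t"
    and colours: "\<And>j. j \<in> {1..length cs} \<Longrightarrow> colour cs j \<in> {1, 2, 3}"
    and qc: "qc_pow q4 t4 cs 2 \<noteq> 1"
begin

abbreviation "n \<equiv> length cs"
abbreviation "hs \<equiv> heis q4 t4 cs"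

lemma q40: "q4 \<noteq> 0" and t40: "t4 \<noteq> 0"
  using roots q0 t0 by auto

text \<open>\<open>qp i r\<close> is \<open>q\<^sub>i\<close> to the power \<open>r/4\<close>.\<close>
abbreviation "qp \<equiv> qpow q4 t4"

lemma qp_nonzero: "qp i r \<noteq> 0"
  by (simp add: qpow_def q40 t40)

lemma qp_add: "qp i (r + s) = qp i r * qp i s"
  unfolding qpow_def by (rule power_int_add) (use q40 t40 in auto)

lemma qp_minus: "qp i (- r) = inverse (qp i r)"
  by (simp add: qpow_def power_int_minus)

lemma qp_mult: "qp i (r * int k) = qp i r ^ k"
  unfolding qpow_def by (simp add: power_int_mult)

lemma qp_4: "qp 1 4 = q" "qp 2 4 = t / q" "qp 3 4 = inverse t" "qp (Suc 0) 4 = q"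
  using roots q40 t40 by (auto simp: qpow_def power_mult_distrib power_inverse divide_inverse)

lemma generic_nat: "q ^ a = t ^ b \<Longrightarrow> a = 0 \<and> b = 0"
proof -
  assume "q ^ a = t ^ b"
  then have "q powi int a * t powi (- int b) = 1"
    using t0 by (simp add: power_int_minus)
  from generic[OF this] show ?thesis by simp
qed

text \<open>Each q_i is a nontrivial monomial in q and t, hence not a root of unity.\<close>

lemma qp_4_generic:
  assumes "i \<in> {1, 2, 3}" "r \<ge> 1"
  shows "qp i (4 * int r) \<noteq> 1"
proof
  assume "qp i (4 * int r) = 1"
  then have *: "qp i 4 ^ r = 1" by (simp only: qp_mult)
  consider "i = 1" | "i = 2" | "i = 3" using assms by auto
  then show False
  proof cases
    case 1 then show False using * generic_nat[of r 0] assms by (simp add: qp_4)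
  next
    case 2
    then have "q ^ r = t ^ r" using * q0 by (simp add: qp_4 power_divide)
    then show False using generic_nat[of r r] assms by simp
  next
    case 3 then show False using * generic_nat[of 0 r] assms t0 by (simp add: qp_4 power_inverse)
  qed
qed

lemma kappa_nonzero: "r \<ge> 1 \<Longrightarrow> kappa q4 t4 (int r) \<noteq> 0"
  using qp_4_generic by (simp add: kappa_def)

text \<open>q_c is a monomial in q and t, so by genericity it can be a root of unity only if it is 1
  itself. Hence the denominators of \<open>alpha_cur\<close>, \<open>beta_cur\<close> and
  \<open>f11\<close> are nonzero in every degree and not only in the first.\<close>

lemma qc_pow_generic:
  assumes "r \<ge> 1"
  shows "qc_pow q4 t4 cs (2 * int r) \<noteq> 1"
proof
  assume "qc_pow q4 t4 cs (2 * int r) = 1"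
  moreover have "qc_pow q4 t4 cs (2 * int r) = qc_pow q4 t4 cs 2 ^ r"
  proof -
    have "qp i (2 * (2 * int r)) = qp i (2 * 2) ^ r" for i
      using qp_mult[of i 4 r] by simp
    then show ?thesis by (simp only: qc_pow_def prod_power_distrib)
  qed
  ultimately have 1: "qc_pow q4 t4 cs 2 ^ r = 1" by simp
  have "\<exists>a b :: int. (\<Prod>j\<in>A. qp (colour cs j) 4) = q powi a * t powi b" if "A \<subseteq> {1..n}" for A
    using finite_subset[OF that finite_atLeastAtMost] that
  proof (induction A rule: finite_induct)
    case empty show ?case by (rule exI[of _ 0], rule exI[of _ 0]) simp
  next
    case (insert j A)
    then obtain a b where ab: "(\<Prod>j\<in>A. qp (colour cs j) 4) = q powi a * t powi b" by auto
    have "colour cs j \<in> {1, 2, 3}" using insert by (intro colours) auto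
    then obtain a' b' :: int where "qp (colour cs j) 4 = q powi a' * t powi b'"
    proof (elim insertE emptyE)
      assume "colour cs j = 1" then show ?thesis by (intro that[of 1 0]) (simp add: qp_4)
    next
      assume "colour cs j = 2" then show ?thesis
        by (intro that[of "-1" 1]) (simp add: qp_4 power_int_minus divide_inverse)
    next
      assume "colour cs j = 3" then show ?thesis by (intro that[of 0 "-1"]) (simp add: qp_4 power_int_minus)
    qed
    then have "(\<Prod>j\<in>insert j A. qp (colour cs j) 4) = q powi (a' + a) * t powi (b' + b)"
      using insert ab q0 t0 by (simp add: power_int_add)
    then show ?case by blast
  qed
  from this[OF order_refl] obtain a b where ab: "qc_pow q4 t4 cs 2 = q powi a * t powi b"
    by (auto simp: qc_pow_def)
  then have "q powi (a * int r) * t powi (b * int r) = 1"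
    using 1 by (simp add: power_int_mult power_mult_distrib)
  then have "a = 0 \<and> b = 0" using generic[of "a * int r" "b * int r"] assms by auto
  then show False using ab qc by simp
qed

section \<open>Combinations of Heisenberg modes over all tensor factors\<close>

definition lowering :: "(nat \<Rightarrow> nat \<Rightarrow> complex) \<Rightarrow> nat \<Rightarrow> fock \<Rightarrow> fock" where
  "lowering a r v = (\<Sum>l=1..n. fock_scale (a l r) (hs l (int r) v))"

definition raising :: "(nat \<Rightarrow> nat \<Rightarrow> complex) \<Rightarrow> nat \<Rightarrow> fock \<Rightarrow> fock" where
  "raising a r v = (\<Sum>l=1..n. fock_scale (a l r) (hs l (- int r) v))"

lemma linear_op_heis: "linear_op (hs l r)"
proof -
  have "fock_deriv x (v + w) = fock_deriv x v + fock_deriv x w" for x v w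
    by (rule poly_mapping_eqI) (simp add: lookup_fock_deriv lookup_add algebra_simps)
  then show ?thesis
    by (auto simp: linear_op_def heis_def fock_scale_add fock_mult_scale fock_deriv_scale mult.commute)
      (simp_all add: fock_mult_def distrib_left)
qed

lemma linear_op_lowering: "linear_op (lowering a r)"
  and linear_op_raising: "linear_op (raising a r)"
  unfolding lowering_def raising_def by (intro linear_op_sumI linear_op_scale linear_op_heis)+

lemma heis_same_sign:
  assumes "r * s \<ge> 0" shows "hs l r (hs l' s v) = hs l' s (hs l r v)"
proof -
  \<comment> \<open>Modes of weakly equal sign are opposite only if both are 0, and the structure
    constant of mode 0 vanishes.\<close>
  have "r = 0" if "r + s = 0"
  proof (rule ccontr)
    assume "r \<noteq> 0"
    have "r * s = - (r * r)" using that by (simp add: eq_neg_iff_add_eq_0 flip: distrib_left)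
    moreover have "r * r > 0" using \<open>r \<noteq> 0\<close> by (simp add: zero_less_mult_iff) linarith
    ultimately show False using assms by simp
  qed
  then have "hs l r (hs l' s v) - hs l' s (hs l r v) = 0"
    unfolding heis_commutator[OF q40 t40] by (auto simp: heis_coeff_def)
  then show ?thesis by simp
qed

lemma lowering_commute: "lowering a r (lowering b s v) = lowering b s (lowering a r v)"
  unfolding lowering_def linear_op_sum[OF linear_op_heis] linear_opD(2)[OF linear_op_heis] fock_scale_sum
  by (subst sum.swap) (auto intro!: sum.cong simp: heis_same_sign mult.commute)

lemma raising_commute: "raising a r (raising b s v) = raising b s (raising a r v)"
  unfolding raising_def linear_op_sum[OF linear_op_heis] linear_opD(2)[OF linear_op_heis] fock_scale_sum
  by (subst sum.swap) (auto intro!: sum.cong simp: heis_same_sign mult.commute)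

text \<open>Only opposite modes of the same tensor factor fail to commute, so the commutator is a
  scalar: a sum over factors, which reappears as a contraction.\<close>

lemma lowering_raising:
  assumes "r \<ge> 1"
  shows "lowering a r (raising b r' v) = raising b r' (lowering a r v) + (if r = r' then
     fock_scale (\<Sum>l=1..n. a l r * b l r * heis_coeff q4 t4 (colour cs l) (int r)) v else 0)"
proof -
  have comm: "hs l (int r) (hs l' (- int r') v) = hs l' (- int r') (hs l (int r) v) +
     (if l = l' \<and> r = r' then fock_scale (heis_coeff q4 t4 (colour cs l) (int r)) v else 0)" for l l' v
    using heis_commutator[OF q40 t40, of cs l "int r" l' "- int r'" v]
    by (auto simp: heis_def[of q4 t4 cs _ 0] algebra_simps)
  have "lowering a r (raising b r' v) = (\<Sum>l=1..n. \<Sum>l'=1..n. fock_scale (a l r * b l' r') (hs l (int r)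
      (hs l' (- int r') v)))"
    unfolding raising_def lowering_def
      linear_op_sum[OF linear_op_heis] linear_opD(2)[OF linear_op_heis] fock_scale_sum by simp
  also have "\<dots> = (\<Sum>l=1..n. \<Sum>l'=1..n. fock_scale (a l r * b l' r') (hs l' (- int r') (hs l (int r) v))) +
     (\<Sum>l=1..n. \<Sum>l'=1..n. if l' = l then if r = r' then fock_scale (a l r * b l' r * heis_coeff q4 t4
         (colour cs l) (int r)) v else 0 else 0)"
    unfolding sum.distrib[symmetric] comm
    by (intro sum.cong refl) (simp add: fock_scale_add)
  also have "(\<Sum>l=1..n. \<Sum>l'=1..n. fock_scale (a l r * b l' r') (hs l' (- int r') (hs l (int r) v))) =
      raising b r' (lowering a r v)"
    unfolding raising_def lowering_def
      linear_op_sum[OF linear_op_heis] linear_opD(2)[OF linear_op_heis] fock_scale_sum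
    by (subst sum.swap) (simp add: mult.commute)
  finally show ?thesis by (simp add: fock_scale_sum_left sum.delta)
qed

lemma exchange_lowering_raising:
  "exchange (cur_exp (-1) (lowering a)) (cur_exp 1 (raising b))
     (\<lambda>r. \<Sum>l=1..n. a l r * b l r * heis_coeff q4 t4 (colour cs l) (int r))"
  by (rule exchange_exp)
    (simp_all add: linear_op_lowering linear_op_raising lowering_commute raising_commute lowering_raising)

lemma exchange_lowering_lowering:
  "exchange (cur_exp (-1) (lowering a)) (cur_exp (-1) (lowering b)) (\<lambda>r. 0)"
proof (rule exchange_commuting)
  fix k m v
  have "lowering b r (op_exp (lowering a) i v) = op_exp (lowering a) i (lowering b r v)" for r i v
    by (rule op_exp_commute) (simp_all add: linear_op_lowering lowering_commute)
  then have "op_exp (lowering a) i (op_exp (lowering b) j v) = op_exp (lowering b) j (op_exp (lowering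
      a) i v)" for i j
    by (intro op_exp_commute) (simp_all add: linear_op_lowering linear_op_op_exp)
  then show "cur_exp (-1) (lowering a) (- int k) (cur_exp (-1) (lowering b) m v) =
      cur_exp (-1) (lowering b) m (cur_exp (-1) (lowering a) (- int k) v)"
    by (simp add: cur_exp_neg linear_op_0[OF linear_op_op_exp[OF linear_op_lowering]])
qed

text \<open>The outermost letter of a nonempty word is a raising operator, and the left vacuum kills
  it.\<close>

lemma creation_raising: "creation (cur_exp 1 (raising a))"
  unfolding creation_def
proof (intro conjI allI impI)
  show "linear_op (cur_exp 1 (raising a) m)" for m
    by (simp add: cur_exp_pos linear_op_zero linear_op_op_exp[OF linear_op_raising])
  have zero: "dual_vacuum (raising a r v) = 0" if "r \<ge> 1" for r v
    using that by (simp add: raising_def linear_dual_sum[OF linear_dual_vacuum]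
        linear_dualD[OF linear_dual_vacuum] dual_vacuum_heis)
  have "dual_vacuum (op_exp (raising a) i v) = 0" if "i \<ge> 1" for i v
    unfolding op_exp_def linear_dual_sum[OF linear_dual_vacuum] linear_dualD[OF linear_dual_vacuum]
  proof (rule sum.neutral, rule ballI)
    fix rs assume "rs \<in> compositions i"
    then show "1 / fact (length rs) * dual_vacuum (foldr (raising a) rs v) = 0"
      using that by (cases rs) (auto simp: compositions_def zero)
  qed
  then show "dual_vacuum (cur_exp 1 (raising a) m v) = (if m = 0 then dual_vacuum v else 0)" for m v
    by (auto simp: cur_exp_pos linear_dual_0[OF linear_dual_vacuum])
qed (simp add: cur_exp_pos)

text \<open>A word of sum i lowers the degree of a vector by i, so it vanishes once i reaches the
  degree bound. On the vacuum the innermost letter of a nonempty word already gives 0.\<close>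

lemma annihilation_lowering: "annihilation (cur_exp (-1) (lowering a))"
  unfolding annihilation_def
proof (intro conjI allI impI)
  show "linear_op (cur_exp (-1) (lowering a) m)" for m
    by (simp add: cur_exp_neg linear_op_zero linear_op_op_exp[OF linear_op_lowering])
  have deg: "degree_below (B - sum_list rs) (foldr (lowering a) rs v)"
    if "degree_below B v" "\<forall>r\<in>set rs. 1 \<le> r" for B v rs
    using that(2)
  proof (induction rs)
    case (Cons r rs)
    define w where "w = foldr (lowering a) rs v"
    have w: "degree_below (B - sum_list rs) w" unfolding w_def by (rule Cons.IH) (use Cons.prems in simp)
    have "hs l (int r) w = fock_scale (heis_coeff q4 t4 (colour cs l) (int r)) (fock_deriv (l, r) w)" for l
      using Cons.prems by (simp add: heis_def)
    then have "degree_below (B - sum_list rs - r) (hs l (int r) w)" for l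
      using degree_below_deriv[OF w, of "(l, r)"] by (simp add: degree_below_scale)
    then have "degree_below (B - sum_list rs - r) (lowering a r w)"
      unfolding lowering_def[of a r w] by (intro degree_below_sum degree_below_scale)
    moreover have "B - sum_list rs - r = B - sum_list (r # rs)" by simp
    ultimately show ?case by (simp only: foldr.simps comp_apply w_def)
  qed (simp add: that)
  show "\<exists>B. \<forall>m<B. cur_exp (-1) (lowering a) m v = 0" for v
  proof -
    obtain B where B: "degree_below B v" using degree_below_exists by blast
    have "op_exp (lowering a) i v = 0" if "i \<ge> B" for i
      unfolding op_exp_def
    proof (rule sum.neutral, rule ballI)
      fix rs assume "rs \<in> compositions i"
      then have "sum_list rs = i" "\<forall>r\<in>set rs. 1 \<le> r" by (auto simp: compositions_def)
      then have "degree_below 0 (foldr (lowering a) rs v)"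
        using deg[OF B, of rs] that by simp
      then have "foldr (lowering a) rs v = 0" by (rule degree_below_0)
      then show "fock_scale (1 / fact (length rs)) (foldr (lowering a) rs v) = 0" by simp
    qed
    then show ?thesis by (intro exI[of _ "- int B"]) (auto simp: cur_exp_neg)
  qed
  have zero: "lowering a r vacuum = 0" if "r \<ge> 1" for r
    using that by (simp add: lowering_def heis_vacuum)
  have vac: "foldr (lowering a) rs vacuum = 0" if "rs \<noteq> []" "\<forall>r\<in>set rs. 1 \<le> r" for rs
    using that
  proof (induction rs)
    case (Cons r rs)
    then show ?case by (cases "rs = []") (simp_all add: zero linear_op_0[OF linear_op_lowering])
  qed simp
  have "op_exp (lowering a) i vacuum = 0" if "i \<ge> 1" for i
    unfolding op_exp_def
  proof (rule sum.neutral, rule ballI)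
    fix rs assume "rs \<in> compositions i"
    then have "foldr (lowering a) rs vacuum = 0"
      using that by (intro vac) (auto simp: compositions_def)
    then show "fock_scale (1 / fact (length rs)) (foldr (lowering a) rs vacuum) = 0" by simp
  qed
  then show "cur_exp (-1) (lowering a) m vacuum = (if m = 0 then vacuum else 0)" for m
    by (auto simp: cur_exp_neg)
qed (simp add: cur_exp_neg)

end

section \<open>The given currents as exponentials of lowering and raising operators\<close>

context corner
begin

text \<open>The coefficients of \<open>b_tilde\<close>, divided by q_c^(r/2) - q_c^(-r/2), so that
  \<open>beta_cur\<close> has exactly these coefficients and \<open>alpha_cur\<close> their
  negatives.\<close>

definition b_coeff :: "nat \<Rightarrow> nat \<Rightarrow> complex" where
  "b_coeff l r = kappa q4 t4 (int r) / of_nat r * qp (colour cs l) (- int r) *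
     (\<Prod>m=l+1..n. qp (colour cs m) (- 2 * int r)) /
     (qc_pow q4 t4 cs (int r) - qc_pow q4 t4 cs (- int r))"

definition phi_coeff :: "nat \<Rightarrow> nat \<Rightarrow> nat \<Rightarrow> complex" where
  "phi_coeff j l r = (if l = j then
     - (kappa q4 t4 (int r) / of_nat r * qp (colour cs j) (- int r)) else 0)"

definition eta_plus_coeff :: "nat \<Rightarrow> nat \<Rightarrow> nat \<Rightarrow> complex" where
  "eta_plus_coeff j l r = (if l = j then kappa q4 t4 (int r) / of_nat r *
     (qp (colour cs j) (- int r) / (qp (colour cs j) (2 * int r) - qp (colour cs j) (- 2 * int r))) else 0)"

definition eta_minus_coeff :: "nat \<Rightarrow> nat \<Rightarrow> nat \<Rightarrow> complex" where
  "eta_minus_coeff j l r = (if l = j then - (kappa q4 t4 (int r) / of_nat r *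
     (qp (colour cs j) (int r) / (qp (colour cs j) (4 * int r) - 1))) else 0)"

abbreviation "shift \<equiv> shift_arg q4 t4 cs"

definition eta_minus :: "nat \<Rightarrow> current" where
  "eta_minus j = cur_subst (shift (j - 1)) (cur_exp (-1) (lowering (eta_minus_coeff j)))"

definition eta_plus :: "nat \<Rightarrow> current" where
  "eta_plus j = cur_subst (shift (j - 1)) (cur_exp 1 (raising (eta_plus_coeff j)))"

definition phi_shifted :: "nat \<Rightarrow> current" where
  "phi_shifted j = cur_subst (shift j) (cur_exp 1 (raising (phi_coeff j)))"

lemma qc_pow_minus: "qc_pow q4 t4 cs (- r) = inverse (qc_pow q4 t4 cs r)"
  by (simp add: qc_pow_def prod_inversef[symmetric] qp_minus)

lemma qc_pow_nonzero: "qc_pow q4 t4 cs r \<noteq> 0"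
  by (simp add: qc_pow_def qp_nonzero)

lemma qc_pow_double: "qc_pow q4 t4 cs (2 * r) = qc_pow q4 t4 cs r ^ 2"
  by (simp add: qc_pow_def power2_eq_square qp_add[symmetric] flip: prod.distrib)

lemma qc_diff_nonzero: "r > 0 \<Longrightarrow> qc_pow q4 t4 cs (int r) - qc_pow q4 t4 cs (- int r) \<noteq> 0"
  using qc_pow_generic[of r] qc_pow_nonzero[of "int r"] qc_pow_double[of "int r"]
  by (auto simp: qc_pow_minus field_simps power2_eq_square)

lemma b_tilde_eq: "r > 0 \<Longrightarrow> b_tilde q4 t4 cs (int r) v = (\<Sum>l=1..n.
    fock_scale (b_coeff l r * (qc_pow q4 t4 cs (int r) - qc_pow q4 t4 cs (- int r))) (hs l (int r) v))"
  "r > 0 \<Longrightarrow> b_tilde q4 t4 cs (- int r) v = (\<Sum>l=1..n.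
    fock_scale (b_coeff l r * (qc_pow q4 t4 cs (int r) - qc_pow q4 t4 cs (- int r))) (hs l (- int r) v))"
  using qc_diff_nonzero[of r] unfolding b_tilde_def b_coeff_def by (simp_all add: ac_simps)

lemma op_exp_cong:
  assumes "\<And>r v. r > 0 \<Longrightarrow> X r v = Y r v" shows "op_exp X k v = op_exp Y k v"
proof -
  have "foldr X rs v = foldr Y rs v" if "\<forall>r\<in>set rs. 1 \<le> r" for rs
    using that by (induction rs) (auto simp: assms)
  then show ?thesis unfolding op_exp_def by (intro sum.cong) (auto simp: compositions_def)
qed

lemma cur_exp_cong:
  assumes "\<And>r v. r > 0 \<Longrightarrow> X r v = Y r v"
  shows "cur_exp 1 X = cur_exp 1 Y" "cur_exp (-1) X = cur_exp (-1) Y"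
  by (auto simp: fun_eq_iff cur_exp_pos cur_exp_neg op_exp_cong[OF assms])

lemma beta_cur_eq: "beta_cur q4 t4 cs = cur_exp (-1) (lowering b_coeff)"
  unfolding beta_cur_def
proof (rule cur_exp_cong)
  fix r :: nat and v assume r: "r > 0"
  show "fock_scale (1 / (qc_pow q4 t4 cs (int r) - qc_pow q4 t4 cs (- int r))) (b_tilde q4 t4 cs (int r)
      v) = lowering b_coeff r v"
    unfolding b_tilde_eq[OF r] lowering_def fock_scale_sum
    using qc_diff_nonzero[OF r] by (intro sum.cong) auto
qed

lemma alpha_cur_eq: "alpha_cur q4 t4 cs = cur_exp 1 (raising (\<lambda>l r. - b_coeff l r))"
  unfolding alpha_cur_def
proof (rule cur_exp_cong)
  fix r :: nat and v assume r: "r > 0"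
  show "fock_scale (- 1 / (qc_pow q4 t4 cs (int r) - qc_pow q4 t4 cs (- int r))) (b_tilde q4 t4 cs (-
      int r) v) =
      raising (\<lambda>l r. - b_coeff l r) r v"
    unfolding b_tilde_eq[OF r] raising_def fock_scale_sum
    using qc_diff_nonzero[OF r] by (intro sum.cong) auto
qed

lemma single_lowering:
  "j \<in> {1..n} \<Longrightarrow> lowering (\<lambda>l r. if l = j then c r else 0) r v = fock_scale (c r) (hs j (int r) v)"
  "j \<in> {1..n} \<Longrightarrow> raising (\<lambda>l r. if l = j then c r else 0) r v = fock_scale (c r) (hs j (- int r) v)"
proof -
  have *: "fock_scale (if l = j then c r else 0) w = (if l = j then fock_scale (c r) w else 0)" for l w
    by simp
  show "j \<in> {1..n} \<Longrightarrow> lowering (\<lambda>l r. if l = j then c r else 0) r v = fock_scale (c r) (hs j (int r) v)"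
    "j \<in> {1..n} \<Longrightarrow> raising (\<lambda>l r. if l = j then c r else 0) r v = fock_scale (c r) (hs j (- int r) v)"
    by (simp_all add: lowering_def raising_def *)
qed

lemma phi_cur_eq:
  assumes "j \<in> {1..n}" shows "cur_subst (shift j) (phi_cur q4 t4 cs j) = phi_shifted j"
proof -
  have "phi_cur q4 t4 cs j = cur_exp 1 (raising (phi_coeff j))"
    unfolding phi_cur_def by (rule cur_exp_cong) (simp add: phi_coeff_def[abs_def] single_lowering[OF assms])
  then show ?thesis by (simp add: phi_shifted_def)
qed

lemma shift_nonzero: "shift j \<noteq> 0"
  by (simp add: shift_arg_def qp_nonzero)

lemma eta_cur_eq:
  assumes "j \<in> {1..n}" shows "cur_subst (shift (j - 1)) (eta_cur q4 t4 cs j) = cur_mult (eta_plus j)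
      (eta_minus j)"
proof -
  have "eta_cur q4 t4 cs j = cur_mult (cur_exp 1 (raising (eta_plus_coeff j))) (cur_exp (-1) (lowering
      (eta_minus_coeff j)))"
    unfolding eta_cur_def
    by (intro arg_cong2[where f = cur_mult] cur_exp_cong)
      (simp_all add: eta_plus_coeff_def[abs_def] eta_minus_coeff_def[abs_def] single_lowering[OF assms])
  then show ?thesis unfolding eta_plus_def eta_minus_def
    by (simp add: cur_subst_mult[OF locally_finite_annihilation] creation_field[OF creation_raising]
        annihilation_lowering field_linear[OF creation_field[OF creation_raising]] shift_nonzero)
qed

definition vertex :: "nat \<Rightarrow> current" where
  "vertex j = foldr cur_mult (map phi_shifted [1..<j]) (cur_mult (eta_plus j) (eta_minus j))"

lemma Lambda_tilde_eq:
  assumes "j \<in> {1..n}"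
  shows "Lambda_tilde q4 t4 cs u j = cur_mult (cur_exp 1 (raising (\<lambda>l r. - b_coeff l r)))
    (cur_mult (cur_smult (u j) (vertex j)) (cur_exp (-1) (lowering b_coeff)))"
proof -
  have "map (\<lambda>l. cur_subst (shift l) (phi_cur q4 t4 cs l)) [1..<j] = map phi_shifted [1..<j]"
    using assms by (intro map_cong refl phi_cur_eq) auto
  then show ?thesis
    unfolding Lambda_tilde_def Lambda_cur_def alpha_cur_eq beta_cur_eq vertex_def eta_cur_eq[OF assms]
    by (simp only:)
qed

text \<open>The annihilation part of \<open>Lambda_tilde\<close>. The left vacuum sees nothing else
  of the current apart from the scalar u j, because alpha, all phi and one half of eta consist of
  creation modes.\<close>

definition lower_vertex :: "nat \<Rightarrow> current" where
  "lower_vertex j = cur_mult (eta_minus j) (cur_exp (-1) (lowering b_coeff))"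

lemma annihilation_eta_minus: "annihilation (eta_minus j)"
  by (simp add: eta_minus_def annihilation_subst annihilation_lowering)

lemma creation_eta_plus: "creation (eta_plus j)"
  by (simp add: eta_plus_def creation_subst creation_raising)

lemma creation_phi_shifted: "creation (phi_shifted j)"
  by (simp add: phi_shifted_def creation_subst creation_raising)

lemma annihilation_lower_vertex: "annihilation (lower_vertex j)"
  by (simp add: lower_vertex_def annihilation_mult annihilation_eta_minus annihilation_lowering)

lemma field_eta: "field_cur (cur_mult (eta_plus j) (eta_minus j))"
  by (intro field_cur_mult_annihilation creation_field[OF creation_eta_plus] annihilation_eta_minus)

lemma field_vertex: "field_cur (vertex j)"
  unfolding vertex_def by (intro field_cur_foldr creation_phi_shifted field_eta)

lemma field_inner: "field_cur (cur_mult (cur_smult c (vertex j)) (cur_exp (-1) (lowering b_coeff)))"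
  by (intro field_cur_mult_annihilation field_cur_smult field_vertex annihilation_lowering)

lemma field_Lambda: "j \<in> {1..n} \<Longrightarrow> field_cur (Lambda_tilde q4 t4 cs u j)"
  unfolding Lambda_tilde_eq by (intro field_cur_mult_creation creation_raising field_inner)

lemma dual_vacuum_Lambda:
  assumes "j \<in> {1..n}"
  shows "dual_vacuum (Lambda_tilde q4 t4 cs u j m v) = u j * dual_vacuum (lower_vertex j m v)"
proof -
  have "dual_vacuum (vertex j p w) = dual_vacuum (eta_minus j p w)" for p w
    unfolding vertex_def dual_vacuum_foldr[OF creation_phi_shifted field_eta]
    by (rule dual_vacuum_cur_mult_creation[OF creation_eta_plus annihilation_field[OF annihilation_eta_minus]])
  then have "dual_vacuum (cur_smult (u j) (vertex j) p w) = u j * dual_vacuum (eta_minus j p w)" for p w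
    by (simp add: cur_smult_def linear_dualD[OF linear_dual_vacuum])
  then show ?thesis
    unfolding Lambda_tilde_eq[OF assms] lower_vertex_def dual_vacuum_cur_mult_creation[OF
        creation_raising field_inner]
    by (intro dual_vacuum_cur_mult_annihilation field_cur_smult field_vertex annihilation_field[OF
        annihilation_eta_minus] annihilation_lowering)
qed

text \<open>An annihilation current meets only the creation factors of \<open>Lambda_tilde\<close>.\<close>

lemma exchange_Lambda:
  assumes b: "b \<in> {1..n}" and A: "annihilation A"
    and al: "exchange A (cur_exp 1 (raising (\<lambda>l r. - b_coeff l r))) s1"
    and ph: "\<And>l. l \<in> {1..<b} \<Longrightarrow> exchange A (phi_shifted l) (s2 l)"
    and ep: "exchange A (eta_plus b) s3"
    and em: "exchange A (eta_minus b) (\<lambda>r. 0)"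
    and be: "exchange A (cur_exp (-1) (lowering b_coeff)) (\<lambda>r. 0)"
  shows "exchange A (Lambda_tilde q4 t4 cs u b) (\<lambda>r. s1 r + (\<Sum>l=1..<b. s2 l r) + s3 r)"
proof -
  have "exchange A (cur_mult (eta_plus b) (eta_minus b)) (\<lambda>r. s3 r + 0)"
    by (rule exchange_mult_right[OF ep em A locally_finite_annihilation])
      (simp_all add: creation_field creation_eta_plus annihilation_eta_minus)
  then have "exchange A (vertex b) (\<lambda>r. (\<Sum>l\<leftarrow>[1..<b]. s2 l r) + (s3 r + 0))"
    unfolding vertex_def by (intro exchange_foldr creation_phi_shifted field_eta A ph) auto
  then have "exchange A (cur_smult (u b) (vertex b)) (\<lambda>r. (\<Sum>l\<leftarrow>[1..<b]. s2 l r) + (s3 r + 0))"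
    using A by (rule exchange_smult_right)
  from exchange_mult_right[OF this be A locally_finite_annihilation]
  have "exchange A (cur_mult (cur_smult (u b) (vertex b)) (cur_exp (-1) (lowering b_coeff)))
      (\<lambda>r. (\<Sum>l\<leftarrow>[1..<b]. s2 l r) + (s3 r + 0) + 0)"
    by (simp add: field_cur_smult field_vertex annihilation_lowering)
  from exchange_mult_right[OF al this A locally_finite_creation]
  show ?thesis unfolding Lambda_tilde_eq[OF b]
    by (simp add: creation_raising field_inner creation_field sum_set_upt_conv_sum_list_nat[symmetric]
        add.assoc)
qed

section \<open>Contractions between the exponential factors\<close>

lemma shift_power: "shift j ^ r = (\<Prod>m=1..j. qp (colour cs m) (2 * int r))"
  unfolding shift_arg_def prod_power_distrib qp_mult ..

lemma shift_square_telescope: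
  "(\<Sum>l=1..j. (shift l ^ r)\<^sup>2 - (shift (l - 1) ^ r)\<^sup>2) = (shift j ^ r)\<^sup>2 - 1"
  by (induction j) (simp_all add: shift_arg_def)

context
  fixes r :: nat assumes r: "r \<ge> 1"
begin

text \<open>All contractions are expressed by S l, the r-th power of the argument shift, and h l,
  the r-th power of the fourth root of q_{c_l}. Passing from factor l - 1 to l multiplies S by h l
  squared, and the square of S n is q_c^r.\<close>

private abbreviation "S l \<equiv> shift l ^ r"
private abbreviation "h l \<equiv> qp (colour cs l) (int r)"
private abbreviation "K \<equiv> kappa q4 t4 (int r) / of_nat r"
private abbreviation "g l \<equiv> heis_coeff q4 t4 (colour cs l) (int r)"

private lemma h0: "h l \<noteq> 0" and S0: "S l \<noteq> 0" and K0: "K \<noteq> 0"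
  using kappa_nonzero r by (simp_all add: qp_nonzero shift_nonzero)

private lemma qp_h: "qp (colour cs l) (2 * int r) = h l ^ 2" "qp (colour cs l) (4 * int r) = h l ^ 4"
  "qp (colour cs l) (- int r) = inverse (h l)" "qp (colour cs l) (- 2 * int r) = inverse (h l ^ 2)"
  "qp (colour cs l) (- (2 * int r)) = inverse (h l ^ 2)"
  using qp_mult[of "colour cs l" "int r" 2] qp_mult[of "colour cs l" "int r" 4]
    qp_minus[of "colour cs l" "2 * int r"]
  by (simp_all add: qp_minus mult.commute)

private lemma S_step: "l \<ge> 1 \<Longrightarrow> S l = S (l - 1) * h l ^ 2"
  unfolding shift_power qp_h[symmetric] by (cases l) simp_all

private lemma g_h: "g l = (h l ^ 2 - inverse (h l ^ 2)) / K"
  by (simp add: heis_coeff_def qp_h)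

private lemma S_n: "qc_pow q4 t4 cs (int r) = S n" "qc_pow q4 t4 cs (- int r) = inverse (S n)"
  "qc_pow q4 t4 cs (2 * int r) = (S n)\<^sup>2"
  unfolding qc_pow_minus qc_pow_double by (simp_all add: qc_pow_def shift_power)

private lemma Sn1: "(S n)\<^sup>2 - 1 \<noteq> 0"
  using qc_pow_generic[OF r] S_n by simp

text \<open>The product of q_{c_m}^(-r/2) over m > l is S l / S n, so the coefficient involves only
  the shift up to l and the total shift.\<close>

private lemma b_S: "l \<in> {1..n} \<Longrightarrow> b_coeff l r = K * inverse (h l) * S l / ((S n)\<^sup>2 - 1)"
proof -
  assume l: "l \<in> {1..n}"
  have "(\<Prod>m=l+1..n. qp (colour cs m) (- 2 * int r)) = inverse (\<Prod>m=l+1..n. h m ^ 2)"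
    unfolding qp_h by (simp flip: prod_inversef)
  also have "{1..n} = {1..l} \<union> {l+1..n}" using l by auto
  then have "S n = S l * (\<Prod>m=l+1..n. h m ^ 2)"
    unfolding shift_power qp_h[symmetric] by (simp add: prod.union_disjoint)
  then have "inverse (\<Prod>m=l+1..n. h m ^ 2) = S l / S n" using S0 h0 by (simp add: field_simps)
  finally have p: "(\<Prod>m=l+1..n. qp (colour cs m) (- 2 * int r)) = S l / S n" .
  have "S l / S n / (S n - inverse (S n)) = S l / ((S n)\<^sup>2 - 1)"
    using S0[of n] by (simp add: field_simps power2_eq_square)
  then show ?thesis
    unfolding b_coeff_def p S_n by (simp only: qp_h mult.assoc flip: times_divide_eq_right)
qed

private lemma h4: "l \<in> {1..n} \<Longrightarrow> h l ^ 4 - 1 \<noteq> 0"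
  using qp_4_generic[OF colours r, of l] qp_h by simp

text \<open>The Heisenberg structure constant contributes the factor 1 - h^(-4). It makes each
  contraction a difference of consecutive squares of S, so that sums over the tensor factors
  telescope.\<close>

private lemma S_h: "l \<ge> 1 \<Longrightarrow> (S l)\<^sup>2 * (1 - inverse (h l ^ 4)) = (S l)\<^sup>2 - (S (l - 1))\<^sup>2"
  using h0[of l] by (simp add: S_step field_simps power_mult_distrib flip: power_mult)

private lemma sum_single:
  assumes "j \<in> {1..n}" "\<And>l. l \<noteq> j \<Longrightarrow> f l = (0 :: complex)"
  shows "(\<Sum>l=1..n. f l) = f j"
  using assms by (subst sum.mono_neutral_right[of _ "{j}"]) auto

text \<open>Field identities kept apart from the definitions of the coefficients. They also hold for
  Z = 0, where both sides are 0 by the convention for division.\<close>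

private lemma contraction_aux:
  fixes K h S Z X :: complex
  assumes "K \<noteq> 0" "h \<noteq> 0"
  shows "(K * inverse h * S / Z) * (- (K * inverse h * S / Z)) * ((h ^ 2 - inverse (h ^ 2)) / K) =
      - (K / Z\<^sup>2) * (S\<^sup>2 * (1 - inverse (h ^ 4)))"
    and "S * (K * inverse h * S / Z * (- (K * inverse h)) * ((h ^ 2 - inverse (h ^ 2)) / K)) =
      - (K / Z) * (S\<^sup>2 * (1 - inverse (h ^ 4)))"
    and "X \<noteq> 0 \<Longrightarrow> S * (K * inverse h * (S * h ^ 2) / Z * (K * (inverse h / X)) * (X / K)) = K / Z * S\<^sup>2"
  using assms by (cases "Z = 0"; simp add: field_simps power2_eq_square power4_eq_xxxx)+

private lemma beta_alpha:
  "(\<Sum>l=1..n. b_coeff l r * (- b_coeff l r) * g l) = - (K / ((S n)\<^sup>2 - 1))"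
proof -
  have "b_coeff l r * (- b_coeff l r) * g l = - (K / ((S n)\<^sup>2 - 1)\<^sup>2) * ((S l)\<^sup>2 - (S (l - 1))\<^sup>2)"
    if "l \<in> {1..n}" for l
  proof -
    have "b_coeff l r * (- b_coeff l r) * g l =
        - (K / ((S n)\<^sup>2 - 1)\<^sup>2) * ((S l)\<^sup>2 * (1 - inverse (h l ^ 4)))"
      unfolding b_S[OF that] g_h by (rule contraction_aux(1)[OF K0 h0])
    then show ?thesis using S_h that by simp
  qed
  then have "(\<Sum>l=1..n. b_coeff l r * (- b_coeff l r) * g l) =
      (\<Sum>l=1..n. - (K / ((S n)\<^sup>2 - 1)\<^sup>2) * ((S l)\<^sup>2 - (S (l - 1))\<^sup>2))"
    by (intro sum.cong) auto
  also have "\<dots> = - (K / ((S n)\<^sup>2 - 1)\<^sup>2) * ((S n)\<^sup>2 - 1)"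
    unfolding sum_distrib_left[symmetric] shift_square_telescope ..
  finally show ?thesis using Sn1 by (simp add: power2_eq_square)
qed

private lemma beta_phi:
  assumes "j \<in> {1..n}"
  shows "S j * (\<Sum>l=1..n. b_coeff l r * phi_coeff j l r * g l) =
    - (K / ((S n)\<^sup>2 - 1)) * ((S j)\<^sup>2 - (S (j - 1))\<^sup>2)"
proof -
  have "(\<Sum>l=1..n. b_coeff l r * phi_coeff j l r * g l) = b_coeff j r * (- (K * inverse (h j))) * g j"
    using assms by (simp add: phi_coeff_def qp_h if_distrib[of "\<lambda>x. _ * x"] if_distrib[of "\<lambda>x. x * _"]
        cong: if_cong)
  also have "S j * \<dots> = - (K / ((S n)\<^sup>2 - 1)) * ((S j)\<^sup>2 * (1 - inverse (h j ^ 4)))"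
    unfolding b_S[OF assms] g_h by (rule contraction_aux(2)[OF K0 h0])
  finally show ?thesis using S_h assms by simp
qed

private lemma beta_eta:
  assumes "j \<in> {1..n}"
  shows "S (j - 1) * (\<Sum>l=1..n. b_coeff l r * eta_plus_coeff j l r * g l) = K / ((S n)\<^sup>2 - 1) * (S (j - 1))\<^sup>2"
proof -
  have d: "h j ^ 2 - inverse (h j ^ 2) \<noteq> 0"
    using h4[OF assms] h0[of j] by (auto simp: field_simps simp flip: power_add)
  have "(\<Sum>l=1..n. b_coeff l r * eta_plus_coeff j l r * g l) =
      b_coeff j r * (K * (inverse (h j) / (h j ^ 2 - inverse (h j ^ 2)))) * g j"
    using assms by (simp add: eta_plus_coeff_def qp_h if_distrib[of "\<lambda>x. _ * x"] if_distrib[of "\<lambda>x. x *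
        _"] cong: if_cong)
  also have "S (j - 1) * \<dots> = K / ((S n)\<^sup>2 - 1) * (S (j - 1))\<^sup>2"
    using contraction_aux(3)[OF K0 h0 d] assms by (simp add: b_S S_step g_h)
  finally show ?thesis .
qed

private lemma cancel_aux'':
  fixes K H Y X S :: complex
  assumes "S \<noteq> 0"
  shows "S * H * (inverse S * (K * X / Y)) = H * X / Y * K"
  using assms by simp

private lemma cancel_aux':
  fixes K h Y X :: complex
  assumes "K \<noteq> 0" "h \<noteq> 0"
  shows "(K * (h / Y)) * (K * inverse h) * (X / K) = K * X / Y"
    and "X \<noteq> 0 \<Longrightarrow> - (K * (h / Y)) * (K * (inverse h / X)) * (X / K) = - (K / Y)"
  using assms by (cases "Y = 0"; simp add: field_simps)+

private lemma cancel_aux: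
  fixes K h Y S Z X H :: complex
  assumes "K \<noteq> 0" "h \<noteq> 0" "Y \<noteq> 0" "H * X = Y"
  shows "K * (h / Y) * (K * inverse h * (S * H) / Z) * (X / K) = K * S / Z"
  using assms(1-3) unfolding assms(4)[symmetric] by (cases "Z = 0") (auto simp: field_simps)

private lemma eta_alpha:
  assumes "j \<in> {1..n}"
  shows "inverse (S (j - 1)) * (\<Sum>l=1..n. eta_minus_coeff j l r * (- b_coeff l r) * g l) = K / ((S n)\<^sup>2 - 1)"
proof -
  have "(\<Sum>l=1..n. eta_minus_coeff j l r * (- b_coeff l r) * g l) =
      (K * (h j / (h j ^ 4 - 1))) * b_coeff j r * g j"
    using assms by (subst sum_single[of j]) (auto simp: eta_minus_coeff_def qp_h)
  also have "\<dots> = K * S (j - 1) / ((S n)\<^sup>2 - 1)"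
  proof -
    have "h j ^ 2 * (h j ^ 2 - inverse (h j ^ 2)) = h j ^ 4 - 1"
      using h0[of j] by (simp add: right_diff_distrib flip: power_add)
    from cancel_aux[OF K0 h0 h4[OF assms] this]
    have "K * (h j / (h j ^ 4 - 1)) * (K * inverse (h j) * (S (j - 1) * h j ^ 2) / ((S n)\<^sup>2 - 1)) * ((h
        j ^ 2 - inverse (h j ^ 2)) / K)
       = K * S (j - 1) / ((S n)\<^sup>2 - 1)" .
    moreover have "S j = S (j - 1) * h j ^ 2" using S_step assms by simp
    ultimately show ?thesis unfolding b_S[OF assms] g_h by (simp only:)
  qed
  finally show ?thesis using S0[of "j - 1"] by simp
qed

private lemma eta_phi:
  assumes "j \<in> {1..n}"
  shows "S i * (inverse (S (j - 1)) * (\<Sum>l=1..n. eta_minus_coeff j l r * phi_coeff i l r * g l)) = (if i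
      = j then K else 0)"
proof (cases "i = j")
  case True
  have "(\<Sum>l=1..n. eta_minus_coeff j l r * phi_coeff i l r * g l) =
      (K * (h j / (h j ^ 4 - 1))) * (K * inverse (h j)) * g j"
    using assms by (simp add: True eta_minus_coeff_def phi_coeff_def qp_h if_distrib[of "\<lambda>x. _ * x"]
        if_distrib[of "\<lambda>x. x * _"] cong: if_cong)
  also have "\<dots> = K * (h j ^ 2 - inverse (h j ^ 2)) / (h j ^ 4 - 1)"
    unfolding g_h by (rule cancel_aux'[OF K0 h0])
  also have "S i * (inverse (S (j - 1)) * \<dots>) = h j ^ 2 * (h j ^ 2 - inverse (h j ^ 2)) / (h j ^ 4 - 1) * K"
  proof -
    have "S i = S (j - 1) * h j ^ 2" using S_step True assms by simp
    then show ?thesis by (simp only: cancel_aux''[OF S0])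
  qed
  also have "h j ^ 2 * (h j ^ 2 - inverse (h j ^ 2)) = h j ^ 4 - 1"
    using h0[of j] by (simp add: right_diff_distrib flip: power_add)
  finally show ?thesis using h4[OF assms] True by simp
next
  case False
  then have "(\<Sum>l=1..n. eta_minus_coeff j l r * phi_coeff i l r * g l) = 0"
    by (intro sum.neutral) (simp add: eta_minus_coeff_def phi_coeff_def)
  then show ?thesis using False by simp
qed

private lemma eta_eta:
  assumes "j \<in> {1..n}"
  shows "S (i - 1) * (inverse (S (j - 1)) * (\<Sum>l=1..n. eta_minus_coeff j l r * eta_plus_coeff i l r * g l)) =
    (if i = j then - (K / (h j ^ 4 - 1)) else 0)"
proof (cases "i = j")
  case True
  have d: "h j ^ 2 - inverse (h j ^ 2) \<noteq> 0"
    using h4[OF assms] h0[of j] by (auto simp: field_simps simp flip: power_add)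
  have "(\<Sum>l=1..n. eta_minus_coeff j l r * eta_plus_coeff i l r * g l) =
      - (K * (h j / (h j ^ 4 - 1))) * (K * (inverse (h j) / (h j ^ 2 - inverse (h j ^ 2)))) * g j"
    using assms by (simp add: True eta_minus_coeff_def eta_plus_coeff_def qp_h if_distrib[of "\<lambda>x. _ *
        x"] if_distrib[of "\<lambda>x. x * _"] cong: if_cong)
  also have "\<dots> = - (K / (h j ^ 4 - 1))"
    unfolding g_h by (rule cancel_aux'(2)[OF K0 h0 d])
  finally show ?thesis using True S0[of "j - 1"] by simp
next
  case False
  then have "(\<Sum>l=1..n. eta_minus_coeff j l r * eta_plus_coeff i l r * g l) = 0"
    by (intro sum.neutral) (simp add: eta_minus_coeff_def eta_plus_coeff_def)
  then show ?thesis using False by simp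
qed

text \<open>The contraction of \<open>beta\<close> with \<open>Lambda_tilde\<close> vanishes.\<close>

lemma beta_contraction:
  assumes b: "b \<in> {1..n}"
  shows "(\<Sum>l=1..n. b_coeff l r * (- b_coeff l r) * g l) +
    (\<Sum>j=1..<b. shift j ^ r * (\<Sum>l=1..n. b_coeff l r * phi_coeff j l r * g l)) +
    shift (b - 1) ^ r * (\<Sum>l=1..n. b_coeff l r * eta_plus_coeff b l r * g l) = 0"
proof -
  have "(\<Sum>j=1..<b. S j * (\<Sum>l=1..n. b_coeff l r * phi_coeff j l r * g l)) =
      (\<Sum>j=1..b-1. - (K / ((S n)\<^sup>2 - 1)) * ((S j)\<^sup>2 - (S (j - 1))\<^sup>2))"
    using b by (intro sum.cong beta_phi) auto
  also have "\<dots> = - (K / ((S n)\<^sup>2 - 1)) * ((S (b - 1))\<^sup>2 - 1)"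
    unfolding sum_distrib_left[symmetric] shift_square_telescope ..
  finally have *: "(\<Sum>j=1..<b. S j * (\<Sum>l=1..n. b_coeff l r * phi_coeff j l r * g l)) =
      - (K / ((S n)\<^sup>2 - 1)) * ((S (b - 1))\<^sup>2 - 1)" .
  \<comment> \<open>With c = K / ((S n)^2 - 1) and x = (S (b - 1))^2, the three summands come from
    alpha, from the telescoped phi factors and from eta.\<close>
  have "- c + - c * (x - 1) + c * x = 0" for c x :: complex
    by (simp add: algebra_simps)
  then show ?thesis
    unfolding beta_alpha beta_eta[OF b] * by (simp only:)
qed

text \<open>\<open>eta_minus\<close> a acts on tensor factor a only. On this factor
  \<open>Lambda_tilde\<close> b has a phi exactly if a < b and an eta exactly if a = b; alpha is
  there in every case and leaves the term in q_c alone.\<close>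

lemma eta_contraction:
  assumes a: "a \<in> {1..n}" and b: "b \<in> {1..n}"
  shows "inverse (shift (a - 1)) ^ r * (\<Sum>l=1..n. eta_minus_coeff a l r * (- b_coeff l r) * g l) +
    (\<Sum>j=1..<b. shift j ^ r * (inverse (shift (a - 1)) ^ r * (\<Sum>l=1..n. eta_minus_coeff a l r * phi_coeff
        j l r * g l))) +
    shift (b - 1) ^ r * (inverse (shift (a - 1)) ^ r * (\<Sum>l=1..n. eta_minus_coeff a l r * eta_plus_coeff
        b l r * g l)) =
    kappa q4 t4 (int r) / of_nat r * (1 / (qc_pow q4 t4 cs (2 * int r) - 1) + of_bool (a < b)
      - of_bool (a = b) / (qp (colour cs a) (4 * int r) - 1))"
proof -
  have "(\<Sum>j=1..<b. S j * (inverse (S (a - 1)) * (\<Sum>l=1..n. eta_minus_coeff a l r * phi_coeff j l r * g l))) =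
      (\<Sum>j=1..<b. if j = a then K else 0)"
    by (intro sum.cong refl eta_phi a)
  also have "\<dots> = of_bool (a < b) * K" using a by simp
  finally have *: "(\<Sum>j=1..<b. S j * (inverse (S (a - 1)) * (\<Sum>l=1..n. eta_minus_coeff a l r * phi_coeff j
      l r * g l))) =
      of_bool (a < b) * K" .
  have "c / z + x * c + (if b = a then - (c / y) else 0) = c * (1 / z + x - of_bool (a = b) / y)" for c
      x y z :: complex
    by (simp add: algebra_simps)
  then show ?thesis
    unfolding power_inverse eta_alpha[OF a] eta_eta[OF a] S_n qp_h * by (simp only:)
qed

end

definition contraction :: "nat \<Rightarrow> nat \<Rightarrow> nat \<Rightarrow> complex" where
  "contraction a b r = kappa q4 t4 (int r) / of_nat r * (1 / (qc_pow q4 t4 cs (2 * int r) - 1) + of_bool (a < b)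
      - of_bool (a = b) / (qp (colour cs a) (4 * int r) - 1))"

lemma exchange_lowering_currents:
  "exchange (cur_exp (-1) (lowering a)) (phi_shifted j)
     (\<lambda>r. shift j ^ r * (\<Sum>l=1..n. a l r * phi_coeff j l r * heis_coeff q4 t4 (colour cs l) (int r)))"
  "exchange (cur_exp (-1) (lowering a)) (eta_plus j)
     (\<lambda>r. shift (j - 1) ^ r * (\<Sum>l=1..n. a l r * eta_plus_coeff j l r * heis_coeff q4 t4 (colour cs l) (int r)))"
  "exchange (cur_exp (-1) (lowering a)) (eta_minus j) (\<lambda>r. shift (j - 1) ^ r * 0)"
  unfolding phi_shifted_def eta_plus_def eta_minus_def
  by (intro exchange_subst_right exchange_lowering_raising exchange_lowering_lowering annihilation_lowering
      creation_field annihilation_field creation_raising shift_nonzero)+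

lemma exchange_eta_minus_currents:
  "exchange (eta_minus a) (cur_exp 1 (raising b)) (\<lambda>r. inverse (shift (a - 1)) ^ r *
     (\<Sum>l=1..n. eta_minus_coeff a l r * b l r * heis_coeff q4 t4 (colour cs l) (int r)))"
  "exchange (eta_minus a) (phi_shifted j) (\<lambda>r. shift j ^ r * (inverse (shift (a - 1)) ^ r *
     (\<Sum>l=1..n. eta_minus_coeff a l r * phi_coeff j l r * heis_coeff q4 t4 (colour cs l) (int r))))"
  "exchange (eta_minus a) (eta_plus j) (\<lambda>r. shift (j - 1) ^ r * (inverse (shift (a - 1)) ^ r *
     (\<Sum>l=1..n. eta_minus_coeff a l r * eta_plus_coeff j l r * heis_coeff q4 t4 (colour cs l) (int r))))"
  "exchange (eta_minus a) (eta_minus j) (\<lambda>r. inverse (shift (a - 1)) ^ r * (shift (j - 1) ^ r * 0))"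
  "exchange (eta_minus a) (cur_exp (-1) (lowering b)) (\<lambda>r. inverse (shift (a - 1)) ^ r * 0)"
proof -
  show 1: "exchange (eta_minus a) (cur_exp 1 (raising b)) (\<lambda>r. inverse (shift (a - 1)) ^ r *
     (\<Sum>l=1..n. eta_minus_coeff a l r * b l r * heis_coeff q4 t4 (colour cs l) (int r)))" for b
    unfolding eta_minus_def
    by (intro exchange_subst_left exchange_lowering_raising creation_field creation_raising shift_nonzero)
  show "exchange (eta_minus a) (phi_shifted j) (\<lambda>r. shift j ^ r * (inverse (shift (a - 1)) ^ r *
     (\<Sum>l=1..n. eta_minus_coeff a l r * phi_coeff j l r * heis_coeff q4 t4 (colour cs l) (int r))))"
    unfolding phi_shifted_def
    by (intro exchange_subst_right 1 annihilation_eta_minus creation_field creation_raising shift_nonzero)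
  show "exchange (eta_minus a) (eta_plus j) (\<lambda>r. shift (j - 1) ^ r * (inverse (shift (a - 1)) ^ r *
     (\<Sum>l=1..n. eta_minus_coeff a l r * eta_plus_coeff j l r * heis_coeff q4 t4 (colour cs l) (int r))))"
    unfolding eta_plus_def
    by (intro exchange_subst_right 1 annihilation_eta_minus creation_field creation_raising shift_nonzero)
  show "exchange (eta_minus a) (eta_minus j) (\<lambda>r. inverse (shift (a - 1)) ^ r * (shift (j - 1) ^ r * 0))"
    unfolding eta_minus_def[of a]
    by (intro exchange_subst_left exchange_lowering_currents annihilation_field annihilation_eta_minus
        shift_nonzero)
  show "exchange (eta_minus a) (cur_exp (-1) (lowering b)) (\<lambda>r. inverse (shift (a - 1)) ^ r * 0)"
    unfolding eta_minus_def
    by (intro exchange_subst_left exchange_lowering_lowering annihilation_field annihilation_lowering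
        shift_nonzero)
qed

text \<open>Since beta contracts trivially with the whole current, only the annihilation half of eta
  in \<open>lower_vertex\<close> contributes.\<close>

lemma exchange_lower_vertex:
  assumes a: "a \<in> {1..n}" and b: "b \<in> {1..n}"
  shows "exchange (lower_vertex a) (Lambda_tilde q4 t4 cs u b) (contraction a b)"
proof -
  have "exchange (cur_exp (-1) (lowering b_coeff)) (Lambda_tilde q4 t4 cs u b) (\<lambda>r.
      (\<Sum>l=1..n. b_coeff l r * (- b_coeff l r) * heis_coeff q4 t4 (colour cs l) (int r)) +
      (\<Sum>j=1..<b. shift j ^ r * (\<Sum>l=1..n. b_coeff l r * phi_coeff j l r * heis_coeff q4 t4 (colour cs l)
          (int r))) +
      shift (b - 1) ^ r * (\<Sum>l=1..n. b_coeff l r * eta_plus_coeff b l r * heis_coeff q4 t4 (colour cs l)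
          (int r)))"
    by (rule exchange_Lambda[OF b annihilation_lowering exchange_lowering_raising
        exchange_lowering_currents(1,2) exchange_cong[OF exchange_lowering_currents(3)]
        exchange_lowering_lowering]) simp
  then have beta: "exchange (cur_exp (-1) (lowering b_coeff)) (Lambda_tilde q4 t4 cs u b) (\<lambda>r. 0)"
    by (rule exchange_cong) (use beta_contraction[OF _ b] in blast)
  have "exchange (eta_minus a) (Lambda_tilde q4 t4 cs u b) (\<lambda>r.
    inverse (shift (a - 1)) ^ r * (\<Sum>l=1..n. eta_minus_coeff a l r * (- b_coeff l r) * heis_coeff q4 t4
        (colour cs l) (int r)) +
    (\<Sum>j=1..<b. shift j ^ r * (inverse (shift (a - 1)) ^ r * (\<Sum>l=1..n. eta_minus_coeff a l r * phi_coeff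
        j l r * heis_coeff q4 t4 (colour cs l) (int r)))) +
    shift (b - 1) ^ r * (inverse (shift (a - 1)) ^ r * (\<Sum>l=1..n. eta_minus_coeff a l r * eta_plus_coeff
        b l r * heis_coeff q4 t4 (colour cs l) (int r))))"
    by (rule exchange_Lambda[OF b annihilation_eta_minus exchange_eta_minus_currents(1,2,3)
        exchange_cong[OF exchange_eta_minus_currents(4)] exchange_cong[OF
            exchange_eta_minus_currents(5)]]) simp_all
  then have "exchange (eta_minus a) (Lambda_tilde q4 t4 cs u b) (contraction a b)"
    by (rule exchange_cong) (use eta_contraction[OF _ a b] in \<open>unfold contraction_def, blast\<close>)
  from exchange_mult_left[OF this beta annihilation_eta_minus annihilation_lowering field_Lambda[OF b]]
  show ?thesis unfolding lower_vertex_def by simp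
qed

end

section \<open>Formal series in the ratios of the variables\<close>

type_synonym series = "(nat \<Rightarrow> int) \<Rightarrow> complex"

lemma sum_PiE_insert:
  assumes "finite S" "x \<notin> S"
  shows "(\<Sum>e\<in>PiE (insert x S) T. f e) = (\<Sum>y\<in>T x. \<Sum>e\<in>PiE S T. f (e(x := y)))"
proof -
  have inj: "inj_on (\<lambda>(y, e). e(x := y)) (T x \<times> PiE S T)"
    using assms(2) inj_combinator[of x S T] by (simp add: PiE_def extensional_def split_def)
  show ?thesis
    unfolding PiE_insert_eq sum.reindex[OF inj] sum.cartesian_product by (simp add: split_def)
qed

text \<open>A grading in which z_j / z_i with i < j has degree j - i \<ge> 1. On series supported in
  nonnegative weight, only boundedly many powers of such a ratio reach a given coefficient, so
  multiplication by a power series in the ratio is a finite sum.\<close>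

definition series_weight :: "nat \<Rightarrow> (nat \<Rightarrow> int) \<Rightarrow> int" where
  "series_weight k m = (\<Sum>i=1..k. int i * m i)"

definition index_pairs :: "nat \<Rightarrow> (nat \<times> nat) set" where
  "index_pairs k = {(i, j). 1 \<le> i \<and> i < j \<and> j \<le> k}"

lemma finite_index_pairs: "finite (index_pairs k)"
  by (rule finite_subset[of _ "{1..k} \<times> {1..k}"]) (auto simp: index_pairs_def)

definition pair_shift :: "nat \<times> nat \<Rightarrow> nat \<Rightarrow> (nat \<Rightarrow> int) \<Rightarrow> nat \<Rightarrow> int" where
  "pair_shift x e m = (\<lambda>l. m l - int e * (of_bool (l = snd x) - of_bool (l = fst x)))"

text \<open>Multiplication of F by g at z_j / z_i, where x = (i, j).\<close>

definition pair_mult :: "nat \<times> nat \<Rightarrow> complex fps \<Rightarrow> series \<Rightarrow> series" where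
  "pair_mult x g F = (\<lambda>m. Sum_any (\<lambda>e. fps_nth g e * F (pair_shift x e m)))"

definition ratio_series :: "nat \<Rightarrow> series \<Rightarrow> bool" where
  "ratio_series k F \<longleftrightarrow> (\<forall>m. F m \<noteq> 0 \<longrightarrow> series_weight k m \<ge> 0)"

lemma weight_pair_shift:
  assumes "x \<in> index_pairs k"
  shows "series_weight k (pair_shift x e m) = series_weight k m - int e * (int (snd x) - int (fst x))"
proof -
  obtain i j where x: "x = (i, j)" and ij: "i \<in> {1..k}" "j \<in> {1..k}"
    using assms by (auto simp: index_pairs_def)
  have "series_weight k (pair_shift x e m) =
      (\<Sum>l=1..k. int l * m l - (if l = j then int e * int l else 0) + (if l = i then int e * int l else 0))"
    unfolding series_weight_def pair_shift_def x by (intro sum.cong refl) (auto simp: algebra_simps)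
  also have "\<dots> = series_weight k m - int e * int j + int e * int i"
    using ij unfolding series_weight_def sum.distrib sum_subtractf by simp
  finally show ?thesis using x by (simp add: right_diff_distrib)
qed

lemma weight_pair_shift_le:
  assumes "x \<in> index_pairs k"
  shows "series_weight k (pair_shift x e m) \<le> series_weight k m - int e"
proof -
  have "int e * 1 \<le> int e * (int (snd x) - int (fst x))"
    using assms by (intro mult_left_mono) (auto simp: index_pairs_def)
  then show ?thesis unfolding weight_pair_shift[OF assms] by simp
qed

lemma pair_shift_0 [simp]: "pair_shift x 0 m = m"
  by (simp add: pair_shift_def)

lemma pair_shift_add: "pair_shift x e (pair_shift x f m) = pair_shift x (e + f) m"
  by (simp add: pair_shift_def fun_eq_iff algebra_simps)

lemma pair_shift_commute: "pair_shift x e (pair_shift y f m) = pair_shift y f (pair_shift x e m)"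
  by (simp add: pair_shift_def fun_eq_iff)

lemma pair_mult_eq:
  assumes "x \<in> index_pairs k" "ratio_series k F" "series_weight k m \<le> int b"
  shows "pair_mult x g F m = (\<Sum>e\<le>b. fps_nth g e * F (pair_shift x e m))"
  unfolding pair_mult_def
proof (rule Sum_any.expand_superset)
  show "{e. fps_nth g e * F (pair_shift x e m) \<noteq> 0} \<subseteq> {..b}"
  proof
    fix e assume "e \<in> {e. fps_nth g e * F (pair_shift x e m) \<noteq> 0}"
    then have "series_weight k (pair_shift x e m) \<ge> 0" using assms(2) by (auto simp: ratio_series_def)
    then show "e \<in> {..b}" using weight_pair_shift_le[OF assms(1), of e m] assms(3) by simp
  qed
qed simp

lemma ratio_series_pair_mult:
  assumes "x \<in> index_pairs k" "ratio_series k F"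
  shows "ratio_series k (pair_mult x g F)"
  unfolding ratio_series_def
proof (intro allI impI)
  fix m assume "pair_mult x g F m \<noteq> 0"
  then obtain e where "fps_nth g e * F (pair_shift x e m) \<noteq> 0"
    unfolding pair_mult_def by (rule Sum_any.not_neutral_obtains_not_neutral)
  then have "series_weight k (pair_shift x e m) \<ge> 0" using assms(2) by (auto simp: ratio_series_def)
  then show "series_weight k m \<ge> 0" using weight_pair_shift_le[OF assms(1), of e m] by simp
qed

lemma pair_mult_mult:
  assumes x: "x \<in> index_pairs k" and F: "ratio_series k F"
  shows "pair_mult x (g * h) F = pair_mult x g (pair_mult x h F)"
proof
  fix m
  define b where "b = nat (series_weight k m)"
  have b: "series_weight k m \<le> int b" by (simp add: b_def)
  have "pair_mult x g (pair_mult x h F) m =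
      (\<Sum>e\<le>b. fps_nth g e * pair_mult x h F (pair_shift x e m))"
    by (rule pair_mult_eq[OF x ratio_series_pair_mult[OF x F] b])
  also have "\<dots> = (\<Sum>e\<le>b. \<Sum>f\<le>b-e. fps_nth g e * fps_nth h f * F (pair_shift x (e + f) m))"
  proof (intro sum.cong refl)
    fix e assume "e \<in> {..b}"
    then have "series_weight k (pair_shift x e m) \<le> int (b - e)"
      using weight_pair_shift_le[OF x, of e m] b by auto
    then show "fps_nth g e * pair_mult x h F (pair_shift x e m) =
        (\<Sum>f\<le>b-e. fps_nth g e * fps_nth h f * F (pair_shift x (e + f) m))"
      by (subst pair_mult_eq[OF x F]) (auto simp: sum_distrib_left pair_shift_add add.commute mult.assoc)
  qed
  also have "\<dots> = (\<Sum>s\<le>b. \<Sum>e\<le>s. fps_nth g e * fps_nth h (s - e) * F (pair_shift x s m))"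
    by (subst sum_triangle_diag0) (auto intro!: sum.cong)
  also have "\<dots> = pair_mult x (g * h) F m"
    unfolding pair_mult_eq[OF x F b] fps_mult_nth by (simp add: sum_distrib_right atMost_atLeast0)
  finally show "pair_mult x (g * h) F m = pair_mult x g (pair_mult x h F) m" ..
qed

lemma pair_mult_commute:
  assumes x: "x \<in> index_pairs k" and y: "y \<in> index_pairs k" and F: "ratio_series k F"
  shows "pair_mult x g (pair_mult y h F) = pair_mult y h (pair_mult x g F)"
proof
  fix m
  define b where "b = nat (series_weight k m)"
  have b: "series_weight k m \<le> int b" by (simp add: b_def)
  have sh: "series_weight k (pair_shift z e m) \<le> int b" if "z \<in> index_pairs k" for z e
    using weight_pair_shift_le[OF that, of e m] b by simp
  have "pair_mult x g (pair_mult y h F) m =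
      (\<Sum>e\<le>b. \<Sum>f\<le>b. fps_nth g e * (fps_nth h f * F (pair_shift y f (pair_shift x e m))))"
    by (simp add: pair_mult_eq[OF x ratio_series_pair_mult[OF y F] b] pair_mult_eq[OF y F sh[OF x]]
        sum_distrib_left)
  also have "\<dots> = (\<Sum>f\<le>b. \<Sum>e\<le>b. fps_nth h f * (fps_nth g e * F (pair_shift x e (pair_shift y f m))))"
    by (subst sum.swap) (simp add: mult_ac pair_shift_commute)
  also have "\<dots> = pair_mult y h (pair_mult x g F) m"
    by (simp add: pair_mult_eq[OF y ratio_series_pair_mult[OF x F] b] pair_mult_eq[OF x F sh[OF y]]
        sum_distrib_left)
  finally show "pair_mult x g (pair_mult y h F) m = pair_mult y h (pair_mult x g F) m" .
qed

lemma pair_mult_1 [simp]: "pair_mult x 1 F = F"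
proof
  fix m
  have "fps_nth 1 e * F (pair_shift x e m) = (if e = 0 then F m else 0)" for e by simp
  then show "pair_mult x 1 F m = F m" by (simp add: pair_mult_def)
qed

lemma ratio_series_sum:
  assumes "\<And>a. a \<in> A \<Longrightarrow> ratio_series k (F a)"
  shows "ratio_series k (\<lambda>m. \<Sum>a\<in>A. c a * F a m)"
  using assms unfolding ratio_series_def by (metis (mono_tags, lifting) mult_zero_right sum.neutral)

lemma pair_mult_sum:
  assumes x: "x \<in> index_pairs k" and F: "\<And>a. a \<in> A \<Longrightarrow> ratio_series k (F a)"
  shows "pair_mult x g (\<lambda>m. \<Sum>a\<in>A. c a * F a m) = (\<lambda>m. \<Sum>a\<in>A. c a * pair_mult x g (F a) m)"
proof
  fix m
  define b where "b = nat (series_weight k m)"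
  have b: "series_weight k m \<le> int b" by (simp add: b_def)
  have "(\<Sum>a\<in>A. c a * pair_mult x g (F a) m) =
      (\<Sum>a\<in>A. \<Sum>e\<le>b. c a * (fps_nth g e * F a (pair_shift x e m)))"
    by (intro sum.cong refl) (simp add: pair_mult_eq[OF x F b] sum_distrib_left)
  also have "\<dots> = (\<Sum>e\<le>b. fps_nth g e * (\<Sum>a\<in>A. c a * F a (pair_shift x e m)))"
    by (subst sum.swap) (simp add: sum_distrib_left mult.left_commute)
  finally show "pair_mult x g (\<lambda>m. \<Sum>a\<in>A. c a * F a m) m = (\<Sum>a\<in>A. c a * pair_mult x g (F a) m)"
    by (simp add: pair_mult_eq[OF x ratio_series_sum[OF F] b])
qed

text \<open>Simultaneous multiplication by \<open>g (i, j)\<close> at \<open>z\<^sub>j / z\<^sub>i\<close> for all \<open>(i, j)\<close> in a set.\<close>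

definition set_shift :: "(nat \<times> nat) set \<Rightarrow> (nat \<times> nat \<Rightarrow> nat) \<Rightarrow> (nat \<Rightarrow> int) \<Rightarrow> nat \<Rightarrow> int" where
  "set_shift S e m = (\<lambda>l. m l - (\<Sum>(i, j)\<in>S. int (e (i, j)) * (of_bool (l = j) - of_bool (l = i))))"

definition set_mult :: "(nat \<times> nat) set \<Rightarrow> (nat \<times> nat \<Rightarrow> complex fps) \<Rightarrow> series \<Rightarrow> series" where
  "set_mult S g F = (\<lambda>m. Sum_any (\<lambda>e. if e \<in> S \<rightarrow>\<^sub>E UNIV
     then (\<Prod>x\<in>S. fps_nth (g x) (e x)) * F (set_shift S e m) else 0))"

lemma set_shift_insert:
  assumes "finite S" "x \<notin> S"
  shows "set_shift (insert x S) (e(x := y)) m = set_shift S e (pair_shift x y m)"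
proof
  fix l
  have "(\<Sum>(i, j)\<in>S. int ((e(x := y)) (i, j)) * (of_bool (l = j) - of_bool (l = i))) =
      (\<Sum>(i, j)\<in>S. int (e (i, j)) * (of_bool (l = j) - of_bool (l = i)) :: int)"
    using assms by (intro sum.cong) auto
  then show "set_shift (insert x S) (e(x := y)) m l = set_shift S e (pair_shift x y m) l"
    using assms by (cases x) (simp add: set_shift_def pair_shift_def)
qed

lemma weight_set_shift:
  assumes "finite S" "S \<subseteq> index_pairs k"
  shows "series_weight k (set_shift S e m) \<le> series_weight k m - (\<Sum>x\<in>S. int (e x))"
  using assms
proof (induction S arbitrary: m rule: finite_induct)
  case (insert x S)
  have "series_weight k (set_shift (insert x S) e m) = series_weight k (set_shift S e (pair_shift x (e x) m))"
    using set_shift_insert[OF insert(1,2), of e "e x"] by simp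
  also have "\<dots> \<le> series_weight k (pair_shift x (e x) m) - (\<Sum>x\<in>S. int (e x))"
    using insert by simp
  also have "series_weight k (pair_shift x (e x) m) \<le> series_weight k m - int (e x)"
    using insert by (intro weight_pair_shift_le) auto
  finally show ?case using insert by simp
qed (simp add: set_shift_def)

lemma set_mult_eq:
  assumes S: "finite S" "S \<subseteq> index_pairs k" and F: "ratio_series k F" and b: "series_weight k m \<le> int b"
  shows "set_mult S g F m = (\<Sum>e\<in>S \<rightarrow>\<^sub>E {..b}. (\<Prod>x\<in>S. fps_nth (g x) (e x)) * F (set_shift S e m))"
proof -
  have "set_mult S g F m = (\<Sum>e\<in>S \<rightarrow>\<^sub>E {..b}. if e \<in> S \<rightarrow>\<^sub>E UNIV
     then (\<Prod>x\<in>S. fps_nth (g x) (e x)) * F (set_shift S e m) else 0)"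
    unfolding set_mult_def
  proof (rule Sum_any.expand_superset)
    show "finite (S \<rightarrow>\<^sub>E {..b})" using S by (intro finite_PiE) auto
    show "{e. (if e \<in> S \<rightarrow>\<^sub>E UNIV then (\<Prod>x\<in>S. fps_nth (g x) (e x)) * F (set_shift S e m) else 0) \<noteq> 0} \<subseteq> S
        \<rightarrow>\<^sub>E {..b}"
    proof
      fix e assume "e \<in> {e. (if e \<in> S \<rightarrow>\<^sub>E UNIV then (\<Prod>x\<in>S. fps_nth (g x) (e x)) * F (set_shift S e m)
          else 0) \<noteq> 0}"
      then have e: "e \<in> S \<rightarrow>\<^sub>E UNIV" and "F (set_shift S e m) \<noteq> 0" by (auto split: if_splits)
      then have "0 \<le> series_weight k m - (\<Sum>x\<in>S. int (e x))"
        using F weight_set_shift[OF S, of e m] by (force simp: ratio_series_def)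
      then have "(\<Sum>x\<in>S. int (e x)) \<le> int b" using b by simp
      moreover have "int (e x) \<le> (\<Sum>x\<in>S. int (e x))" if "x \<in> S" for x
        using that S by (intro member_le_sum) auto
      ultimately show "e \<in> S \<rightarrow>\<^sub>E {..b}" using e by (fastforce simp: PiE_iff)
    qed
  qed
  also have "\<dots> = (\<Sum>e\<in>S \<rightarrow>\<^sub>E {..b}. (\<Prod>x\<in>S. fps_nth (g x) (e x)) * F (set_shift S e m))"
    by (intro sum.cong) (auto simp: PiE_iff)
  finally show ?thesis .
qed

lemma set_mult_empty [simp]: "set_mult {} g F = F"
proof
  fix m
  have "(if e \<in> {} \<rightarrow>\<^sub>E UNIV then (\<Prod>x\<in>{}. fps_nth (g x) (e x)) * F (set_shift {} e m) else 0) =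
      (if e = (\<lambda>_. undefined) then F m else 0)" for e
    by (simp add: PiE_empty_domain set_shift_def)
  then show "set_mult {} g F m = F m" unfolding set_mult_def by simp
qed

context
  fixes k :: nat and S :: "(nat \<times> nat) set"
  assumes S: "finite S" "S \<subseteq> index_pairs k"
begin

text \<open>Links the simultaneous product over many pairs, the form in which the correlation series
  is defined, with iterated multiplication by single ratios, the form in which contractions
  arise.\<close>

lemma set_mult_insert:
  assumes x: "x \<in> index_pairs k" "x \<notin> S" and F: "ratio_series k F"
  shows "set_mult (insert x S) g F = pair_mult x (g x) (set_mult S g F)"
    and "ratio_series k (set_mult S g F)"
proof -
  show R: "ratio_series k (set_mult S g F)"
    unfolding ratio_series_def
  proof (intro allI impI)
    fix m assume "set_mult S g F m \<noteq> 0"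
    then obtain e where "F (set_shift S e m) \<noteq> 0"
      unfolding set_mult_def by (elim Sum_any.not_neutral_obtains_not_neutral) (auto split: if_splits)
    then have "0 \<le> series_weight k (set_shift S e m)" using F by (simp add: ratio_series_def)
    moreover have "0 \<le> (\<Sum>x\<in>S. int (e x))" by (simp add: sum_nonneg)
    ultimately show "0 \<le> series_weight k m" using weight_set_shift[OF S, of e m] by simp
  qed
  show "set_mult (insert x S) g F = pair_mult x (g x) (set_mult S g F)"
  proof
    fix m
    define b where "b = nat (series_weight k m)"
    have b: "series_weight k m \<le> int b" by (simp add: b_def)
    have sh: "series_weight k (pair_shift x e m) \<le> int b" for e
      using weight_pair_shift_le[OF x(1), of e m] b by simp
    have "set_mult (insert x S) g F m =
        (\<Sum>y\<le>b. \<Sum>e\<in>S \<rightarrow>\<^sub>E {..b}. (\<Prod>z\<in>insert x S. fps_nth (g z) ((e(x := y)) z)) *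
          F (set_shift (insert x S) (e(x := y)) m))"
      using S x by (subst set_mult_eq[OF _ _ F b]) (simp_all add: sum_PiE_insert)
    also have "\<dots> = (\<Sum>y\<le>b. \<Sum>e\<in>S \<rightarrow>\<^sub>E {..b}. fps_nth (g x) y * ((\<Prod>z\<in>S. fps_nth (g z) (e z)) *
          F (set_shift S e (pair_shift x y m))))"
    proof (intro sum.cong refl)
      fix y e
      have "(\<Prod>z\<in>S. fps_nth (g z) ((e(x := y)) z)) = (\<Prod>z\<in>S. fps_nth (g z) (e z))"
        using x by (intro prod.cong) auto
      then show "(\<Prod>z\<in>insert x S. fps_nth (g z) ((e(x := y)) z)) * F (set_shift (insert x S) (e(x := y)) m) =
          fps_nth (g x) y * ((\<Prod>z\<in>S. fps_nth (g z) (e z)) * F (set_shift S e (pair_shift x y m)))"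
        using S x by (simp add: set_shift_insert mult.assoc del: fun_upd_apply) simp
    qed
    also have "\<dots> = pair_mult x (g x) (set_mult S g F) m"
      unfolding pair_mult_eq[OF x(1) R b] set_mult_eq[OF S F sh] by (simp add: sum_distrib_left)
    finally show "set_mult (insert x S) g F m = pair_mult x (g x) (set_mult S g F) m" .
  qed
qed

end

lemma ratio_series_set_mult:
  assumes "finite S" "S \<subseteq> index_pairs k" "ratio_series k F"
  shows "ratio_series k (set_mult S g F)"
  using assms by (induction S rule: finite_induct) (simp_all add: set_mult_insert(1)[of _ k]
      ratio_series_pair_mult)

lemma set_mult_pair_mult:
  assumes "finite S" "S \<subseteq> index_pairs k" "ratio_series k F" "x \<in> index_pairs k"
  shows "set_mult S g (pair_mult x h F) = pair_mult x h (set_mult S g F)"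
  using assms
proof (induction S rule: finite_induct)
  case (insert y S)
  then show ?case
    using pair_mult_commute[of y k x "set_mult S g F" "g y" h] ratio_series_set_mult[of S k F g]
    by (simp add: set_mult_insert(1)[of _ k] ratio_series_pair_mult)
qed simp

lemma set_mult_mult:
  assumes "finite S" "S \<subseteq> index_pairs k" "ratio_series k F"
  shows "set_mult S (\<lambda>x. g x * h x) F = set_mult S g (set_mult S h F)"
  using assms
proof (induction S rule: finite_induct)
  case (insert x S)
  then show ?case
    by (simp add: set_mult_insert(1)[of _ k] ratio_series_pair_mult ratio_series_set_mult pair_mult_mult[of _ k]
        set_mult_pair_mult[of S k])
qed simp

lemma set_mult_union:
  assumes "finite S" "S \<subseteq> index_pairs k" "finite S'" "S' \<subseteq> index_pairs k" "S \<inter> S' = {}" "ratio_series k F"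
  shows "set_mult (S \<union> S') g F = set_mult S g (set_mult S' g F)"
  using assms
proof (induction S rule: finite_induct)
  case (insert x S)
  then show ?case
    using set_mult_insert(1)[of "S \<union> S'" k x F g] set_mult_insert(1)[of S k x "set_mult S' g F" g]
      ratio_series_set_mult[of S' k F g]
    by auto
qed simp

lemma set_mult_sum:
  assumes "finite S" "S \<subseteq> index_pairs k" "\<And>a. a \<in> A \<Longrightarrow> ratio_series k (F a)"
  shows "set_mult S g (\<lambda>m. \<Sum>a\<in>A. c a * F a m) = (\<lambda>m. \<Sum>a\<in>A. c a * set_mult S g (F a) m)"
  using assms
proof (induction S rule: finite_induct)
  case (insert x S)
  then show ?case
    using set_mult_insert(1)[of S k x "\<lambda>m. \<Sum>a\<in>A. c a * F a m" g] ratio_series_sum[of A k F c]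
      pair_mult_sum[of x k A "\<lambda>a. set_mult S g (F a)" "g x" c]
    by (simp add: set_mult_insert(1)[of _ k] ratio_series_set_mult)
qed simp

section \<open>The correlation functions as formal series\<close>

definition unit_series :: series where
  "unit_series m = (if \<forall>l. m l = 0 then 1 else 0)"

lemma ratio_series_unit: "ratio_series k unit_series"
  by (simp add: ratio_series_def unit_series_def series_weight_def)

definition supported :: "nat \<Rightarrow> nat \<Rightarrow> (nat \<Rightarrow> int) \<Rightarrow> bool" where
  "supported i k m \<longleftrightarrow> (\<forall>l. l \<notin> {i..k} \<longrightarrow> m l = 0)"

declare upt_Suc [simp del]

text \<open>Numerators of the contraction of the summands \<open>a\<close> (first) and \<open>b\<close>; the denominator is
  \<open>(1 - x) (1 - t x) (1 - x / t)\<close> in all cases.\<close>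

definition pair_num :: "complex \<Rightarrow> complex \<Rightarrow> (nat \<Rightarrow> nat) \<Rightarrow> nat \<Rightarrow> nat \<Rightarrow> complex list" where
  "pair_num q t col a b = (if b < a then [q, t / q, inverse t]
     else if a < b then [q / t, inverse q, t]
     else if col a = 1 then [inverse q, q, 1]
     else if col a = 2 then [q / t, t / q, 1] else [1, t, inverse t])"

definition pair_den :: "complex \<Rightarrow> complex list" where
  "pair_den t = [1, t, inverse t]"

text \<open>Multilinear expansion: a summand is chosen in each factor of the operator product, and
  the choices are the maps from positions to J.\<close>

lemma foldr_sum_expand:
  assumes "distinct xs" "finite J" "\<And>i j. i \<in> set xs \<Longrightarrow> j \<in> J \<Longrightarrow> linear_op (X j i)"
  shows "foldr (\<lambda>i v. \<Sum>j\<in>J. fock_scale (c j) (X j i v)) xs v =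
    (\<Sum>a\<in>set xs \<rightarrow>\<^sub>E J. fock_scale (\<Prod>i\<in>set xs. c (a i)) (foldr (\<lambda>i. X (a i) i) xs v))"
  using assms(1,3)
proof (induction xs)
  case (Cons x xs)
  have "foldr (\<lambda>i v. \<Sum>j\<in>J. fock_scale (c j) (X j i v)) (x # xs) v =
      (\<Sum>j\<in>J. \<Sum>a\<in>set xs \<rightarrow>\<^sub>E J. fock_scale (c j * (\<Prod>i\<in>set xs. c (a i)))
        (X j x (foldr (\<lambda>i. X (a i) i) xs v)))"
    using Cons by (simp add: linear_op_sum linear_opD(2) fock_scale_sum)
  also have "\<dots> = (\<Sum>j\<in>J. \<Sum>a\<in>set xs \<rightarrow>\<^sub>E J.
      fock_scale (\<Prod>i\<in>insert x (set xs). c ((a(x := j)) i)) (foldr (\<lambda>i. X ((a(x := j)) i) i) (x # xs) v))"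
  proof (intro sum.cong refl)
    fix j a
    have "(\<Prod>i\<in>set xs. c ((a(x := j)) i)) = (\<Prod>i\<in>set xs. c (a i))"
      using Cons.prems by (intro prod.cong) auto
    moreover have "foldr (\<lambda>i. X ((a(x := j)) i) i) xs v = foldr (\<lambda>i. X (a i) i) xs v"
      using Cons.prems by (intro foldr_cong) auto
    ultimately show "fock_scale (c j * (\<Prod>i\<in>set xs. c (a i))) (X j x (foldr (\<lambda>i. X (a i) i) xs v)) =
        fock_scale (\<Prod>i\<in>insert x (set xs). c ((a(x := j)) i)) (foldr (\<lambda>i. X ((a(x := j)) i) i) (x # xs) v)"
      using Cons.prems by simp
  qed
  also have "\<dots> = (\<Sum>a\<in>set (x # xs) \<rightarrow>\<^sub>E J. fock_scale (\<Prod>i\<in>set (x # xs). c (a i))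
      (foldr (\<lambda>i. X (a i) i) (x # xs) v))"
    unfolding list.set using Cons.prems by (subst sum_PiE_insert) auto
  finally show ?case .
qed simp

context corner
begin

section \<open>Moving annihilation parts to the right vacuum\<close>

context
  fixes u :: "nat \<Rightarrow> complex" and a :: "nat \<Rightarrow> nat" and k :: nat
begin

private abbreviation "L \<equiv> Lambda_tilde q4 t4 cs u"
private abbreviation "word m is \<equiv> foldr (\<lambda>l. L (a l) (m l)) is"

definition word_vev :: "nat \<Rightarrow> series" where
  "word_vev i m = (if supported i k m
     then dual_vacuum (word m [i..<Suc k] vacuum) else 0)"

text \<open>Current i, reduced to its annihilation part, after it has passed the currents i + 1 to
  j. For j = i it still stands outermost, for j = k it acts directly on the vacuum.\<close>

private definition moved :: "nat \<Rightarrow> nat \<Rightarrow> series" where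
  "moved i j m = (if supported i k m
     then dual_vacuum (word m [Suc i..<Suc j] (lower_vertex (a i) (m i) (word m [Suc j..<Suc k]
         vacuum))) else 0)"

private abbreviation "eps \<equiv> (\<lambda>(i, j). exp_series (contraction (a i) (a j)))"

context
  assumes a: "\<And>i. i \<in> {1..k} \<Longrightarrow> a i \<in> {1..n}"
begin

private lemma word_cong: "(\<And>l. l \<in> set is \<Longrightarrow> m l = m' l) \<Longrightarrow> word m is v = word m' is v"
  by (rule foldr_cong) auto

private lemma linear_word: "set is \<subseteq> {1..k} \<Longrightarrow> linear_op (word m is)"
  by (rule linear_op_foldr) (auto intro!: field_linear field_Lambda a)

private lemma word_vev_moved:
  assumes "i \<in> {1..k}"
  shows "word_vev i m = u (a i) * moved i i m"
proof -
  have "[i..<Suc k] = i # [Suc i..<Suc k]" using assms by (simp add: upt_rec)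
  then show ?thesis
    using assms by (simp add: word_vev_def moved_def dual_vacuum_Lambda[OF a])
qed

text \<open>On the vacuum only mode 0 of the annihilation part survives. So z_i drops out, and the
  support condition for i turns into the one for i + 1.\<close>

private lemma moved_end:
  assumes "i \<in> {1..k}"
  shows "moved i k m = word_vev (Suc i) m"
proof -
  have *: "lower_vertex (a i) p vacuum = (if p = 0 then vacuum else 0)" for p
    using annihilation_lower_vertex by (simp add: annihilation_def)
  have "supported (Suc i) k m \<longleftrightarrow> supported i k m \<and> m i = 0"
  proof -
    have "{i..k} = insert i {Suc i..k}" using assms by auto
    then show ?thesis unfolding supported_def by auto
  qed
  moreover have "word m [Suc i..<Suc k] 0 = 0"
    by (rule linear_op_0[OF linear_word]) auto
  ultimately show ?thesis
    by (simp add: word_vev_def moved_def * linear_dual_0[OF linear_dual_vacuum])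
qed

text \<open>One exchange relation. Degree e of its scalar series lowers the mode of current j by e
  and raises that of current i by e, so the series is in z_j / z_i.\<close>

private lemma moved_step:
  assumes "1 \<le> i" "i < j" "j \<le> k"
  shows "moved i (j - 1) = pair_mult (i, j) (exp_series (contraction (a i) (a j))) (moved i j)"
proof
  fix m
  define E where "E = exp_series (contraction (a i) (a j))"
  define w where "w m = word m [Suc j..<Suc k] vacuum" for m
  have j: "[Suc i..<Suc (j - 1)] = [Suc i..<j]" "[Suc i..<Suc j] = [Suc i..<j] @ [j]"
    "[Suc (j - 1)..<Suc k] = j # [Suc j..<Suc k]"
    using assms by (simp_all add: upt_rec[of j] upt_Suc_append)
  have ij: "a i \<in> {1..n}" "a j \<in> {1..n}" using a assms by auto
  have lin: "linear_op (word m [Suc i..<j])" for m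
    using assms by (intro linear_word) auto
  have cond: "supported i k (pair_shift (i, j) e m) \<longleftrightarrow> supported i k m" for e
    using assms by (auto simp: pair_shift_def supported_def)
  have moved_shift: "moved i j (pair_shift (i, j) e m) = (if supported i k m
     then dual_vacuum (word m [Suc i..<j] (L (a j) (m j - int e) (lower_vertex (a i) (m i + int e) (w
         m)))) else 0)" for e
  proof -
    have "word (pair_shift (i, j) e m) [Suc i..<j] v = word m [Suc i..<j] v"
      "word (pair_shift (i, j) e m) [Suc j..<Suc k] v = word m [Suc j..<Suc k] v" for v
      using assms by (auto intro!: word_cong simp: pair_shift_def)
    then show ?thesis
      unfolding moved_def cond j w_def using assms by (simp add: pair_shift_def)
  qed
  have lv_pos: "lower_vertex (a i) p v = 0" if "p > 0" for p v
    using annihilation_lower_vertex that by (simp add: annihilation_def)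
  have zero: "L (a j) p 0 = 0" for p by (rule linear_op_0[OF field_linear[OF field_Lambda[OF ij(2)]]])
  show "moved i (j - 1) m = pair_mult (i, j) E (moved i j) m"
  proof (cases "supported i k m")
    case True
    show ?thesis
    proof (cases "m i > 0")
      case pos: True
      then show ?thesis
        using linear_op_0[OF lin] unfolding pair_mult_def moved_shift unfolding moved_def j
        by (simp add: lv_pos zero linear_dual_0[OF linear_dual_vacuum])
    next
      case False
      then obtain p where p: "m i = - int p"
        by (metis linorder_not_less nonneg_int_cases neg_0_le_iff_le minus_minus)
      have "moved i (j - 1) m = dual_vacuum (word m [Suc i..<j] (lower_vertex (a i) (- int p) (L (a j)
          (m j) (w m))))"
        using True unfolding moved_def j p w_def by simp
      also have "\<dots> = (\<Sum>e\<le>p. fps_nth E e * dual_vacuum (word m [Suc i..<j] (L (a j) (m j - int e)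
          (lower_vertex (a i) (m i + int e) (w m)))))"
        unfolding exchange_lower_vertex[OF ij, unfolded exchange_def, rule_format] linear_op_sum[OF lin]
            linear_opD(2)[OF lin]
          linear_dual_sum[OF linear_dual_vacuum] linear_dualD(2)[OF linear_dual_vacuum] E_def
        by (intro sum.cong refl) (simp add: p add.commute)
      also have "\<dots> = (\<Sum>e\<le>p. fps_nth E e * moved i j (pair_shift (i, j) e m))"
        unfolding moved_shift using True by simp
      also have "\<dots> = pair_mult (i, j) E (moved i j) m"
        unfolding pair_mult_def
      proof (rule Sum_any.expand_superset[symmetric])
        have "moved i j (pair_shift (i, j) e m) = 0" if "\<not> e \<le> p" for e
        proof -
          have "m i + int e > 0" using that p by simp
          then show ?thesis
            unfolding moved_shift by (simp only: lv_pos zero linear_op_0[OF lin] linear_dual_0[OF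
                linear_dual_vacuum] if_cancel)
        qed
        then show "{e. fps_nth E e * moved i j (pair_shift (i, j) e m) \<noteq> 0} \<subseteq> {..p}" by force
      qed simp
      finally show ?thesis .
    qed
  next
    case False
    have "moved i j (pair_shift (i, j) e m) = 0" for e
      unfolding moved_shift using False by simp
    moreover have "moved i (j - 1) m = 0" unfolding moved_def using False by simp
    ultimately show ?thesis by (simp add: pair_mult_def)
  qed
qed

private lemma moved_eq:
  assumes "1 \<le> i" "i \<le> j" "j \<le> k" "ratio_series k (word_vev (Suc i))"
  shows "moved i j = set_mult {(i, l) |l. j < l \<and> l \<le> k} eps (word_vev (Suc i))"
  using assms(3,2)
proof (induction j rule: inc_induct)
  case base
  have "{(i, l) |l. k < l \<and> l \<le> k} = {}" by auto
  then have "set_mult {(i, l) |l. k < l \<and> l \<le> k} eps (word_vev (Suc i)) = word_vev (Suc i)"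
    by (simp only: set_mult_empty)
  then show ?case using moved_end[of i] assms by (simp add: fun_eq_iff)
next
  case (step j)
  let ?S = "{(i, l) |l. Suc j < l \<and> l \<le> k}"
  have S: "?S \<subseteq> index_pairs k" using step assms by (auto simp: index_pairs_def)
  have fin: "finite ?S" using finite_subset[OF S finite_index_pairs] .
  have "moved i j = pair_mult (i, Suc j) (exp_series (contraction (a i) (a (Suc j)))) (moved i (Suc j))"
    using moved_step[of i "Suc j"] step assms by simp
  also have "\<dots> = set_mult (insert (i, Suc j) ?S) eps (word_vev (Suc i))"
    using step assms set_mult_insert(1)[OF fin S, of "(i, Suc j)" "word_vev (Suc i)" eps]
    by (auto simp: index_pairs_def)
  also have "insert (i, Suc j) ?S = {(i, l) |l. j < l \<and> l \<le> k}"
    using step by auto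
  finally show ?case .
qed

private lemma word_vev_eq:
  assumes "1 \<le> i" "i \<le> Suc k"
  shows "word_vev i = (\<lambda>m. (\<Prod>l=i..k. u (a l)) *
    set_mult {(i', j). i \<le> i' \<and> i' < j \<and> j \<le> k} eps unit_series m)"
  using assms(2,1)
proof (induction i rule: inc_induct)
  case base
  have "{(i', j). Suc k \<le> i' \<and> i' < j \<and> j \<le> k} = {}" by auto
  then have "set_mult {(i', j). Suc k \<le> i' \<and> i' < j \<and> j \<le> k} eps unit_series = unit_series"
    by (simp only: set_mult_empty)
  moreover have "word_vev (Suc k) = unit_series"
    by (simp add: fun_eq_iff word_vev_def supported_def unit_series_def dual_vacuum_def vacuum_def)
  ultimately show ?case by simp
next
  case (step i)
  let ?S = "{(i', j). Suc i \<le> i' \<and> i' < j \<and> j \<le> k}" and ?T = "{(i, l) |l. i < l \<and> l \<le> k}"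
  let ?c = "\<Prod>l=Suc i..k. u (a l)"
  have S: "?S \<subseteq> index_pairs k" "?T \<subseteq> index_pairs k" using step by (auto simp: index_pairs_def)
  have fin: "finite ?S" "finite ?T" using finite_subset[OF _ finite_index_pairs] S by blast+
  have r: "ratio_series k (set_mult ?S eps unit_series)"
    by (rule ratio_series_set_mult[OF fin(1) S(1) ratio_series_unit])
  have IH: "word_vev (Suc i) = (\<lambda>m. ?c * set_mult ?S eps unit_series m)" using step by simp
  have r': "ratio_series k (word_vev (Suc i))"
    unfolding IH using r by (simp add: ratio_series_def)
  have "word_vev i = (\<lambda>m. u (a i) * moved i i m)" using word_vev_moved step by (simp add: fun_eq_iff)
  \<comment> \<open>The sum over a one-point set brings the scalar factor into the form of
    \<open>set_mult_sum\<close>.\<close>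
  also have "moved i i = set_mult ?T eps (\<lambda>m. \<Sum>x\<in>{()}. ?c * set_mult ?S eps unit_series m)"
    using moved_eq[of i i] step r' by (simp add: IH)
  also have "\<dots> = (\<lambda>m. ?c * set_mult ?T eps (set_mult ?S eps unit_series) m)"
    using r by (subst set_mult_sum[OF fin(2) S(2)]) auto
  also have "set_mult ?T eps (set_mult ?S eps unit_series) = set_mult (?T \<union> ?S) eps unit_series"
    by (rule set_mult_union[OF fin(2) S(2) fin(1) S(1) _ ratio_series_unit, symmetric]) auto
  also have "?T \<union> ?S = {(i', j). i \<le> i' \<and> i' < j \<and> j \<le> k}" by auto
  also have "(\<lambda>m. u (a i) * (?c * set_mult \<dots> eps unit_series m)) =
     (\<lambda>m. (\<Prod>l=i..k. u (a l)) * set_mult {(i', j). i \<le> i' \<and> i' < j \<and> j \<le> k} eps unit_series m)"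
    using step by (simp add: prod.atLeast_Suc_atMost mult.assoc)
  finally show ?case .
qed

lemma word_vev_1: "word_vev 1 = (\<lambda>m. (\<Prod>l=1..k. u (a l)) * set_mult (index_pairs k) eps unit_series m)"
  using word_vev_eq[of 1] by (simp add: index_pairs_def)

end

end

section \<open>Expansion over the colours of the currents and the resulting pair factors\<close>

definition colour_weight :: "nat \<Rightarrow> complex" where
  "colour_weight j = (qp (colour cs j) 2 - qp (colour cs j) (- 2)) / (qp 3 2 - qp 3 (- 2))"

lemma vev_expand:
  "vev q4 t4 cs u k = (\<lambda>m. \<Sum>a\<in>{1..k} \<rightarrow>\<^sub>E {1..n}. (\<Prod>i=1..k. colour_weight (a i) * u (a i)) *
     set_mult (index_pairs k) (\<lambda>(i, j). exp_series (contraction (a i) (a j))) unit_series m)"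
proof
  fix m
  have "foldr (\<lambda>i. T1_tilde q4 t4 cs u (m i)) [1..<Suc k] vacuum =
      foldr (\<lambda>i v. \<Sum>j\<in>{1..n}. fock_scale (colour_weight j) (Lambda_tilde q4 t4 cs u j (m i) v)) [1..<Suc
          k] vacuum"
    by (intro foldr_cong) (auto simp: T1_tilde_def[abs_def] colour_weight_def)
  also have "\<dots> = (\<Sum>a\<in>set [1..<Suc k] \<rightarrow>\<^sub>E {1..n}. fock_scale (\<Prod>i\<in>set [1..<Suc k]. colour_weight (a i))
      (foldr (\<lambda>i. Lambda_tilde q4 t4 cs u (a i) (m i)) [1..<Suc k] vacuum))"
    by (rule foldr_sum_expand[where X = "\<lambda>j i. Lambda_tilde q4 t4 cs u j (m i)"])
      (auto intro!: field_linear[OF field_Lambda])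
  also have "set [1..<Suc k] = {1..k}" by auto
  finally have "dual_vacuum (foldr (\<lambda>i. T1_tilde q4 t4 cs u (m i)) [1..<Suc k] vacuum) =
      (\<Sum>a\<in>{1..k} \<rightarrow>\<^sub>E {1..n}. (\<Prod>i=1..k. colour_weight (a i)) *
        dual_vacuum (foldr (\<lambda>i. Lambda_tilde q4 t4 cs u (a i) (m i)) [1..<Suc k] vacuum))"
    by (simp only: linear_dual_sum[OF linear_dual_vacuum] linear_dualD(2)[OF linear_dual_vacuum])
  then have *: "(if \<forall>i. i \<notin> {1..k} \<longrightarrow> m i = 0 then dual_vacuum (foldr (\<lambda>i. T1_tilde q4 t4 cs u (m i))
      [1..<Suc k] vacuum) else 0) =
      (\<Sum>a\<in>{1..k} \<rightarrow>\<^sub>E {1..n}. (\<Prod>i=1..k. colour_weight (a i)) *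
        (if \<forall>i. i \<notin> {1..k} \<longrightarrow> m i = 0 then dual_vacuum (foldr (\<lambda>i. Lambda_tilde q4 t4 cs u (a i) (m i))
            [1..<Suc k] vacuum) else 0))"
    (is "(if ?P then _ else _) = _")
  proof (cases ?P)
    case True
    with \<open>dual_vacuum _ = _\<close> show ?thesis by (simp only: if_P[OF True])
  next
    case False
    then show ?thesis by (simp only: if_not_P[OF False] if_False mult_zero_right sum.neutral_const)
  qed
  have "vev q4 t4 cs u k m = (\<Sum>a\<in>{1..k} \<rightarrow>\<^sub>E {1..n}. (\<Prod>i=1..k. colour_weight (a i)) * word_vev u a k 1 m)"
    unfolding vev_def word_vev_def supported_def by (rule *)
  also have "\<dots> = (\<Sum>a\<in>{1..k} \<rightarrow>\<^sub>E {1..n}. (\<Prod>i=1..k. colour_weight (a i) * u (a i)) *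
     set_mult (index_pairs k) (\<lambda>(i, j). exp_series (contraction (a i) (a j))) unit_series m)"
    by (intro sum.cong refl, subst word_vev_1) (auto simp: prod.distrib mult.assoc)
  finally show "vev q4 t4 cs u k m = \<dots>" .
qed

lemma corr_series_expand:
  "corr_series q4 t4 cs u k = (\<lambda>m. \<Sum>a\<in>{1..k} \<rightarrow>\<^sub>E {1..n}. (\<Prod>i=1..k. colour_weight (a i) * u (a i)) *
     set_mult (index_pairs k) (\<lambda>(i, j). f11 q4 t4 cs * exp_series (contraction (a i) (a j))) unit_series m)"
proof -
  note R = finite_index_pairs[of k] order_refl[of "index_pairs k"]
  have "corr_series q4 t4 cs u k = set_mult (index_pairs k) (\<lambda>_. f11 q4 t4 cs) (vev q4 t4 cs u k)"
    unfolding corr_series_def set_mult_def set_shift_def index_pairs_def Let_def ..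
  also have "\<dots> = (\<lambda>m. \<Sum>a\<in>{1..k} \<rightarrow>\<^sub>E {1..n}. (\<Prod>i=1..k. colour_weight (a i) * u (a i)) *
     set_mult (index_pairs k) (\<lambda>_. f11 q4 t4 cs) (set_mult (index_pairs k) (\<lambda>(i, j). exp_series
         (contraction (a i) (a j))) unit_series) m)"
    unfolding vev_expand by (rule set_mult_sum[OF R], rule ratio_series_set_mult[OF R ratio_series_unit])
  also have "\<dots> = (\<lambda>m. \<Sum>a\<in>{1..k} \<rightarrow>\<^sub>E {1..n}. (\<Prod>i=1..k. colour_weight (a i) * u (a i)) *
     set_mult (index_pairs k) (\<lambda>(i, j). f11 q4 t4 cs * exp_series (contraction (a i) (a j))) unit_series m)"
    by (intro ext sum.cong refl arg_cong2[where f = "(*)"])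
      (subst set_mult_mult[OF R ratio_series_unit, symmetric], simp add: split_def)
  finally show ?thesis .
qed

text \<open>The identity behind the choice of \<open>f11\<close>: added to the part of the
  contraction that comes from alpha, its exponent makes Q, a square root of q_c^r, disappear. The
  s1, s2, s3 are square roots of q_1^r, q_2^r, q_3^r with product 1.\<close>

lemma f11_aux:
  fixes Q s1 s2 s3 :: complex
  assumes "Q \<noteq> 0" "Q\<^sup>2 \<noteq> 1" "s1 \<noteq> 0" "s2 \<noteq> 0" "s3 = inverse (s1 * s2)"
  shows "(Q * inverse s3 - inverse Q * s3) * ((s1 - inverse s1) * (s2 - inverse s2) / (Q - inverse Q)) +
    (s1\<^sup>2 - 1) * (s2\<^sup>2 - 1) * (s3\<^sup>2 - 1) * (1 / (Q\<^sup>2 - 1)) = (s1\<^sup>2 - 1) * (s2\<^sup>2 - 1)"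
proof -
  define D where "D = Q\<^sup>2 - 1"
  have D: "D \<noteq> 0" using assms by (simp add: D_def)
  have 1: "Q - inverse Q = D / Q" "s1 - inverse s1 = (s1\<^sup>2 - 1) / s1" "s2 - inverse s2 = (s2\<^sup>2 - 1) / s2"
    using assms by (simp_all add: D_def field_simps power2_eq_square)
  have s3: "s3 \<noteq> 0" "s1 * s2 * s3 = 1"
    using assms right_inverse[of "s1 * s2"] by (simp_all del: inverse_mult_distrib)
  have 2: "Q * inverse s3 - inverse Q * s3 = (Q\<^sup>2 - s3\<^sup>2) / (Q * s3)"
    using assms(1) s3 by (simp add: field_simps power2_eq_square)
  have "(Q * inverse s3 - inverse Q * s3) * ((s1 - inverse s1) * (s2 - inverse s2) / (Q - inverse Q)) =
      (Q\<^sup>2 - s3\<^sup>2) * ((s1\<^sup>2 - 1) * (s2\<^sup>2 - 1)) / (D * (s1 * s2 * s3))"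
    unfolding 1 2 using assms(1) by simp
  also have "\<dots> = (Q\<^sup>2 - s3\<^sup>2) * ((s1\<^sup>2 - 1) * (s2\<^sup>2 - 1)) / D" using s3 by simp
  finally have "(Q * inverse s3 - inverse Q * s3) * ((s1 - inverse s1) * (s2 - inverse s2) / (Q - inverse Q)) +
    (s1\<^sup>2 - 1) * (s2\<^sup>2 - 1) * (s3\<^sup>2 - 1) * (1 / D) = ((s1\<^sup>2 - 1) * (s2\<^sup>2 - 1)) * ((Q\<^sup>2 - s3\<^sup>2) + (s3\<^sup>2 -
        1)) / D"
    using D by (simp add: field_simps)
  also have "\<dots> = (s1\<^sup>2 - 1) * (s2\<^sup>2 - 1)" using D by (simp add: D_def)
  finally show ?thesis by (simp add: D_def)
qed

lemma qp_4_power: "qp i (4 * int r) = qp i 4 ^ r"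
  by (rule qp_mult)

text \<open>Once q_c has cancelled, the exponent is a polynomial in A, B, C, the r-th powers of q_1,
  q_2, q_3. The relation A B C = 1 rewrites its products as r-th powers of single numbers, which is
  the form required by \<open>exp_series_rational\<close>.\<close>

lemma f11_contraction:
  assumes a: "a \<in> {1..n}" and b: "b \<in> {1..n}"
  shows "linear_fps (pair_den t) * (f11 q4 t4 cs * exp_series (contraction a b)) =
    linear_fps (pair_num q t (colour cs) a b)"
proof -
  define c where "c r = 1 / of_nat r *
     (qc_pow q4 t4 cs (int r) * qp 3 (- 2 * int r) - qc_pow q4 t4 cs (- int r) * qp 3 (2 * int r)) *
     ((qp 1 (2 * int r) - qp 1 (- 2 * int r)) * (qp 2 (2 * int r) - qp 2 (- 2 * int r))
        / (qc_pow q4 t4 cs (int r) - qc_pow q4 t4 cs (- int r)))" for r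
  have "f11 q4 t4 cs = exp_series c"
    unfolding f11_def exp_series_def c_def by simp
  then have "f11 q4 t4 cs * exp_series (contraction a b) = exp_series (\<lambda>r. c r + contraction a b r)"
    by (simp add: exp_series_add)
  moreover have "linear_fps (pair_den t) * exp_series (\<lambda>r. c r + contraction a b r) = linear_fps
      (pair_num q t (colour cs) a b)"
  proof (rule exp_series_rational)
    fix r :: nat assume r: "r \<ge> 1"
    define A B C where "A = q ^ r" and "B = (t / q) ^ r" and "C = inverse t ^ r"
    have K: "kappa q4 t4 (int r) = (A - 1) * (B - 1) * (C - 1)"
      by (simp add: kappa_def qp_4_power qp_4 A_def B_def C_def mult.assoc)
    have sq: "(qp i (2 * int r))\<^sup>2 = qp i 4 ^ r" for i
      unfolding qp_4_power[symmetric] by (simp add: power2_eq_square qp_add[symmetric])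
    have s3: "qp 3 (2 * int r) = inverse (qp 1 (2 * int r) * qp 2 (2 * int r))"
      using q40 t40 by (simp add: qpow_def power_int_mult_distrib power_int_inverse)
    have "c r + kappa q4 t4 (int r) / of_nat r * (1 / (qc_pow q4 t4 cs (2 * int r) - 1)) =
        1 / of_nat r * ((qc_pow q4 t4 cs (int r) * inverse (qp 3 (2 * int r)) - inverse (qc_pow q4 t4 cs
            (int r)) * qp 3 (2 * int r)) *
     ((qp 1 (2 * int r) - inverse (qp 1 (2 * int r))) * (qp 2 (2 * int r) - inverse (qp 2 (2 * int r)))
        / (qc_pow q4 t4 cs (int r) - inverse (qc_pow q4 t4 cs (int r)))) +
        ((qp 1 (2 * int r))\<^sup>2 - 1) * ((qp 2 (2 * int r))\<^sup>2 - 1) * ((qp 3 (2 * int r))\<^sup>2 - 1) *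
          (1 / ((qc_pow q4 t4 cs (int r))\<^sup>2 - 1)))"
      using qp_minus[of _ "2 * int r"]
      by (simp add: c_def qc_pow_minus qc_pow_double sq qp_4 K A_def B_def C_def distrib_left)
    also have "\<dots> = 1 / of_nat r * ((A - 1) * (B - 1))"
      using qc_pow_generic[OF r] s3
      by (subst f11_aux) (simp_all add: qc_pow_nonzero qp_nonzero qc_pow_double sq qp_4 A_def B_def)
    finally have *: "c r + kappa q4 t4 (int r) / of_nat r * (1 / (qc_pow q4 t4 cs (2 * int r) - 1)) =
        1 / of_nat r * ((A - 1) * (B - 1))" .
    have "c r + contraction a b r =
        (c r + kappa q4 t4 (int r) / of_nat r * (1 / (qc_pow q4 t4 cs (2 * int r) - 1))) +
        kappa q4 t4 (int r) / of_nat r * (of_bool (a < b) - of_bool (a = b) / (qp (colour cs a) (4 * int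
            r) - 1))"
      unfolding contraction_def by (simp only: distrib_left right_diff_distrib add.assoc add_diff_eq)
    also have "\<dots> = 1 / of_nat r * ((A - 1) * (B - 1) +
        (A - 1) * (B - 1) * (C - 1) * (of_bool (a < b) - of_bool (a = b) / (qp (colour cs a) (4 * int r) - 1)))"
      unfolding * unfolding K by (simp only: distrib_left times_divide_eq_left times_divide_eq_right
          mult_1_left)
    finally have sum: "c r + contraction a b r = \<dots>" .
    have nz: "A \<noteq> 1" "B \<noteq> 1" "C \<noteq> 1"
      using qp_4_generic[OF _ r, of 1] qp_4_generic[OF _ r, of 2] qp_4_generic[OF _ r, of 3]
      by (auto simp: qp_4_power qp_4 A_def B_def C_def)
    have ABC: "A * B = t ^ r" "A * C = (q / t) ^ r" "B * C = inverse q ^ r" "A * B * C = 1"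
      "C = inverse t ^ r"
      using q0 t0 by (simp_all add: A_def B_def C_def field_simps)
    have "(A - 1) * (B - 1) +
        (A - 1) * (B - 1) * (C - 1) * (of_bool (a < b) - of_bool (a = b) / (qp (colour cs a) (4 * int r) - 1)) =
        (\<Sum>b\<leftarrow>pair_den t. b ^ r) - (\<Sum>c\<leftarrow>pair_num q t (colour cs) a b. c ^ r)"
    proof -
      consider "a < b" | "b < a" | "a = b" "colour cs a = 1" | "a = b" "colour cs a = 2" | "a = b"
          "colour cs a = 3"
        using colours[OF a] by fastforce
      then show ?thesis
      proof cases
        case 1
        have "(A - 1) * (B - 1) * C = A * B * C - A * C - B * C + C" by (simp add: algebra_simps)
        then have "(A - 1) * (B - 1) * C = 1 - (q / t) ^ r - inverse q ^ r + inverse t ^ r"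
          by (simp only: ABC(2-4), simp only: C_def)
        moreover have "(A - 1) * (B - 1) + (A - 1) * (B - 1) * (C - 1) = (A - 1) * (B - 1) * C"
          by (simp add: algebra_simps)
        ultimately show ?thesis using 1 by (simp add: pair_num_def pair_den_def)
      next
        case 2
        have "(A - 1) * (B - 1) = A * B - A - B + 1" by (simp add: algebra_simps)
        then show ?thesis using 2 by (simp add: pair_num_def pair_den_def ABC) (simp add: A_def B_def)
      next
        case 3
        have "(A - 1) * (B - 1) * (C - 1) / (A - 1) = (B - 1) * (C - 1)" using nz by simp
        moreover have "(A - 1) * (B - 1) - (B - 1) * (C - 1) = A * B - B * C - A + C" by (simp add:
            algebra_simps)
        ultimately show ?thesis using 3
          by (simp add: pair_num_def pair_den_def qp_4_power qp_4 ABC(1-4) flip: A_def C_def)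
      next
        case 4
        have "(A - 1) * (B - 1) * (C - 1) / (B - 1) = (A - 1) * (C - 1)" using nz by simp
        moreover have "(A - 1) * (B - 1) - (A - 1) * (C - 1) = A * B - A * C - B + C" by (simp add:
            algebra_simps)
        ultimately show ?thesis using 4
          by (simp add: pair_num_def pair_den_def qp_4_power qp_4 ABC(1-4) flip: B_def C_def)
      next
        case 5
        have "(A - 1) * (B - 1) * (C - 1) / (C - 1) = (A - 1) * (B - 1)" using nz by simp
        then show ?thesis using 5 by (simp add: pair_num_def pair_den_def qp_4_power qp_4 flip: C_def)
      qed
    qed
    moreover have "(\<Sum>x\<leftarrow>xs. x ^ r / of_nat r) = 1 / of_nat r * (\<Sum>x\<leftarrow>xs. x ^ r)" for xs :: "complex list"
      by (induction xs) (simp_all add: add_divide_distrib)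
    ultimately show "c r + contraction a b r =
        (\<Sum>b\<leftarrow>pair_den t. b ^ r / of_nat r) - (\<Sum>c\<leftarrow>pair_num q t (colour cs) a b. c ^ r / of_nat r)"
      unfolding sum by (simp only: right_diff_distrib)
  qed
  ultimately show ?thesis by simp
qed

end

section \<open>Expansions of rational functions\<close>

abbreviation monomial :: "(nat \<Rightarrow>\<^sub>0 nat) \<Rightarrow> complex \<Rightarrow> mpol" where
  "monomial \<equiv> Poly_Mapping.single"

lemma mpol_sum_monomials: "(P :: mpol) = (\<Sum>n\<in>Poly_Mapping.keys P. monomial n (Poly_Mapping.lookup P n))"
  by (rule poly_mapping_eqI)
    (simp add: lookup_sum lookup_single when_def sum.delta' in_keys_iff)

text \<open>A polynomial is a finite sum of monomials, so additive maps need to be compared on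
  monomials only.\<close>

lemma mpol_additive_induct:
  assumes "\<And>n c. f (monomial n c) = g (monomial n c)" "f 0 = g 0"
    and "\<And>P Q. f (P + Q) = f P + f Q" "\<And>P Q. g (P + Q) = g P + g Q"
  shows "f (P :: mpol) = (g P :: 'a :: ab_group_add)"
proof -
  have "f (sum h A) = g (sum h A)" if "\<And>x. x \<in> A \<Longrightarrow> f (h x) = g (h x)" for h :: "_ \<Rightarrow> mpol" and A
    using that by (induction A rule: infinite_finite_induct) (simp_all add: assms)
  from this[of "Poly_Mapping.keys P" "\<lambda>n. monomial n (Poly_Mapping.lookup P n)"] assms(1)
  show ?thesis unfolding mpol_sum_monomials[symmetric] by blast
qed

definition sub_exp :: "(nat \<Rightarrow> int) \<Rightarrow> (nat \<Rightarrow>\<^sub>0 nat) \<Rightarrow> nat \<Rightarrow> int" where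
  "sub_exp m n = (\<lambda>i. m i - int (Poly_Mapping.lookup n i))"

text \<open>Multiplication of a two-sided series by a polynomial. As a sum over all exponents it is
  additive in Q without any bookkeeping of monomials that cancel.\<close>

definition act :: "mpol \<Rightarrow> series \<Rightarrow> series" where
  "act Q F = (\<lambda>m. Sum_any (\<lambda>n. Poly_Mapping.lookup Q n * F (sub_exp m n)))"

lemma finite_act: "finite {n. Poly_Mapping.lookup Q n * F (sub_exp m n) \<noteq> (0 :: complex)}"
  by (rule finite_subset[OF _ finite_keys[of Q]]) (auto simp: in_keys_iff)

lemma act_keys: "act Q F m = (\<Sum>n\<in>Poly_Mapping.keys Q. Poly_Mapping.lookup Q n * F (sub_exp m n))"
  unfolding act_def by (rule Sum_any.expand_superset) (auto simp: in_keys_iff)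

lemma act_add: "act (P + Q) F m = act P F m + act Q F m"
  unfolding act_def lookup_add distrib_right by (rule Sum_any.distrib[OF finite_act finite_act])

lemma act_0 [simp]: "act 0 F m = 0"
  by (simp add: act_def)

lemma act_monomial: "act (monomial n c) F m = c * F (sub_exp m n)"
  by (cases "c = 0") (simp_all add: act_keys)

lemma act_linear: "act Q (\<lambda>m. a * F m + b * G m) m = a * act Q F m + b * act Q G m"
  by (simp add: act_keys sum.distrib sum_distrib_left algebra_simps)

lemma sub_exp_add: "sub_exp m (n + n') = sub_exp (sub_exp m n) n'"
  by (simp add: sub_exp_def lookup_add algebra_simps fun_eq_iff)

lemma act_mult: "act (P * Q) F = act P (act Q F)"
proof
  fix m
  show "act (P * Q) F m = act P (act Q F) m"
  proof (rule mpol_additive_induct[where f = "\<lambda>P. act (P * Q) F m" and g = "\<lambda>P. act P (act Q F) m"])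
    fix n c
    show "act (monomial n c * Q) F m = act (monomial n c) (act Q F) m"
      by (rule mpol_additive_induct[where f = "\<lambda>Q. act (monomial n c * Q) F m" and g = "\<lambda>Q. act
          (monomial n c) (act Q F) m"])
        (simp_all add: act_monomial mult_single sub_exp_add distrib_left act_add)
  qed (simp_all add: distrib_right act_add)
qed

lemma act_unit: "act P unit_series m =
   (\<Sum>n\<in>Poly_Mapping.keys P. if m = (\<lambda>i. int (Poly_Mapping.lookup n i)) then Poly_Mapping.lookup P n else 0)"
  unfolding act_keys by (intro sum.cong refl) (auto simp: unit_series_def sub_exp_def fun_eq_iff)

lemma act_unit_inj:
  assumes "act P unit_series = act Q unit_series" shows "P = Q"
proof (rule poly_mapping_eqI)
  fix n
  have *: "act R unit_series (\<lambda>i. int (Poly_Mapping.lookup n i)) = Poly_Mapping.lookup R n" for R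
  proof -
    have "(\<lambda>i. int (Poly_Mapping.lookup n i)) = (\<lambda>i. int (Poly_Mapping.lookup n' i)) \<longleftrightarrow> n' = n" for n'
      by (auto simp: fun_eq_iff poly_mapping_eq_iff)
    then show ?thesis by (simp only: act_unit) (simp add: in_keys_iff)
  qed
  show "Poly_Mapping.lookup P n = Poly_Mapping.lookup Q n" unfolding *[symmetric] assms ..
qed

lemma is_expansion_act:
  "is_expansion F R \<longleftrightarrow> (\<exists>P Q. Q \<noteq> 0 \<and> R = Fraction_Field.Fract P Q \<and> act Q F = act P unit_series)"
  unfolding is_expansion_def fun_eq_iff[of "act _ _" "act _ _"] act_unit
  by (simp only: act_keys sub_exp_def)

text \<open>The series Q Q' F, computed in two ways, is the series of Q' P and of Q P'. These are
  polynomials and are recovered from their series by \<open>act_unit_inj\<close>, so zero divisors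
  among two-sided series do no harm.\<close>

lemma is_expansion_unique:
  assumes "is_expansion F R" "is_expansion F R'"
  shows "R = R'"
proof -
  obtain P Q where PQ: "Q \<noteq> 0" "R = Fraction_Field.Fract P Q" "act Q F = act P unit_series"
    using assms(1) unfolding is_expansion_act by blast
  obtain P' Q' where PQ': "Q' \<noteq> 0" "R' = Fraction_Field.Fract P' Q'" "act Q' F = act P' unit_series"
    using assms(2) unfolding is_expansion_act by blast
  have "act (Q' * P) unit_series = act (Q * P') unit_series"
  proof -
    have "act (Q' * Q) F = act (Q * Q') F" by (simp only: mult.commute)
    then show ?thesis unfolding act_mult PQ(3) PQ'(3) .
  qed
  then have "Q' * P = Q * P'" by (rule act_unit_inj)
  then show ?thesis unfolding PQ(2) PQ'(2) using PQ(1) PQ'(1) by (simp add: eq_fract mult.commute)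
qed

lemma is_expansionI:
  "Q \<noteq> 0 \<Longrightarrow> act Q F = act P unit_series \<Longrightarrow> R = Fraction_Field.Fract P Q \<Longrightarrow> is_expansion F R"
  unfolding is_expansion_act by blast

lemma rational_of_eq: "is_expansion F R \<Longrightarrow> rational_of F = R"
  unfolding rational_of_def using is_expansion_unique by blast

lemma rf_const_simps: "rf_const 0 = 0" "rf_const 1 = 1" "rf_const (a + b) = rf_const a + rf_const b"
  "rf_const (a * b) = rf_const a * rf_const b"
proof -
  show "rf_const 0 = 0" unfolding rf_const_def single_zero Zero_fract_def ..
  show "rf_const 1 = 1" unfolding rf_const_def single_one One_fract_def ..
  show "rf_const (a + b) = rf_const a + rf_const b" "rf_const (a * b) = rf_const a * rf_const b"
    by (simp_all add: rf_const_def single_add mult_single)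
qed

lemma is_expansion_unit: "is_expansion unit_series 1"
  by (rule is_expansionI[of 1 _ 1]) (simp_all only: One_fract_def one_neq_zero not_False_eq_True)

lemma is_expansion_linear:
  assumes "is_expansion F R" "is_expansion G R'"
  shows "is_expansion (\<lambda>m. a * F m + b * G m) (rf_const a * R + rf_const b * R')"
proof -
  obtain P Q where PQ: "Q \<noteq> 0" "R = Fraction_Field.Fract P Q" "act Q F = act P unit_series"
    using assms(1) unfolding is_expansion_act by blast
  obtain P' Q' where PQ': "Q' \<noteq> 0" "R' = Fraction_Field.Fract P' Q'" "act Q' G = act P' unit_series"
    using assms(2) unfolding is_expansion_act by blast
  have c: "act (monomial 0 a * P) H m = a * act P H m" for a P H m
    by (simp add: act_mult act_monomial sub_exp_def)
  have "act (Q * Q') (\<lambda>m. a * F m + b * G m) m = a * act (Q' * P) unit_series m + b * act (Q * P')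
      unit_series m" for m
  proof -
    have "act (Q * Q') F = act Q' (act Q F)" by (simp only: mult.commute act_mult[symmetric])
    moreover have "act (Q * Q') G = act Q (act Q' G)" by (rule act_mult)
    ultimately show ?thesis unfolding act_linear PQ(3) PQ'(3) act_mult by (simp only:)
  qed
  then have "act (Q * Q') (\<lambda>m. a * F m + b * G m) =
      act (monomial 0 a * (Q' * P) + monomial 0 b * (Q * P')) unit_series"
    by (intro ext) (simp only: act_add c)
  moreover have "rf_const a * R + rf_const b * R' =
      Fraction_Field.Fract (monomial 0 a * (Q' * P) + monomial 0 b * (Q * P')) (Q * Q')"
  proof -
    have "rf_const a * R + rf_const b * R' =
        Fraction_Field.Fract (monomial 0 a * P * Q' + monomial 0 b * P' * Q) (Q * Q')"
      using PQ(1) PQ'(1) by (simp add: PQ(2) PQ'(2) rf_const_def)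
    then show ?thesis by (simp only: mult_ac)
  qed
  ultimately show ?thesis using PQ(1) PQ'(1) by (intro is_expansionI) simp_all
qed

lemma is_expansion_sum:
  assumes "finite A" "\<And>a. a \<in> A \<Longrightarrow> is_expansion (F a) (R a)"
  shows "is_expansion (\<lambda>m. \<Sum>a\<in>A. c a * F a m) (\<Sum>a\<in>A. rf_const (c a) * R a)"
  using assms
proof (induction A rule: finite_induct)
  case empty
  have "is_expansion (\<lambda>m. 0 * unit_series m + 0 * unit_series m) (rf_const 0 * 1 + rf_const 0 * 1)"
    by (intro is_expansion_linear is_expansion_unit)
  then show ?case by (simp add: rf_const_simps)
next
  case (insert x A)
  have "is_expansion (\<lambda>m. c x * F x m + 1 * (\<Sum>a\<in>A. c a * F a m)) (rf_const (c x) * R x + rf_const 1 *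
      (\<Sum>a\<in>A. rf_const (c a) * R a))"
    using insert by (intro is_expansion_linear) auto
  then show ?case using insert by (simp add: rf_const_simps)
qed

section \<open>Linear factors in the ratios of two variables\<close>

definition var_mono :: "nat \<Rightarrow> mpol" where
  "var_mono i = monomial (Poly_Mapping.single i 1) 1"

text \<open>The product of the homogenized factors z_i - a z_j, each being z_i times 1 - a z_j /
  z_i, where x = (i, j).\<close>

definition linear_mpol :: "nat \<times> nat \<Rightarrow> complex list \<Rightarrow> mpol" where
  "linear_mpol x as = prod_list (map (\<lambda>a. var_mono (fst x) - monomial (Poly_Mapping.single (snd x) 1) a) as)"

definition linear_rf :: "complex list \<Rightarrow> ratfun \<Rightarrow> ratfun" where
  "linear_rf as z = prod_list (map (\<lambda>a. 1 - rf_const a * z) as)"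

lemma pair_mult_linear:
  assumes x: "x \<in> index_pairs k" and F: "ratio_series k F"
  shows "pair_mult x (1 - fps_const a * fps_X) F m = F m - a * F (pair_shift x 1 m)"
proof -
  have *: "fps_nth (1 - fps_const a * fps_X) e * F (pair_shift x e m) =
      (if e = 0 then F m else 0) + (if e = 1 then - a * F (pair_shift x 1 m) else 0)" for e
    by (cases e) (auto simp: fps_X_def)
  have "pair_mult x (1 - fps_const a * fps_X) F m =
      Sum_any (\<lambda>e :: nat. (if e = 0 then F m else 0) + (if e = 1 then - a * F (pair_shift x 1 m) else 0))"
    by (simp only: pair_mult_def *)
  also have "\<dots> = F m - a * F (pair_shift x 1 m)"
    by (subst Sum_any.distrib) (auto intro: finite_subset[of _ "{0}"] finite_subset[of _ "{1}"])
  finally show ?thesis .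
qed

lemma act_linear_mpol:
  assumes x: "x \<in> index_pairs k" and F: "ratio_series k F"
  shows "act (linear_mpol x as) F = act (var_mono (fst x) ^ length as) (pair_mult x (linear_fps as) F)"
proof (induction as)
  case Nil
  show ?case by (simp add: linear_mpol_def)
next
  case (Cons a as)
  let ?G = "pair_mult x (linear_fps as) F"
  let ?v = "var_mono (fst x)" and ?w = "monomial (Poly_Mapping.single (snd x) 1) a"
  have G: "ratio_series k ?G" by (rule ratio_series_pair_mult[OF x F])
  have neg: "act (P - Q) H m = act P H m - act Q H m" for P Q H m
    using act_add[of "P - Q" Q H m] by simp
  have "act (?v - ?w) ?G m = act ?v (pair_mult x (1 - fps_const a * fps_X) ?G) m" for m
  proof -
    have "pair_shift x 1 (sub_exp m (Poly_Mapping.single (fst x) 1)) = sub_exp m (Poly_Mapping.single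
        (snd x) 1)"
      using x by (auto simp: pair_shift_def sub_exp_def fun_eq_iff lookup_single when_def index_pairs_def)
    then show ?thesis by (simp add: neg var_mono_def act_monomial pair_mult_linear[OF x G])
  qed
  then have *: "act (?v - ?w) ?G = act ?v (pair_mult x (1 - fps_const a * fps_X) ?G)" ..
  have "act (linear_mpol x (a # as)) F = act (?v - ?w) (act (linear_mpol x as) F)"
    by (simp add: linear_mpol_def act_mult)
  also have "\<dots> = act (?v ^ length as) (act (?v - ?w) ?G)"
    unfolding Cons by (simp add: act_mult[symmetric] mult.commute)
  also have "\<dots> = act (?v ^ length (a # as)) (pair_mult x (linear_fps (a # as)) F)"
    unfolding * act_mult[symmetric] pair_mult_mult[OF x F, symmetric]
    by (simp only: linear_fps_simps list.size add_0_right add_Suc_right power_Suc2)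
  finally show ?case .
qed

lemma var_mono_nonzero: "var_mono i \<noteq> 0"
proof
  assume "var_mono i = 0"
  then have "Poly_Mapping.lookup (var_mono i) (Poly_Mapping.single i 1) = 0" by simp
  then show False by (simp add: var_mono_def)
qed

lemma linear_mpol_nonzero:
  assumes "fst x \<noteq> snd x" shows "linear_mpol x as \<noteq> 0"
proof -
  have "var_mono (fst x) - monomial (Poly_Mapping.single (snd x) 1) a \<noteq> 0" for a
  proof
    assume "var_mono (fst x) - monomial (Poly_Mapping.single (snd x) 1) a = 0"
    then have "Poly_Mapping.lookup (var_mono (fst x) - monomial (Poly_Mapping.single (snd x) 1) a)
        (Poly_Mapping.single (fst x) 1) = 0"
      by simp
    moreover have "Poly_Mapping.single (snd x) (1::nat) \<noteq> Poly_Mapping.single (fst x) 1"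
    proof
      assume "Poly_Mapping.single (snd x) (1::nat) = Poly_Mapping.single (fst x) 1"
      then have "Poly_Mapping.lookup (Poly_Mapping.single (snd x) (1::nat)) (fst x) =
          Poly_Mapping.lookup (Poly_Mapping.single (fst x) (1::nat)) (fst x)" by simp
      then show False using assms by (simp add: lookup_single when_def split: if_splits)
    qed
    ultimately show False by (simp add: var_mono_def lookup_minus lookup_single_not_eq)
  qed
  then show ?thesis by (induction as) (simp_all add: linear_mpol_def)
qed

lemma Fract_linear_mpol:
  "Fraction_Field.Fract (linear_mpol x as) 1 = rf_var (fst x) ^ length as * linear_rf as (rf_var (snd x)
      / rf_var (fst x))"
proof (induction as)
  case Nil
  show ?case by (simp add: linear_mpol_def linear_rf_def One_fract_def)
next
  case (Cons a as)
  have v: "rf_var (fst x) \<noteq> 0"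
    using var_mono_nonzero[of "fst x"] by (simp add: rf_var_def var_mono_def Zero_fract_def eq_fract)
  have "rf_const a * rf_var (snd x) = Fraction_Field.Fract (monomial (Poly_Mapping.single (snd x) 1) a) 1"
    by (simp add: rf_const_def rf_var_def mult_single)
  then have "Fraction_Field.Fract (var_mono (fst x) - monomial (Poly_Mapping.single (snd x) 1) a) 1 =
      rf_var (fst x) - rf_const a * rf_var (snd x)"
    by (simp add: rf_var_def var_mono_def)
  also have "\<dots> = rf_var (fst x) * (1 - rf_const a * (rf_var (snd x) / rf_var (fst x)))"
    using v by (simp add: field_simps)
  finally have "Fraction_Field.Fract (linear_mpol x (a # as)) 1 =
      rf_var (fst x) * (1 - rf_const a * (rf_var (snd x) / rf_var (fst x))) * Fraction_Field.Fract
          (linear_mpol x as) 1"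
  proof -
    assume *: "Fraction_Field.Fract (var_mono (fst x) - monomial (Poly_Mapping.single (snd x) 1) a) 1 =
      rf_var (fst x) * (1 - rf_const a * (rf_var (snd x) / rf_var (fst x)))"
    have "linear_mpol x (a # as) = (var_mono (fst x) - monomial (Poly_Mapping.single (snd x) 1) a) *
        linear_mpol x as"
      by (simp add: linear_mpol_def)
    moreover have "Fraction_Field.Fract (A * B) 1 = Fraction_Field.Fract A 1 * Fraction_Field.Fract B 1"
        for A B :: mpol
      by simp
    ultimately show ?thesis by (simp only: *)
  qed
  then show ?case unfolding Cons by (simp add: linear_rf_def mult_ac)
qed

text \<open>Numerator and denominator are both homogenized by a power of z_i; because
  \<open>as\<close> and \<open>bs\<close> have equal length, these powers agree and cancel.\<close>

lemma is_expansion_pair_mult: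
  assumes x: "x \<in> index_pairs k" and F: "ratio_series k F" and R: "is_expansion F R"
    and g: "linear_fps bs * g = linear_fps as" and len: "length as = length bs"
  shows "is_expansion (pair_mult x g F)
    (linear_rf as (rf_var (snd x) / rf_var (fst x)) / linear_rf bs (rf_var (snd x) / rf_var (fst x)) * R)"
proof -
  obtain P Q where PQ: "Q \<noteq> 0" "R = Fraction_Field.Fract P Q" "act Q F = act P unit_series"
    using R unfolding is_expansion_act by blast
  let ?A = "linear_mpol x as" and ?B = "linear_mpol x bs"
  have B: "?B \<noteq> 0" using x by (intro linear_mpol_nonzero) (auto simp: index_pairs_def)
  have "act ?B (pair_mult x g F) = act (var_mono (fst x) ^ length bs) (pair_mult x (linear_fps bs)
      (pair_mult x g F))"
    by (rule act_linear_mpol[OF x ratio_series_pair_mult[OF x F]])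
  also have "\<dots> = act ?A F"
    unfolding pair_mult_mult[OF x F, symmetric] g act_linear_mpol[OF x F] len ..
  finally have "act (Q * ?B) (pair_mult x g F) = act Q (act ?A F)" by (simp add: act_mult)
  also have "\<dots> = act ?A (act P unit_series)" unfolding PQ(3)[symmetric] act_mult[symmetric] by (simp
      add: mult.commute)
  finally have eq: "act (Q * ?B) (pair_mult x g F) = act (?A * P) unit_series" by (simp add: act_mult)
  have v: "rf_var (fst x) \<noteq> 0"
    using var_mono_nonzero[of "fst x"] by (simp add: rf_var_def var_mono_def Zero_fract_def eq_fract)
  have "Fraction_Field.Fract (?A * P) (Q * ?B) = Fraction_Field.Fract P Q * (Fraction_Field.Fract ?A 1 /
      Fraction_Field.Fract ?B 1)"
    using B PQ(1) by (simp add: mult.commute)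
  also have "\<dots> = linear_rf as (rf_var (snd x) / rf_var (fst x)) / linear_rf bs (rf_var (snd x) / rf_var
      (fst x)) * R"
    unfolding Fract_linear_mpol PQ(2) len using v by simp
  finally show ?thesis using eq B PQ(1) by (intro is_expansionI[OF _ eq]) simp_all
qed

lemma is_expansion_set_mult:
  assumes "finite S" "S \<subseteq> index_pairs k"
    and "\<And>x. x \<in> S \<Longrightarrow> linear_fps (bs x) * g x = linear_fps (as x)"
    and "\<And>x. x \<in> S \<Longrightarrow> length (as x) = length (bs x)"
  shows "is_expansion (set_mult S g unit_series)
    (\<Prod>x\<in>S. linear_rf (as x) (rf_var (snd x) / rf_var (fst x)) / linear_rf (bs x) (rf_var (snd x) /
        rf_var (fst x)))"
  using assms
proof (induction S rule: finite_induct)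
  case (insert x S)
  then have "is_expansion (pair_mult x (g x) (set_mult S g unit_series))
    (linear_rf (as x) (rf_var (snd x) / rf_var (fst x)) / linear_rf (bs x) (rf_var (snd x) / rf_var (fst x)) *
     (\<Prod>x\<in>S. linear_rf (as x) (rf_var (snd x) / rf_var (fst x)) / linear_rf (bs x) (rf_var (snd x) /
         rf_var (fst x))))"
    by (intro is_expansion_pair_mult[of x k] ratio_series_set_mult ratio_series_unit) auto
  then show ?case using insert set_mult_insert(1)[of S k x unit_series g] ratio_series_unit by simp
qed (simp add: is_expansion_unit)

theorem (in corner) rational_of_corr_series:
  "rational_of (corr_series q4 t4 cs u k) = (\<Sum>a\<in>{1..k} \<rightarrow>\<^sub>E {1..n}.
     rf_const (\<Prod>i=1..k. colour_weight (a i) * u (a i)) *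
     (\<Prod>(i, j)\<in>index_pairs k. linear_rf (pair_num q t (colour cs) (a i) (a j)) (rf_var j / rf_var i) /
        linear_rf (pair_den t) (rf_var j / rf_var i)))"
proof (rule rational_of_eq)
  have "is_expansion (set_mult (index_pairs k) (\<lambda>(i, j). f11 q4 t4 cs * exp_series (contraction (a i) (a
      j))) unit_series)
      (\<Prod>x\<in>index_pairs k. linear_rf (pair_num q t (colour cs) (a (fst x)) (a (snd x))) (rf_var (snd x) /
          rf_var (fst x)) /
        linear_rf (pair_den t) (rf_var (snd x) / rf_var (fst x)))"
    if a: "a \<in> {1..k} \<rightarrow>\<^sub>E {1..n}" for a
  proof (rule is_expansion_set_mult[OF finite_index_pairs order_refl])
    fix x assume x: "x \<in> index_pairs k"
    then have "a (fst x) \<in> {1..n}" "a (snd x) \<in> {1..n}"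
      using a by (auto simp: index_pairs_def intro!: PiE_mem[OF a])
    then show "linear_fps (pair_den t) * (case x of (i, j) \<Rightarrow> f11 q4 t4 cs * exp_series (contraction (a
        i) (a j))) =
        linear_fps (pair_num q t (colour cs) (a (fst x)) (a (snd x)))"
      using f11_contraction by (simp add: split_def)
  qed (simp add: pair_num_def pair_den_def)
  then show "is_expansion (corr_series q4 t4 cs u k) (\<Sum>a\<in>{1..k} \<rightarrow>\<^sub>E {1..n}.
     rf_const (\<Prod>i=1..k. colour_weight (a i) * u (a i)) *
     (\<Prod>(i, j)\<in>index_pairs k. linear_rf (pair_num q t (colour cs) (a i) (a j)) (rf_var j / rf_var i) /
        linear_rf (pair_den t) (rf_var j / rf_var i)))"
    unfolding corr_series_expand by (intro is_expansion_sum finite_PiE) (simp_all add: split_def)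
qed

section \<open>Evaluation of rational functions\<close>

text \<open>The target field is left general because the specialization is carried out twice: into
  rational functions of \<xi> and y, and from there into numbers.\<close>

locale substitution =
  fixes emb :: "complex \<Rightarrow> 'f :: field" and p :: "nat \<Rightarrow> 'f"
  assumes emb: "emb 0 = 0" "emb 1 = 1" "\<And>a b. emb (a + b) = emb a + emb b" "\<And>a b. emb (a * b) = emb a * emb b"
begin

definition mono_value :: "(nat \<Rightarrow>\<^sub>0 nat) \<Rightarrow> 'f" where
  "mono_value n = (\<Prod>i\<in>Poly_Mapping.keys n. p i ^ Poly_Mapping.lookup n i)"

lemma mono_value_superset:
  "finite A \<Longrightarrow> Poly_Mapping.keys n \<subseteq> A \<Longrightarrow> mono_value n = (\<Prod>i\<in>A. p i ^ Poly_Mapping.lookup n i)"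
  unfolding mono_value_def by (rule prod.mono_neutral_left) (auto simp: in_keys_iff)

lemma mono_value_add: "mono_value (n + n') = mono_value n * mono_value n'"
proof -
  let ?A = "Poly_Mapping.keys n \<union> Poly_Mapping.keys n'"
  have "mono_value (n + n') = (\<Prod>i\<in>?A. p i ^ Poly_Mapping.lookup (n + n') i)"
    using keys_add[of n n'] by (intro mono_value_superset) auto
  then show ?thesis
    by (simp add: mono_value_superset[of ?A n] mono_value_superset[of ?A n'] lookup_add power_add prod.distrib)
qed

abbreviation "value_at \<equiv> mpol_subst emb p"

lemma value_at_superset:
  "finite A \<Longrightarrow> Poly_Mapping.keys P \<subseteq> A \<Longrightarrow> value_at P = (\<Sum>n\<in>A. emb (Poly_Mapping.lookup P n) * mono_value n)"
  unfolding mpol_subst_def mono_value_def[symmetric]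
  by (rule sum.mono_neutral_left) (auto simp: in_keys_iff emb)

lemma value_at_add: "value_at (P + Q) = value_at P + value_at Q"
proof -
  let ?A = "Poly_Mapping.keys P \<union> Poly_Mapping.keys Q"
  have "value_at (P + Q) = (\<Sum>n\<in>?A. emb (Poly_Mapping.lookup (P + Q) n) * mono_value n)"
    using keys_add[of P Q] by (intro value_at_superset) auto
  then show ?thesis
    by (simp add: value_at_superset[of ?A P] value_at_superset[of ?A Q] lookup_add emb distrib_right
        sum.distrib)
qed

lemma value_at_monomial: "value_at (monomial n c) = emb c * mono_value n"
  by (subst value_at_superset[of "{n}"]) auto

lemma value_at_0: "value_at 0 = 0"
  by (simp add: mpol_subst_def)

lemma value_at_mult: "value_at (P * Q) = value_at P * value_at Q"
proof (rule mpol_additive_induct[where f = "\<lambda>P. value_at (P * Q)" and g = "\<lambda>P. value_at P * value_at Q"])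
  fix n c
  show "value_at (monomial n c * Q) = value_at (monomial n c) * value_at Q"
    by (rule mpol_additive_induct[where f = "\<lambda>Q. value_at (monomial n c * Q)" and g = "\<lambda>Q. value_at
        (monomial n c) * value_at Q"])
      (simp_all add: mult_single value_at_monomial mono_value_add emb value_at_add value_at_0
          distrib_left distrib_right mult_ac)
qed (simp_all add: value_at_add value_at_0 distrib_right)

lemma value_at_1: "value_at 1 = 1"
  using value_at_monomial[of 0 1] by (simp add: emb mono_value_def)

text \<open>A relation rather than a function, since a value exists only where some representation
  has a nonvanishing denominator. Cross-multiplication shows that it is single-valued.\<close>

definition has_value :: "ratfun \<Rightarrow> 'f \<Rightarrow> bool" where
  "has_value R S \<longleftrightarrow> (\<exists>P Q. R = Fraction_Field.Fract P Q \<and> value_at Q \<noteq> 0 \<and> S = value_at P / value_at Q)"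

lemma has_value_unique:
  assumes "has_value R S" "has_value R S'" shows "S = S'"
proof -
  obtain P Q where PQ: "R = Fraction_Field.Fract P Q" "value_at Q \<noteq> 0" "S = value_at P / value_at Q"
    using assms(1) unfolding has_value_def by blast
  obtain P' Q' where PQ': "R = Fraction_Field.Fract P' Q'" "value_at Q' \<noteq> 0" "S' = value_at P' / value_at Q'"
    using assms(2) unfolding has_value_def by blast
  have "Q \<noteq> 0" "Q' \<noteq> 0" using PQ(2) PQ'(2) value_at_0 by auto
  then have "P * Q' = P' * Q" using PQ(1) PQ'(1) eq_fract by metis
  then have "value_at P * value_at Q' = value_at P' * value_at Q" by (metis value_at_mult)
  then show ?thesis unfolding PQ(3) PQ'(3) using PQ(2) PQ'(2) by (simp add: frac_eq_eq)
qed

lemma rf_subst_eq: "has_value R S \<Longrightarrow> rf_subst emb p R = S"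
  unfolding rf_subst_def has_value_def[symmetric] using has_value_unique by blast

lemma has_valueI: "R = Fraction_Field.Fract P Q \<Longrightarrow> value_at Q \<noteq> 0 \<Longrightarrow> S = value_at P / value_at Q \<Longrightarrow> has_value R S"
  unfolding has_value_def by blast

lemma has_value_add:
  assumes "has_value R S" "has_value R' S'" shows "has_value (R + R') (S + S')"
proof -
  obtain P Q where PQ: "R = Fraction_Field.Fract P Q" "value_at Q \<noteq> 0" "S = value_at P / value_at Q"
    using assms(1) unfolding has_value_def by blast
  obtain P' Q' where PQ': "R' = Fraction_Field.Fract P' Q'" "value_at Q' \<noteq> 0" "S' = value_at P' / value_at Q'"
    using assms(2) unfolding has_value_def by blast
  have nz: "Q \<noteq> 0" "Q' \<noteq> 0" using PQ(2) PQ'(2) value_at_0 by auto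
  show ?thesis
    by (rule has_valueI[of _ "P * Q' + P' * Q" "Q * Q'"])
      (use nz PQ PQ' in \<open>simp_all add: value_at_add value_at_mult add_frac_eq\<close>)
qed

lemma has_value_mult:
  assumes "has_value R S" "has_value R' S'" shows "has_value (R * R') (S * S')"
proof -
  obtain P Q where PQ: "R = Fraction_Field.Fract P Q" "value_at Q \<noteq> 0" "S = value_at P / value_at Q"
    using assms(1) unfolding has_value_def by blast
  obtain P' Q' where PQ': "R' = Fraction_Field.Fract P' Q'" "value_at Q' \<noteq> 0" "S' = value_at P' / value_at Q'"
    using assms(2) unfolding has_value_def by blast
  show ?thesis
    by (rule has_valueI[of _ "P * P'" "Q * Q'"]) (use PQ PQ' in \<open>simp_all add: value_at_mult\<close>)
qed

lemma has_value_inverse: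
  assumes "has_value R S" "S \<noteq> 0" shows "has_value (inverse R) (inverse S)"
proof -
  obtain P Q where PQ: "R = Fraction_Field.Fract P Q" "value_at Q \<noteq> 0" "S = value_at P / value_at Q"
    using assms(1) unfolding has_value_def by blast
  show ?thesis
  proof (rule has_valueI[of _ Q P])
    show "inverse R = Fraction_Field.Fract Q P" unfolding PQ(1) by (rule inverse_fract)
    show "value_at P \<noteq> 0" using PQ(3) assms(2) by auto
    show "inverse S = value_at Q / value_at P" unfolding PQ(3) by (rule inverse_divide)
  qed
qed

lemma has_value_const: "has_value (rf_const c) (emb c)"
  by (rule has_valueI[of _ "monomial 0 c" 1])
    (simp_all only: rf_const_def value_at_1 value_at_monomial mono_value_def keys_zero, simp_all)

lemma has_value_var: "has_value (rf_var i) (p i)"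
proof -
  have "value_at (var_mono i) = p i"
    by (simp add: var_mono_def value_at_monomial emb mono_value_def)
  then show ?thesis
    by (intro has_valueI[of _ "var_mono i" 1]) (simp_all add: rf_var_def var_mono_def value_at_1)
qed

end

interpretation const_subst: substitution rf_const p for p
  by unfold_locales (rule rf_const_simps)+

interpretation id_subst: substitution "\<lambda>a. a" p for p
  by unfold_locales auto

section \<open>The specialization as two successive substitutions\<close>

definition linear_value :: "complex list \<Rightarrow> complex \<Rightarrow> complex" where
  "linear_value as x = prod_list (map (\<lambda>a. 1 - a * x) as)"

locale specialization =
  fixes q \<xi> y :: complex and lam :: "nat \<Rightarrow> nat"
begin

abbreviation "spec_values \<equiv> (\<lambda>i. if i \<in> {1..psize lam} then spec_list q lam ! (i - 1) else 0)"

abbreviation "point \<equiv> (\<lambda>i :: nat. if i = 0 then \<xi> else if i = 1 then y else 0)"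

text \<open>Composes the two substitutions of the limit. The relation is compatible with the field
  operations, and for inverses it asks only that the final number be nonzero, which is what can be
  checked.\<close>

definition specializes :: "ratfun \<Rightarrow> complex \<Rightarrow> bool" where
  "specializes R s \<longleftrightarrow> (\<exists>S. const_subst.has_value spec_values R S \<and> id_subst.has_value point S s)"

lemma rf_eval2_Psi:
  assumes "specializes R s" shows "rf_eval2 (Psi_tilde q lam R) \<xi> y = s"
proof -
  obtain S where S: "const_subst.has_value spec_values R S" "id_subst.has_value point S s"
    using assms unfolding specializes_def by blast
  have "Psi_tilde q lam R = S" unfolding Psi_tilde_def by (rule const_subst.rf_subst_eq[OF S(1)])
  then show ?thesis unfolding rf_eval2_def using id_subst.rf_subst_eq[OF S(2)] by simp
qed

lemma specializes_add: "specializes R s \<Longrightarrow> specializes R' s' \<Longrightarrow> specializes (R + R') (s + s')"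
  unfolding specializes_def using const_subst.has_value_add id_subst.has_value_add by blast

lemma specializes_mult: "specializes R s \<Longrightarrow> specializes R' s' \<Longrightarrow> specializes (R * R') (s * s')"
  unfolding specializes_def using const_subst.has_value_mult id_subst.has_value_mult by blast

lemma specializes_const: "specializes (rf_const c) c"
  unfolding specializes_def using const_subst.has_value_const id_subst.has_value_const by blast

lemma specializes_inverse:
  assumes "specializes R s" "s \<noteq> 0" shows "specializes (inverse R) (inverse s)"
proof -
  obtain S where S: "const_subst.has_value spec_values R S" "id_subst.has_value point S s"
    using assms unfolding specializes_def by blast
  \<comment> \<open>The zero rational function has value 0, so a nonzero final value forces the
    intermediate function to be nonzero.\<close>
  have "S \<noteq> 0"
  proof
    assume "S = 0"
    then have "id_subst.has_value point 0 s" using S(2) by simp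
    moreover have "id_subst.has_value point 0 0"
      using id_subst.has_value_const[of point 0] by (simp only: rf_const_simps(1))
    ultimately show False using id_subst.has_value_unique assms(2) by blast
  qed
  then show ?thesis
    unfolding specializes_def using S assms(2) const_subst.has_value_inverse id_subst.has_value_inverse by blast
qed

lemma specializes_divide:
  "specializes R s \<Longrightarrow> specializes R' s' \<Longrightarrow> s' \<noteq> 0 \<Longrightarrow> specializes (R / R') (s / s')"
  unfolding divide_inverse by (intro specializes_mult specializes_inverse)

lemma specializes_0: "specializes 0 0" and specializes_1: "specializes 1 1"
  using specializes_const[of 0] specializes_const[of 1] by (simp_all only: rf_const_simps(1,2))

lemma specializes_linear: "specializes z x \<Longrightarrow> specializes (1 - rf_const a * z) (1 - a * x)"
proof -
  assume z: "specializes z x"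
  have "rf_const (- 1) = - 1"
  proof -
    have "rf_const (1 + - 1) = rf_const 1 + rf_const (- 1)" by (rule rf_const_simps(3))
    then have "1 + rf_const (- 1) = 0" by (simp only: rf_const_simps(1,2) add.right_inverse)
    then show ?thesis using minus_unique by metis
  qed
  then have *: "1 - rf_const a * z = 1 + rf_const (- 1) * (rf_const a * z)" by simp
  have "specializes (1 + rf_const (- 1) * (rf_const a * z)) (1 + (- 1) * (a * x))"
    by (intro specializes_add specializes_1 specializes_mult specializes_const z)
  then show ?thesis unfolding * by simp
qed

lemma specializes_prod:
  "(\<And>x. x \<in> A \<Longrightarrow> specializes (f x) (g x)) \<Longrightarrow> specializes (prod f A) (prod g A)"
  by (induction A rule: infinite_finite_induct) (auto intro!: specializes_mult specializes_1)

lemma specializes_sum: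
  "(\<And>x. x \<in> A \<Longrightarrow> specializes (f x) (g x)) \<Longrightarrow> specializes (sum f A) (sum g A)"
  by (induction A rule: infinite_finite_induct) (auto intro!: specializes_add specializes_0)

lemma specializes_linear_rf: "specializes z x \<Longrightarrow> specializes (linear_rf as z) (linear_value as x)"
  unfolding linear_rf_def linear_value_def
  by (induction as) (auto intro!: specializes_mult specializes_1 specializes_linear)

end

section \<open>Boxes and positions\<close>

text \<open>The position of a box when the diagram is read row by row; this is the order of the
  variables in \<open>block\<close> and of the values in \<open>spec_list\<close>.\<close>

definition box_index :: "(nat \<Rightarrow> nat) \<Rightarrow> nat \<times> nat \<Rightarrow> nat" where
  "box_index lam b = (\<Sum>d\<in>{1..<fst b}. lam d) + snd b"

definition box_before :: "nat \<times> nat \<Rightarrow> nat \<times> nat \<Rightarrow> bool" where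
  "box_before b c \<longleftrightarrow> fst b < fst c \<or> fst b = fst c \<and> snd b < snd c"

lemma partition_decreasing:
  assumes "is_partition lam" "1 \<le> i" "i \<le> j" shows "lam j \<le> lam i"
  using assms(3,2)
proof (induction j rule: dec_induct)
  case (step m)
  have "lam (Suc m) \<le> lam m" using assms(1) step by (simp add: is_partition_def)
  with step show ?case by simp
qed simp

lemma plength_support:
  assumes "is_partition lam" shows "{i. 1 \<le> i \<and> 0 < lam i} = {1..plength lam}"
proof -
  define A where "A = {i. 1 \<le> i \<and> 0 < lam i}"
  have fin: "finite A" using assms by (simp add: is_partition_def A_def)
  have len: "plength lam = card A" by (simp add: plength_def A_def)
  have "A = {1..plength lam}"
  proof (cases "A = {}")
    case True
    then show ?thesis unfolding len by simp
  next
    case False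
    have "i \<in> A \<longleftrightarrow> i \<in> {1..Max A}" for i
    proof
      assume i: "i \<in> A"
      then show "i \<in> {1..Max A}" using Max_ge[OF fin i] by (simp add: A_def)
    next
      assume i: "i \<in> {1..Max A}"
      have "0 < lam (Max A)" using Max_in[OF fin False] by (simp add: A_def)
      moreover have "lam (Max A) \<le> lam i" using i by - (rule partition_decreasing[OF assms], simp_all)
      ultimately show "i \<in> A" using i by (simp add: A_def)
    qed
    then have eq: "A = {1..Max A}" by (rule set_eqI)
    have "card A = card {1..Max A}" using eq by (rule arg_cong)
    then have m: "plength lam = Max A" unfolding len by simp
    show ?thesis unfolding m by (rule eq)
  qed
  then show ?thesis unfolding A_def .
qed

lemma plength_pos: "is_partition lam \<Longrightarrow> 1 \<le> i \<Longrightarrow> 0 < lam i \<longleftrightarrow> i \<le> plength lam"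
  using eqset_imp_iff[OF plength_support, of lam i] by simp

lemma diagram_rows: "is_partition lam \<Longrightarrow> diagram lam = (SIGMA i:{1..plength lam}. {1..lam i})"
proof -
  assume part: "is_partition lam"
  show ?thesis
  proof (intro set_eqI iffI)
    fix b assume "b \<in> diagram lam"
    then obtain i j where b: "b = (i, j)" "1 \<le> i" "1 \<le> j" "j \<le> lam i" by (auto simp: diagram_def)
    then have "0 < lam i" by linarith
    then have "i \<le> plength lam" using plength_pos[OF part b(2)] by blast
    then show "b \<in> (SIGMA i:{1..plength lam}. {1..lam i})" using b by simp
  next
    fix b assume "b \<in> (SIGMA i:{1..plength lam}. {1..lam i})"
    then show "b \<in> diagram lam" by (auto simp: diagram_def)
  qed
qed

lemma finite_diagram: "is_partition lam \<Longrightarrow> finite (diagram lam)"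
  by (simp add: diagram_rows)

context
  fixes lam :: "nat \<Rightarrow> nat"
  assumes part: "is_partition lam"
begin

lemma box_index_less:
  assumes b: "b \<in> diagram lam" and c: "c \<in> diagram lam" and bc: "box_before b c"
  shows "box_index lam b < box_index lam c"
proof (cases "fst b = fst c")
  case True
  then show ?thesis using bc by (simp add: box_before_def box_index_def)
next
  case False
  then have lt: "fst b < fst c" using bc by (simp add: box_before_def)
  have "box_index lam b \<le> (\<Sum>d\<in>{1..<Suc (fst b)}. lam d)"
    using b by (auto simp: box_index_def diagram_def)
  also have "\<dots> \<le> (\<Sum>d\<in>{1..<fst c}. lam d)" using lt by (intro sum_mono2) auto
  also have "\<dots> < box_index lam c" using c by (auto simp: box_index_def diagram_def)
  finally show ?thesis .
qed

lemma box_before_total: "b \<noteq> c \<Longrightarrow> box_before b c \<or> box_before c b"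
  by (cases b; cases c) (auto simp: box_before_def)

lemma box_index_inj: "inj_on (box_index lam) (diagram lam)"
  by (rule inj_onI) (metis box_before_total box_index_less less_irrefl)

lemma box_index_less_iff:
  "b \<in> diagram lam \<Longrightarrow> c \<in> diagram lam \<Longrightarrow> box_index lam b < box_index lam c \<longleftrightarrow> box_before b c"
  using box_before_total box_index_less by (metis less_asym less_irrefl)

text \<open>The image lies in the interval and, as the numbering is injective, has as many elements
  as the diagram has boxes.\<close>

lemma box_index_range: "box_index lam ` diagram lam = {1..psize lam}"
proof (rule card_subset_eq)
  show "finite {1..psize lam}" by simp
  show "box_index lam ` diagram lam \<subseteq> {1..psize lam}"
  proof
    fix x assume "x \<in> box_index lam ` diagram lam"
    then obtain i j where x: "x = box_index lam (i, j)" and ij: "i \<in> {1..plength lam}" "j \<in> {1..lam i}"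
      using diagram_rows[OF part] by auto
    have "x \<le> (\<Sum>d\<in>{1..<Suc i}. lam d)" using ij by (simp add: x box_index_def)
    also have "\<dots> \<le> psize lam" unfolding psize_def using ij by (intro sum_mono2) auto
    finally show "x \<in> {1..psize lam}" using ij by (simp add: x box_index_def)
  qed
  show "card (box_index lam ` diagram lam) = card {1..psize lam}"
  proof -
    have "card (box_index lam ` diagram lam) = card (diagram lam)" by (rule card_image[OF box_index_inj])
    also have "\<dots> = psize lam" unfolding diagram_rows[OF part] by (simp add: psize_def)
    finally show ?thesis by simp
  qed
qed

lemma box_index_bij: "bij_betw (box_index lam) (diagram lam) {1..psize lam}"
  using box_index_inj box_index_range by (simp add: bij_betw_def)

lemma block_eq: "block lam c = box_index lam ` (\<lambda>j. (c, j)) ` {1..lam c}" if "c \<ge> 1"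
proof -
  have "(\<Sum>d\<in>{1..c}. lam d) = (\<Sum>d\<in>{1..<c}. lam d) + lam c"
    using that by (simp flip: atLeastLessThanSuc_atLeastAtMost)
  then have "block lam c = (\<lambda>j. (\<Sum>d\<in>{1..<c}. lam d) + j) ` {1..lam c}"
    by (simp add: block_def image_add_atLeastAtMost)
  then show ?thesis by (simp add: image_image box_index_def)
qed

lemma spec_list_nth:
  assumes "b \<in> diagram lam"
  shows "spec_list q lam ! (box_index lam b - 1) =
    rf_const (q ^ (snd b - 1)) * rf_var 0 ^ (fst b - 1) * rf_var 1"
proof -
  obtain i j where b: "b = (i, j)" and ij: "i \<in> {1..plength lam}" "j \<in> {1..lam i}"
    using assms diagram_rows[OF part] by auto
  have lt: "j - 1 < lam i" using ij by auto
  define row where "row c = map (\<lambda>a. rf_const (q ^ a) * rf_var 0 ^ (c - 1) * rf_var 1) [0..<lam c]" for c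
  have "[1..<Suc (plength lam)] = [1..<i] @ i # [Suc i..<Suc (plength lam)]"
    using ij upt_add_eq_append[of 1 i "Suc (plength lam) - i"] by (simp add: upt_rec[of i])
  then have "spec_list q lam = concat (map row [1..<i]) @ row i @ concat (map row [Suc i..<Suc (plength lam)])"
    unfolding spec_list_def row_def[symmetric] by simp
  moreover have "length (concat (map row [1..<i])) = (\<Sum>d\<in>{1..<i}. lam d)"
    by (simp add: length_concat row_def comp_def sum_set_upt_conv_sum_list_nat[symmetric])
  moreover have "box_index lam b - 1 = (\<Sum>d\<in>{1..<i}. lam d) + (j - 1)"
    using ij by (simp add: b box_index_def)
  moreover have "(xs @ ys @ zs) ! (length xs + m) = ys ! m" if "m < length ys" for xs ys zs :: "ratfun
      list" and m
    using that by (simp add: nth_append)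
  from this[of "j - 1" "row i" "concat (map row [1..<i])" "concat (map row [Suc i..<Suc (plength lam)])"]
  have "(concat (map row [1..<i]) @ row i @ concat (map row [Suc i..<Suc (plength lam)])) !
      (length (concat (map row [1..<i])) + (j - 1)) = row i ! (j - 1)"
    using lt by (simp add: row_def)
  ultimately have "spec_list q lam ! (box_index lam b - 1) = row i ! (j - 1)"
    by (simp only:)
  also have "\<dots> = rf_const (q ^ (j - 1)) * rf_var 0 ^ (i - 1) * rf_var 1"
    using lt by (simp add: row_def)
  finally show ?thesis by (simp add: b)
qed

end

definition box_pairs :: "(nat \<Rightarrow> nat) \<Rightarrow> ((nat \<times> nat) \<times> (nat \<times> nat)) set" where
  "box_pairs lam = {(b, c). b \<in> diagram lam \<and> c \<in> diagram lam \<and> box_before b c}"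

definition box_value :: "complex \<Rightarrow> complex \<Rightarrow> complex \<Rightarrow> nat \<times> nat \<Rightarrow> complex" where
  "box_value q \<xi> y b = q ^ (snd b - 1) * \<xi> ^ (fst b - 1) * y"

definition pair_value :: "complex \<Rightarrow> complex \<Rightarrow> (nat \<Rightarrow> nat) \<Rightarrow> nat \<Rightarrow> nat \<Rightarrow> complex \<Rightarrow> complex" where
  "pair_value q t col a b x = linear_value (pair_num q t col a b) x /
     linear_value (pair_den t) x"

text \<open>The value of \<open>Delta\<close> at \<open>q\<^sub>3\<close> to the power \<open>- 1/2\<close> times \<open>x\<close>.\<close>

definition norm_value :: "complex \<Rightarrow> complex \<Rightarrow> complex \<Rightarrow> complex" where
  "norm_value q t x = (1 - q * x) * (1 - t / q * x) / ((1 - x) * (1 - t * x))"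

lemma finite_box_pairs: "is_partition lam \<Longrightarrow> finite (box_pairs lam)"
  by (rule finite_subset[of _ "diagram lam \<times> diagram lam"]) (auto simp: box_pairs_def finite_diagram)

lemma box_pairs_bij:
  assumes part: "is_partition lam"
  shows "bij_betw (map_prod (box_index lam) (box_index lam)) (box_pairs lam) (index_pairs (psize lam))"
  unfolding bij_betw_def
proof
  show "inj_on (map_prod (box_index lam) (box_index lam)) (box_pairs lam)"
    using map_prod_inj_on[OF box_index_inj[OF part] box_index_inj[OF part]]
    by (rule inj_on_subset) (auto simp: box_pairs_def)
  show "map_prod (box_index lam) (box_index lam) ` box_pairs lam = index_pairs (psize lam)"
  proof (intro set_eqI iffI)
    fix x assume "x \<in> map_prod (box_index lam) (box_index lam) ` box_pairs lam"
    then obtain b c where x: "x = (box_index lam b, box_index lam c)" and bc: "b \<in> diagram lam" "c \<in>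
        diagram lam" "box_before b c"
      by (auto simp: box_pairs_def)
    have "box_index lam b \<in> {1..psize lam}" "box_index lam c \<in> {1..psize lam}"
      using bc box_index_range[OF part] by blast+
    then show "x \<in> index_pairs (psize lam)"
      using box_index_less[OF part bc] by (simp add: x index_pairs_def)
  next
    fix x assume "x \<in> index_pairs (psize lam)"
    then obtain i j where x: "x = (i, j)" "i < j" "i \<in> {1..psize lam}" "j \<in> {1..psize lam}"
      by (auto simp: index_pairs_def)
    then obtain b c where bc: "b \<in> diagram lam" "c \<in> diagram lam" "i = box_index lam b" "j = box_index lam c"
      using box_index_range[OF part] by (metis imageE)
    then have "(b, c) \<in> box_pairs lam" using x box_index_less_iff[OF part bc(1,2)] by (simp add: box_pairs_def)
    then show "x \<in> map_prod (box_index lam) (box_index lam) ` box_pairs lam"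
      by (rule image_eqI[rotated]) (simp add: x(1) bc)
  qed
qed

context corner
begin

context
  fixes lam :: "nat \<Rightarrow> nat" and \<xi> y :: complex and u :: "nat \<Rightarrow> complex"
  assumes part: "is_partition lam" and xi: "\<xi> \<noteq> 0" and y: "y \<noteq> 0"
    and den: "\<And>b c. (b, c) \<in> box_pairs lam \<Longrightarrow>
      linear_value (pair_den t) (box_value q \<xi> y c / box_value q \<xi> y b) \<noteq> 0"
    and num: "\<And>b c. (b, c) \<in> box_pairs lam \<Longrightarrow> fst b < fst c \<Longrightarrow>
      norm_value q t (box_value q \<xi> y c / box_value q \<xi> y b) \<noteq> 0"
begin

interpretation specialization q \<xi> y lam .

private abbreviation "z \<equiv> box_value q \<xi> y"
private abbreviation "pos \<equiv> box_index lam"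

private lemma z_nonzero: "z b \<noteq> 0"
  using q0 xi y by (simp add: box_value_def)

lemma specializes_var:
  assumes "b \<in> diagram lam" shows "specializes (rf_var (pos b)) (z b)"
proof -
  define S where "S = rf_const (q ^ (snd b - 1)) * rf_var 0 ^ (fst b - 1) * rf_var 1"
  have "pos b \<in> {1..psize lam}" using box_index_range[OF part] assms by blast
  then have v: "spec_values (pos b) = S"
    using spec_list_nth[OF part assms, of q] by (simp add: S_def)
  have "const_subst.has_value spec_values (rf_var (pos b)) S"
    using const_subst.has_value_var[of spec_values "pos b"] unfolding v .
  moreover have "id_subst.has_value point S (z b)"
  proof -
    have 0: "id_subst.has_value point (rf_var 0) \<xi>" and 1: "id_subst.has_value point (rf_var 1) y"
      using id_subst.has_value_var[of point 0] id_subst.has_value_var[of point 1] by simp_all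
    have "id_subst.has_value point (rf_var 0 ^ e) (\<xi> ^ e)" for e
    proof (induction e)
      case 0
      then show ?case using id_subst.has_value_const[of point 1] by (simp only: rf_const_simps power_0)
    next
      case (Suc e)
      then show ?case using id_subst.has_value_mult[OF 0] by simp
    qed
    then show ?thesis
      unfolding S_def box_value_def by (intro id_subst.has_value_mult id_subst.has_value_const 1)
  qed
  ultimately show ?thesis unfolding specializes_def by blast
qed

lemma specializes_ratio:
  "b \<in> diagram lam \<Longrightarrow> c \<in> diagram lam \<Longrightarrow> specializes (rf_var (pos c) / rf_var (pos b)) (z c / z b)"
  by (intro specializes_divide specializes_var z_nonzero)

text \<open>At this argument the half-integral powers of q_3 combine, and the four coefficients in
  \<open>Delta\<close> become q, t / q, 1 and t.\<close>

lemma specializes_Delta: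
  assumes "(b, c) \<in> box_pairs lam"
  shows "specializes (Delta q4 t4 (rf_const (qp 3 (- 2)) * (rf_var (pos c) / rf_var (pos b))))
      (norm_value q t (z c / z b))"
proof -
  define x where "x = z c / z b"
  define w where "w = rf_const (qp 3 (- 2)) * (rf_var (pos c) / rf_var (pos b))"
  have "specializes w (qp 3 (- 2) * x)"
    unfolding w_def x_def using assms
    by (intro specializes_mult specializes_const specializes_ratio) (auto simp: box_pairs_def)
  from specializes_linear[OF this] have lin: "specializes (1 - rf_const a * w) (1 - a * qp 3 (- 2) * x)" for a
    by (simp add: mult.assoc)
  define a h where "a = qp 1 4 * qp 3 2" and "h = qp 3 2"
  have h: "h * qp 3 (- 2) = 1" unfolding h_def qp_add[symmetric] by (simp add: qpow_def)
  have h': "inverse h * qp 3 (- 2) = t"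
  proof -
    have "inverse h * qp 3 (- 2) = qp 3 (- 4)" unfolding h_def qp_minus[symmetric] qp_add[symmetric] by simp
    then show ?thesis using qp_minus[of 3 4] by (simp add: qp_4)
  qed
  have a1: "a * qp 3 (- 2) = q" unfolding a_def mult.assoc h[unfolded h_def] by (simp add: qp_4)
  have a2: "inverse a * qp 3 (- 2) = t / q"
    using h' by (simp add: a_def h_def qp_4 divide_inverse mult.assoc mult.commute[of "inverse q"])
  have "linear_value (pair_den t) x \<noteq> 0" using den[OF assms] by (simp add: x_def)
  then have nz: "(1 - x) * (1 - t * x) \<noteq> 0" by (auto simp: linear_value_def pair_den_def)
  have "specializes (((1 - rf_const a * w) * (1 - rf_const (inverse a) * w)) / ((1 - rf_const h * w) *
      (1 - rf_const (inverse h) * w)))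
      (((1 - a * qp 3 (- 2) * x) * (1 - inverse a * qp 3 (- 2) * x)) / ((1 - h * qp 3 (- 2) * x) * (1 -
          inverse h * qp 3 (- 2) * x)))"
    by (intro specializes_divide specializes_mult lin) (use nz in \<open>simp add: h h'\<close>)
  moreover have "Delta q4 t4 w = ((1 - rf_const a * w) * (1 - rf_const (inverse a) * w)) /
      ((1 - rf_const h * w) * (1 - rf_const (inverse h) * w))"
    by (simp only: Delta_def Let_def a_def h_def)
  ultimately show ?thesis
    unfolding w_def[symmetric] x_def[symmetric] a1 a2 h h' norm_value_def by (simp only: mult_1_left)
qed

lemma specializes_Norm_factor:
  "specializes (Norm_factor q4 t4 lam)
     (\<Prod>(b, c)\<in>box_pairs lam. if fst b < fst c then inverse (norm_value q t (z c / z b)) else 1)"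
proof -
  let ?R = "{(c, d). 1 \<le> c \<and> c < d \<and> d \<le> plength lam}"
  let ?D = "\<lambda>i j. inverse (Delta q4 t4 (rf_const (qp 3 (- 2)) * (rf_var j / rf_var i)))"
  let ?A = "SIGMA x:?R. {1..lam (fst x)} \<times> {1..lam (snd x)}"
  let ?P = "{(b, c) \<in> box_pairs lam. fst b < fst c}"
  have fin: "finite ?R" by (rule finite_subset[of _ "{1..plength lam} \<times> {1..plength lam}"]) auto
  have inj: "inj_on pos ((\<lambda>j. (c, j)) ` {1..lam c})" if "c \<ge> 1" for c
    by (rule inj_on_subset[OF box_index_inj[OF part]]) (use that in \<open>auto simp: diagram_def\<close>)
  \<comment> \<open>The numbering identifies block c of the variables with row c of the
    diagram.\<close>
  have bl: "(\<Prod>i\<in>block lam c. f i) = (\<Prod>j\<in>{1..lam c}. f (pos (c, j)))" if "c \<ge> 1" for c and f :: "nat \<Rightarrow> ratfun"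
    unfolding block_eq[OF part that] prod.reindex[OF inj[OF that]] comp_def
    by (subst prod.reindex) (auto simp: inj_on_def)
  have "Norm_factor q4 t4 lam = (\<Prod>(c, d)\<in>?R. \<Prod>j\<in>{1..lam c}. \<Prod>j'\<in>{1..lam d}. ?D (pos (c, j)) (pos (d, j')))"
    unfolding Norm_factor_def by (intro prod.cong refl) (auto simp: bl)
  also have "\<dots> = (\<Prod>x\<in>?R. \<Prod>(j, j')\<in>{1..lam (fst x)} \<times> {1..lam (snd x)}. ?D (pos (fst x, j)) (pos (snd x, j')))"
    unfolding prod.cartesian_product by (simp add: split_def)
  also have "\<dots> = (\<Prod>(x, j, j')\<in>?A. ?D (pos (fst x, j)) (pos (snd x, j')))"
    by (subst prod.Sigma[OF fin]) (auto simp: split_def)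
  also have "\<dots> = (\<Prod>(b, c)\<in>?P. ?D (pos b) (pos c))"
    by (rule prod.reindex_bij_witness[where i = "\<lambda>(b, c). ((fst b, fst c), snd b, snd c)" and j = "\<lambda>(x,
        j, j'). ((fst x, j), (snd x, j'))"])
      (auto simp: box_pairs_def box_before_def diagram_rows[OF part])
  finally have eq: "Norm_factor q4 t4 lam = (\<Prod>(b, c)\<in>?P. ?D (pos b) (pos c))" .
  have "specializes (\<Prod>(b, c)\<in>?P. ?D (pos b) (pos c)) (\<Prod>(b, c)\<in>?P. inverse (norm_value q t (z c / z b)))"
  proof (rule specializes_prod)
    fix x assume "x \<in> ?P"
    then obtain b c where x: "x = (b, c)" and bc: "(b, c) \<in> box_pairs lam" "fst b < fst c" by auto
    show "specializes (case x of (b, c) \<Rightarrow> ?D (pos b) (pos c)) (case x of (b, c) \<Rightarrow> inverse (norm_value q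
        t (z c / z b)))"
      unfolding x prod.case by (rule specializes_inverse[OF specializes_Delta[OF bc(1)] num[OF bc]])
  qed
  also have "(\<Prod>(b, c)\<in>?P. inverse (norm_value q t (z c / z b))) =
      (\<Prod>(b, c)\<in>box_pairs lam. if fst b < fst c then inverse (norm_value q t (z c / z b)) else 1)"
    by (rule prod.mono_neutral_cong_left) (auto simp: finite_box_pairs[OF part] split: if_splits)
  finally show ?thesis unfolding eq .
qed

text \<open>The numbering of the boxes transports maps from positions to colours into fillings, and
  pairs of positions into pairs of boxes in reading order.\<close>

theorem rf_eval2_correlation:
  "rf_eval2 (Psi_tilde q lam (Norm_factor q4 t4 lam * rational_of (corr_series q4 t4 cs u (psize lam)))) \<xi> y =
   (\<Sum>T\<in>diagram lam \<rightarrow>\<^sub>E {1..n}. (\<Prod>b\<in>diagram lam. colour_weight (T b) * u (T b)) *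
     (\<Prod>(b, c)\<in>box_pairs lam. pair_value q t (colour cs) (T b) (T c) (z c / z b) *
       (if fst b < fst c then inverse (norm_value q t (z c / z b)) else 1)))"
proof (rule rf_eval2_Psi)
  let ?k = "psize lam"
  define inv where "inv = inv_into (diagram lam) pos"
  have inv: "inv (pos b) = b" if "b \<in> diagram lam" for b
    unfolding inv_def using that box_index_inj[OF part] by simp
  have pos_inv: "inv i \<in> diagram lam" "pos (inv i) = i" if "i \<in> {1..?k}" for i
    using that unfolding inv_def box_index_range[OF part, symmetric] by (simp_all add: inv_into_into
        f_inv_into_f)
  let ?G = "\<lambda>a. (\<Prod>i=1..?k. colour_weight (a i) * u (a i)) *
     (\<Prod>(b, c)\<in>box_pairs lam. pair_value q t (colour cs) (a (pos b)) (a (pos c)) (z c / z b))"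
  have "specializes (\<Prod>(i, j)\<in>index_pairs ?k. linear_rf (pair_num q t (colour cs) (a i) (a j)) (rf_var j
      / rf_var i) /
        linear_rf (pair_den t) (rf_var j / rf_var i))
     (\<Prod>(b, c)\<in>box_pairs lam. pair_value q t (colour cs) (a (pos b)) (a (pos c)) (z c / z b))" for a
  proof -
    have "(\<Prod>(i, j)\<in>index_pairs ?k. linear_rf (pair_num q t (colour cs) (a i) (a j)) (rf_var j / rf_var i) /
        linear_rf (pair_den t) (rf_var j / rf_var i)) =
      (\<Prod>(b, c)\<in>box_pairs lam. linear_rf (pair_num q t (colour cs) (a (pos b)) (a (pos c))) (rf_var (pos
          c) / rf_var (pos b)) /
        linear_rf (pair_den t) (rf_var (pos c) / rf_var (pos b)))"
      by (subst prod.reindex_bij_betw[OF box_pairs_bij[OF part], symmetric]) (simp add: split_def)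
    moreover have "specializes \<dots> (\<Prod>(b, c)\<in>box_pairs lam. pair_value q t (colour cs) (a (pos b)) (a (pos
        c)) (z c / z b))"
      unfolding pair_value_def
      by (rule specializes_prod)
        (use den in \<open>auto intro!: specializes_divide specializes_linear_rf specializes_ratio simp:
            box_pairs_def\<close>)
    ultimately show ?thesis by simp
  qed
  then have "specializes (rational_of (corr_series q4 t4 cs u ?k)) (\<Sum>a\<in>{1..?k} \<rightarrow>\<^sub>E {1..n}. ?G a)"
    unfolding rational_of_corr_series by (intro specializes_sum specializes_mult specializes_const)
  from specializes_mult[OF specializes_Norm_factor this]
  have "specializes (Norm_factor q4 t4 lam * rational_of (corr_series q4 t4 cs u ?k))
     ((\<Prod>(b, c)\<in>box_pairs lam. if fst b < fst c then inverse (norm_value q t (z c / z b)) else 1) *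
       (\<Sum>a\<in>{1..?k} \<rightarrow>\<^sub>E {1..n}. ?G a))" .
  also have "(\<Sum>a\<in>{1..?k} \<rightarrow>\<^sub>E {1..n}. ?G a) =
     (\<Sum>T\<in>diagram lam \<rightarrow>\<^sub>E {1..n}. (\<Prod>b\<in>diagram lam. colour_weight (T b) * u (T b)) *
     (\<Prod>(b, c)\<in>box_pairs lam. pair_value q t (colour cs) (T b) (T c) (z c / z b)))"
  proof (rule sum.reindex_bij_witness[where j = "\<lambda>a. restrict (\<lambda>b. a (pos b)) (diagram lam)"
        and i = "\<lambda>T. restrict (\<lambda>i. T (inv i)) {1..?k}"])
    fix a assume a: "a \<in> {1..?k} \<rightarrow>\<^sub>E {1..n}"
    show "restrict (\<lambda>i. restrict (\<lambda>b. a (pos b)) (diagram lam) (inv i)) {1..?k} = a"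
    proof
      fix i
      show "restrict (\<lambda>i. restrict (\<lambda>b. a (pos b)) (diagram lam) (inv i)) {1..?k} i = a i"
      proof (cases "i \<in> {1..?k}")
        case True
        then show ?thesis using pos_inv[OF True] by simp
      next
        case False
        then show ?thesis using PiE_arb[OF a False] False by (simp only: restrict_apply if_False)
      qed
    qed
    show "restrict (\<lambda>b. a (pos b)) (diagram lam) \<in> diagram lam \<rightarrow>\<^sub>E {1..n}"
    proof (rule restrict_PiE_iff[THEN iffD2], rule ballI)
      fix b assume "b \<in> diagram lam"
      then have "pos b \<in> {1..?k}" using box_index_range[OF part] by blast
      then show "a (pos b) \<in> {1..n}" by (rule PiE_mem[OF a])
    qed
    have "(\<Prod>b\<in>diagram lam. colour_weight (restrict (\<lambda>b. a (pos b)) (diagram lam) b) * u (restrict (\<lambda>b. a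
        (pos b)) (diagram lam) b)) =
        (\<Prod>i=1..?k. colour_weight (a i) * u (a i))"
      by (subst prod.reindex_bij_betw[OF box_index_bij[OF part], symmetric]) simp
    moreover have "(\<Prod>(b, c)\<in>box_pairs lam. pair_value q t (colour cs) (restrict (\<lambda>b. a (pos b)) (diagram lam) b)
        (restrict (\<lambda>b. a (pos b)) (diagram lam) c) (z c / z b)) =
       (\<Prod>(b, c)\<in>box_pairs lam. pair_value q t (colour cs) (a (pos b)) (a (pos c)) (z c / z b))"
      by (intro prod.cong refl) (auto simp: box_pairs_def)
    ultimately show "(\<Prod>b\<in>diagram lam. colour_weight (restrict (\<lambda>b. a (pos b)) (diagram lam) b) * u
        (restrict (\<lambda>b. a (pos b)) (diagram lam) b)) *
       (\<Prod>(b, c)\<in>box_pairs lam. pair_value q t (colour cs) (restrict (\<lambda>b. a (pos b)) (diagram lam) b)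
        (restrict (\<lambda>b. a (pos b)) (diagram lam) c) (z c / z b)) = ?G a" by (simp only:)
  next
    fix T assume T: "T \<in> diagram lam \<rightarrow>\<^sub>E {1..n}"
    show "restrict (\<lambda>b. restrict (\<lambda>i. T (inv i)) {1..?k} (pos b)) (diagram lam) = T"
    proof
      fix b
      show "restrict (\<lambda>b. restrict (\<lambda>i. T (inv i)) {1..?k} (pos b)) (diagram lam) b = T b"
      proof (cases "b \<in> diagram lam")
        case True
        then have "pos b \<in> {1..?k}" using box_index_range[OF part] by blast
        then show ?thesis using True inv by simp
      next
        case False
        then show ?thesis using PiE_arb[OF T False] by simp
      qed
    qed
    show "restrict (\<lambda>i. T (inv i)) {1..?k} \<in> {1..?k} \<rightarrow>\<^sub>E {1..n}"
      using pos_inv PiE_mem[OF T] by (simp add: restrict_PiE_iff)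
  qed
  also have "(\<Prod>(b, c)\<in>box_pairs lam. if fst b < fst c then inverse (norm_value q t (z c / z b)) else 1) * \<dots> =
   (\<Sum>T\<in>diagram lam \<rightarrow>\<^sub>E {1..n}. (\<Prod>b\<in>diagram lam. colour_weight (T b) * u (T b)) *
     (\<Prod>(b, c)\<in>box_pairs lam. pair_value q t (colour cs) (T b) (T c) (z c / z b) *
       (if fst b < fst c then inverse (norm_value q t (z c / z b)) else 1)))"
    by (simp add: sum_distrib_left split_def prod.distrib mult_ac)
  finally show "specializes (Norm_factor q4 t4 lam * rational_of (corr_series q4 t4 cs u ?k)) \<dots>" .
qed

end

end

section \<open>Weights of horizontal, vertical and general strips\<close>

locale generic_qt =
  fixes q t :: complex
  assumes q_nonzero: "q \<noteq> 0" and t_nonzero: "t \<noteq> 0"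
    and generic_powi: "\<And>a b :: int. q powi a * t powi b = 1 \<Longrightarrow> a = 0 \<and> b = 0"
begin

text \<open>The value of a linear factor at a monomial in q and t. By genericity it vanishes only if
  both exponents are 0, so every nonvanishing claim becomes a statement about integers.\<close>

definition br :: "int \<Rightarrow> int \<Rightarrow> complex" where
  "br a b = 1 - q powi a * t powi b"

lemma br_eq_0_iff [simp]: "br a b = 0 \<longleftrightarrow> a = 0 \<and> b = 0"
  using generic_powi[of a b] by (auto simp: br_def)

lemma br_flip: "br a b = - (q powi a * t powi b) * br (- a) (- b)"
  using q_nonzero t_nonzero by (simp add: br_def power_int_minus field_simps)

text \<open>Reversing the signs in one factor costs a monomial; the monomials cancel in the quotient
  because the exponents have equal sums above and below.\<close>

lemma br_quotient_flip:
  assumes "a + c = e + g" "b + d = f + h"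
  shows "br a b * br c d / (br e f * br g h) =
    br (- a) (- b) * br (- c) (- d) / (br (- e) (- f) * br (- g) (- h))"
proof -
  have nz: "q powi x \<noteq> 0" "t powi x \<noteq> 0" for x using q_nonzero t_nonzero by simp_all
  have "q powi a * q powi c = q powi e * q powi g" "t powi b * t powi d = t powi f * t powi h"
    using assms q_nonzero t_nonzero by (simp_all flip: power_int_add)
  then have *: "(q powi a * t powi b) * (q powi c * t powi d) = (q powi e * t powi f) * (q powi g * t powi h)"
    by (simp add: mult_ac)
  have "br a b * br c d / (br e f * br g h) =
      ((q powi a * t powi b) * (q powi c * t powi d) * (br (- a) (- b) * br (- c) (- d))) /
      ((q powi e * t powi f) * (q powi g * t powi h) * (br (- e) (- f) * br (- g) (- h)))"
    by (subst (1 2 3 4) br_flip) (simp add: mult_ac)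
  then show ?thesis unfolding * using nz by simp
qed

text \<open>The \<open>W\<close> functions are values of pair factors at the ratio q^m t^(-d), with
  column distance m and row distance d, divided by \<open>Delta\<close> for boxes in different rows.
  The suffixes gt (within a row) and lt (across rows) compare the entry of the earlier box with that
  of the later one; \<open>W_same\<close> and \<open>W_eq\<close> treat equal entries, within a row
  and across rows.\<close>

definition W_gt :: "int \<Rightarrow> complex" where
  "W_gt m = br (m + 1) 0 * br (m - 1) 1 / (br m 0 * br m 1)"

definition W_lt :: "int \<Rightarrow> int \<Rightarrow> complex" where
  "W_lt m d = br (m + 1) (- d - 1) * br (m - 1) (- d) * br m (1 - d) /
     (br m (- d - 1) * br (m + 1) (- d) * br (m - 1) (1 - d))"

definition W_same :: "nat \<Rightarrow> int \<Rightarrow> complex" where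
  "W_same col m = (if col = 1 then br (m - 1) 0 * br (m + 1) 0 / (br m 1 * br m (- 1))
     else if col = 2 then br (m + 1) (- 1) * br (m - 1) 1 / (br m 1 * br m (- 1)) else 1)"

definition W_eq :: "nat \<Rightarrow> int \<Rightarrow> int \<Rightarrow> complex" where
  "W_eq col m d = (if col = 1 then br (m - 1) (- d) * br m (- d) / (br m (- d - 1) * br (m - 1) (1 - d))
     else if col = 2 then br (m + 1) (- d - 1) * br m (- d) / (br m (- d - 1) * br (m + 1) (- d))
     else br m (- d) * br m (1 - d) / (br (m + 1) (- d) * br (m - 1) (1 - d)))"

text \<open>The product of the pair weights of the box \<open>(i, J)\<close> of \<open>nu / mu\<close> with the boxes to its left
  and the boxes in lower rows (up to row \<open>n\<close>), all boxes of \<open>nu / mu\<close> having the same entry.\<close>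

definition strip_weight :: "nat \<Rightarrow> nat \<Rightarrow> (nat \<Rightarrow> nat) \<Rightarrow> (nat \<Rightarrow> nat) \<Rightarrow> nat \<Rightarrow> nat \<Rightarrow> complex" where
  "strip_weight col n nu mu i J =
     (\<Prod>c=1..mu i. W_gt (int J - int c)) * (\<Prod>c=Suc (mu i)..<J. W_same col (int J - int c)) *
     (\<Prod>j=Suc i..n. (\<Prod>c=1..mu j. W_lt (int c - int J) (int j - int i)) *
        (\<Prod>c=Suc (mu j)..nu j. W_eq col (int c - int J) (int j - int i)))"

text \<open>A multiplicative primitive of \<open>W_lt\<close> in the column: for p < 0 the quotient
  of its values at p + 1 and p is \<open>W_lt\<close> at p + 1. Its value at the left end telescopes
  once more over the rows, see \<open>prod_gfac\<close>.\<close>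

definition gfac :: "int \<Rightarrow> int \<Rightarrow> complex" where
  "gfac p d = br (p + 1) (- d - 1) * br p (1 - d) / (br p (- d) * br (p + 1) (- d))"

lemma W_lt_step:
  assumes "d \<ge> 1" "p < 0"
  shows "gfac p d * W_lt (p + 1) d = gfac (p + 1) d"
  using assms unfolding gfac_def W_lt_def by (simp add: divide_simps)

lemma prod_W_lt:
  assumes "d \<ge> 1" "k < J"
  shows "(\<Prod>c=1..k. W_lt (int c - int J) d) = gfac (int k - int J) d / gfac (- int J) d"
  using assms(2)
proof (induction k)
  case 0
  then have "gfac (- int J) d \<noteq> 0" using assms by (simp add: gfac_def)
  then show ?case by simp
next
  case (Suc k)
  have "(\<Prod>c=1..Suc k. W_lt (int c - int J) d) = gfac (int k - int J) d / gfac (- int J) d * W_lt (int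
      (Suc k) - int J) d"
    using Suc by simp
  also have "\<dots> = gfac (int k - int J) d * W_lt (int k - int J + 1) d / gfac (- int J) d"
    by (simp add: algebra_simps)
  also have "\<dots> = gfac (int k - int J + 1) d / gfac (- int J) d"
    using assms Suc by (subst W_lt_step) auto
  finally show ?case by (simp add: algebra_simps)
qed

lemma prod_gfac:
  assumes "J \<ge> 1"
  shows "(\<Prod>d=1..D. gfac (- int J) (int d)) =
    br (1 - int J) (- int D - 1) * br (- int J) 0 / (br (1 - int J) (- 1) * br (- int J) (- int D))"
proof (induction D)
  case 0
  then show ?case using assms by simp
next
  case (Suc D)
  have "(\<Prod>d=1..Suc D. gfac (- int J) (int d)) =
      br (1 - int J) (- int D - 1) * br (- int J) 0 / (br (1 - int J) (- 1) * br (- int J) (- int D)) *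
      (br (1 - int J) (- int D - 2) * br (- int J) (- int D) / (br (- int J) (- int D - 1) * br (1 - int
          J) (- int D - 1)))"
  proof -
    have e: "- int J + 1 = 1 - int J" "- int D - 1 - 1 = - int D - 2" "1 - int (Suc D) = - int D"
      "- int (Suc D) = - int D - 1" by simp_all
    have "gfac (- int J) (int (Suc D)) = br (1 - int J) (- int D - 2) * br (- int J) (- int D) /
        (br (- int J) (- int D - 1) * br (1 - int J) (- int D - 1))"
      unfolding gfac_def e ..
    then show ?thesis using Suc by (simp only: prod.nat_ivl_Suc' le_add1 plus_1_eq_Suc)
        (simp add: mult.commute)
  qed
  also have "\<dots> = br (1 - int J) (- int D - 2) * br (- int J) 0 / (br (1 - int J) (- 1) * br (- int J) (-
      int D - 1))"
    using assms by (simp add: divide_simps)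
  moreover have "- int D - 2 = - int (Suc D) - 1" "- int D - 1 = - int (Suc D)" by simp_all
  ultimately show ?case by (simp only:)
qed

lemma prod_W_gt:
  assumes "k < J"
  shows "(\<Prod>c=1..k. W_gt (int J - int c)) =
    br (int J) 0 * br (int J - int k - 1) 1 / (br (int J - int k) 0 * br (int J - 1) 1)"
  using assms
proof (induction k)
  case 0
  then show ?case by simp
next
  case (Suc k)
  define m where "m = int J - int k"
  have m: "m > 1" using Suc by (simp add: m_def)
  have "(\<Prod>c=1..Suc k. W_gt (int J - int c)) =
      br (int J) 0 * br (m - 1) 1 / (br m 0 * br (int J - 1) 1) * (br m 0 * br (m - 2) 1 / (br (m - 1) 0
          * br (m - 1) 1))"
    using Suc by (simp add: W_gt_def m_def algebra_simps)
  also have "\<dots> = br (int J) 0 * br (m - 2) 1 / (br (m - 1) 0 * br (int J - 1) 1)"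
    using m Suc.prems by (simp add: divide_simps)
  finally show ?case by (simp add: m_def algebra_simps)
qed

text \<open>One step of \<open>f_ratio\<close> at u = t^d: the quotient of f at q^(s + 1) u by f at
  q^s u.\<close>

definition ffac :: "int \<Rightarrow> int \<Rightarrow> complex" where
  "ffac s d = br (s + 1) d / br s (d + 1)"

text \<open>Combines the boxes with larger entries to the left with the left ends that all lower
  rows leave when \<open>prod_W_lt\<close> telescopes. What remains are two steps of f: one for the
  row of the box itself and one for the empty row below the last.\<close>

lemma first_row_weight:
  assumes "k < J"
  shows "(\<Prod>c=1..k. W_gt (int J - int c)) / (\<Prod>d=1..D. gfac (- int J) (int d)) =
    1 / ffac (int J - 1 - int k) 0 * ffac (int J - 1) (int D)"
proof -
  have J: "J \<ge> 1" using assms by simp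
  have "(\<Prod>c=1..k. W_gt (int J - int c)) / (\<Prod>d=1..D. gfac (- int J) (int d)) =
      br (int J - int k - 1) 1 / br (int J - int k) 0 *
      ((br (int J) 0 * br (1 - int J) (- 1)) * br (- int J) (- int D) / ((br (- int J) 0 * br (int J -
          1) 1) * br (1 - int J) (- int D - 1)))"
    unfolding prod_W_gt[OF assms] prod_gfac[OF J] by (simp add: mult_ac)
  also have "(br (int J) 0 * br (1 - int J) (- 1)) * br (- int J) (- int D) / ((br (- int J) 0 * br (int
      J - 1) 1) * br (1 - int J) (- int D - 1)) =
      br (int J) (int D) / br (int J - 1) (int D + 1)"
  proof -
    have 1: "br (int J) 0 * br (1 - int J) (- 1) = q powi 1 * t powi (- 1) * (br (- int J) 0 * br (int J
        - 1) 1)"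
      using q_nonzero t_nonzero
      by (subst br_flip[of "int J"], subst br_flip[of "1 - int J"])
        (simp add: power_int_add power_int_diff power_int_minus field_simps)
    have 2: "br (- int J) (- int D) = - (q powi (- int J) * t powi (- int D)) * br (int J) (int D)"
      by (subst br_flip) simp
    have 3: "br (1 - int J) (- int D - 1) = - (q powi (1 - int J) * t powi (- int D - 1)) * br (int J -
        1) (int D + 1)"
      by (subst br_flip) (simp add: algebra_simps)
    have nz: "br (- int J) 0 * br (int J - 1) 1 \<noteq> 0" using J by simp
    have c: "q powi 1 * t powi (- 1) * (q powi (- int J) * t powi (- int D)) = q powi (1 - int J) * t
        powi (- int D - 1)"
      using q_nonzero t_nonzero by (simp add: power_int_add power_int_diff power_int_minus field_simps)
    have nz': "q powi (1 - int J) * t powi (- int D - 1) \<noteq> 0" using q_nonzero t_nonzero by simp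
    define X where "X = br (- int J) 0 * br (int J - 1) 1"
    have "(br (int J) 0 * br (1 - int J) (- 1)) * br (- int J) (- int D) =
        - (q powi 1 * t powi (- 1) * (q powi (- int J) * t powi (- int D))) * (X * br (int J) (int D))"
      unfolding 1 2 X_def by (simp add: mult_ac)
    then have eq: "(br (int J) 0 * br (1 - int J) (- 1)) * br (- int J) (- int D) =
        - (q powi (1 - int J) * t powi (- int D - 1)) * (X * br (int J) (int D))" unfolding c .
    have "(br (- int J) 0 * br (int J - 1) 1) * br (1 - int J) (- int D - 1) =
        - (q powi (1 - int J) * t powi (- int D - 1)) * (X * br (int J - 1) (int D + 1))"
      unfolding 3 X_def by (simp add: mult_ac)
    then show ?thesis unfolding eq using nz nz' q_nonzero by (simp add: X_def)
  qed
  finally show ?thesis by (simp add: ffac_def algebra_simps)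
qed

lemma f_ratio_up:
  assumes "m \<le> (k::nat)"
  shows "f_ratio q t (t ^ d) (int k - x) (int m - x) = (\<Prod>J=Suc m..k. ffac (int J - 1 - x) (int d))"
proof -
  have "f_ratio q t (t ^ d) (int k - x) (int m - x) = (\<Prod>i<k - m. ffac (int m - x + int i) (int d))"
    using assms q_nonzero t_nonzero unfolding f_ratio_def
    by (auto intro!: prod.cong arg_cong2[where f = "(/)"] simp: ffac_def br_def power_int_add mult_ac
        nat_diff_distrib
        simp flip: of_nat_diff)
  also have "\<dots> = (\<Prod>J=Suc m..k. ffac (int J - 1 - x) (int d))"
    by (rule prod.reindex_bij_witness[where j = "\<lambda>i. Suc (m + i)" and i = "\<lambda>J. J - Suc m"])
      (use assms in \<open>auto simp: algebra_simps\<close>)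
  finally show ?thesis .
qed

lemma f_ratio_down:
  assumes "m \<le> (k::nat)"
  shows "f_ratio q t (t ^ d) (int m - x) (int k - x) = (\<Prod>J=Suc m..k. 1 / ffac (int J - 1 - x) (int d))"
proof (cases "m = k")
  case True
  then show ?thesis by (simp add: f_ratio_def)
next
  case False
  then have "f_ratio q t (t ^ d) (int m - x) (int k - x) = inverse (f_ratio q t (t ^ d) (int k - x) (int
      m - x))"
    using assms by (simp add: f_ratio_def)
  then show ?thesis unfolding f_ratio_up[OF assms] by (simp add: prod_inversef[symmetric] divide_inverse)
qed

text \<open>In the products of f, row j + 1 is paired with row j. Shifting the index pairs
  quantities of the same row, as in \<open>strip_weight\<close>, and splits off the two
  ends.\<close>

lemma prod_shift_quotient:
  fixes A B :: "nat \<Rightarrow> complex"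
  assumes "i \<le> n"
  shows "(\<Prod>j=i..n. A (Suc j) / B j) = A (Suc n) / B i * (\<Prod>j=Suc i..n. A j / B j)"
  using assms by (induction n rule: dec_induct) simp_all

lemma pairs_prod:
  fixes F :: "nat \<Rightarrow> nat \<Rightarrow> complex"
  assumes "l \<le> n" "\<And>i j. 1 \<le> i \<Longrightarrow> i \<le> j \<Longrightarrow> l < j \<Longrightarrow> j \<le> n \<Longrightarrow> F i j = 1"
  shows "(\<Prod>(i, j)\<in>{(i, j). 1 \<le> i \<and> i \<le> j \<and> j \<le> l}. F i j) = (\<Prod>i=1..n. \<Prod>j=i..n. F i j)"
proof -
  have "(\<Prod>(i, j)\<in>{(i, j). 1 \<le> i \<and> i \<le> j \<and> j \<le> l}. F i j) = (\<Prod>(i, j)\<in>(SIGMA i:{1..n}. {i..n}). F i j)"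
  proof (rule prod.mono_neutral_left)
    show "\<forall>x\<in>(SIGMA i:{1..n}. {i..n}) - {(i, j). 1 \<le> i \<and> i \<le> j \<and> j \<le> l}. (case x of (i, j) \<Rightarrow> F i j) = 1"
    proof
      fix x assume "x \<in> (SIGMA i:{1..n}. {i..n}) - {(i, j). 1 \<le> i \<and> i \<le> j \<and> j \<le> l}"
      moreover obtain i j where x: "x = (i, j)" by (cases x)
      ultimately have "1 \<le> i" "i \<le> j" "j \<le> n" "\<not> j \<le> l" by auto
      then show "(case x of (i, j) \<Rightarrow> F i j) = 1" using assms(2)[of i j] x by simp
    qed
  qed (use assms(1) in auto)
  then show ?thesis by (simp add: prod.Sigma)
qed

end

section \<open>Ordinary and hyper strips\<close>

locale skew = generic_qt +
  fixes nu mu :: "nat \<Rightarrow> nat" and n :: nat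
  assumes nu: "is_partition nu" and mu: "is_partition mu" and sub: "\<And>i. mu i \<le> nu i" and n: "plength nu \<le> n"
begin

lemma nu_0: "n < j \<Longrightarrow> nu j = 0"
  using plength_pos[OF nu, of j] n by (cases "j = 0") auto

lemma plength_mu: "plength mu \<le> n"
proof (rule ccontr)
  assume "\<not> plength mu \<le> n"
  then have "nu (plength mu) = 0" "0 < mu (plength mu)" using nu_0 plength_pos[OF mu, of "plength mu"] by auto
  then show False using sub[of "plength mu"] by simp
qed

lemma mu_0: "1 \<le> j \<Longrightarrow> plength mu < j \<Longrightarrow> mu j = 0"
  using plength_pos[OF mu, of j] by auto

lemma nu_mono: "1 \<le> i \<Longrightarrow> i \<le> j \<Longrightarrow> nu j \<le> nu i"
  by (rule partition_decreasing[OF nu])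

lemma mu_mono: "1 \<le> i \<Longrightarrow> i \<le> j \<Longrightarrow> mu j \<le> mu i"
  by (rule partition_decreasing[OF mu])

text \<open>Along each lower row the weights \<open>W_lt\<close> telescope. The left ends are
  collected by \<open>first_row_weight\<close>; the right end, together with the boxes of equal
  entry in that row, gives h j.\<close>

lemma strip_weight_rows:
  assumes i: "i \<in> {1..n}" and J: "mu i < J"
    and lower: "\<And>j. j \<in> {Suc i..n} \<Longrightarrow>
      gfac (int (mu j) - int J) (int j - int i) * (\<Prod>c=Suc (mu j)..nu j. W_eq col (int c - int J) (int j
          - int i)) = h j"
  shows "strip_weight col n nu mu i J = (\<Prod>c=Suc (mu i)..<J. W_same col (int J - int c)) *
    (1 / ffac (int J - 1 - int (mu i)) 0 * ffac (int J - 1) (int (n - i)) * (\<Prod>j=Suc i..n. h j))"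
proof -
  have "(\<Prod>j=Suc i..n. (\<Prod>c=1..mu j. W_lt (int c - int J) (int j - int i)) *
        (\<Prod>c=Suc (mu j)..nu j. W_eq col (int c - int J) (int j - int i))) =
      (\<Prod>j=Suc i..n. h j / gfac (- int J) (int j - int i))"
  proof (intro prod.cong refl)
    fix j assume j: "j \<in> {Suc i..n}"
    have "mu j < J" using mu_mono[of i j] i j J by auto
    then have "(\<Prod>c=1..mu j. W_lt (int c - int J) (int j - int i)) =
        gfac (int (mu j) - int J) (int j - int i) / gfac (- int J) (int j - int i)"
      using j by (intro prod_W_lt) auto
    then show "(\<Prod>c=1..mu j. W_lt (int c - int J) (int j - int i)) *
        (\<Prod>c=Suc (mu j)..nu j. W_eq col (int c - int J) (int j - int i)) = h j / gfac (- int J) (int j - int i)"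
      unfolding lower[OF j, symmetric] by simp
  qed
  also have "\<dots> = (\<Prod>j=Suc i..n. h j) / (\<Prod>j=Suc i..n. gfac (- int J) (int j - int i))"
    by (rule prod_dividef)
  also have "(\<Prod>j=Suc i..n. gfac (- int J) (int j - int i)) = (\<Prod>d=1..n-i. gfac (- int J) (int d))"
    by (rule prod.reindex_bij_witness[where j = "\<lambda>j. j - i" and i = "\<lambda>d. d + i"]) (auto simp: of_nat_diff)
  finally show ?thesis
    unfolding strip_weight_def first_row_weight[OF J, symmetric] by simp
qed

text \<open>The hypothesis makes nu / mu a horizontal strip. Its boxes in lower rows then lie
  strictly to the left of column J, where the weights \<open>W_eq\<close> 3 telescope without
  vanishing denominators; within the row of the box the weights are 1.\<close>

lemma ordinary_strip:
  assumes strip: "\<And>i. 1 \<le> i \<Longrightarrow> nu (Suc i) \<le> mu i"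
  shows "psi_skew q t nu mu = (\<Prod>i=1..n. \<Prod>J=Suc (mu i)..nu i. strip_weight 3 n nu mu i J)"
proof -
  let ?f = "\<lambda>i j. f_ratio q t (t ^ (j - i)) (int (mu i) - int (mu j)) (int (nu i) - int (mu j)) *
     f_ratio q t (t ^ (j - i)) (int (nu i) - int (nu (j + 1))) (int (mu i) - int (nu (j + 1)))"
  have f: "?f i j = (\<Prod>J=Suc (mu i)..nu i. ffac (int J - 1 - int (nu (Suc j))) (int (j - i)) / ffac (int
      J - 1 - int (mu j)) (int (j - i)))" for i j
    unfolding f_ratio_up[OF sub] f_ratio_down[OF sub] by (simp add: prod.distrib[symmetric])
  have "psi_skew q t nu mu = (\<Prod>i=1..n. \<Prod>j=i..n. ?f i j)"
    unfolding psi_skew_def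
  proof (rule pairs_prod[OF plength_mu])
    fix i j assume ij: "1 \<le> i" "i \<le> j" "plength mu < j"
    have m: "mu j = 0" using mu_0 ij by simp
    moreover have "nu (Suc j) = 0" using strip[of j] m ij by simp
    ultimately show "?f i j = 1"
      unfolding f by (intro prod.neutral) (auto simp: ffac_def)
  qed
  also have "\<dots> = (\<Prod>i=1..n. \<Prod>J=Suc (mu i)..nu i. strip_weight 3 n nu mu i J)"
    unfolding f
  proof (rule prod.cong[OF refl])
    fix i assume i: "i \<in> {1..n}"
    have box: "(\<Prod>j=i..n. ffac (int J - 1 - int (nu (Suc j))) (int (j - i)) / ffac (int J - 1 - int (mu
        j)) (int (j - i))) =
        strip_weight 3 n nu mu i J" if J: "J \<in> {Suc (mu i)..nu i}" for J
    proof -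
      let ?h = "\<lambda>j. ffac (int J - 1 - int (nu j)) (int (j - 1 - i)) / ffac (int J - 1 - int (mu j)) (int
          (j - i))"
      have "(\<Prod>j=i..n. ffac (int J - 1 - int (nu (Suc j))) (int (j - i)) / ffac (int J - 1 - int (mu j))
          (int (j - i))) =
          ffac (int J - 1 - int (nu (Suc n))) (int (n - i)) / ffac (int J - 1 - int (mu i)) (int (i -
              i)) * (\<Prod>j=Suc i..n. ?h j)"
        using prod_shift_quotient[of i n "\<lambda>j. ffac (int J - 1 - int (nu j)) (int (j - 1 - i))" "\<lambda>j. ffac
            (int J - 1 - int (mu j)) (int (j - i))"] i
        by simp
      also have "\<dots> = (\<Prod>c=Suc (mu i)..<J. W_same 3 (int J - int c)) *
          (1 / ffac (int J - 1 - int (mu i)) 0 * ffac (int J - 1) (int (n - i)) * (\<Prod>j=Suc i..n. ?h j))"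
        using nu_0[of "Suc n"] by (simp add: W_same_def)
      also have "\<dots> = strip_weight 3 n nu mu i J"
      proof (rule strip_weight_rows[OF i, symmetric])
        show "mu i < J" using J by simp
        fix j assume j: "j \<in> {Suc i..n}"
        define d where "d = int j - int i"
        define p l where "p = int (mu j) - int J" and "l = int (nu j) - int J"
        have d: "d \<ge> 1" using j by (simp add: d_def)
        have nuj: "nu j < J" using nu_mono[of "Suc i" j] strip[of i] i j J by auto
        have V: "(\<Prod>c=Suc (mu j)..k. W_eq 3 (int c - int J) d) =
            br (p + 1) (- d) * br (int k - int J) (1 - d) / (br (int k - int J + 1) (- d) * br p (1 - d))"
          if "mu j \<le> k" "k < J" for k
          using that
        proof (induction k rule: dec_induct)
          case base
          then show ?case using d by (simp add: p_def)
        next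
          case (step k)
          define m where "m = int k - int J"
          have m: "m < 0" using step by (simp add: m_def)
          have p0: "p < 0" using step by (simp add: p_def)
          have "(\<Prod>c=Suc (mu j)..Suc k. W_eq 3 (int c - int J) d) =
              br (p + 1) (- d) * br m (1 - d) / (br (m + 1) (- d) * br p (1 - d)) * W_eq 3 (m + 1) d"
            using step by (simp add: m_def algebra_simps)
          also have "\<dots> = br (p + 1) (- d) * br (m + 1) (1 - d) / (br (m + 2) (- d) * br p (1 - d))"
            using d m p0 unfolding W_eq_def by (simp add: divide_simps) (simp add: algebra_simps)
          finally show ?case by (simp add: m_def algebra_simps)
        qed
        have "gfac p d * (\<Prod>c=Suc (mu j)..nu j. W_eq 3 (int c - int J) d) =
            br l (1 - d) * br (p + 1) (- d - 1) / (br (l + 1) (- d) * br p (- d))"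
          using d nuj sub[of j] unfolding V[OF sub nuj] gfac_def l_def[symmetric]
          by (simp add: divide_simps p_def)
        \<comment> \<open>All exponents change sign, to reach those in \<open>ffac\<close>; this is
          allowed since they have equal sums in numerator and denominator.\<close>
        also have "\<dots> = br (- l) (d - 1) * br (- p - 1) (d + 1) / (br (- l - 1) d * br (- p) d)"
        proof -
          have e: "- (l + 1) = - l - 1" "- (p + 1) = - p - 1" "- (1 - d) = d - 1" "- (- d - 1) = d + 1"
              "- (- d) = d"
            by simp_all
          show ?thesis by (subst br_quotient_flip, simp, simp) (simp only: e)
        qed
        also have "\<dots> = ?h j"
          using j by (simp add: ffac_def d_def p_def l_def of_nat_diff algebra_simps)
        finally show "gfac (int (mu j) - int J) (int j - int i) * (\<Prod>c=Suc (mu j)..nu j. W_eq 3 (int c -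
            int J) (int j - int i)) = ?h j"
          by (simp add: p_def d_def)
      qed
      finally show "(\<Prod>j=i..n. ffac (int J - 1 - int (nu (Suc j))) (int (j - i)) / ffac (int J - 1 - int
          (mu j)) (int (j - i))) =
          strip_weight 3 n nu mu i J" .
    qed
    show "(\<Prod>j=i..n. \<Prod>J=Suc (mu i)..nu i. ffac (int J - 1 - int (nu (Suc j))) (int (j - i)) / ffac (int J
        - 1 - int (mu j)) (int (j - i))) =
        (\<Prod>J=Suc (mu i)..nu i. strip_weight 3 n nu mu i J)"
      by (subst prod.swap) (intro prod.cong refl box)
  qed
  finally show ?thesis .
qed

text \<open>The share of one hyper entry in \<open>A2_weight\<close>, written box by box: the
  exponent counted there from the end of mu becomes J - 1 for the box in column J.\<close>

definition hyper_weight :: complex where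
  "hyper_weight = C_skew q t nu mu *
     (\<Prod>i=1..n. \<Prod>r=1..nu i - mu i - 1. br (int r + 1) (- 1) * br 0 1 / (br 1 (- 1) * br (int r) 1)) *
     (\<Prod>i=1..n. \<Prod>j=Suc i..n. \<Prod>J=Suc (mu i)..nu i.
        br (int J - 1 - int (nu j)) (int j - int i + 1) * br (int J - 1 - int (mu j)) (int j - int i) /
        (br (int J - 1 - int (nu j)) (int j - int i) * br (int J - 1 - int (mu j)) (int j - int i + 1)))"

text \<open>The strip is arbitrary: equal hyper entries may repeat in rows and columns, and the
  weights \<open>W_eq\<close> 2 telescope in every column, because their factors carry nonzero
  powers of t. Weights along the row give the middle product of \<open>hyper_weight\<close>; the
  last product corrects \<open>C_skew\<close>, which has mu where \<open>psi_skew\<close> has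
  nu.\<close>

lemma hyper_strip: "hyper_weight = (\<Prod>i=1..n. \<Prod>J=Suc (mu i)..nu i. strip_weight 2 n nu mu i J)"
proof -
  let ?f = "\<lambda>i j. f_ratio q t (t ^ (j - i)) (int (mu i) - int (mu j)) (int (nu i) - int (mu j)) *
     f_ratio q t (t ^ (j - i)) (int (nu i) - int (mu (j + 1))) (int (mu i) - int (mu (j + 1)))"
  let ?g = "\<lambda>i j J. br (int J - 1 - int (nu j)) (int j - int i + 1) * br (int J - 1 - int (mu j)) (int j
      - int i) /
        (br (int J - 1 - int (nu j)) (int j - int i) * br (int J - 1 - int (mu j)) (int j - int i + 1))"
  let ?s = "\<lambda>r. br (int r + 1) (- 1) * br 0 1 / (br 1 (- 1) * br (int r) 1)"
  have f: "?f i j = (\<Prod>J=Suc (mu i)..nu i. ffac (int J - 1 - int (mu (Suc j))) (int (j - i)) / ffac (int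
      J - 1 - int (mu j)) (int (j - i)))" for i j
    unfolding f_ratio_up[OF sub] f_ratio_down[OF sub] by (simp add: prod.distrib[symmetric])
  have "C_skew q t nu mu = (\<Prod>i=1..n. \<Prod>j=i..n. ?f i j)"
    unfolding C_skew_def
  proof (rule pairs_prod[OF plength_mu])
    fix i j assume ij: "1 \<le> i" "i \<le> j" "plength mu < j"
    have "mu j = 0" "mu (Suc j) = 0" using mu_0 ij by simp_all
    then show "?f i j = 1"
      unfolding f by (intro prod.neutral) (auto simp: ffac_def)
  qed
  then have C: "C_skew q t nu mu = (\<Prod>i=1..n. \<Prod>J=Suc (mu i)..nu i. \<Prod>j=i..n.
      ffac (int J - 1 - int (mu (Suc j))) (int (j - i)) / ffac (int J - 1 - int (mu j)) (int (j - i)))"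
    unfolding f by (subst prod.swap) simp
  have s: "(\<Prod>r=1..nu i - mu i - 1. ?s r) = (\<Prod>J=Suc (mu i)..nu i. ?s (J - mu i - 1))" for i
  proof -
    have "(\<Prod>r<nu i - mu i. ?s r) = (\<Prod>J=Suc (mu i)..nu i. ?s (J - mu i - 1))"
      by (rule prod.reindex_bij_witness[where j = "\<lambda>r. Suc (mu i + r)" and i = "\<lambda>J. J - mu i - 1"]) auto
    \<comment> \<open>The additional factor at r = 0 is 1; with it there is exactly one factor for
      each box of the row.\<close>
    moreover have "(\<Prod>r<nu i - mu i. ?s r) = (\<Prod>r=1..nu i - mu i - 1. ?s r)"
    proof (rule prod.mono_neutral_right)
      show "\<forall>r\<in>{..<nu i - mu i} - {1..nu i - mu i - 1}. ?s r = 1"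
      proof
        fix r assume "r \<in> {..<nu i - mu i} - {1..nu i - mu i - 1}"
        then have "r = 0" by auto
        then show "?s r = 1" by simp
      qed
    qed auto
    ultimately show ?thesis by simp
  qed
  have g: "(\<Prod>j=Suc i..n. \<Prod>J=Suc (mu i)..nu i. ?g i j J) = (\<Prod>J=Suc (mu i)..nu i. \<Prod>j=Suc i..n. ?g i j J)" for i
    by (rule prod.swap)
  have "hyper_weight = (\<Prod>i=1..n. \<Prod>J=Suc (mu i)..nu i. (\<Prod>j=i..n.
      ffac (int J - 1 - int (mu (Suc j))) (int (j - i)) / ffac (int J - 1 - int (mu j)) (int (j - i))) *
      ?s (J - mu i - 1) * (\<Prod>j=Suc i..n. ?g i j J))"
    unfolding hyper_weight_def C s g by (simp only: prod.distrib)
  also have "\<dots> = (\<Prod>i=1..n. \<Prod>J=Suc (mu i)..nu i. strip_weight 2 n nu mu i J)"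
  proof (intro prod.cong refl)
    fix i J assume i: "i \<in> {1..n}" and J: "J \<in> {Suc (mu i)..nu i}"
    let ?h = "\<lambda>j. ffac (int J - 1 - int (mu j)) (int (j - 1 - i)) / ffac (int J - 1 - int (mu j)) (int (j - i))"
    have same: "(\<Prod>c=J-r..<J. W_same 2 (int J - int c)) = ?s r" if "r < J" for r
      using that
    proof (induction r)
      case (Suc r)
      have "{J - Suc r..<J} = insert (J - Suc r) {J - r..<J}" using Suc by auto
      then have "(\<Prod>c=J-Suc r..<J. W_same 2 (int J - int c)) = W_same 2 (int (Suc r)) * ?s r"
        using Suc by (simp add: of_nat_diff)
      also have "\<dots> = ?s (Suc r)"
        unfolding W_same_def by (simp add: divide_simps add.commute)
      finally show ?case .
    qed simp
    have "J - (J - mu i - 1) = Suc (mu i)" using J by auto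
    then have same': "(\<Prod>c=Suc (mu i)..<J. W_same 2 (int J - int c)) = ?s (J - mu i - 1)"
      using same[of "J - mu i - 1"] J by simp
    have "(\<Prod>j=i..n. ffac (int J - 1 - int (mu (Suc j))) (int (j - i)) / ffac (int J - 1 - int (mu j))
        (int (j - i))) =
        ffac (int J - 1 - int (mu (Suc n))) (int (n - i)) / ffac (int J - 1 - int (mu i)) (int (i - i))
            * (\<Prod>j=Suc i..n. ?h j)"
      using prod_shift_quotient[of i n "\<lambda>j. ffac (int J - 1 - int (mu j)) (int (j - 1 - i))" "\<lambda>j. ffac
          (int J - 1 - int (mu j)) (int (j - i))"] i
      by simp
    moreover have "mu (Suc n) = 0" using mu_0[of "Suc n"] plength_mu by simp
    ultimately have "(\<Prod>j=i..n. ffac (int J - 1 - int (mu (Suc j))) (int (j - i)) / ffac (int J - 1 - int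
        (mu j)) (int (j - i))) *
      ?s (J - mu i - 1) * (\<Prod>j=Suc i..n. ?g i j J) = (\<Prod>c=Suc (mu i)..<J. W_same 2 (int J - int c)) *
        (1 / ffac (int J - 1 - int (mu i)) 0 * ffac (int J - 1) (int (n - i)) * (\<Prod>j=Suc i..n. ?h j * ?g i j J))"
    proof -
      assume E: "(\<Prod>j=i..n. ffac (int J - 1 - int (mu (Suc j))) (int (j - i)) / ffac (int J - 1 - int (mu
          j)) (int (j - i))) =
        ffac (int J - 1 - int (mu (Suc n))) (int (n - i)) / ffac (int J - 1 - int (mu i)) (int (i - i))
            * (\<Prod>j=Suc i..n. ?h j)"
        and "mu (Suc n) = 0"
      have pd: "(\<Prod>j=Suc i..n. ?h j * ?g i j J) = (\<Prod>j=Suc i..n. ?h j) * (\<Prod>j=Suc i..n. ?g i j J)"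
        by (rule prod.distrib)
      have "a / b * P * s * G = s * (1 / b * a * (P * G))" for a b P s G :: complex by simp
      from this[of "ffac (int J - 1) (int (n - i))" "ffac (int J - 1 - int (mu i)) 0"]
      show ?thesis
        unfolding same' pd E \<open>mu (Suc n) = 0\<close> diff_self_eq_0 of_nat_0 diff_0_right by (simp only:)
    qed
    also have "\<dots> = strip_weight 2 n nu mu i J"
    proof (rule strip_weight_rows[OF i, symmetric])
      show "mu i < J" using J by simp
      fix j assume j: "j \<in> {Suc i..n}"
      define d where "d = int j - int i"
      define p l where "p = int (mu j) - int J" and "l = int (nu j) - int J"
      have d: "d \<ge> 1" using j by (simp add: d_def)
      have muj: "mu j < J" using mu_mono[of i j] i j J by auto
      then have p: "p < 0" by (simp add: p_def)
      have V: "(\<Prod>c=Suc (mu j)..k. W_eq 2 (int c - int J) d) =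
          br (int k - int J + 1) (- d - 1) * br (p + 1) (- d) / (br (p + 1) (- d - 1) * br (int k - int
              J + 1) (- d))"
        if "mu j \<le> k" for k
        using that
      proof (induction k rule: dec_induct)
        case base
        then show ?case using d by (simp add: p_def)
      next
        case (step k)
        define m where "m = int k - int J + 1"
        have "(\<Prod>c=Suc (mu j)..Suc k. W_eq 2 (int c - int J) d) =
            br m (- d - 1) * br (p + 1) (- d) / (br (p + 1) (- d - 1) * br m (- d)) * W_eq 2 m d"
          using step by (simp add: m_def algebra_simps)
        also have "\<dots> = br (m + 1) (- d - 1) * br (p + 1) (- d) / (br (p + 1) (- d - 1) * br (m + 1) (- d))"
          using d unfolding W_eq_def by (simp add: divide_simps)
        finally show ?case by (simp add: m_def algebra_simps)
      qed
      have "gfac p d * (\<Prod>c=Suc (mu j)..nu j. W_eq 2 (int c - int J) d) =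
          br (l + 1) (- d - 1) * br p (1 - d) / (br p (- d) * br (l + 1) (- d))"
        using d unfolding V[OF sub] gfac_def l_def[symmetric] by (simp add: divide_simps)
      also have "\<dots> = br (- l - 1) (d + 1) * br (- p) (d - 1) / (br (- p) d * br (- l - 1) d)"
      proof -
        have e: "- (l + 1) = - l - 1" "- (1 - d) = d - 1" "- (- d - 1) = d + 1" "- (- d) = d"
          by simp_all
        show ?thesis by (subst br_quotient_flip, simp, simp) (simp only: e)
      qed
      \<comment> \<open>Multiplies and divides by terms in p so as to separate \<open>?h\<close>,
        which involves mu only, from the correction \<open>?g\<close>.\<close>
      also have "\<dots> = (br (- p) (d - 1) / br (- p - 1) d) / (br (- p) d / br (- p - 1) (d + 1)) *
          (br (- l - 1) (d + 1) * br (- p - 1) d / (br (- l - 1) d * br (- p - 1) (d + 1)))"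
        using d p by (simp add: divide_simps)
      also have "\<dots> = ?h j * ?g i j J"
        using j by (simp add: ffac_def d_def p_def l_def of_nat_diff algebra_simps)
      finally show "gfac (int (mu j) - int J) (int j - int i) * (\<Prod>c=Suc (mu j)..nu j. W_eq 2 (int c -
          int J) (int j - int i)) = ?h j * ?g i j J"
        by (simp add: p_def d_def)
    qed
    finally show "(\<Prod>j=i..n. ffac (int J - 1 - int (mu (Suc j))) (int (j - i)) / ffac (int J - 1 - int
        (mu j)) (int (j - i))) *
      ?s (J - mu i - 1) * (\<Prod>j=Suc i..n. ?g i j J) = strip_weight 2 n nu mu i J" .
  qed
  finally show ?thesis .
qed

end

section \<open>Transposed partitions and hook products\<close>

lemma ptranspose_iff:
  assumes part: "is_partition lam" and "1 \<le> i" "1 \<le> j"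
  shows "i \<le> ptranspose lam j \<longleftrightarrow> j \<le> lam i"
proof -
  define A where "A = {i. 1 \<le> i \<and> j \<le> lam i}"
  have sub: "A \<subseteq> {1..plength lam}"
  proof
    fix x assume "x \<in> A"
    then have x: "1 \<le> x" "j \<le> lam x" by (simp_all add: A_def)
    then have "0 < lam x" using assms(3) by linarith
    then show "x \<in> {1..plength lam}" using plength_pos[OF part x(1)] x(1) by simp
  qed
  have down: "i' \<in> A" if "x \<in> A" "1 \<le> i'" "i' \<le> x" for x i'
    using partition_decreasing[OF part that(2,3)] that(1,2) by (auto simp: A_def)
  have "A = {1..card A}"
  proof (cases "A = {}")
    case False
    have fin: "finite A" using finite_subset[OF sub] by simp
    have eq: "A = {1..Max A}"
    proof (intro set_eqI iffI)
      fix x assume "x \<in> A" then show "x \<in> {1..Max A}" using Max_ge[OF fin] by (auto simp: A_def)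
    next
      fix x assume "x \<in> {1..Max A}" then show "x \<in> A" using down[OF Max_in[OF fin False]] by auto
    qed
    have "card A = card {1..Max A}" using eq by (rule arg_cong)
    then have m: "card A = Max A" by simp
    show ?thesis unfolding m by (rule eq)
  qed simp
  then have "i \<in> A \<longleftrightarrow> i \<in> {1..card A}" by (rule eqset_imp_iff)
  then show ?thesis using assms(2) by (simp add: A_def ptranspose_def)
qed

text \<open>The value at the irrelevant index 0 is a convention: all i \<ge> 1 are counted, and an
  infinite set has cardinality 0.\<close>

lemma ptranspose_0: "is_partition lam \<Longrightarrow> ptranspose lam 0 = 0"
proof -
  have "infinite {i :: nat. 1 \<le> i}" by (simp add: atLeast_def[symmetric] infinite_Ici)
  then show ?thesis by (simp add: ptranspose_def)
qed

lemma is_partition_ptranspose: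
  assumes "is_partition lam" shows "is_partition (ptranspose lam)"
  unfolding is_partition_def
proof (intro conjI allI impI)
  fix j :: nat assume j: "1 \<le> j"
  show "ptranspose lam (Suc j) \<le> ptranspose lam j"
  proof (cases "ptranspose lam (Suc j) = 0")
    case False
    then have "Suc j \<le> lam (ptranspose lam (Suc j))"
      using ptranspose_iff[OF assms, of "ptranspose lam (Suc j)" "Suc j"] by simp
    then show ?thesis
      using False j by (subst ptranspose_iff[OF assms]) auto
  qed simp
next
  have "{j. 1 \<le> j \<and> 0 < ptranspose lam j} \<subseteq> {..lam 1}"
  proof
    fix j assume j: "j \<in> {j. 1 \<le> j \<and> 0 < ptranspose lam j}"
    then have "1 \<le> ptranspose lam j" by simp
    then show "j \<in> {..lam 1}" using ptranspose_iff[OF assms, of 1 j] j by simp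
  qed
  then show "finite {j. 1 \<le> j \<and> 0 < ptranspose lam j}" by (rule finite_subset) simp
qed

lemma ptranspose_ptranspose:
  assumes "is_partition lam" "1 \<le> i" shows "ptranspose (ptranspose lam) i = lam i"
proof -
  have *: "x \<le> ptranspose (ptranspose lam) i \<longleftrightarrow> x \<le> lam i" if "1 \<le> x" for x
    using ptranspose_iff[OF is_partition_ptranspose[OF assms(1)] that assms(2)] ptranspose_iff[OF
        assms(1) assms(2) that] by simp
  show ?thesis
  proof (rule order_antisym)
    show "ptranspose (ptranspose lam) i \<le> lam i"
      using *[of "ptranspose (ptranspose lam) i"] by (cases "ptranspose (ptranspose lam) i = 0") auto
    show "lam i \<le> ptranspose (ptranspose lam) i"
      using *[of "lam i"] by (cases "lam i = 0") auto
  qed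
qed

context generic_qt
begin

text \<open>Macdonald's \<open>b\<^sub>\<lambda>(s)\<close> at the box \<open>s = (i, c)\<close>.\<close>

definition bw :: "(nat \<Rightarrow> nat) \<Rightarrow> nat \<Rightarrow> nat \<Rightarrow> complex" where
  "bw lam i c = br (int (lam i) - int c) (int (ptranspose lam c) - int i + 1) /
     br (int (lam i) - int c + 1) (int (ptranspose lam c) - int i)"

lemma bw_nonzero:
  assumes "is_partition lam" "1 \<le> i" "1 \<le> c" "c \<le> lam i" shows "bw lam i c \<noteq> 0"
  using assms(4) ptranspose_iff[OF assms(1,2,3)] by (auto simp: bw_def)

definition hook_ratio :: "(nat \<Rightarrow> nat) \<Rightarrow> complex" where
  "hook_ratio lam = H_hook lam q (inverse t) / H_hook (ptranspose lam) (inverse t) q"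

text \<open>Reflection of the boxes exchanges arms and legs.\<close>

lemma H_hook_ptranspose:
  assumes part: "is_partition lam"
  shows "H_hook (ptranspose lam) a b = (\<Prod>s\<in>diagram lam. a ^ (leg lam s + 1) - b ^ arm lam s)"
  unfolding H_hook_def
  by (rule prod.reindex_bij_witness[where j = "\<lambda>(j, i). (i, j)" and i = "\<lambda>(i, j). (j, i)"])
    (auto simp: diagram_def arm_def leg_def ptranspose_iff[OF part] ptranspose_ptranspose[OF part])

text \<open>Every hook factor is, up to sign, a power of 1 / t times a value of \<open>br\<close>.
  The two powers differ by one, which leaves - t for each box.\<close>

lemma H_hook_ratio:
  assumes part: "is_partition lam" and n: "plength lam \<le> n"
  shows "hook_ratio lam = (\<Prod>i=1..n. \<Prod>c=1..lam i. - t / bw lam i c)"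
proof -
  have "hook_ratio lam =
      (\<Prod>b\<in>diagram lam. (q ^ (arm lam b + 1) - inverse t ^ leg lam b) / (inverse t ^ (leg lam b + 1) - q
          ^ arm lam b))"
    unfolding hook_ratio_def H_hook_ptranspose[OF part] by (simp add: H_hook_def prod_dividef)
  also have "\<dots> = (\<Prod>b\<in>diagram lam. - t / bw lam (fst b) (snd b))"
  proof (intro prod.cong refl)
    fix b assume "b \<in> diagram lam"
    then obtain i c where b: "b = (i, c)" "1 \<le> i" "1 \<le> c" "c \<le> lam i" by (auto simp: diagram_def)
    define A l where "A = lam i - c" and "l = ptranspose lam c - i"
    have "i \<le> ptranspose lam c" using ptranspose_iff[OF part b(2,3)] b(4) by simp
    then have w: "bw lam i c = br (int A) (int l + 1) / br (int A + 1) (int l)"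
      using b(4) by (simp add: bw_def A_def l_def of_nat_diff)
    have 1: "q ^ (A + 1) - inverse t ^ l = - (inverse t ^ l) * br (int A + 1) (int l)"
      using q_nonzero t_nonzero by (simp add: br_def power_int_add field_simps)
    have 2: "inverse t ^ (l + 1) - q ^ A = (inverse t * inverse t ^ l) * br (int A) (int l + 1)"
      using q_nonzero t_nonzero by (simp add: br_def power_int_add field_simps)
    have "- w * X / (inverse t * w * Y) = - t / (Y / X)" if "w \<noteq> 0" "X \<noteq> 0" "Y \<noteq> 0" for w X Y
      using that t_nonzero by (simp add: field_simps)
    from this[of "inverse t ^ l" "br (int A + 1) (int l)" "br (int A) (int l + 1)"]
    show "(q ^ (arm lam b + 1) - inverse t ^ leg lam b) / (inverse t ^ (leg lam b + 1) - q ^ arm lam b)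
        = - t / bw lam (fst b) (snd b)"
      unfolding b(1) arm_def leg_def fst_conv snd_conv A_def[symmetric] l_def[symmetric] w 1 2
      using t_nonzero by simp
  qed
  also have "\<dots> = (\<Prod>b\<in>(SIGMA i:{1..n}. {1..lam i}). - t / bw lam (fst b) (snd b))"
  proof (rule prod.cong[OF _ refl])
    show "diagram lam = (SIGMA i:{1..n}. {1..lam i})"
    proof (intro set_eqI iffI)
      fix b assume "b \<in> diagram lam" then show "b \<in> (SIGMA i:{1..n}. {1..lam i})"
        unfolding diagram_rows[OF part] using n by auto
    next
      fix b assume "b \<in> (SIGMA i:{1..n}. {1..lam i})" then show "b \<in> diagram lam"
        by (auto simp: diagram_def)
    qed
  qed
  finally show ?thesis by (simp add: prod.Sigma split_def)
qed

lemma hook_ratio_nonzero: "is_partition lam \<Longrightarrow> hook_ratio lam \<noteq> 0"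
  unfolding H_hook_ratio[OF _ order_refl] using bw_nonzero t_nonzero by auto

section \<open>Super strips, column by column\<close>

lemma prod_W_lt_column:
  assumes "x < 0"
  shows "(\<Prod>d=1..a. W_lt x (int d)) = br (x + 1) (- int a - 1) * br (x - 1) (- int a) * br x 0 * br x (- 1) /
     (br (x + 1) (- 1) * br (x - 1) 0 * br x (- int a) * br x (- int a - 1))"
proof (induction a)
  case 0
  then show ?case using assms by simp
next
  case (Suc a)
  define A where "A = - int a"
  have A: "A \<le> 0" by (simp add: A_def)
  have e: "A - 1 - 1 = A - 2" "- int (Suc a) = A - 1" "1 - int (Suc a) = A" by (simp_all add: A_def)
  have "(\<Prod>d=1..Suc a. W_lt x (int d)) = (\<Prod>d=1..a. W_lt x (int d)) * W_lt x (int (Suc a))" by simp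
  also have "\<dots> = br (x + 1) (A - 1) * br (x - 1) A * br x 0 * br x (- 1) /
     (br (x + 1) (- 1) * br (x - 1) 0 * br x A * br x (A - 1)) *
     (br (x + 1) (A - 2) * br (x - 1) (A - 1) * br x A / (br x (A - 2) * br (x + 1) (A - 1) * br (x - 1) A))"
  proof -
    have "W_lt x (int (Suc a)) =
        br (x + 1) (A - 2) * br (x - 1) (A - 1) * br x A / (br x (A - 2) * br (x + 1) (A - 1) * br (x - 1) A)"
      unfolding W_lt_def e ..
    then show ?thesis unfolding Suc A_def[symmetric] by (simp only:)
  qed
  also have "\<dots> = br (x + 1) (A - 2) * br (x - 1) (A - 1) * br x 0 * br x (- 1) /
     (br (x + 1) (- 1) * br (x - 1) 0 * br x (A - 1) * br x (A - 2))"
    using assms A by (simp add: divide_simps)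
  finally show ?case unfolding e .
qed

lemma prod_W_eq_column:
  assumes "x \<le> 0" "a \<le> l"
  shows "(\<Prod>d=Suc a..l. W_eq 1 x (int d)) = br x (- int a - 1) * br (x - 1) (- int l) /
     (br x (- int l - 1) * br (x - 1) (- int a))"
  using assms(2)
proof (induction l rule: dec_induct)
  case base
  then show ?case using assms by simp
next
  case (step l)
  define A where "A = - int l"
  have A: "A \<le> 0" by (simp add: A_def)
  have e: "A - 1 - 1 = A - 2" "- int (Suc l) = A - 1" "1 - int (Suc l) = A" by (simp_all add: A_def)
  have "(\<Prod>d=Suc a..Suc l. W_eq 1 x (int d)) = (\<Prod>d=Suc a..l. W_eq 1 x (int d)) * W_eq 1 x (int (Suc l))"
    using step by simp
  also have "W_eq 1 x (int (Suc l)) = br (x - 1) (A - 1) * br x (A - 1) / (br x (A - 2) * br (x - 1) A)"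
    unfolding W_eq_def e by simp
  also have "(\<Prod>d=Suc a..l. W_eq 1 x (int d)) * \<dots> = br x (- int a - 1) * br (x - 1) (A - 1) / (br x (A -
      2) * br (x - 1) (- int a))"
    unfolding step.IH A_def[symmetric] using assms A by (simp add: divide_simps)
  finally show ?case unfolding e .
qed

text \<open>The column at offset x to the left of a super box: \<open>W_gt\<close> is its box in the
  same row, followed below by a boxes with larger entries and then boxes with equal entry. The
  result will be the quotient of \<open>bw\<close> for mu by \<open>bw\<close> for nu.\<close>

lemma column_weight:
  assumes x: "x < 0" and al: "a \<le> l"
  shows "W_gt (- x) * ((\<Prod>d=1..a. W_lt x (int d)) * (\<Prod>d=Suc a..l. W_eq 1 x (int d))) =
    br (- x - 1) (int a + 1) * br (- x + 1) (int l) / (br (- x) (int a) * br (- x) (int l + 1))"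
proof -
  have "W_gt (- x) = br (x - 1) 0 * br (x + 1) (- 1) / (br x 0 * br x (- 1))"
  proof -
    have e: "- (- x + 1) = x - 1" "- (- x - 1) = x + 1" "- (- x) = x" "- (0 :: int) = 0" by simp_all
    show ?thesis unfolding W_gt_def by (subst br_quotient_flip, simp, simp) (simp only: e)
  qed
  then have "W_gt (- x) * ((\<Prod>d=1..a. W_lt x (int d)) * (\<Prod>d=Suc a..l. W_eq 1 x (int d))) =
      br (x + 1) (- int a - 1) * br (x - 1) (- int l) / (br x (- int a) * br x (- int l - 1))"
    unfolding prod_W_lt_column[OF x] prod_W_eq_column[OF less_imp_le[OF x] al]
    using x by (simp add: divide_simps)
  also have "\<dots> = br (- x - 1) (int a + 1) * br (- x + 1) (int l) / (br (- x) (int a) * br (- x) (int l + 1))"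
  proof -
    have e: "- (x + 1) = - x - 1" "- (x - 1) = - x + 1" "- (- int a - 1) = int a + 1" "- (- int l - 1) =
        int l + 1"
      "- (- int a) = int a" "- (- int l) = int l" by simp_all
    show ?thesis by (subst br_quotient_flip, simp, simp) (simp only: e)
  qed
  finally show ?thesis .
qed

text \<open>The column of the super box itself, at offset 0: the boxes of the strip below it all
  have the same entry.\<close>

lemma last_column_weight:
  "(\<Prod>d=1..l. W_eq 1 0 (int d)) = br 0 1 / br 1 0 * (br 1 (int l) / br 0 (int l + 1))"
proof -
  have "(\<Prod>d=1..l. W_eq 1 0 (int d)) = br 0 (- 1) * br (- 1) (- int l) / (br 0 (- int l - 1) * br (- 1) 0)"
    using prod_W_eq_column[of 0 0 l] by simp
  also have "\<dots> = br 0 1 * br 1 (int l) / (br 0 (int l + 1) * br 1 0)"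
  proof -
    have e: "- (0 :: int) = 0" "- (- 1 :: int) = 1" "- (- int l) = int l" "- (- int l - 1) = int l + 1"
        by simp_all
    show ?thesis by (subst br_quotient_flip, simp, simp) (simp only: e)
  qed
  finally show ?thesis by simp
qed

end

context skew
begin

abbreviation "nu' \<equiv> ptranspose nu"
abbreviation "mu' \<equiv> ptranspose mu"

lemma sub_transpose: "mu' c \<le> nu' c"
proof (cases "c = 0 \<or> mu' c = 0")
  case True
  then show ?thesis using ptranspose_0[OF mu] by auto
next
  case False
  then have "c \<le> mu (mu' c)" using ptranspose_iff[OF mu, of "mu' c" c] by simp
  then show ?thesis using ptranspose_iff[OF nu, of "mu' c" c] False sub[of "mu' c"] by simp
qed

lemma nu'_le: "1 \<le> c \<Longrightarrow> nu' c \<le> n"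
  using ptranspose_iff[OF nu, of "nu' c" c] nu_0[of "nu' c"] by (cases "nu' c = 0") (auto simp:
      not_less[symmetric])

text \<open>Grouping the lower boxes by columns instead of rows, every column to the left
  contributes a quotient of values of \<open>bw\<close>. The column of the box contributes the
  reciprocal of its own \<open>bw\<close> and a constant.\<close>

lemma super_box:
  assumes i: "i \<in> {1..n}" and J: "nu i = Suc (mu i)"
  shows "strip_weight 1 n nu mu i (nu i) =
    br 0 1 / br 1 0 * (\<Prod>c=1..mu i. bw mu i c / bw nu i c) / bw nu i (nu i)"
proof -
  define J where "J = nu i"
  have J': "J = Suc (mu i)" using J by (simp add: J_def)
  let ?L = "\<lambda>j c. W_lt (int c - int J) (int j - int i)" and ?E = "\<lambda>j c. W_eq 1 (int c - int J) (int j - int i)"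
  have i1: "1 \<le> i" using i by simp
  have L: "(\<Prod>j=Suc i..n. \<Prod>c=1..mu j. ?L j c) = (\<Prod>c=1..mu i. \<Prod>j=Suc i..mu' c. ?L j c)"
  proof -
    have "(\<Prod>j=Suc i..n. \<Prod>c=1..mu j. ?L j c) = (\<Prod>(j, c)\<in>(SIGMA j:{Suc i..n}. {1..mu j}). ?L j c)"
      by (simp add: prod.Sigma)
    also have "\<dots> = (\<Prod>(c, j)\<in>(SIGMA c:{1..mu i}. {Suc i..mu' c}). ?L j c)"
    proof (rule prod.reindex_bij_witness[where i = "\<lambda>(c, j). (j, c)" and j = "\<lambda>(j, c). (c, j)"])
      fix x assume x: "x \<in> (SIGMA j:{Suc i..n}. {1..mu j})"
      then show "(case x of (j, c) \<Rightarrow> (c, j)) \<in> (SIGMA c:{1..mu i}. {Suc i..mu' c})"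
        using mu_mono[OF i1, of "fst x"] ptranspose_iff[OF mu, of "fst x" "snd x"] by auto
    next
      fix x assume x: "x \<in> (SIGMA c:{1..mu i}. {Suc i..mu' c})"
      then show "(case x of (c, j) \<Rightarrow> (j, c)) \<in> (SIGMA j:{Suc i..n}. {1..mu j})"
        using ptranspose_iff[OF mu, of "snd x" "fst x"] sub_transpose[of "fst x"] nu'_le[of "fst x"] by auto
    qed auto
    finally show ?thesis by (simp add: prod.Sigma)
  qed
  have mJ: "mu' J < i" using ptranspose_iff[OF mu i1, of J] J' by auto
  have E: "(\<Prod>j=Suc i..n. \<Prod>c=Suc (mu j)..nu j. ?E j c) =
      (\<Prod>c=1..mu i. \<Prod>j=Suc (mu' c)..nu' c. ?E j c) * (\<Prod>j=Suc i..nu' J. ?E j J)"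
  proof -
    \<comment> \<open>In column J the partition mu ends above row i, so there the rows have to start
      just below the box and not just below mu.\<close>
    let ?S = "\<lambda>c. if c = J then {Suc i..nu' c} else {Suc (mu' c)..nu' c}"
    have "(\<Prod>j=Suc i..n. \<Prod>c=Suc (mu j)..nu j. ?E j c) = (\<Prod>(j, c)\<in>(SIGMA j:{Suc i..n}. {Suc (mu j)..nu
        j}). ?E j c)"
      by (simp add: prod.Sigma)
    also have "\<dots> = (\<Prod>(c, j)\<in>(SIGMA c:{1..J}. ?S c). ?E j c)"
    proof (rule prod.reindex_bij_witness[where i = "\<lambda>(c, j). (j, c)" and j = "\<lambda>(j, c). (c, j)"])
      fix x assume "x \<in> (SIGMA j:{Suc i..n}. {Suc (mu j)..nu j})"
      then obtain j c where x: "x = (j, c)" "Suc i \<le> j" "j \<le> n" "mu j < c" "c \<le> nu j" by auto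
      have "c \<le> J" using nu_mono[OF i1, of j] x by (simp add: J_def)
      moreover have "j \<le> nu' c" using ptranspose_iff[OF nu, of j c] x by simp
      moreover have "\<not> j \<le> mu' c" using ptranspose_iff[OF mu, of j c] x by simp
      ultimately show "(case x of (j, c) \<Rightarrow> (c, j)) \<in> (SIGMA c:{1..J}. ?S c)" using x by auto
    next
      fix x assume "x \<in> (SIGMA c:{1..J}. ?S c)"
      then obtain c j where x: "x = (c, j)" "1 \<le> c" "c \<le> J" "j \<in> ?S c" by auto
      have jc: "j \<le> nu' c" "\<not> j \<le> mu' c" "Suc i \<le> j"
      proof -
        show "j \<le> nu' c" using x by (auto split: if_splits)
        have "i \<le> mu' c" if "c \<noteq> J" using ptranspose_iff[OF mu i1 x(2)] that x(3) J' by simp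
        then show "Suc i \<le> j" using x(4) by (auto split: if_splits)
        then show "\<not> j \<le> mu' c" using x(4) mJ by (auto split: if_splits)
      qed
      then have "c \<le> nu j" "\<not> c \<le> mu j"
        using ptranspose_iff[OF nu, of j c] ptranspose_iff[OF mu, of j c] x(2) by auto
      then show "(case x of (c, j) \<Rightarrow> (j, c)) \<in> (SIGMA j:{Suc i..n}. {Suc (mu j)..nu j})"
        using x jc nu'_le[of c] by simp
    qed auto
    also have "\<dots> = (\<Prod>c=1..J. \<Prod>j\<in>?S c. ?E j c)" by (subst prod.Sigma) auto
    also have "\<dots> = (\<Prod>c=1..mu i. \<Prod>j\<in>?S c. ?E j c) * (\<Prod>j\<in>?S J. ?E j J)"
      unfolding J' by simp
    also have "(\<Prod>c=1..mu i. \<Prod>j\<in>?S c. ?E j c) = (\<Prod>c=1..mu i. \<Prod>j=Suc (mu' c)..nu' c. ?E j c)"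
      using J' by (intro prod.cong[OF refl]) auto
    finally show ?thesis by simp
  qed
  have col: "W_gt (int J - int c) * ((\<Prod>j=Suc i..mu' c. ?L j c) * (\<Prod>j=Suc (mu' c)..nu' c. ?E j c)) = bw
      mu i c / bw nu i c"
    if c: "c \<in> {1..mu i}" for c
  proof -
    define x where "x = int c - int J"
    have x: "x < 0" using c J' by (simp add: x_def)
    have ic: "i \<le> mu' c" using ptranspose_iff[OF mu i1, of c] c by simp
    have ic': "i \<le> nu' c" using ic sub_transpose[of c] by simp
    have 1: "(\<Prod>j=Suc i..mu' c. ?L j c) = (\<Prod>d=1..mu' c - i. W_lt x (int d))"
      by (rule prod.reindex_bij_witness[where j = "\<lambda>j. j - i" and i = "\<lambda>d. d + i"]) (auto simp:
          of_nat_diff x_def)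
    have 2: "(\<Prod>j=Suc (mu' c)..nu' c. ?E j c) = (\<Prod>d=Suc (mu' c - i)..nu' c - i. W_eq 1 x (int d))"
      by (rule prod.reindex_bij_witness[where j = "\<lambda>j. j - i" and i = "\<lambda>d. d + i"]) (use ic in \<open>auto
          simp: of_nat_diff x_def\<close>)
    have 3: "mu' c - i \<le> nu' c - i" using sub_transpose[of c] by simp
    have 4: "int J - int c = - x" by (simp add: x_def)
    have 5: "int (mu i) - int c = - x - 1" "int (mu i) - int c + 1 = - x" "int (nu i) - int c = - x"
        "int (nu i) - int c + 1 = - x + 1"
      using J' by (simp_all add: x_def flip: J_def)
    show ?thesis
      unfolding 1 2 4 column_weight[OF x 3] bw_def 5 using ic ic' by (simp add: of_nat_diff)
  qed
  have last: "(\<Prod>j=Suc i..nu' J. ?E j J) = br 0 1 / br 1 0 / bw nu i J"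
  proof -
    have "i \<le> nu' J" using ptranspose_iff[OF nu i1, of J] J' by (simp add: J_def)
    moreover have "(\<Prod>j=Suc i..nu' J. ?E j J) = (\<Prod>d=1..nu' J - i. W_eq 1 0 (int d))"
      by (rule prod.reindex_bij_witness[where j = "\<lambda>j. j - i" and i = "\<lambda>d. d + i"]) (auto simp: of_nat_diff)
    ultimately show ?thesis
      unfolding last_column_weight bw_def J_def[symmetric] by (simp add: of_nat_diff)
  qed
  have "strip_weight 1 n nu mu i J = (\<Prod>c=1..mu i. W_gt (int J - int c)) *
      ((\<Prod>j=Suc i..n. \<Prod>c=1..mu j. ?L j c) * (\<Prod>j=Suc i..n. \<Prod>c=Suc (mu j)..nu j. ?E j c))"
    unfolding strip_weight_def prod.distrib by (simp add: J')
  also have "\<dots> = (\<Prod>c=1..mu i. W_gt (int J - int c) * ((\<Prod>j=Suc i..mu' c. ?L j c) * (\<Prod>j=Suc (mu' c)..nu'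
      c. ?E j c))) *
      (br 0 1 / br 1 0 / bw nu i J)"
    unfolding L E last prod.distrib by (simp add: mult_ac)
  also have "(\<Prod>c=1..mu i. W_gt (int J - int c) * ((\<Prod>j=Suc i..mu' c. ?L j c) * (\<Prod>j=Suc (mu' c)..nu' c. ?E
      j c))) =
      (\<Prod>c=1..mu i. bw mu i c / bw nu i c)"
    by (intro prod.cong refl col)
  finally show ?thesis by (simp add: J_def)
qed

lemma swapped_generic: "generic_qt t q"
  using q_nonzero t_nonzero generic_powi by unfold_locales (auto simp: mult.commute)

text \<open>For swapped parameters and transposed partitions a step of f is \<open>B\<close>, and
  \<open>bw\<close> is a value of \<open>B\<close>. The row c lies above nu' (j + 1) and up to mu' j
  exactly if nu and mu both have length j there, so what remains are the rows without a box of the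
  strip.\<close>

lemma super_psi:
  assumes strip: "\<And>i. 1 \<le> i \<Longrightarrow> nu i \<le> Suc (mu i)"
  shows "psi_skew t q nu' mu' = (\<Prod>i=1..n. if nu i = mu i then (\<Prod>c=1..mu i. bw nu i c / bw mu i c) else 1)"
proof -
  interpret sw: generic_qt t q by (rule swapped_generic)
  define B where "B d s = br d (s + 1) / br (d + 1) s" for d s
  have ffac: "sw.ffac s d = B d s" for s d
    by (simp add: sw.ffac_def B_def br_def sw.br_def mult.commute)
  have B0: "B (int d) (int s) \<noteq> 0" for d s by (simp add: B_def)
  have tele: "(\<Prod>c=Suc m..k. B d (x - int c) / B d (x - 1 - int c)) = B d (x - 1 - int m) / B d (x - 1 - int k)"
    if "m \<le> k" and nz: "\<And>c. m \<le> c \<Longrightarrow> c \<le> k \<Longrightarrow> B d (x - 1 - int c) \<noteq> 0" for m k d x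
    using that
  proof (induction k rule: dec_induct)
    case (step k)
    then have "(\<Prod>c=Suc m..Suc k. B d (x - int c) / B d (x - 1 - int c)) =
        B d (x - 1 - int m) / B d (x - 1 - int k) * (B d (x - 1 - int k) / B d (x - 1 - int (Suc k)))"
      by (simp add: algebra_simps)
    then show ?case using step.prems[of k] step.hyps by simp
  qed simp
  have tele': "(\<Prod>s=Suc m..k. B d (int s - x) / B d (int s - 1 - x)) = B d (int k - x) / B d (int m - x)"
    if "m \<le> k" and nz: "\<And>s. m \<le> s \<Longrightarrow> s \<le> k \<Longrightarrow> B d (int s - x) \<noteq> 0" for m k d x
    using that
  proof (induction k rule: dec_induct)
    case (step k)
    then have "(\<Prod>s=Suc m..Suc k. B d (int s - x) / B d (int s - 1 - x)) =
        B d (int k - x) / B d (int m - x) * (B d (int (Suc k) - x) / B d (int k - x))"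
      by simp
    then show ?case using step.prems[of k] step.hyps by simp
  qed simp
  have row: "nu' (Suc j) \<le> mu' j" if "1 \<le> j" for j
  proof (cases "nu' (Suc j) = 0")
    case False
    then have "Suc j \<le> nu (nu' (Suc j))" using ptranspose_iff[OF nu, of "nu' (Suc j)" "Suc j"] by simp
    then have "j \<le> mu (nu' (Suc j))" using strip[of "nu' (Suc j)"] False by simp
    then show ?thesis using ptranspose_iff[OF mu, of "nu' (Suc j)" j] False that by simp
  qed simp
  have f: "f_ratio t q (q ^ (j - i)) (int (mu' i) - int (mu' j)) (int (nu' i) - int (mu' j)) *
     f_ratio t q (q ^ (j - i)) (int (nu' i) - int (nu' (j + 1))) (int (mu' i) - int (nu' (j + 1))) =
     (\<Prod>c=Suc (nu' (Suc j))..mu' j. bw nu c i / bw mu c i)" if ij: "1 \<le> i" "i \<le> j" for i j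
  proof -
    have mono: "mu' j \<le> mu' i" by (rule partition_decreasing[OF is_partition_ptranspose[OF mu] ij])
    have "f_ratio t q (q ^ (j - i)) (int (mu' i) - int (mu' j)) (int (nu' i) - int (mu' j)) *
       f_ratio t q (q ^ (j - i)) (int (nu' i) - int (nu' (j + 1))) (int (mu' i) - int (nu' (j + 1))) =
       (\<Prod>s=Suc (mu' i)..nu' i. B (int (j - i)) (int s - 1 - int (nu' (Suc j))) / B (int (j - i)) (int s
           - 1 - int (mu' j)))"
      unfolding sw.f_ratio_up[OF sub_transpose] sw.f_ratio_down[OF sub_transpose] ffac
      by (simp add: prod.distrib[symmetric])
    \<comment> \<open>The quotient of two distant values is interpolated by one factor for each row
      c. After exchanging the products, the product over s telescopes instead.\<close>
    also have "\<dots> = (\<Prod>s=Suc (mu' i)..nu' i. \<Prod>c=Suc (nu' (Suc j))..mu' j.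
        B (int (j - i)) (int s - int c) / B (int (j - i)) (int s - 1 - int c))"
    proof (rule prod.cong[OF refl])
      fix s assume s: "s \<in> {Suc (mu' i)..nu' i}"
      have "B (int (j - i)) (int s - 1 - int c) \<noteq> 0" if "c \<le> mu' j" for c
      proof -
        have e: "int s - 1 - int c = int (s - 1 - c)" using that s mono by auto
        show ?thesis unfolding e by (rule B0)
      qed
      then show "B (int (j - i)) (int s - 1 - int (nu' (Suc j))) / B (int (j - i)) (int s - 1 - int (mu' j)) =
          (\<Prod>c=Suc (nu' (Suc j))..mu' j. B (int (j - i)) (int s - int c) / B (int (j - i)) (int s - 1 - int c))"
        using row[of j] ij by (subst tele) auto
    qed
    also have "\<dots> = (\<Prod>c=Suc (nu' (Suc j))..mu' j. \<Prod>s=Suc (mu' i)..nu' i.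
        B (int (j - i)) (int s - int c) / B (int (j - i)) (int s - 1 - int c))"
      by (rule prod.swap)
    also have "\<dots> = (\<Prod>c=Suc (nu' (Suc j))..mu' j. bw nu c i / bw mu c i)"
    proof (rule prod.cong[OF refl])
      fix c assume c: "c \<in> {Suc (nu' (Suc j))..mu' j}"
      have "B (int (j - i)) (int s - int c) \<noteq> 0" if "mu' i \<le> s" for s
        using B0[of "j - i" "s - c"] that c mono by (simp add: of_nat_diff)
      then have "(\<Prod>s=Suc (mu' i)..nu' i. B (int (j - i)) (int s - int c) / B (int (j - i)) (int s - 1 -
          int c)) =
          B (int (j - i)) (int (nu' i) - int c) / B (int (j - i)) (int (mu' i) - int c)"
        using sub_transpose[of i] by (intro tele') auto
      moreover have "mu c = j" "nu c = j"
        using c ij ptranspose_iff[OF mu, of c j] ptranspose_iff[OF nu, of c "Suc j"] sub[of c] by auto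
      ultimately show "(\<Prod>s=Suc (mu' i)..nu' i. B (int (j - i)) (int s - int c) / B (int (j - i)) (int s
          - 1 - int c)) = bw nu c i / bw mu c i"
        using ij by (simp add: bw_def B_def of_nat_diff)
    qed
    finally show ?thesis .
  qed
  let ?P = "{(i, j). 1 \<le> i \<and> i \<le> j \<and> j \<le> plength mu'}"
  have finP: "finite ?P" by (rule finite_subset[of _ "{1..plength mu'} \<times> {1..plength mu'}"]) auto
  have "psi_skew t q nu' mu' = (\<Prod>(i, j)\<in>?P. \<Prod>c=Suc (nu' (Suc j))..mu' j. bw nu c i / bw mu c i)"
    unfolding psi_skew_def
  proof (rule prod.cong[OF refl])
    fix x assume "x \<in> ?P"
    moreover obtain i j where x: "x = (i, j)" by (cases x)
    ultimately have ij: "1 \<le> i" "i \<le> j" by auto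
    show "(case x of (i, j) \<Rightarrow> f_ratio t q (q ^ (j - i)) (int (mu' i) - int (mu' j)) (int (nu' i) - int
        (mu' j)) *
       f_ratio t q (q ^ (j - i)) (int (nu' i) - int (nu' (j + 1))) (int (mu' i) - int (nu' (j + 1)))) =
       (case x of (i, j) \<Rightarrow> \<Prod>c=Suc (nu' (Suc j))..mu' j. bw nu c i / bw mu c i)"
      unfolding x prod.case by (rule f[OF ij])
  qed
  also have "\<dots> = (\<Prod>(x, c)\<in>(SIGMA x:?P. {Suc (nu' (Suc (snd x)))..mu' (snd x)}). bw nu c (fst x) / bw mu
      c (fst x))"
    by (subst prod.Sigma[OF finP, symmetric]) (auto simp: split_def)
  also have "\<dots> = (\<Prod>(c, i)\<in>(SIGMA c:{1..n}. if nu c = mu c then {1..mu c} else {}). bw nu c i / bw mu c i)"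
  proof (rule prod.reindex_bij_witness[where j = "\<lambda>(x, c). (c, fst x)" and i = "\<lambda>(c, i). ((i, mu c), c)"])
    fix a assume "a \<in> (SIGMA x:?P. {Suc (nu' (Suc (snd x)))..mu' (snd x)})"
    then obtain i j c where a: "a = ((i, j), c)" and ij: "1 \<le> i" "i \<le> j" and c: "c \<in> {Suc (nu' (Suc
        j))..mu' j}" by auto
    have m: "mu c = j" "nu c = j"
      using c ij ptranspose_iff[OF mu, of c j] ptranspose_iff[OF nu, of c "Suc j"] sub[of c] by auto
    show "(case case a of (x, c) \<Rightarrow> (c, fst x) of (c, i) \<Rightarrow> ((i, mu c), c)) = a" by (simp add: a m)
    have "c \<le> n" using c sub_transpose[of j] nu'_le[of j] ij by simp
    then show "(case a of (x, c) \<Rightarrow> (c, fst x)) \<in> (SIGMA c:{1..n}. if nu c = mu c then {1..mu c} else {})"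
      using a m ij c by simp
  next
    fix b assume "b \<in> (SIGMA c:{1..n}. if nu c = mu c then {1..mu c} else {})"
    then obtain c i where b: "b = (c, i)" and c: "1 \<le> c" "c \<le> n" "nu c = mu c" "1 \<le> i" "i \<le> mu c"
      by (auto split: if_splits)
    have "c \<le> mu' (mu c)" using ptranspose_iff[OF mu, of c "mu c"] c by simp
    moreover have "\<not> c \<le> nu' (Suc (mu c))" using ptranspose_iff[OF nu, of c "Suc (mu c)"] c by simp
    moreover have "mu c \<le> plength mu'"
      using plength_pos[OF is_partition_ptranspose[OF mu], of "mu c"] \<open>c \<le> mu' (mu c)\<close> c by simp
    ultimately show "(case b of (c, i) \<Rightarrow> ((i, mu c), c)) \<in> (SIGMA x:?P. {Suc (nu' (Suc (snd x)))..mu' (snd x)})"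
      using b c by simp
  qed auto
  also have "\<dots> = (\<Prod>c=1..n. \<Prod>i\<in>(if nu c = mu c then {1..mu c} else {}). bw nu c i / bw mu c i)"
    by (subst prod.Sigma) auto
  also have "\<dots> = (\<Prod>i=1..n. if nu i = mu i then (\<Prod>c=1..mu i. bw nu i c / bw mu i c) else 1)"
    by (intro prod.cong refl) auto
  finally show ?thesis .
qed

text \<open>\<open>super_psi\<close> runs over the rows without a box of the strip, the pair weights
  over those with one. The quotient of hook products involves both: it cancels the former and yields
  the latter, and its constant - t per box is matched by (q - 1) / (1 / t - 1) and the constant in
  \<open>super_box\<close>.\<close>

lemma super_strip:
  assumes strip: "\<And>i. 1 \<le> i \<Longrightarrow> nu i \<le> Suc (mu i)"
  shows "psi_skew t q nu' mu' * (hook_ratio nu / hook_ratio mu) =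
    (\<Prod>i=1..n. \<Prod>J=Suc (mu i)..nu i. (q - 1) / (inverse t - 1) * strip_weight 1 n nu mu i J)"
proof -
  have kap: "(q - 1) / (inverse t - 1) = - t * (br 1 0 / br 0 1)"
  proof -
    have "1 - t \<noteq> 0" using br_eq_0_iff[of 0 1] by (simp add: br_def)
    then show ?thesis using t_nonzero by (simp add: br_def divide_simps) (simp add: algebra_simps)
  qed
  have row: "(if nu i = mu i then (\<Prod>c=1..mu i. bw nu i c / bw mu i c) else 1) *
      ((\<Prod>c=1..nu i. - t / bw nu i c) / (\<Prod>c=1..mu i. - t / bw mu i c)) =
      (\<Prod>J=Suc (mu i)..nu i. (q - 1) / (inverse t - 1) * strip_weight 1 n nu mu i J)" if i: "i \<in> {1..n}" for i
  proof -
    have nzm: "bw mu i c \<noteq> 0" "bw nu i c \<noteq> 0" if "c \<in> {1..mu i}" for c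
    proof -
      have c: "1 \<le> i" "1 \<le> c" "c \<le> mu i" "c \<le> nu i" using that i sub[of i] by auto
      show "bw mu i c \<noteq> 0" "bw nu i c \<noteq> 0"
        using bw_nonzero[OF mu c(1,2,3)] bw_nonzero[OF nu c(1,2,4)] by blast+
    qed
    have pm: "(\<Prod>c=1..mu i. - t / bw nu i c) / (\<Prod>c=1..mu i. - t / bw mu i c) = (\<Prod>c=1..mu i. bw mu i c /
        bw nu i c)"
      unfolding prod_dividef[symmetric] using t_nonzero nzm by (intro prod.cong) auto
    consider "nu i = mu i" | "nu i = Suc (mu i)" using strip[of i] sub[of i] i by force
    then show ?thesis
    proof cases
      case 1
      have "(\<Prod>c=1..mu i. bw nu i c / bw mu i c) * (\<Prod>c=1..mu i. bw mu i c / bw nu i c) = 1"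
        unfolding prod.distrib[symmetric] using nzm by (intro prod.neutral) auto
      then show ?thesis using 1 pm by simp
    next
      case 2
      have nz: "br 0 1 \<noteq> 0" "br 1 0 \<noteq> 0" by simp_all
      have "(\<Prod>c=1..nu i. - t / bw nu i c) / (\<Prod>c=1..mu i. - t / bw mu i c) =
          (\<Prod>c=1..mu i. bw mu i c / bw nu i c) * (- t / bw nu i (nu i))"
        unfolding pm[symmetric] 2 by simp
      moreover have "{Suc (mu i)..nu i} = {nu i}" using 2 by simp
      moreover have "(q - 1) / (inverse t - 1) * strip_weight 1 n nu mu i (nu i) =
          (\<Prod>c=1..mu i. bw mu i c / bw nu i c) * (- t / bw nu i (nu i))"
        unfolding kap super_box[OF i 2] using nz by simp
      ultimately show ?thesis using 2 by simp
    qed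
  qed
  have "psi_skew t q nu' mu' * (hook_ratio nu / hook_ratio mu) =
      (\<Prod>i=1..n. (if nu i = mu i then (\<Prod>c=1..mu i. bw nu i c / bw mu i c) else 1) *
      ((\<Prod>c=1..nu i. - t / bw nu i c) / (\<Prod>c=1..mu i. - t / bw mu i c)))"
  proof -
    have "psi_skew t q nu' mu' = (\<Prod>i=1..n. if nu i = mu i then (\<Prod>c=1..mu i. bw nu i c / bw mu i c) else 1)"
      by (rule super_psi[OF strip])
    moreover have "hook_ratio nu / hook_ratio mu =
        (\<Prod>i=1..n. (\<Prod>c=1..nu i. - t / bw nu i c) / (\<Prod>c=1..mu i. - t / bw mu i c))"
      unfolding H_hook_ratio[OF nu n] H_hook_ratio[OF mu plength_mu] by (rule prod_dividef[symmetric])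
    ultimately show ?thesis by (simp only: prod.distrib)
  qed
  also have "\<dots> = (\<Prod>i=1..n. \<Prod>J=Suc (mu i)..nu i. (q - 1) / (inverse t - 1) * strip_weight 1 n nu mu i J)"
    by (rule prod.cong[OF refl row])
  finally show ?thesis .
qed

end

section \<open>Weights of tritableaux\<close>

definition entry_colour :: "nat \<Rightarrow> nat \<Rightarrow> nat \<Rightarrow> nat" where
  "entry_colour N M j = (if j \<le> N then 3 else if j \<le> N + M then 1 else 2)"

lemma prod_Sigma:
  fixes g :: "'a \<times> 'b \<Rightarrow> complex"
  assumes "finite A" "\<And>x. x \<in> A \<Longrightarrow> finite (B x)"
  shows "(\<Prod>p\<in>Sigma A B. g p) = (\<Prod>x\<in>A. \<Prod>y\<in>B x. g (x, y))"
  using assms by (simp add: prod.Sigma)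

lemma prod_split_1:
  fixes g :: "nat \<Rightarrow> complex"
  assumes "a \<le> b"
  shows "(\<Prod>c=1..b. g c) = (\<Prod>c=1..a. g c) * (\<Prod>c=Suc a..b. g c)"
proof -
  have "{1..b} = {1..a} \<union> {Suc a..b}" using assms by auto
  then show ?thesis by (simp only:) (subst prod.union_disjoint; auto)
qed

text \<open>The coefficient of a current of colour c, stripped of the powers of q and t that come
  from the square roots; those rescale the variables of the polynomial.\<close>

definition (in generic_qt) box_factor :: "nat \<Rightarrow> complex" where
  "box_factor c = (if c = 1 then (q - 1) / (inverse t - 1)
     else if c = 2 then (t / q - 1) / (inverse t - 1) else 1)"

locale filling = generic_qt +
  fixes N M L :: nat and lam :: "nat \<Rightarrow> nat" and T :: "nat \<times> nat \<Rightarrow> nat"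
  assumes part: "is_partition lam" and T_PiE: "T \<in> diagram lam \<rightarrow>\<^sub>E {1..N+M+L}"
begin

abbreviation "col \<equiv> entry_colour N M"

text \<open>Within a row the case T b < T c receives the value for equal entries as a default; rows
  of a tritableau decrease weakly, so it does not arise there.\<close>

definition limit_weight :: "nat \<times> nat \<Rightarrow> nat \<times> nat \<Rightarrow> complex" where
  "limit_weight b c = (let m = int (snd c) - int (snd b); d = int (fst c) - int (fst b) in
     if fst b = fst c then (if T c < T b then W_gt m else W_same (col (T b)) m)
     else if T c < T b then 1 else if T b < T c then W_lt m d else W_eq (col (T b)) m d)"

lemma diagram_up: "(i, j) \<in> diagram lam \<Longrightarrow> 1 \<le> i' \<Longrightarrow> i' \<le> i \<Longrightarrow> (i', j) \<in> diagram lam"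
  using partition_decreasing[OF part, of i' i] by (auto simp: diagram_def)

end

section \<open>Tritableaux as chains of partitions\<close>

locale tritableau = filling +
  assumes T: "T \<in> RSSYTT N M L lam"
begin

abbreviation "n \<equiv> plength lam"
abbreviation "S \<equiv> sub_shape lam T"

lemma T_range: "b \<in> diagram lam \<Longrightarrow> T b \<in> {1..N+M+L}"
  using T_PiE by (rule PiE_mem)

lemma T_row: "(i, j) \<in> diagram lam \<Longrightarrow> (i, j') \<in> diagram lam \<Longrightarrow> j \<le> j' \<Longrightarrow> T (i, j') \<le> T (i, j)"
  using T unfolding RSSYTT_def by (cases "j = j'") auto

lemma T_column: "(i, j) \<in> diagram lam \<Longrightarrow> (i', j) \<in> diagram lam \<Longrightarrow> i \<le> i' \<Longrightarrow> T (i', j) \<le> T (i, j)"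
  using T unfolding RSSYTT_def by (cases "i = i'") auto

lemma T_ordinary: "(i, j) \<in> diagram lam \<Longrightarrow> (i', j) \<in> diagram lam \<Longrightarrow> i < i' \<Longrightarrow>
    T (i, j) \<in> {1..N} \<Longrightarrow> T (i', j) \<in> {1..N} \<Longrightarrow> T (i', j) < T (i, j)"
  using T unfolding RSSYTT_def by blast

lemma T_super: "(i, j) \<in> diagram lam \<Longrightarrow> (i, j') \<in> diagram lam \<Longrightarrow> j < j' \<Longrightarrow>
    T (i, j) \<in> {N+1..N+M} \<Longrightarrow> T (i, j') \<in> {N+1..N+M} \<Longrightarrow> T (i, j') < T (i, j)"
  using T unfolding RSSYTT_def by blast

text \<open>Rows decrease weakly, so the boxes with entries at least d form an initial segment of
  the row.\<close>

lemma sub_shape_set: "{j. (i, j) \<in> diagram lam \<and> d \<le> T (i, j)} = {1..S d i}"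
proof -
  define A where "A = {j. (i, j) \<in> diagram lam \<and> d \<le> T (i, j)}"
  have fin: "finite A" by (rule finite_subset[of _ "{..lam i}"]) (auto simp: A_def diagram_def)
  have down: "j' \<in> A" if "j \<in> A" "1 \<le> j'" "j' \<le> j" for j j'
    using that T_row[of i j' j] by (auto simp: A_def diagram_def)
  have "A = {1..card A}"
  proof (cases "A = {}")
    case False
    have eq: "A = {1..Max A}"
    proof (intro set_eqI iffI)
      fix x assume "x \<in> A" then show "x \<in> {1..Max A}" using Max_ge[OF fin] by (auto simp: A_def diagram_def)
    next
      fix x assume "x \<in> {1..Max A}" then show "x \<in> A" using down[OF Max_in[OF fin False]] by auto
    qed
    have "card A = card {1..Max A}" using eq by (rule arg_cong)
    then have m: "card A = Max A" by simp
    show ?thesis unfolding m by (rule eq)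
  qed simp
  then show ?thesis by (simp add: A_def sub_shape_def)
qed

lemma S_iff: "1 \<le> j \<Longrightarrow> j \<le> S d i \<longleftrightarrow> (i, j) \<in> diagram lam \<and> d \<le> T (i, j)"
  using eqset_imp_iff[OF sub_shape_set[of i d], of j] by auto

lemma S_le: "1 \<le> i \<Longrightarrow> S d i \<le> lam i"
  using S_iff[of "S d i" d i] by (cases "S d i = 0") (auto simp: diagram_def)

lemma S_mono: "d \<le> d' \<Longrightarrow> S d' i \<le> S d i"
  using S_iff[of "S d' i" d' i] S_iff[of "S d' i" d i] by (cases "S d' i = 0") auto

lemma S_top: "S (N + M + L + 1) i = 0"
  using S_iff[of "S (N + M + L + 1) i" "N + M + L + 1" i] T_range[of "(i, S (N + M + L + 1) i)"]
  by (cases "S (N + M + L + 1) i = 0") auto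

lemma T_eq_iff: "1 \<le> j \<Longrightarrow> (i, j) \<in> diagram lam \<and> T (i, j) = d \<longleftrightarrow> j \<in> {Suc (S (d + 1) i)..S d i}"
  using S_iff[of j d i] S_iff[of j "d + 1" i] by auto

lemma part_S: "is_partition (S d)"
  unfolding is_partition_def
proof (intro conjI allI impI)
  fix i :: nat assume i: "1 \<le> i"
  show "S d (Suc i) \<le> S d i"
  proof (cases "S d (Suc i) = 0")
    case False
    then have *: "(Suc i, S d (Suc i)) \<in> diagram lam" "d \<le> T (Suc i, S d (Suc i))"
      using S_iff[of "S d (Suc i)" d "Suc i"] by auto
    moreover have up: "(i, S d (Suc i)) \<in> diagram lam" using diagram_up[OF *(1) i] by simp
    ultimately have "d \<le> T (i, S d (Suc i))" using T_column[OF up *(1)] by simp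
    then show ?thesis using S_iff[of "S d (Suc i)" d i] up False by simp
  qed simp
next
  have "{i. 1 \<le> i \<and> 0 < S d i} \<subseteq> {i. 1 \<le> i \<and> 0 < lam i}"
    using S_le order_less_le_trans by blast
  moreover have "finite {i. 1 \<le> i \<and> 0 < lam i}" using part by (simp add: is_partition_def)
  ultimately show "finite {i. 1 \<le> i \<and> 0 < S d i}" by (rule finite_subset)
qed

lemma plength_S: "plength (S d) \<le> n"
proof (rule ccontr)
  assume *: "\<not> plength (S d) \<le> n"
  then have "1 \<le> plength (S d)" by simp
  then have "0 < S d (plength (S d))" using plength_pos[OF part_S] by blast
  then have "0 < lam (plength (S d))" using S_le[OF \<open>1 \<le> plength (S d)\<close>, of d] by simp
  then show False using plength_pos[OF part \<open>1 \<le> plength (S d)\<close>] * by blast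
qed

lemma skew_S: "skew q t (S d) (S (d + 1)) n"
  by unfold_locales (use part_S plength_S S_mono[of d "d + 1"] in auto)

text \<open>Otherwise the last box of row i + 1 in the shape for d and the box above it would both
  carry the ordinary entry d.\<close>

lemma ordinary_S: "d \<in> {1..N} \<Longrightarrow> 1 \<le> i \<Longrightarrow> S d (Suc i) \<le> S (d + 1) i"
proof (cases "S d (Suc i) = 0")
  case False
  assume d: "d \<in> {1..N}" and i: "1 \<le> i"
  define j where "j = S d (Suc i)"
  have j: "1 \<le> j" using False by (simp add: j_def)
  have *: "(Suc i, j) \<in> diagram lam" "d \<le> T (Suc i, j)"
    using S_iff[of j d "Suc i"] j by (auto simp: j_def)
  have up: "(i, j) \<in> diagram lam" using diagram_up[OF *(1) i] by simp
  have le: "T (Suc i, j) \<le> T (i, j)" using T_column[OF up *(1)] by simp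
  have "T (i, j) \<noteq> d"
  proof
    assume "T (i, j) = d"
    then have "T (Suc i, j) < T (i, j)" using T_ordinary[OF up *(1)] * le d by simp
    then show False using * \<open>T (i, j) = d\<close> by simp
  qed
  then have "d + 1 \<le> T (i, j)" using * le by simp
  then show ?thesis using S_iff[of j "d + 1" i] up j by (simp add: j_def)
qed simp

lemma super_S: "d \<in> {N+1..N+M} \<Longrightarrow> S d i \<le> Suc (S (d + 1) i)"
proof (rule ccontr)
  assume d: "d \<in> {N+1..N+M}" and "\<not> S d i \<le> Suc (S (d + 1) i)"
  define j where "j = Suc (S (d + 1) i)"
  have "j \<in> {Suc (S (d + 1) i)..S d i}" "Suc j \<in> {Suc (S (d + 1) i)..S d i}"
    using \<open>\<not> _\<close> by (auto simp: j_def)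
  then have "(i, j) \<in> diagram lam \<and> T (i, j) = d" "(i, Suc j) \<in> diagram lam \<and> T (i, Suc j) = d"
    using T_eq_iff[of j i d] T_eq_iff[of "Suc j" i d] by (simp_all add: j_def)
  then show False using T_super[of i j "Suc j"] d by auto
qed

text \<open>Each row falls into entries above d, equal to d and below d, with break points given by
  the shapes for d + 1 and d. To the left of the box only the first two kinds occur, and in lower
  rows the last kind contributes 1.\<close>

lemma box_weight:
  assumes b: "(i, J) \<in> diagram lam"
  shows "(\<Prod>c=1..<J. limit_weight (i, c) (i, J)) * (\<Prod>j=Suc i..n. \<Prod>c=1..lam j. limit_weight (i, J) (j, c)) =
    strip_weight (col (T (i, J))) n (S (T (i, J))) (S (T (i, J) + 1)) i J"
proof -
  define d where "d = T (i, J)"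
  have J: "1 \<le> J" using b by (simp add: diagram_def)
  have muJ: "S (d + 1) i < J" "J \<le> S d i" using T_eq_iff[OF J, of i d] b by (auto simp: d_def)
  have "(\<Prod>c=1..<J. limit_weight (i, c) (i, J)) =
      (\<Prod>c=1..<Suc (S (d + 1) i). limit_weight (i, c) (i, J)) * (\<Prod>c=Suc (S (d + 1) i)..<J. limit_weight
          (i, c) (i, J))"
    using muJ by (subst prod.atLeastLessThan_concat) auto
  also have "(\<Prod>c=1..<Suc (S (d + 1) i). limit_weight (i, c) (i, J)) = (\<Prod>c=1..S (d + 1) i. W_gt (int J - int c))"
    unfolding atLeastLessThanSuc_atLeastAtMost
  proof (rule prod.cong[OF refl])
    fix c assume "c \<in> {1..S (d + 1) i}"
    then have "d + 1 \<le> T (i, c)" using S_iff[of c "d + 1" i] by simp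
    then show "limit_weight (i, c) (i, J) = W_gt (int J - int c)"
      by (simp add: limit_weight_def flip: d_def)
  qed
  also have "(\<Prod>c=Suc (S (d + 1) i)..<J. limit_weight (i, c) (i, J)) = (\<Prod>c=Suc (S (d + 1) i)..<J. W_same
      (col d) (int J - int c))"
  proof (rule prod.cong[OF refl])
    fix c assume "c \<in> {Suc (S (d + 1) i)..<J}"
    then have "T (i, c) = d" using T_eq_iff[of c i d] muJ by auto
    then show "limit_weight (i, c) (i, J) = W_same (col d) (int J - int c)"
      by (simp add: limit_weight_def flip: d_def)
  qed
  finally have left: "(\<Prod>c=1..<J. limit_weight (i, c) (i, J)) = (\<Prod>c=1..S (d + 1) i. W_gt (int J - int c)) *
      (\<Prod>c=Suc (S (d + 1) i)..<J. W_same (col d) (int J - int c))" .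
  have right: "(\<Prod>c=1..lam j. limit_weight (i, J) (j, c)) = (\<Prod>c=1..S (d + 1) j. W_lt (int c - int J) (int
      j - int i)) *
        (\<Prod>c=Suc (S (d + 1) j)..S d j. W_eq (col d) (int c - int J) (int j - int i))" if j: "j \<in> {Suc
            i..n}" for j
  proof -
    have le: "S (d + 1) j \<le> S d j" "S d j \<le> lam j" using S_mono[of d "d + 1" j] S_le[of j d] j by auto
    have "(\<Prod>c=1..lam j. limit_weight (i, J) (j, c)) = (\<Prod>c=1..S (d + 1) j. limit_weight (i, J) (j, c)) *
        (\<Prod>c=Suc (S (d + 1) j)..S d j. limit_weight (i, J) (j, c)) * (\<Prod>c=Suc (S d j)..lam j. limit_weight
            (i, J) (j, c))"
      by (simp only: prod_split_1[OF le(1)] prod_split_1[OF le(2)])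
    also have "(\<Prod>c=Suc (S d j)..lam j. limit_weight (i, J) (j, c)) = 1"
    proof (rule prod.neutral, rule ballI)
      fix c assume c: "c \<in> {Suc (S d j)..lam j}"
      then have "(j, c) \<in> diagram lam" using j by (auto simp: diagram_def)
      then have "T (j, c) < d" using S_iff[of c d j] c by auto
      then show "limit_weight (i, J) (j, c) = 1" using j by (simp add: limit_weight_def flip: d_def)
    qed
    also have "(\<Prod>c=1..S (d + 1) j. limit_weight (i, J) (j, c)) = (\<Prod>c=1..S (d + 1) j. W_lt (int c - int
        J) (int j - int i))"
    proof (rule prod.cong[OF refl])
      fix c assume "c \<in> {1..S (d + 1) j}"
      then have "d + 1 \<le> T (j, c)" using S_iff[of c "d + 1" j] by simp
      then show "limit_weight (i, J) (j, c) = W_lt (int c - int J) (int j - int i)"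
        using j by (simp add: limit_weight_def flip: d_def)
    qed
    also have "(\<Prod>c=Suc (S (d + 1) j)..S d j. limit_weight (i, J) (j, c)) =
        (\<Prod>c=Suc (S (d + 1) j)..S d j. W_eq (col d) (int c - int J) (int j - int i))"
    proof (rule prod.cong[OF refl])
      fix c assume "c \<in> {Suc (S (d + 1) j)..S d j}"
      then have "T (j, c) = d" using T_eq_iff[of c j d] by auto
      then show "limit_weight (i, J) (j, c) = W_eq (col d) (int c - int J) (int j - int i)"
        using j by (simp add: limit_weight_def flip: d_def)
    qed
    finally show ?thesis by simp
  qed
  have "(\<Prod>j=Suc i..n. \<Prod>c=1..lam j. limit_weight (i, J) (j, c)) = (\<Prod>j=Suc i..n.
      (\<Prod>c=1..S (d + 1) j. W_lt (int c - int J) (int j - int i)) *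
        (\<Prod>c=Suc (S (d + 1) j)..S d j. W_eq (col d) (int c - int J) (int j - int i)))"
    by (rule prod.cong[OF refl right])
  then show ?thesis unfolding left strip_weight_def d_def[symmetric] by (simp only:)
qed

text \<open>Every pair is charged to one of its boxes: to the right one if they share a row, to the
  upper one otherwise.\<close>

lemma pairs_by_box:
  fixes w :: "nat \<times> nat \<Rightarrow> nat \<times> nat \<Rightarrow> complex"
  shows "(\<Prod>(b, c)\<in>box_pairs lam. w b c) =
    (\<Prod>(i, J)\<in>diagram lam. (\<Prod>c=1..<J. w (i, c) (i, J)) * (\<Prod>j=Suc i..n. \<Prod>c=1..lam j. w (i, J) (j, c)))"
proof -
  let ?A = "{(b, c) \<in> box_pairs lam. fst b = fst c}" and ?B = "{(b, c) \<in> box_pairs lam. fst b \<noteq> fst c}"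
  have fin: "finite (box_pairs lam)" "finite (diagram lam)"
    using finite_box_pairs[OF part] finite_diagram[OF part] by auto
  have "(\<Prod>(b, c)\<in>box_pairs lam. w b c) = (\<Prod>(b, c)\<in>?A \<union> ?B. w b c)"
    by (rule arg_cong[where f = "prod _"]) auto
  also have "\<dots> = (\<Prod>(b, c)\<in>?A. w b c) * (\<Prod>(b, c)\<in>?B. w b c)"
  proof (rule prod.union_disjoint)
    show "finite ?A" "finite ?B" using fin(1) by (auto intro: finite_subset[rotated])
    show "?A \<inter> ?B = {}" by auto
  qed
  also have "(\<Prod>(b, c)\<in>?A. w b c) = (\<Prod>((i, J), c)\<in>(SIGMA x:diagram lam. {1..<snd x}). w (i, c) (i, J))"
    by (rule prod.reindex_bij_witness[where j = "\<lambda>(b, c). (c, snd b)" and i = "\<lambda>((i, J), c). ((i, c), (i, J))"])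
      (auto simp: box_pairs_def box_before_def diagram_def)
  also have "\<dots> = (\<Prod>(i, J)\<in>diagram lam. \<Prod>c=1..<J. w (i, c) (i, J))"
    using fin(2) by (subst prod_Sigma) (simp_all add: split_def)
  also have "(\<Prod>(b, c)\<in>?B. w b c) = (\<Prod>(b, j, c)\<in>(SIGMA b:diagram lam. SIGMA j:{Suc (fst b)..n}. {1..lam
      j}). w b (j, c))"
    by (rule prod.reindex_bij_witness[where j = "\<lambda>(b, c). (b, fst c, snd c)" and i = "\<lambda>(b, j, c). (b, (j, c))"])
      (auto simp: box_pairs_def box_before_def diagram_rows[OF part])
  also have "\<dots> = (\<Prod>b\<in>diagram lam. \<Prod>(j, c)\<in>(SIGMA j:{Suc (fst b)..n}. {1..lam j}). w b (j, c))"
    using fin(2) by (subst prod.Sigma) auto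
  also have "\<dots> = (\<Prod>(i, J)\<in>diagram lam. \<Prod>j=Suc i..n. \<Prod>c=1..lam j. w (i, J) (j, c))"
    by (rule prod.cong[OF refl]) (auto simp: prod.Sigma)
  finally show ?thesis by (simp add: prod.distrib split_def)
qed

lemma prod_by_entry:
  fixes G :: "nat \<Rightarrow> nat \<times> nat \<Rightarrow> complex"
  shows "(\<Prod>b\<in>diagram lam. G (T b) b) = (\<Prod>d=1..N+M+L. \<Prod>i=1..n. \<Prod>J=Suc (S (d + 1) i)..S d i. G d (i, J))"
proof -
  have "(\<Prod>b\<in>diagram lam. G (T b) b) = (\<Prod>d=1..N+M+L. \<Prod>b\<in>{b \<in> diagram lam. T b = d}. G (T b) b)"
    using T_range by (intro prod.group[symmetric] finite_diagram[OF part]) auto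
  also have "\<dots> = (\<Prod>d=1..N+M+L. \<Prod>i=1..n. \<Prod>J=Suc (S (d + 1) i)..S d i. G d (i, J))"
  proof (rule prod.cong[OF refl])
    fix d
    have "{b \<in> diagram lam. T b = d} = (SIGMA i:{1..n}. {Suc (S (d + 1) i)..S d i})"
    proof (intro set_eqI iffI)
      fix b assume b: "b \<in> {b \<in> diagram lam. T b = d}"
      moreover obtain i J where bi: "b = (i, J)" by (cases b)
      ultimately have J: "1 \<le> J" "i \<in> {1..n}" unfolding diagram_rows[OF part] by auto
      have "J \<in> {Suc (S (d + 1) i)..S d i}" using T_eq_iff[OF J(1), of i d] b bi by simp
      then show "b \<in> (SIGMA i:{1..n}. {Suc (S (d + 1) i)..S d i})" using J(2) bi by simp
    next
      fix b assume "b \<in> (SIGMA i:{1..n}. {Suc (S (d + 1) i)..S d i})"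
      then show "b \<in> {b \<in> diagram lam. T b = d}" using T_eq_iff[of "snd b" "fst b" d] by (cases b) auto
    qed
    moreover have "(\<Prod>b\<in>{b \<in> diagram lam. T b = d}. G (T b) b) = (\<Prod>b\<in>{b \<in> diagram lam. T b = d}. G d b)"
      by (rule prod.cong[OF refl]) simp
    ultimately have "(\<Prod>b\<in>{b \<in> diagram lam. T b = d}. G (T b) b) =
        (\<Prod>b\<in>(SIGMA i:{1..n}. {Suc (S (d + 1) i)..S d i}). G d b)" by simp
    also have "\<dots> = (\<Prod>i=1..n. \<Prod>J=Suc (S (d + 1) i)..S d i. G d (i, J))"
      by (subst prod.Sigma) (simp_all add: split_def)
    finally show "(\<Prod>b\<in>{b \<in> diagram lam. T b = d}. G (T b) b) = (\<Prod>i=1..n. \<Prod>J=Suc (S (d + 1) i)..S d i. G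
        d (i, J))" .
  qed
  finally show ?thesis .
qed


section \<open>Assembling the weight of a tritableau\<close>

lemma theta_eq: "theta lam T i d = S d i - S (d + 1) i"
proof -
  have "{j. (i, j) \<in> diagram lam \<and> T (i, j) = d} = {Suc (S (d + 1) i)..S d i}"
  proof (intro set_eqI iffI)
    fix j assume j: "j \<in> {j. (i, j) \<in> diagram lam \<and> T (i, j) = d}"
    then have "1 \<le> j" by (simp add: diagram_def)
    from T_eq_iff[OF this] j show "j \<in> {Suc (S (d + 1) i)..S d i}" by blast
  next
    fix j assume j: "j \<in> {Suc (S (d + 1) i)..S d i}"
    then have "1 \<le> j" by simp
    from T_eq_iff[OF this] j show "j \<in> {j. (i, j) \<in> diagram lam \<and> T (i, j) = d}" by blast
  qed
  then show ?thesis unfolding theta_def by simp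
qed

lemma S_above: "plength (S d0) < i \<Longrightarrow> d0 \<le> d \<Longrightarrow> S d i = 0"
  using S_mono[of d0 d i] plength_pos[OF part_S, of i d0] by (cases "i = 0") auto

lemma prod_shift_box:
  fixes g :: "nat \<Rightarrow> complex"
  shows "(\<Prod>a<nu - mu. g (mu + a + 1)) = (\<Prod>J=Suc mu..nu. g J)"
  by (rule prod.reindex_bij_witness[where i = "\<lambda>J. J - mu - 1" and j = "\<lambda>a. mu + a + 1"]) auto

lemma prod_extend:
  fixes g :: "nat \<Rightarrow> complex"
  assumes "l \<le> n'" "\<And>i. l < i \<Longrightarrow> g i = 1"
  shows "(\<Prod>i=a..l. g i) = (\<Prod>i=a..n'. g i)"
  by (rule prod.mono_neutral_left) (use assms in auto)

text \<open>The products over the rows of the hyper shape are extended to all n rows by factors 1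
  and then regrouped by the entry d.\<close>

lemma A2_weight_eq:
  "A2_weight q t N M L lam T = (\<Prod>d=N+M+1..N+M+L. skew.hyper_weight q t (S d) (S (d + 1)) n)"
proof -
  define l2 where "l2 = plength (S (N + M + 1))"
  have l2: "l2 \<le> n" unfolding l2_def by (rule plength_S)
  define E where "E = (\<lambda>d z a d' tau. q powi (int (S (d + 1) z) + int a - int (S d' tau)))"
  define A where "A = (\<lambda>j. ((1 - q * inverse t * q ^ j) * (1 - t)) / ((1 - q * inverse t) * (1 - t * q ^ j)))"
  define B where "B = (\<lambda>d z tau a. ((1 - t ^ (tau - z + 1) * E d z a d tau) * (1 - t ^ (tau - z) * E d z
      a (d+1) tau)) /
         ((1 - t ^ (tau - z) * E d z a d tau) * (1 - t ^ (tau - z + 1) * E d z a (d+1) tau)))"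
  define A' where "A' = (\<lambda>r. br (int r + 1) (- 1) * br 0 1 / (br 1 (- 1) * br (int r) 1))"
  define B' where "B' = (\<lambda>d i j J. br (int J - 1 - int (S d j)) (int j - int i + 1) * br (int J - 1 -
      int (S (d + 1) j)) (int j - int i) /
        (br (int J - 1 - int (S d j)) (int j - int i) * br (int J - 1 - int (S (d + 1) j)) (int j - int
            i + 1)))"
  have A: "A r = A' r" for r
    using q_nonzero by (simp add: A_def A'_def br_def power_int_add power_int_minus mult_ac)
  \<comment> \<open>The exponent S (d + 1) z + a belongs to the box in column S (d + 1) z + a + 1,
    hence the term - 1.\<close>
  have Efac: "1 - t ^ c * E d z a d' tau = br (int (S (d + 1) z + a + 1) - 1 - int (S d' tau)) (int c)"
      for d z a d' tau c
    by (simp add: E_def br_def mult.commute add_ac)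
  have B: "B d i j a = B' d i j (S (d + 1) i + a + 1)" if "i < j" for d i j a
  proof -
    have "int (j - i) = int j - int i" "int (j - i + 1) = int j - int i + 1" using that by auto
    then show ?thesis unfolding B_def B'_def Efac by (simp only:)
  qed
  have second: "(\<Prod>z=1..l2. \<Prod>d=N+M+1..N+M+L. \<Prod>j=1..theta lam T z d - 1. A j) =
      (\<Prod>d=N+M+1..N+M+L. \<Prod>i=1..n. \<Prod>r=1..S d i - S (d + 1) i - 1. A' r)"
  proof -
    have "(\<Prod>z=1..l2. \<Prod>d=N+M+1..N+M+L. \<Prod>j=1..theta lam T z d - 1. A j) =
        (\<Prod>z=1..n. \<Prod>d=N+M+1..N+M+L. \<Prod>j=1..theta lam T z d - 1. A j)"
    proof (rule prod_extend[OF l2], rule prod.neutral, rule ballI)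
      fix z d assume "l2 < z" "d \<in> {N+M+1..N+M+L}"
      then have "theta lam T z d = 0" using S_above[of "N + M + 1" z d] unfolding theta_eq l2_def by simp
      then show "(\<Prod>j=1..theta lam T z d - 1. A j) = 1" by simp
    qed
    also have "\<dots> = (\<Prod>d=N+M+1..N+M+L. \<Prod>z=1..n. \<Prod>j=1..theta lam T z d - 1. A j)" by (rule prod.swap)
    finally show ?thesis unfolding A theta_eq .
  qed
  have third: "(\<Prod>z=1..l2. \<Prod>tau=z+1..l2. \<Prod>a<theta lam T z d. B d z tau a) =
      (\<Prod>i=1..n. \<Prod>j=Suc i..n. \<Prod>J=Suc (S (d + 1) i)..S d i. B' d i j J)" if d: "d \<in> {N+M+1..N+M+L}" for d
  proof -
    have "(\<Prod>z=1..l2. \<Prod>tau=z+1..l2. \<Prod>a<theta lam T z d. B d z tau a) =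
      (\<Prod>z=1..l2. \<Prod>tau=Suc z..n. \<Prod>a<theta lam T z d. B d z tau a)"
    proof (rule prod.cong[OF refl])
      fix z assume z: "z \<in> {1..l2}"
      show "(\<Prod>tau=z+1..l2. \<Prod>a<theta lam T z d. B d z tau a) = (\<Prod>tau=Suc z..n. \<Prod>a<theta lam T z d. B d z tau a)"
        unfolding Suc_eq_plus1
      proof (rule prod_extend[OF l2], rule prod.neutral, rule ballI)
        fix tau a assume tau: "l2 < tau"
        then have s: "S d tau = 0" "S (d + 1) tau = 0"
          using S_above[of "N + M + 1" tau d] S_above[of "N + M + 1" tau "d + 1"] d unfolding l2_def by auto
        have zt: "z < tau" using z tau by simp
        then have nz: "br x (int tau - int z) \<noteq> 0" "br x (int tau - int z + 1) \<noteq> 0" for x by auto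
        show "B d z tau a = 1" unfolding B[OF zt] B'_def s using zt by auto
      qed
    qed
    also have "\<dots> = (\<Prod>z=1..n. \<Prod>tau=Suc z..n. \<Prod>a<theta lam T z d. B d z tau a)"
    proof (rule prod_extend[OF l2], rule prod.neutral, rule ballI)
      fix z tau assume "l2 < z"
      then have "theta lam T z d = 0" using S_above[of "N + M + 1" z d] d unfolding theta_eq l2_def by simp
      then show "(\<Prod>a<theta lam T z d. B d z tau a) = 1" by simp
    qed
    also have "\<dots> = (\<Prod>i=1..n. \<Prod>j=Suc i..n. \<Prod>J=Suc (S (d + 1) i)..S d i. B' d i j J)"
    proof (rule prod.cong[OF refl], rule prod.cong[OF refl])
      fix z tau assume "tau \<in> {Suc z..n}"
      then have zt: "z < tau" by simp
      show "(\<Prod>a<theta lam T z d. B d z tau a) = (\<Prod>J=Suc (S (d + 1) z)..S d z. B' d z tau J)"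
        unfolding theta_eq B[OF zt] by (rule prod_shift_box)
    qed
    finally show ?thesis .
  qed
  have "A2_weight q t N M L lam T = (\<Prod>d=N+M+1..N+M+L. C_skew q t (S d) (S (d + 1))) *
      (\<Prod>z=1..l2. \<Prod>d=N+M+1..N+M+L. \<Prod>j=1..theta lam T z d - 1. A j) *
      (\<Prod>d=N+M+1..N+M+L. \<Prod>z=1..l2. \<Prod>tau=z+1..l2. \<Prod>a<theta lam T z d. B d z tau a)"
    unfolding A2_weight_def Let_def A_def B_def E_def l2_def by (rule refl)
  also have "\<dots> = (\<Prod>d=N+M+1..N+M+L. C_skew q t (S d) (S (d + 1)) *
      (\<Prod>i=1..n. \<Prod>r=1..S d i - S (d + 1) i - 1. A' r) *
      (\<Prod>i=1..n. \<Prod>j=Suc i..n. \<Prod>J=Suc (S (d + 1) i)..S d i. B' d i j J))"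
    unfolding second prod.distrib by (simp only: third cong: prod.cong)
  also have "\<dots> = (\<Prod>d=N+M+1..N+M+L. skew.hyper_weight q t (S d) (S (d + 1)) n)"
  proof (rule prod.cong[OF refl])
    fix d
    show "C_skew q t (S d) (S (d + 1)) * (\<Prod>i=1..n. \<Prod>r=1..S d i - S (d + 1) i - 1. A' r) *
      (\<Prod>i=1..n. \<Prod>j=Suc i..n. \<Prod>J=Suc (S (d + 1) i)..S d i. B' d i j J) = skew.hyper_weight q t (S d) (S
          (d + 1)) n"
      unfolding skew.hyper_weight_def[OF skew_S] A'_def B'_def by (rule refl)
  qed
  finally show ?thesis .
qed

lemma prod_telescope:
  fixes h :: "nat \<Rightarrow> complex"
  assumes "\<And>d. h d \<noteq> 0"
  shows "(\<Prod>d=a+1..a+m. h d / h (d + 1)) = h (a + 1) / h (a + m + 1)"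
  using assms by (induction m) (simp_all add: prod.cl_ivl_Suc)

theorem limit_product:
  "(\<Prod>(b, c)\<in>box_pairs lam. limit_weight b c) * (\<Prod>b\<in>diagram lam. box_factor (col (T b))) =
    R_weight q t N M L lam T"
proof -
  define kap where "kap = (inverse q * t - 1) / (inverse t - 1)"
  have "t / q \<noteq> 1" using generic_powi[of "-1" 1] by (auto simp: power_int_minus field_simps)
  moreover have "inverse t \<noteq> 1" using br_eq_0_iff[of 0 1] by (auto simp: br_def)
  ultimately have kap: "kap \<noteq> 0" "box_factor 2 = kap"
    by (auto simp: kap_def box_factor_def divide_inverse mult.commute)
  define G where "G = (\<lambda>d (i, J). strip_weight (col d) n (S d) (S (d + 1)) i J * box_factor (col d))"
  define P where "P = (\<lambda>d. \<Prod>i=1..n. \<Prod>J=Suc (S (d + 1) i)..S d i. G d (i, J))"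
  \<comment> \<open>Attaches the power of the hyper constant to a whole shape, so that the number of
    boxes of one entry becomes a quotient that telescopes over the entries.\<close>
  define K where "K = (\<lambda>d. \<Prod>i=1..n. kap ^ S d i)"
  have K: "K d \<noteq> 0" for d using kap by (simp add: K_def)
  have hr: "hook_ratio (S d) \<noteq> 0" for d by (rule hook_ratio_nonzero[OF part_S])
  have "(\<Prod>(b, c)\<in>box_pairs lam. limit_weight b c) * (\<Prod>b\<in>diagram lam. box_factor (col (T b))) =
      (\<Prod>b\<in>diagram lam. G (T b) b)"
    unfolding pairs_by_box prod.distrib[symmetric]
  proof (rule prod.cong[OF refl])
    fix b assume b: "b \<in> diagram lam"
    obtain i J where bi: "b = (i, J)" by (cases b)
    show "(case b of (i, J) \<Rightarrow> (\<Prod>c=1..<J. limit_weight (i, c) (i, J)) * (\<Prod>j=Suc i..n. \<Prod>c=1..lam j.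
        limit_weight (i, J) (j, c))) *
        box_factor (col (T b)) = G (T b) b"
      using box_weight[of i J] b unfolding bi G_def by simp
  qed
  also have "\<dots> = (\<Prod>d=1..N+M+L. P d)" unfolding P_def by (rule prod_by_entry)
  also have "\<dots> = (\<Prod>d=1..N. P d) * (\<Prod>d=N+1..N+M. P d) * (\<Prod>d=N+M+1..N+M+L. P d)"
    using prod_split_1[of N "N + M" P] prod_split_1[of "N + M" "N + M + L" P] by simp
  also have "(\<Prod>d=1..N. P d) = psi_T0 q t N lam T"
    unfolding psi_T0_def
  proof (rule prod.cong[OF refl])
    fix d assume d: "d \<in> {1..N}"
    have c: "col d = 3" using d by (simp add: entry_colour_def)
    have "P d = (\<Prod>i=1..n. \<Prod>J=Suc (S (d + 1) i)..S d i. strip_weight 3 n (S d) (S (d + 1)) i J)"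
      unfolding P_def G_def c by (simp add: box_factor_def)
    also have "\<dots> = psi_skew q t (S d) (S (d + 1))"
      by (rule skew.ordinary_strip[OF skew_S ordinary_S[OF d], symmetric])
    finally show "P d = psi_skew q t (S d) (S (d + 1))" .
  qed
  also have "(\<Prod>d=N+1..N+M. P d) = psi_T1' t q N M lam T * (hook_ratio (S (N + 1)) / hook_ratio (S (N + M + 1)))"
    unfolding psi_T1'_def prod_telescope[of "\<lambda>d. hook_ratio (S d)", OF hr, symmetric] prod.distrib[symmetric]
  proof (rule prod.cong[OF refl])
    fix d assume d: "d \<in> {N+1..N+M}"
    have c: "col d = 1" using d by (simp add: entry_colour_def)
    have "P d = (\<Prod>i=1..n. \<Prod>J=Suc (S (d + 1) i)..S d i. (q - 1) / (inverse t - 1) * strip_weight 1 n (S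
        d) (S (d + 1)) i J)"
      unfolding P_def G_def c by (simp add: box_factor_def mult.commute)
    also have "\<dots> = psi_skew t q (ptranspose (S d)) (ptranspose (S (d + 1))) * (hook_ratio (S d) /
        hook_ratio (S (d + 1)))"
      by (rule skew.super_strip[OF skew_S super_S[OF d], symmetric])
    finally show "P d = psi_skew t q (ptranspose (S d)) (ptranspose (S (d + 1))) * (hook_ratio (S d) /
        hook_ratio (S (d + 1)))" .
  qed
  also have "(\<Prod>d=N+M+1..N+M+L. P d) = A2_weight q t N M L lam T * (K (N + M + 1) / K (N + M + L + 1))"
    unfolding A2_weight_eq prod_telescope[of K, OF K, symmetric] prod.distrib[symmetric]
  proof (rule prod.cong[OF refl])
    fix d assume d: "d \<in> {N+M+1..N+M+L}"
    have c: "col d = 2" using d by (simp add: entry_colour_def)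
    have "K d / K (d + 1) = (\<Prod>i=1..n. kap ^ (S d i - S (d + 1) i))"
      unfolding K_def prod_dividef[symmetric] using S_mono[of d "d + 1"] kap(1)
      by (intro prod.cong refl) (simp add: power_diff)
    then show "P d = skew.hyper_weight q t (S d) (S (d + 1)) n * (K d / K (d + 1))"
      unfolding P_def G_def c kap(2) skew.hyper_strip[OF skew_S] by (simp add: prod.distrib)
  qed
  also have "K (N + M + L + 1) = 1" unfolding K_def S_top by simp
  also have "K (N + M + 1) = kap ^ psize (S (N + M + 1))"
  proof -
    have "psize (S (N + M + 1)) = (\<Sum>i=1..n. S (N + M + 1) i)" unfolding psize_def
    proof (rule sum.mono_neutral_left)
      show "{1..plength (S (N + M + 1))} \<subseteq> {1..n}" using plength_S by auto
      show "\<forall>i\<in>{1..n} - {1..plength (S (N + M + 1))}. S (N + M + 1) i = 0" using S_above[of "N + M + 1"] by auto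
    qed simp
    then show ?thesis by (simp only: K_def power_sum)
  qed
  finally have LHS: "(\<Prod>(b, c)\<in>box_pairs lam. limit_weight b c) * (\<Prod>b\<in>diagram lam. box_factor (col (T b))) =
     psi_T0 q t N lam T * (psi_T1' t q N M lam T * (hook_ratio (S (N + 1)) / hook_ratio (S (N + M + 1)))) *
       (A2_weight q t N M L lam T * (kap ^ psize (S (N + M + 1)) / 1))" .
  \<comment> \<open>The product over the hyper shape in \<open>R_weight\<close> is the reciprocal of
    its \<open>hook_ratio\<close>: the lower end left by the telescoping over super entries.\<close>
  have "(\<Prod>b\<in>diagram (S (N + M + 1)). (inverse t ^ (leg (S (N + M + 1)) b + 1) - q ^ arm (S (N + M + 1)) b) /
      (q ^ (arm (S (N + M + 1)) b + 1) - inverse t ^ leg (S (N + M + 1)) b)) = 1 / hook_ratio (S (N + M + 1))"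
    unfolding hook_ratio_def H_hook_ptranspose[OF part_S] prod_dividef by (simp add: H_hook_def)
  then have "R_weight q t N M L lam T = A2_weight q t N M L lam T * psi_T1' t q N M lam T * psi_T0 q t N lam T *
      hook_ratio (S (N + 1)) * (1 / hook_ratio (S (N + M + 1))) * kap ^ psize (S (N + M + 1))"
    unfolding R_weight_def Let_def kap_def hook_ratio_def[of "S (N + 1)"] by (simp only:)
  then show ?thesis unfolding LHS by simp
qed

end

section \<open>The limit of the pair weights\<close>

context filling
begin

text \<open>A linear factor of the pair weights with the ratio q^m \<xi>^d inserted; a and e collect
  the exponents of q and t.\<close>

definition lf :: "int \<Rightarrow> int \<Rightarrow> nat \<Rightarrow> complex \<Rightarrow> complex" where
  "lf a e d \<xi> = 1 - q powi a * t powi e * \<xi> ^ d"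

abbreviation "t_inv \<equiv> inverse t"

lemma lf_tendsto: "(lf a e d \<longlongrightarrow> br a (e - int d)) (at t_inv)"
proof -
  have "(lf a e d \<longlongrightarrow> 1 - q powi a * t powi e * t_inv ^ d) (at t_inv)"
    unfolding lf_def by (intro tendsto_intros)
  moreover have "t powi (e - int d) = t powi e * t_inv ^ d"
    using t_nonzero by (simp add: power_int_diff field_simps)
  ultimately show ?thesis by (simp add: br_def mult.assoc)
qed

lemma lf_critical: "lf 0 1 1 \<xi> = 1 - t * \<xi>"
  by (simp add: lf_def)

lemma lf_0: "lf a e 0 \<xi> = br a e"
  by (simp add: lf_def br_def)

lemma critical_nonzero: "eventually (\<lambda>\<xi>. 1 - t * \<xi> \<noteq> 0) (at t_inv)"
  unfolding eventually_at_filter using t_nonzero by (auto simp: field_simps)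

text \<open>For these exponents the limit is 0 only if a = 0 and e = d = 1. Then the factor is 1 - t
  \<xi> itself, which is nonzero away from the limit point.\<close>

lemma lf_nonzero:
  assumes "1 \<le> d" "e \<le> 1"
  shows "eventually (\<lambda>\<xi>. lf a e d \<xi> \<noteq> 0) (at t_inv)"
proof (cases "a = 0 \<and> e = int d")
  case True
  then have "e = 1" "d = 1" using assms by auto
  then show ?thesis using critical_nonzero True lf_critical by simp
next
  case False
  then have "br a (e - int d) \<noteq> 0" by simp
  then show ?thesis by (rule tendsto_imp_eventually_ne[OF lf_tendsto])
qed

definition weight :: "complex \<Rightarrow> nat \<times> nat \<Rightarrow> nat \<times> nat \<Rightarrow> complex \<Rightarrow> complex" where
  "weight y b c \<xi> = pair_value q t col (T b) (T c) (box_value q \<xi> y c / box_value q \<xi> y b) *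
     (if fst b < fst c then inverse (norm_value q t (box_value q \<xi> y c / box_value q \<xi> y b)) else 1)"

definition dcol :: "nat \<times> nat \<Rightarrow> nat \<times> nat \<Rightarrow> int" where
  "dcol b c = int (snd c) - int (snd b)"

definition drow :: "nat \<times> nat \<Rightarrow> nat \<times> nat \<Rightarrow> nat" where
  "drow b c = fst c - fst b"

lemma box_ratio:
  assumes bc: "(b, c) \<in> box_pairs lam" and y: "y \<noteq> 0" and \<xi>: "\<xi> \<noteq> 0"
  shows "box_value q \<xi> y c / box_value q \<xi> y b = q powi dcol b c * \<xi> ^ drow b c"
proof -
  obtain i j i' j' where b: "b = (i, j)" "c = (i', j')" by (cases b, cases c)
  have ij: "1 \<le> i" "1 \<le> j" "1 \<le> i'" "1 \<le> j'" "i \<le> i'"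
    using bc unfolding b box_pairs_def box_before_def diagram_def by auto
  have "q powi (int j' - int j) = q ^ (j' - 1) / q ^ (j - 1)"
  proof -
    have "int j' - int j = int (j' - 1) - int (j - 1)" using ij by simp
    then show ?thesis using q_nonzero by (simp only: power_int_diff power_int_of_nat simp_thms)
  qed
  moreover have "\<xi> ^ (i' - i) = \<xi> ^ (i' - 1) / \<xi> ^ (i - 1)"
    using ij \<xi> power_diff[of \<xi> "i - 1" "i' - 1"] by simp
  ultimately show ?thesis using y unfolding box_value_def b dcol_def drow_def by simp
qed

lemma pair_x:
  "1 - q * (q powi m * \<xi> ^ d) = lf (m + 1) 0 d \<xi>" "1 - t / q * (q powi m * \<xi> ^ d) = lf (m - 1) 1 d \<xi>"
  "1 - inverse t * (q powi m * \<xi> ^ d) = lf m (- 1) d \<xi>" "1 - q powi m * \<xi> ^ d = lf m 0 d \<xi>"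
  "1 - t * (q powi m * \<xi> ^ d) = lf m 1 d \<xi>" "1 - q / t * (q powi m * \<xi> ^ d) = lf (m + 1) (- 1) d \<xi>"
  "1 - inverse q * (q powi m * \<xi> ^ d) = lf (m - 1) 0 d \<xi>"
  using q_nonzero t_nonzero by (auto simp: lf_def power_int_add power_int_diff power_int_minus field_simps)

lemma drow_dcol:
  assumes "(b, c) \<in> box_pairs lam"
  shows "drow b c = 0 \<longleftrightarrow> fst b = fst c" "1 \<le> drow b c \<longleftrightarrow> fst b < fst c" "drow b c = 0 \<Longrightarrow> 1 \<le> dcol b c"
    "int (fst c) - int (fst b) = int (drow b c)"
  using assms by (auto simp: box_pairs_def box_before_def drow_def dcol_def)

text \<open>The points at which none of the factors to be divided by vanishes. The condition
  involves the shape but no entries, so one punctured neighbourhood serves all fillings.\<close>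

definition regular :: "complex \<Rightarrow> bool" where
  "regular \<xi> \<longleftrightarrow> \<xi> \<noteq> 0 \<and> 1 - t * \<xi> \<noteq> 0 \<and> (\<forall>(b, c)\<in>box_pairs lam. 1 \<le> drow b c \<longrightarrow>
     (let m = dcol b c; d = drow b c in lf (m + 1) 0 d \<xi> \<noteq> 0 \<and> lf (m - 1) 1 d \<xi> \<noteq> 0 \<and>
       lf m (- 1) d \<xi> \<noteq> 0 \<and> lf m 0 d \<xi> \<noteq> 0 \<and> lf m 1 d \<xi> \<noteq> 0))"

lemma eventually_regular: "eventually regular (at t_inv)"
proof -
  have "eventually (\<lambda>\<xi>. \<xi> \<noteq> 0) (at t_inv)"
    using t_nonzero by (intro tendsto_imp_eventually_ne[OF tendsto_ident_at]) simp
  moreover have "eventually (\<lambda>\<xi>. \<forall>p\<in>box_pairs lam. 1 \<le> drow (fst p) (snd p) \<longrightarrow>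
     (let m = dcol (fst p) (snd p); d = drow (fst p) (snd p) in lf (m + 1) 0 d \<xi> \<noteq> 0 \<and> lf (m - 1) 1 d \<xi> \<noteq> 0 \<and>
       lf m (- 1) d \<xi> \<noteq> 0 \<and> lf m 0 d \<xi> \<noteq> 0 \<and> lf m 1 d \<xi> \<noteq> 0)) (at t_inv)"
  proof (rule eventually_ball_finite[OF finite_box_pairs[OF part]], rule ballI)
    fix p
    show "eventually (\<lambda>\<xi>. 1 \<le> drow (fst p) (snd p) \<longrightarrow>
     (let m = dcol (fst p) (snd p); d = drow (fst p) (snd p) in lf (m + 1) 0 d \<xi> \<noteq> 0 \<and> lf (m - 1) 1 d \<xi> \<noteq> 0 \<and>
       lf m (- 1) d \<xi> \<noteq> 0 \<and> lf m 0 d \<xi> \<noteq> 0 \<and> lf m 1 d \<xi> \<noteq> 0)) (at t_inv)"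
    proof (cases "1 \<le> drow (fst p) (snd p)")
      case True
      then show ?thesis unfolding Let_def by (simp only: simp_thms) (intro eventually_conj lf_nonzero; simp)
    qed simp
  qed
  ultimately show ?thesis using critical_nonzero
    by eventually_elim (simp add: regular_def split_def)
qed

lemma linear_values:
  "linear_value (pair_den t) (q powi m * \<xi> ^ d) = lf m 0 d \<xi> * (lf m 1 d \<xi> * lf m (- 1) d \<xi>)"
  "norm_value q t (q powi m * \<xi> ^ d) = lf (m + 1) 0 d \<xi> * lf (m - 1) 1 d \<xi> / (lf m 0 d \<xi> * lf m 1 d \<xi>)"
  by (simp_all only: linear_value_def pair_den_def norm_value_def list.map prod_list.Cons prod_list.Nil
      mult_1_left mult_1_right pair_x)

lemma regularD:
  assumes "regular \<xi>" "(b, c) \<in> box_pairs lam" "1 \<le> drow b c"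
  shows "lf (dcol b c + 1) 0 (drow b c) \<xi> \<noteq> 0" "lf (dcol b c - 1) 1 (drow b c) \<xi> \<noteq> 0"
    "lf (dcol b c) (- 1) (drow b c) \<xi> \<noteq> 0" "lf (dcol b c) 0 (drow b c) \<xi> \<noteq> 0" "lf (dcol b c) 1 (drow b c) \<xi> \<noteq> 0"
  using assms unfolding regular_def Let_def by blast+

lemma regular_nonzero: "regular \<xi> \<Longrightarrow> \<xi> \<noteq> 0" "regular \<xi> \<Longrightarrow> 1 - t * \<xi> \<noteq> 0"
  unfolding regular_def by auto

text \<open>These are the nonvanishing hypotheses of \<open>rf_eval2_correlation\<close>. Within a
  row the ratio is q^m with m \<ge> 1, and genericity of q and t suffices.\<close>

lemma regular_conditions:
  assumes reg: "regular \<xi>" and y: "y \<noteq> 0" and bc: "(b, c) \<in> box_pairs lam"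
  shows "linear_value (pair_den t) (box_value q \<xi> y c / box_value q \<xi> y b) \<noteq> 0"
    "fst b < fst c \<Longrightarrow> norm_value q t (box_value q \<xi> y c / box_value q \<xi> y b) \<noteq> 0"
proof -
  show "linear_value (pair_den t) (box_value q \<xi> y c / box_value q \<xi> y b) \<noteq> 0"
  proof (cases "drow b c = 0")
    case True
    then show ?thesis unfolding box_ratio[OF bc y regular_nonzero(1)[OF reg]] linear_values
      using drow_dcol(3)[OF bc] by (simp add: lf_0)
  next
    case False
    then show ?thesis unfolding box_ratio[OF bc y regular_nonzero(1)[OF reg]] linear_values
      using regularD[OF reg bc] by simp
  qed
  assume "fst b < fst c"
  then have "1 \<le> drow b c" using drow_dcol(2)[OF bc] by simp
  then show "norm_value q t (box_value q \<xi> y c / box_value q \<xi> y b) \<noteq> 0"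
    unfolding box_ratio[OF bc y regular_nonzero(1)[OF reg]] linear_values using regularD[OF reg bc] by simp
qed

lemma numerator_values:
  "linear_value [q, t / q, inverse t] (q powi m * \<xi> ^ d) = lf (m + 1) 0 d \<xi> * (lf (m - 1) 1 d \<xi> * lf m
      (- 1) d \<xi>)"
  "linear_value [q / t, inverse q, t] (q powi m * \<xi> ^ d) = lf (m + 1) (- 1) d \<xi> * (lf (m - 1) 0 d \<xi> * lf
      m 1 d \<xi>)"
  "linear_value [inverse q, q, 1] (q powi m * \<xi> ^ d) = lf (m - 1) 0 d \<xi> * (lf (m + 1) 0 d \<xi> * lf m 0 d \<xi>)"
  "linear_value [q / t, t / q, 1] (q powi m * \<xi> ^ d) = lf (m + 1) (- 1) d \<xi> * (lf (m - 1) 1 d \<xi> * lf m 0 d \<xi>)"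
  "linear_value [1, t, inverse t] (q powi m * \<xi> ^ d) = lf m 0 d \<xi> * (lf m 1 d \<xi> * lf m (- 1) d \<xi>)"
  by (simp_all only: linear_value_def list.map prod_list.Cons prod_list.Nil mult_1_left mult_1_right pair_x)

lemma pair_value_eq:
  "pair_value q t col a b (q powi m * \<xi> ^ d) =
    (if b < a then lf (m + 1) 0 d \<xi> * (lf (m - 1) 1 d \<xi> * lf m (- 1) d \<xi>)
     else if a < b then lf (m + 1) (- 1) d \<xi> * (lf (m - 1) 0 d \<xi> * lf m 1 d \<xi>)
     else if col a = 1 then lf (m - 1) 0 d \<xi> * (lf (m + 1) 0 d \<xi> * lf m 0 d \<xi>)
     else if col a = 2 then lf (m + 1) (- 1) d \<xi> * (lf (m - 1) 1 d \<xi> * lf m 0 d \<xi>)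
     else lf m 0 d \<xi> * (lf m 1 d \<xi> * lf m (- 1) d \<xi>)) / (lf m 0 d \<xi> * (lf m 1 d \<xi> * lf m (- 1) d \<xi>))"
  unfolding pair_value_def pair_num_def linear_values
    if_distrib[where f = "\<lambda>l. linear_value l (q powi m * \<xi> ^ d)"] numerator_values by (rule refl)

lemma weight_row:
  assumes reg: "regular \<xi>" and y: "y \<noteq> 0" and bc: "(b, c) \<in> box_pairs lam" and d: "drow b c = 0"
  shows "weight y b c \<xi> = (if T c < T b then W_gt (dcol b c)
     else if T b < T c then br (dcol b c + 1) (- 1) * br (dcol b c - 1) 0 / (br (dcol b c) 0 * br (dcol
         b c) (- 1))
     else W_same (col (T b)) (dcol b c))"
proof -
  define m where "m = dcol b c"
  have m: "1 \<le> m" using drow_dcol(3)[OF bc d] by (simp add: m_def)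
  have row: "\<not> fst b < fst c" using drow_dcol(1)[OF bc] d by simp
  have x: "box_value q \<xi> y c / box_value q \<xi> y b = q powi m * \<xi> ^ 0"
    using box_ratio[OF bc y regular_nonzero(1)[OF reg]] d by (simp only: m_def)
  have nz: "br m e \<noteq> 0" "br (m + 1) e \<noteq> 0" for e using m by auto
  show ?thesis
    unfolding weight_def x pair_value_eq m_def[symmetric] lf_0 using row m nz by (auto simp: W_gt_def
        W_same_def)
qed

text \<open>Division by \<open>Delta\<close> removes E and F from the denominator at the price of A
  and B. For T c < T b the numerator contains A and B, and everything cancels.\<close>

lemma weight_rows:
  assumes reg: "regular \<xi>" and y: "y \<noteq> 0" and bc: "(b, c) \<in> box_pairs lam" and d: "1 \<le> drow b c"
  defines "A \<equiv> lf (dcol b c + 1) 0 (drow b c) \<xi>" and "B \<equiv> lf (dcol b c - 1) 1 (drow b c) \<xi>"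
    and "C \<equiv> lf (dcol b c) (- 1) (drow b c) \<xi>" and "E \<equiv> lf (dcol b c) 0 (drow b c) \<xi>"
    and "F \<equiv> lf (dcol b c) 1 (drow b c) \<xi>" and "G \<equiv> lf (dcol b c + 1) (- 1) (drow b c) \<xi>"
    and "H \<equiv> lf (dcol b c - 1) 0 (drow b c) \<xi>"
  shows "weight y b c \<xi> = (if T c < T b then 1 else if T b < T c then G * H * F / (C * A * B)
     else if col (T b) = 1 then H * E / (C * B) else if col (T b) = 2 then G * E / (C * A) else E * F /
         (A * B))"
proof -
  have x: "box_value q \<xi> y c / box_value q \<xi> y b = q powi dcol b c * \<xi> ^ drow b c"
    by (rule box_ratio[OF bc y regular_nonzero(1)[OF reg]])
  have row: "fst b < fst c" using drow_dcol(2)[OF bc] d by simp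
  have nz: "A \<noteq> 0" "B \<noteq> 0" "C \<noteq> 0" "E \<noteq> 0" "F \<noteq> 0"
    using regularD[OF reg bc d] by (simp_all add: A_def B_def C_def E_def F_def)
  have w: "weight y b c \<xi> = (if T c < T b then A * (B * C) else if T b < T c then G * (H * F)
     else if col (T b) = 1 then H * (A * E) else if col (T b) = 2 then G * (B * E) else E * (F * C)) /
         (E * (F * C)) *
     inverse (A * B / (E * F))"
    unfolding weight_def x pair_value_eq linear_values A_def B_def C_def E_def F_def G_def H_def
    using row by (simp only: if_True)
  show ?thesis unfolding w using nz by (simp add: field_simps)
qed

lemma lf_tendsto': "e - int d = f \<Longrightarrow> (lf a e d \<longlongrightarrow> br a f) (at t_inv)"
  using lf_tendsto by blast

text \<open>The critical factor 1 - t \<xi> is \<open>lf\<close> 0 1 1. In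
  \<open>weight_rows\<close> the numerator F is critical for the box directly below, and the
  denominator B, whose q-exponent is one less, for the box diagonally below to the right. The
  conditions on entries say when F, respectively B, is present.\<close>

definition zero_pair :: "nat \<times> nat \<Rightarrow> nat \<times> nat \<Rightarrow> bool" where
  "zero_pair b c \<longleftrightarrow> drow b c = 1 \<and> dcol b c = 0 \<and> (T b < T c \<or> T b = T c \<and> col (T b) = 3)"

definition pole_pair :: "nat \<times> nat \<Rightarrow> nat \<times> nat \<Rightarrow> bool" where
  "pole_pair b c \<longleftrightarrow> drow b c = 1 \<and> dcol b c = 1 \<and> (T b < T c \<or> T b = T c \<and> col (T b) \<noteq> 2)"

lemma colours_T: "col j = 1 \<or> col j = 2 \<or> col j = 3"
  by (simp add: entry_colour_def)

text \<open>Without critical factors every denominator has a nonzero limit. The hypothesis on rows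
  excludes the case in which \<open>limit_weight\<close> is a mere default.\<close>

lemma weight_tendsto:
  assumes y: "y \<noteq> 0" and bc: "(b, c) \<in> box_pairs lam"
    and zp: "\<not> zero_pair b c" "\<not> pole_pair b c" and row: "drow b c = 0 \<Longrightarrow> T c \<le> T b"
  shows "(weight y b c \<longlongrightarrow> limit_weight b c) (at t_inv)"
proof (cases "drow b c = 0")
  case True
  have f: "fst b = fst c" using drow_dcol(1)[OF bc] True by simp
  have "eventually (\<lambda>\<xi>. weight y b c \<xi> = limit_weight b c) (at t_inv)"
    using eventually_regular
  proof eventually_elim
    case (elim \<xi>)
    show ?case unfolding weight_row[OF elim y bc True] using row[OF True] f
      by (simp add: limit_weight_def dcol_def)
  qed
  then show ?thesis by (rule tendsto_eventually)
next
  case False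
  define d m where "d = drow b c" and "m = dcol b c"
  have d: "1 \<le> d" using False by (simp add: d_def)
  have f: "fst b \<noteq> fst c" using drow_dcol(1)[OF bc] False by simp
  have lim: "limit_weight b c = (if T c < T b then 1 else if T b < T c then W_lt m (int d) else W_eq
      (col (T b)) m (int d))"
    unfolding limit_weight_def Let_def drow_dcol(4)[OF bc] using f by (simp add: d_def m_def dcol_def)
  have A: "(lf (m + 1) 0 d \<longlongrightarrow> br (m + 1) (- int d)) (at t_inv)" and B: "(lf (m - 1) 1 d \<longlongrightarrow> br (m - 1) (1 -
      int d)) (at t_inv)"
    and C: "(lf m (- 1) d \<longlongrightarrow> br m (- int d - 1)) (at t_inv)" and E: "(lf m 0 d \<longlongrightarrow> br m (- int d)) (at t_inv)"
    and F: "(lf m 1 d \<longlongrightarrow> br m (1 - int d)) (at t_inv)" and G: "(lf (m + 1) (- 1) d \<longlongrightarrow> br (m + 1) (- int d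
        - 1)) (at t_inv)"
    and H: "(lf (m - 1) 0 d \<longlongrightarrow> br (m - 1) (- int d)) (at t_inv)"
    by (rule lf_tendsto', simp)+
  have nz: "br (m + 1) (- int d) \<noteq> 0" "br m (- int d - 1) \<noteq> 0" using d by auto
  have nzB: "br (m - 1) (1 - int d) \<noteq> 0" if "T b < T c \<or> T b = T c \<and> col (T b) \<noteq> 2"
    using zp(2) that by (auto simp: pole_pair_def d_def m_def)
  let ?w = "\<lambda>\<xi>. if T c < T b then 1 else if T b < T c then lf (m + 1) (- 1) d \<xi> * lf (m - 1) 0 d \<xi> * lf
      m 1 d \<xi> / (lf m (- 1) d \<xi> * lf (m + 1) 0 d \<xi> * lf (m - 1) 1 d \<xi>)
     else if col (T b) = 1 then lf (m - 1) 0 d \<xi> * lf m 0 d \<xi> / (lf m (- 1) d \<xi> * lf (m - 1) 1 d \<xi>)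
     else if col (T b) = 2 then lf (m + 1) (- 1) d \<xi> * lf m 0 d \<xi> / (lf m (- 1) d \<xi> * lf (m + 1) 0 d \<xi>)
     else lf m 0 d \<xi> * lf m 1 d \<xi> / (lf (m + 1) 0 d \<xi> * lf (m - 1) 1 d \<xi>)"
  have ev: "eventually (\<lambda>\<xi>. weight y b c \<xi> = ?w \<xi>) (at t_inv)"
    using eventually_regular
  proof eventually_elim
    case (elim \<xi>)
    show ?case using weight_rows[OF elim y bc] d unfolding d_def m_def by blast
  qed
  have "(?w \<longlongrightarrow> limit_weight b c) (at t_inv)"
  proof (cases "T c < T b")
    case True
    then show ?thesis by (simp add: lim)
  next
    case ge: False
    show ?thesis
    proof (cases "T b < T c")
      case True
      have "(?w \<longlongrightarrow> br (m + 1) (- int d - 1) * br (m - 1) (- int d) * br m (1 - int d) /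
          (br m (- int d - 1) * br (m + 1) (- int d) * br (m - 1) (1 - int d))) (at t_inv)"
        using True ge nz nzB by (simp del: br_eq_0_iff) (intro tendsto_intros A B C E F G H; simp del:
            br_eq_0_iff)
      then show ?thesis using True ge unfolding lim W_lt_def by simp
    next
      case False
      then have eq: "T b = T c" using ge by simp
      consider "col (T b) = 1" | "col (T b) = 2" | "col (T b) = 3" using colours_T by blast
      then show ?thesis
      proof cases
        case 1
        have "(?w \<longlongrightarrow> br (m - 1) (- int d) * br m (- int d) / (br m (- int d - 1) * br (m - 1) (1 - int
            d))) (at t_inv)"
          using 1 eq nz nzB by (simp del: br_eq_0_iff) (intro tendsto_intros A B C E F G H; simp del:
              br_eq_0_iff)
        then show ?thesis using eq 1 unfolding lim W_eq_def by simp
      next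
        case 2
        have "(?w \<longlongrightarrow> br (m + 1) (- int d - 1) * br m (- int d) / (br m (- int d - 1) * br (m + 1) (- int
            d))) (at t_inv)"
          using 2 eq nz by (simp del: br_eq_0_iff) (intro tendsto_intros A B C E F G H; simp del: br_eq_0_iff)
        then show ?thesis using eq 2 unfolding lim W_eq_def by simp
      next
        case 3
        have "(?w \<longlongrightarrow> br m (- int d) * br m (1 - int d) / (br (m + 1) (- int d) * br (m - 1) (1 - int d)))
            (at t_inv)"
          using 3 eq nz nzB by (simp del: br_eq_0_iff) (intro tendsto_intros A B C E F G H; simp del:
              br_eq_0_iff)
        then show ?thesis using eq 3 unfolding lim W_eq_def by simp
      qed
    qed
  qed
  then show ?thesis using tendsto_cong[OF ev] by blast
qed

section \<open>Pair weights with the critical factor removed\<close>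

definition conv :: "(complex \<Rightarrow> complex) \<Rightarrow> bool" where
  "conv f \<longleftrightarrow> (\<exists>l. (f \<longlongrightarrow> l) (at t_inv))"

lemma conv_mult: "conv f \<Longrightarrow> conv g \<Longrightarrow> conv (\<lambda>\<xi>. f \<xi> * g \<xi>)"
  unfolding conv_def by (blast intro: tendsto_mult)

lemma conv_lf: "conv (lf a e d)"
  unfolding conv_def using lf_tendsto by blast

lemma conv_inverse_lf: "br a (e - int d) \<noteq> 0 \<Longrightarrow> conv (\<lambda>\<xi>. inverse (lf a e d \<xi>))"
  unfolding conv_def using tendsto_inverse[OF lf_tendsto] by blast

lemma conv_cong: "conv g \<Longrightarrow> eventually (\<lambda>\<xi>. f \<xi> = g \<xi>) (at t_inv) \<Longrightarrow> conv f"
  unfolding conv_def using tendsto_cong by blast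

lemma conv_zero: "conv (\<lambda>\<xi>. lf m 1 d \<xi> / (if d = 1 \<and> m = 0 then 1 - t * \<xi> else 1))"
proof (cases "d = 1 \<and> m = 0")
  case True
  have "conv (\<lambda>\<xi>. 1)" unfolding conv_def by (blast intro: tendsto_const)
  then show ?thesis
    by (rule conv_cong) (use critical_nonzero in eventually_elim, use True in \<open>simp add: lf_def\<close>)
next
  case False
  then show ?thesis using conv_lf[of m 1 d] by (simp only: if_False div_by_1)
qed

lemma conv_pole: "conv (\<lambda>\<xi>. (if d = 1 \<and> m = 1 then 1 - t * \<xi> else 1) / lf (m - 1) 1 d \<xi>)"
proof (cases "d = 1 \<and> m = 1")
  case True
  have "conv (\<lambda>\<xi>. 1)" unfolding conv_def by (blast intro: tendsto_const)
  then show ?thesis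
    by (rule conv_cong) (use critical_nonzero in eventually_elim, use True in \<open>simp add: lf_def\<close>)
next
  case False
  then have "conv (\<lambda>\<xi>. inverse (lf (m - 1) 1 d \<xi>))" by (intro conv_inverse_lf) auto
  then show ?thesis using False by (simp only: if_False divide_inverse mult_1)
qed

text \<open>Apart from the critical factors all numerators converge and all denominators have
  nonzero limits; each critical factor is compensated by the power of 1 - t \<xi> that
  \<open>zero_pair\<close> and \<open>pole_pair\<close> prescribe.\<close>

lemma conv_weight:
  assumes y: "y \<noteq> 0" and bc: "(b, c) \<in> box_pairs lam"
  shows "conv (\<lambda>\<xi>. weight y b c \<xi> * (if pole_pair b c then 1 - t * \<xi> else 1) / (if zero_pair b c then 1
      - t * \<xi> else 1))"
proof (cases "drow b c = 0")
  case True
  then have zp: "\<not> pole_pair b c" "\<not> zero_pair b c" by (auto simp: pole_pair_def zero_pair_def)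
  let ?l = "if T c < T b then W_gt (dcol b c)
     else if T b < T c then br (dcol b c + 1) (- 1) * br (dcol b c - 1) 0 / (br (dcol b c) 0 * br (dcol
         b c) (- 1))
     else W_same (col (T b)) (dcol b c)"
  have "eventually (\<lambda>\<xi>. weight y b c \<xi> = ?l) (at t_inv)"
    using eventually_regular by eventually_elim (rule weight_row[OF _ y bc True])
  then have "(weight y b c \<longlongrightarrow> ?l) (at t_inv)" by (rule tendsto_eventually)
  then show ?thesis unfolding conv_def using zp by (simp only: if_False mult_1_right div_by_1) blast
next
  case False
  define d m where "d = drow b c" and "m = dcol b c"
  have d: "1 \<le> d" using False by (simp add: d_def)
  have iA: "conv (\<lambda>\<xi>. inverse (lf (m + 1) 0 d \<xi>))" and iC: "conv (\<lambda>\<xi>. inverse (lf m (- 1) d \<xi>))"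
    using d by (auto intro!: conv_inverse_lf)
  let ?P = "\<lambda>\<xi>. (if d = 1 \<and> m = 1 then 1 - t * \<xi> else 1) / lf (m - 1) 1 d \<xi>"
  let ?Z = "\<lambda>\<xi>. lf m 1 d \<xi> / (if d = 1 \<and> m = 0 then 1 - t * \<xi> else 1)"
  let ?w = "\<lambda>\<xi>. weight y b c \<xi> * (if pole_pair b c then 1 - t * \<xi> else 1) / (if zero_pair b c then 1 - t
      * \<xi> else 1)"
  note rows = weight_rows[OF _ y bc, folded d_def m_def, OF _ d]
  note pp = pole_pair_def[of b c, folded d_def m_def] and zz = zero_pair_def[of b c, folded d_def m_def]
  consider (gt) "T c < T b" | (lt) "T b < T c" | (c1) "T b = T c" "col (T b) = 1" | (c2) "T b = T c"
      "col (T b) = 2"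
    | (c3) "T b = T c" "col (T b) = 3" using colours_T[of "T b"] by linarith
  then show ?thesis
  proof cases
    case gt
    have "conv (\<lambda>\<xi>. 1)" unfolding conv_def by (blast intro: tendsto_const)
    then show ?thesis
    proof (rule conv_cong)
      show "eventually (\<lambda>\<xi>. ?w \<xi> = 1) (at t_inv)" using eventually_regular
        by eventually_elim (use gt rows in \<open>simp add: pp zz\<close>)
    qed
  next
    case lt
    have "conv (\<lambda>\<xi>. lf (m + 1) (- 1) d \<xi> * lf (m - 1) 0 d \<xi> * ?Z \<xi> * inverse (lf m (- 1) d \<xi>) * inverse
        (lf (m + 1) 0 d \<xi>) * ?P \<xi>)"
      by (intro conv_mult conv_lf iA iC conv_zero conv_pole)
    then show ?thesis
    proof (rule conv_cong)
      show "eventually (\<lambda>\<xi>. ?w \<xi> = lf (m + 1) (- 1) d \<xi> * lf (m - 1) 0 d \<xi> * ?Z \<xi> * inverse (lf m (- 1)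
          d \<xi>) * inverse (lf (m + 1) 0 d \<xi>) * ?P \<xi>) (at t_inv)"
        using eventually_regular
        by eventually_elim (use lt in \<open>simp add: rows pp zz divide_inverse mult_ac\<close>)
    qed
  next
    case c1
    have "conv (\<lambda>\<xi>. lf (m - 1) 0 d \<xi> * lf m 0 d \<xi> * inverse (lf m (- 1) d \<xi>) * ?P \<xi>)"
      by (intro conv_mult conv_lf iA iC conv_zero conv_pole)
    then show ?thesis
    proof (rule conv_cong)
      show "eventually (\<lambda>\<xi>. ?w \<xi> = lf (m - 1) 0 d \<xi> * lf m 0 d \<xi> * inverse (lf m (- 1) d \<xi>) * ?P \<xi>) (at t_inv)"
        using eventually_regular
        by eventually_elim (use c1 in \<open>simp add: rows pp zz divide_inverse mult_ac\<close>)
    qed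
  next
    case c2
    have "conv (\<lambda>\<xi>. lf (m + 1) (- 1) d \<xi> * lf m 0 d \<xi> * inverse (lf m (- 1) d \<xi>) * inverse (lf (m + 1) 0 d \<xi>))"
      by (intro conv_mult conv_lf iA iC conv_zero conv_pole)
    then show ?thesis
    proof (rule conv_cong)
      show "eventually (\<lambda>\<xi>. ?w \<xi> = lf (m + 1) (- 1) d \<xi> * lf m 0 d \<xi> * inverse (lf m (- 1) d \<xi>) *
          inverse (lf (m + 1) 0 d \<xi>)) (at t_inv)"
        using eventually_regular
        by eventually_elim (use c2 in \<open>simp add: rows pp zz divide_inverse mult_ac\<close>)
    qed
  next
    case c3
    have "conv (\<lambda>\<xi>. lf m 0 d \<xi> * ?Z \<xi> * inverse (lf (m + 1) 0 d \<xi>) * ?P \<xi>)"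
      by (intro conv_mult conv_lf iA iC conv_zero conv_pole)
    then show ?thesis
    proof (rule conv_cong)
      show "eventually (\<lambda>\<xi>. ?w \<xi> = lf m 0 d \<xi> * ?Z \<xi> * inverse (lf (m + 1) 0 d \<xi>) * ?P \<xi>) (at t_inv)"
        using eventually_regular
        by eventually_elim (use c3 in \<open>simp add: rows pp zz divide_inverse mult_ac\<close>)
    qed
  qed
qed

end

context filling
begin

section \<open>Tableau conditions on neighbours, and the count of zeros against poles\<close>

abbreviation "D \<equiv> diagram lam"

lemma box_left: "(i, j) \<in> D \<Longrightarrow> 1 \<le> j' \<Longrightarrow> j' \<le> j \<Longrightarrow> (i, j') \<in> D"
  by (auto simp: diagram_def)

lemma row_neighbours:
  assumes "(i, j) \<in> D" "(i, Suc j) \<in> D"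
  shows "((i, j), (i, Suc j)) \<in> box_pairs lam" "drow (i, j) (i, Suc j) = 0" "dcol (i, j) (i, Suc j) = 1"
  using assms by (auto simp: box_pairs_def box_before_def drow_def dcol_def)

lemma neighbours: "drow b c = 1 \<longleftrightarrow> fst c = Suc (fst b)" "dcol b c = 0 \<longleftrightarrow> snd c = snd b"
    "dcol b c = 1 \<longleftrightarrow> snd c = Suc (snd b)"
  by (auto simp: drow_def dcol_def)

lemma zero_pair_iff:
  "(b, c) \<in> box_pairs lam \<and> zero_pair b c \<longleftrightarrow> (\<exists>i j. b = (i, j) \<and> c = (Suc i, j) \<and> (i, j) \<in> D \<and> (Suc i, j) \<in> D \<and>
     (T (i, j) < T (Suc i, j) \<or> T (i, j) = T (Suc i, j) \<and> col (T (i, j)) = 3))"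
  unfolding zero_pair_def neighbours box_pairs_def box_before_def by (cases b; cases c) auto

lemma pole_pair_iff:
  "(b, c) \<in> box_pairs lam \<and> pole_pair b c \<longleftrightarrow> (\<exists>i j. b = (i, j) \<and> c = (Suc i, Suc j) \<and> (i, j) \<in> D \<and> (Suc
      i, Suc j) \<in> D \<and>
     (T (i, j) < T (Suc i, Suc j) \<or> T (i, j) = T (Suc i, Suc j) \<and> col (T (i, j)) \<noteq> 2))"
  unfolding pole_pair_def neighbours box_pairs_def box_before_def by (cases b; cases c) auto

definition zero_pairs :: "((nat \<times> nat) \<times> nat \<times> nat) set" where
  "zero_pairs = {(b, c) \<in> box_pairs lam. zero_pair b c}"

definition pole_pairs :: "((nat \<times> nat) \<times> nat \<times> nat) set" where
  "pole_pairs = {(b, c) \<in> box_pairs lam. pole_pair b c}"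

definition row_ok :: bool where
  "row_ok \<longleftrightarrow> (\<forall>i j. (i, j) \<in> D \<and> (i, Suc j) \<in> D \<longrightarrow>
     T (i, Suc j) \<le> T (i, j) \<and> (T (i, Suc j) = T (i, j) \<longrightarrow> col (T (i, j)) \<noteq> 1))"

lemma zero_weight:
  assumes y: "y \<noteq> 0" and "\<not> row_ok"
  shows "\<exists>(b, c)\<in>box_pairs lam. eventually (\<lambda>\<xi>. weight y b c \<xi> = 0) (at t_inv)"
proof -
  obtain i j where ij: "(i, j) \<in> D" "(i, Suc j) \<in> D"
    and T': "T (i, j) < T (i, Suc j) \<or> T (i, Suc j) = T (i, j) \<and> col (T (i, j)) = 1"
    using assms(2) unfolding row_ok_def by (auto simp: not_le)
  note nb = row_neighbours[OF ij]
  \<comment> \<open>At column distance 1 the numerator contains br 0 0, both for increasing entries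
    and for equal super entries.\<close>
  have "eventually (\<lambda>\<xi>. weight y (i, j) (i, Suc j) \<xi> = 0) (at t_inv)"
    using eventually_regular
  proof eventually_elim
    case (elim \<xi>)
    show ?case unfolding weight_row[OF elim y nb(1,2)] nb(3) using T' by (auto simp: W_same_def)
  qed
  then show ?thesis using nb(1) by blast
qed

text \<open>If the two ends carry equal entries, then by monotonicity so do all boxes in between,
  and the first pair of neighbours already excludes a super entry.\<close>

lemma row_chain:
  assumes "row_ok" "(i, j) \<in> D" "(i, Suc (j + k)) \<in> D"
  shows "T (i, Suc (j + k)) \<le> T (i, j) \<and> (T (i, Suc (j + k)) = T (i, j) \<longrightarrow> col (T (i, j)) \<noteq> 1)"
  using assms(3)
proof (induction k)
  case 0
  then show ?case using assms(1,2) unfolding row_ok_def by simp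
next
  case (Suc k)
  have m: "(i, Suc (j + k)) \<in> D" using box_left[OF Suc.prems, of "Suc (j + k)"] by simp
  have "T (i, Suc (j + Suc k)) \<le> T (i, Suc (j + k))" using assms(1) m Suc.prems unfolding row_ok_def by simp
  then show ?case using Suc.IH[OF m] by auto
qed

lemma column_chain:
  assumes "zero_pairs = {}" "(i, j) \<in> D" "(Suc (i + k), j) \<in> D"
  shows "T (Suc (i + k), j) \<le> T (i, j) \<and> (T (Suc (i + k), j) = T (i, j) \<longrightarrow> col (T (i, j)) \<noteq> 3)"
  using assms(3)
proof (induction k)
  case 0
  have "((i, j), (Suc i, j)) \<notin> zero_pairs" using assms(1) by simp
  then have "\<not> (T (i, j) < T (Suc i, j) \<or> T (i, j) = T (Suc i, j) \<and> col (T (i, j)) = 3)"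
    using assms(2) 0 zero_pair_iff[of "(i, j)" "(Suc i, j)"] by (auto simp: zero_pairs_def)
  then show ?case by auto
next
  case (Suc k)
  have i: "1 \<le> i" using assms(2) by (simp add: diagram_def)
  have m: "(Suc (i + k), j) \<in> D" using diagram_up[OF Suc.prems, of "Suc (i + k)"] by simp
  have "((Suc (i + k), j), (Suc (Suc (i + k)), j)) \<notin> zero_pairs" using assms(1) by simp
  then have "T (Suc (i + Suc k), j) \<le> T (Suc (i + k), j)"
    using m Suc.prems zero_pair_iff[of "(Suc (i + k), j)" "(Suc (Suc (i + k)), j)"] by (auto simp:
        zero_pairs_def)
  then show ?case using Suc.IH[OF m] by auto
qed

lemma RSSYTT_I:
  assumes row: "row_ok" and zp: "zero_pairs = {}"
  shows "T \<in> RSSYTT N M L lam"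
proof -
  have r: "T (i, j') \<le> T (i, j) \<and> (T (i, j') = T (i, j) \<longrightarrow> col (T (i, j)) \<noteq> 1)"
    if "(i, j) \<in> D" "(i, j') \<in> D" "j < j'" for i j j'
    using row_chain[OF row that(1), of "j' - Suc j"] that(2,3) by simp
  have c: "T (i', j) \<le> T (i, j) \<and> (T (i', j) = T (i, j) \<longrightarrow> col (T (i, j)) \<noteq> 3)"
    if "(i, j) \<in> D" "(i', j) \<in> D" "i < i'" for i i' j
    using column_chain[OF zp that(1), of "i' - Suc i"] that(2,3) by simp
  have o: "T (i', j) < T (i, j)" if "(i, j) \<in> D" "(i', j) \<in> D" "i < i'" "T (i, j) \<in> {1..N}" for i i' j
    using c[OF that(1-3)] that(4) by (auto simp: entry_colour_def)
  have s: "T (i, j') < T (i, j)" if "(i, j) \<in> D" "(i, j') \<in> D" "j < j'" "T (i, j) \<in> {N+1..N+M}" for i j j'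
    using r[OF that(1-3)] that(4) by (auto simp: entry_colour_def)
  show ?thesis unfolding RSSYTT_def using T_PiE r c o s by blast
qed

text \<open>Moving the upper box one step to the right cannot increase its entry. If all three
  entries are equal, the tie in the row excludes super and the hypothesis excludes hyper, so they
  are ordinary; in every other case the vertical pair increases strictly.\<close>

lemma pole_covered:
  assumes row: "row_ok" and p: "(i, j) \<in> D" "(Suc i, Suc j) \<in> D"
    and T': "T (i, j) < T (Suc i, Suc j) \<or> T (i, j) = T (Suc i, Suc j) \<and> col (T (i, j)) \<noteq> 2"
  shows "((i, Suc j), (Suc i, Suc j)) \<in> zero_pairs"
proof -
  have i: "1 \<le> i" using p by (simp add: diagram_def)
  have B: "(i, Suc j) \<in> D" using diagram_up[OF p(2) i] by simp
  have "T (i, Suc j) \<le> T (i, j)" "T (i, Suc j) = T (i, j) \<Longrightarrow> col (T (i, j)) \<noteq> 1"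
    using row B p unfolding row_ok_def by auto
  then have "T (i, Suc j) < T (Suc i, Suc j) \<or> T (i, Suc j) = T (Suc i, Suc j) \<and> col (T (i, Suc j)) = 3"
    using T' colours_T[of "T (i, j)"] by (cases "T (i, Suc j) = T (i, j)") auto
  then show ?thesis using zero_pair_iff[of "(i, Suc j)" "(Suc i, Suc j)"] B p by (auto simp: zero_pairs_def)
qed

text \<open>Moving the lower box one step to the left cannot decrease its entry. Hence a vertical
  pair that is reached from a diagonal one has another vertical pair in the column before
  it.\<close>

lemma pole_left:
  assumes row: "row_ok" and p: "(i, j) \<in> D" "(Suc i, Suc j) \<in> D"
    and T': "T (i, j) < T (Suc i, Suc j) \<or> T (i, j) = T (Suc i, Suc j) \<and> col (T (i, j)) \<noteq> 2"
  shows "((i, j), (Suc i, j)) \<in> zero_pairs"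
proof -
  have j: "1 \<le> j" using p by (simp add: diagram_def)
  have F: "(Suc i, j) \<in> D" using box_left[OF p(2) j] by simp
  have "T (Suc i, Suc j) \<le> T (Suc i, j)" "T (Suc i, Suc j) = T (Suc i, j) \<Longrightarrow> col (T (Suc i, j)) \<noteq> 1"
    using row F p unfolding row_ok_def by auto
  then have "T (i, j) < T (Suc i, j) \<or> T (i, j) = T (Suc i, j) \<and> col (T (i, j)) = 3"
    using T' colours_T[of "T (i, j)"] by (cases "T (Suc i, Suc j) = T (Suc i, j)") auto
  then show ?thesis using zero_pair_iff[of "(i, j)" "(Suc i, j)"] F p by (auto simp: zero_pairs_def)
qed

lemma finite_pairs: "finite zero_pairs" "finite pole_pairs"
  using finite_box_pairs[OF part] by (auto simp: zero_pairs_def pole_pairs_def intro: finite_subset[rotated])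

text \<open>The diagonal pair with upper left box \<open>b\<close> is sent to the vertical pair with the same lower
  box. A leftmost vertical pair is not in the image.\<close>

lemma more_zeros:
  assumes row: "row_ok" and zp: "zero_pairs \<noteq> {}"
  shows "card pole_pairs < card zero_pairs"
proof -
  define \<phi> :: "(nat \<times> nat) \<times> nat \<times> nat \<Rightarrow> (nat \<times> nat) \<times> nat \<times> nat"
    where "\<phi> p = ((fst (fst p), snd (snd p)), snd p)" for p
  have pole: "\<exists>i j. p = ((i, j), (Suc i, Suc j)) \<and> (i, j) \<in> D \<and> (Suc i, Suc j) \<in> D \<and>
     (T (i, j) < T (Suc i, Suc j) \<or> T (i, j) = T (Suc i, Suc j) \<and> col (T (i, j)) \<noteq> 2)" if "p \<in> pole_pairs" for p
    using that pole_pair_iff[of "fst p" "snd p"] by (cases p) (auto simp: pole_pairs_def)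
  have inj: "inj_on \<phi> pole_pairs"
  proof (rule inj_onI)
    fix p p' assume p: "p \<in> pole_pairs" "p' \<in> pole_pairs" "\<phi> p = \<phi> p'"
    obtain i j where "p = ((i, j), (Suc i, Suc j))" using pole[OF p(1)] by blast
    moreover obtain i' j' where "p' = ((i', j'), (Suc i', Suc j'))" using pole[OF p(2)] by blast
    ultimately show "p = p'" using p(3) by (simp add: \<phi>_def)
  qed
  have sub: "\<phi> ` pole_pairs \<subseteq> zero_pairs"
  proof (rule image_subsetI)
    fix p assume "p \<in> pole_pairs"
    from pole[OF this] obtain i j where p: "p = ((i, j), (Suc i, Suc j))"
      and *: "(i, j) \<in> D" "(Suc i, Suc j) \<in> D" "T (i, j) < T (Suc i, Suc j) \<or> T (i, j) = T (Suc i, Suc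
          j) \<and> col (T (i, j)) \<noteq> 2"
      by blast
    show "\<phi> p \<in> zero_pairs" using pole_covered[OF row *] by (simp add: \<phi>_def p)
  qed
  obtain p0 where p0: "p0 \<in> zero_pairs" using zp by blast
  obtain z where z: "z \<in> zero_pairs" and least: "\<And>z'. z' \<in> zero_pairs \<Longrightarrow> snd (snd z) \<le> snd (snd z')"
    using ex_has_least_nat[of "\<lambda>z. z \<in> zero_pairs" p0 "\<lambda>z. snd (snd z)"] p0 by blast
  have "z \<notin> \<phi> ` pole_pairs"
  proof
    assume "z \<in> \<phi> ` pole_pairs"
    then obtain p where "p \<in> pole_pairs" and zp: "z = \<phi> p" by blast
    from pole[OF this(1)] obtain i j where p: "p = ((i, j), (Suc i, Suc j))"
      and *: "(i, j) \<in> D" "(Suc i, Suc j) \<in> D" "T (i, j) < T (Suc i, Suc j) \<or> T (i, j) = T (Suc i, Suc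
          j) \<and> col (T (i, j)) \<noteq> 2"
      by blast
    show False using least[OF pole_left[OF row *]] by (simp add: zp \<phi>_def p)
  qed
  then have "\<phi> ` pole_pairs \<subset> zero_pairs" using sub z by blast
  then have "card (\<phi> ` pole_pairs) < card zero_pairs" by (rule psubset_card_mono[OF finite_pairs(1)])
  then show ?thesis using card_image[OF inj] by simp
qed

text \<open>A diagonal pair of this kind would force equal entries in (i, j), (i, j + 1) and (i + 1,
  j + 1). Ordinary entries cannot repeat in the column and super entries cannot repeat in the row,
  and hyper is excluded.\<close>

lemma RSSYTT_pairs:
  assumes "T \<in> RSSYTT N M L lam" and bc: "(b, c) \<in> box_pairs lam"
  shows "\<not> zero_pair b c" "\<not> pole_pair b c" "drow b c = 0 \<Longrightarrow> T c \<le> T b"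
proof -
  interpret tritableau q t N M L lam T by unfold_locales (rule assms(1))
  show "\<not> zero_pair b c"
  proof
    assume "zero_pair b c"
    then obtain i j where *: "(i, j) \<in> D" "(Suc i, j) \<in> D" "T (i, j) < T (Suc i, j) \<or> T (i, j) = T (Suc
        i, j) \<and> col (T (i, j)) = 3"
      using zero_pair_iff bc by blast
    have "T (Suc i, j) \<le> T (i, j)" using T_column[OF *(1,2)] by simp
    then have eq: "T (i, j) = T (Suc i, j)" "col (T (i, j)) = 3" using *(3) by auto
    then have "T (i, j) \<in> {1..N}" using T_range[OF *(1)] by (auto simp: entry_colour_def split: if_splits)
    then show False using T_ordinary[OF *(1,2)] eq(1) by simp
  qed
  show "\<not> pole_pair b c"
  proof
    assume "pole_pair b c"
    then obtain i j where *: "(i, j) \<in> D" "(Suc i, Suc j) \<in> D"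
       "T (i, j) < T (Suc i, Suc j) \<or> T (i, j) = T (Suc i, Suc j) \<and> col (T (i, j)) \<noteq> 2"
      using pole_pair_iff bc by blast
    have i: "1 \<le> i" using *(1) by (simp add: diagram_def)
    have B: "(i, Suc j) \<in> D" using diagram_up[OF *(2) i] by simp
    have "T (i, Suc j) \<le> T (i, j)" "T (Suc i, Suc j) \<le> T (i, Suc j)"
      using T_row[OF *(1) B] T_column[OF B *(2)] by auto
    then have eq: "T (i, Suc j) = T (i, j)" "T (Suc i, Suc j) = T (i, j)" and c: "col (T (i, j)) \<noteq> 2"
        using *(3) by auto
    have "T (i, j) \<in> {1..N} \<or> T (i, j) \<in> {N+1..N+M}" using c T_range[OF *(1)] by (auto simp:
        entry_colour_def split: if_splits)
    then show False using T_ordinary[OF B *(2)] T_super[OF *(1) B] eq by auto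
  qed
  assume d: "drow b c = 0"
  obtain i j i' j' where bb: "b = (i, j)" "c = (i', j')" by (cases b, cases c)
  have "i = i'" "j < j'" "(i, j) \<in> D" "(i', j') \<in> D"
    using drow_dcol(1)[OF bc] d bc unfolding bb by (auto simp: box_pairs_def box_before_def)
  then show "T c \<le> T b" unfolding bb using T_row[of i j j'] by simp
qed

theorem weight_product_tendsto:
  assumes y: "y \<noteq> 0"
  shows "((\<lambda>\<xi>. \<Prod>(b, c)\<in>box_pairs lam. weight y b c \<xi>) \<longlongrightarrow>
    (if T \<in> RSSYTT N M L lam then \<Prod>(b, c)\<in>box_pairs lam. limit_weight b c else 0)) (at t_inv)"
proof (cases "T \<in> RSSYTT N M L lam")
  case True
  have "((\<lambda>\<xi>. \<Prod>p\<in>box_pairs lam. weight y (fst p) (snd p) \<xi>) \<longlongrightarrow> (\<Prod>p\<in>box_pairs lam. limit_weight (fst p)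
      (snd p))) (at t_inv)"
  proof (rule tendsto_prod)
    fix p assume p: "p \<in> box_pairs lam"
    then have bc: "(fst p, snd p) \<in> box_pairs lam" by simp
    show "(weight y (fst p) (snd p) \<longlongrightarrow> limit_weight (fst p) (snd p)) (at t_inv)"
      by (rule weight_tendsto[OF y bc RSSYTT_pairs[OF True bc]])
  qed
  then show ?thesis using True by (simp add: split_def)
next
  case False
  have "((\<lambda>\<xi>. \<Prod>(b, c)\<in>box_pairs lam. weight y b c \<xi>) \<longlongrightarrow> 0) (at t_inv)"
  proof (cases "row_ok")
    case False
    then obtain b c where bc: "(b, c) \<in> box_pairs lam" and ev: "eventually (\<lambda>\<xi>. weight y b c \<xi> = 0) (at t_inv)"
      using zero_weight[OF y] by blast
    from ev have "eventually (\<lambda>\<xi>. (\<Prod>(b, c)\<in>box_pairs lam. weight y b c \<xi>) = 0) (at t_inv)"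
    proof eventually_elim
      case (elim \<xi>)
      show ?case using elim bc finite_box_pairs[OF part] by (intro prod_zero bexI[of _ "(b, c)"]) simp_all
    qed
    then show ?thesis by (rule tendsto_eventually)
  next
    case True
    then have "zero_pairs \<noteq> {}" using RSSYTT_I False by blast
    then have less: "card pole_pairs < card zero_pairs" by (rule more_zeros[OF True])
    let ?v = "\<lambda>p \<xi>. weight y (fst p) (snd p) \<xi> * (if pole_pair (fst p) (snd p) then 1 - t * \<xi> else 1) /
        (if zero_pair (fst p) (snd p) then 1 - t * \<xi> else 1)"
    have "\<forall>p\<in>box_pairs lam. \<exists>l. (?v p \<longlongrightarrow> l) (at t_inv)"
    proof (rule ballI)
      fix p assume "p \<in> box_pairs lam"
      then have "(fst p, snd p) \<in> box_pairs lam" by simp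
      from conv_weight[OF y this] show "\<exists>l. (?v p \<longlongrightarrow> l) (at t_inv)" unfolding conv_def .
    qed
    from bchoice[OF this] obtain l where l: "\<forall>p\<in>box_pairs lam. (?v p \<longlongrightarrow> l p) (at t_inv)" ..
    \<comment> \<open>After normalization all pair factors converge, and a strictly positive power
      of 1 - t \<xi> is left over.\<close>
    have lim: "((\<lambda>\<xi>. (\<Prod>p\<in>box_pairs lam. ?v p \<xi>) * (1 - t * \<xi>) ^ (card zero_pairs - card pole_pairs)) \<longlongrightarrow>
        (\<Prod>p\<in>box_pairs lam. l p) * (1 - t * t_inv) ^ (card zero_pairs - card pole_pairs)) (at t_inv)"
      by (intro tendsto_mult tendsto_prod bspec[OF l] tendsto_power tendsto_diff tendsto_const tendsto_ident_at)
    have zero: "(1 - t * t_inv) ^ (card zero_pairs - card pole_pairs) = 0"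
      using less t_nonzero by simp
    have ev: "eventually (\<lambda>\<xi>. (\<Prod>(b, c)\<in>box_pairs lam. weight y b c \<xi>) =
        (\<Prod>p\<in>box_pairs lam. ?v p \<xi>) * (1 - t * \<xi>) ^ (card zero_pairs - card pole_pairs)) (at t_inv)"
      using critical_nonzero
    proof eventually_elim
      case (elim \<xi>)
      have fin: "finite (box_pairs lam)" by (rule finite_box_pairs[OF part])
      have Z: "(\<Prod>p\<in>box_pairs lam. if zero_pair (fst p) (snd p) then 1 - t * \<xi> else 1) = (1 - t * \<xi>) ^
          card zero_pairs"
      proof -
        have "zero_pairs = {p \<in> box_pairs lam. zero_pair (fst p) (snd p)}" by (auto simp: zero_pairs_def)
        then show ?thesis using fin by (simp add: prod.inter_filter[symmetric])
      qed
      have P: "(\<Prod>p\<in>box_pairs lam. if pole_pair (fst p) (snd p) then 1 - t * \<xi> else 1) = (1 - t * \<xi>) ^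
          card pole_pairs"
      proof -
        have "pole_pairs = {p \<in> box_pairs lam. pole_pair (fst p) (snd p)}" by (auto simp: pole_pairs_def)
        then show ?thesis using fin by (simp add: prod.inter_filter[symmetric])
      qed
      have "(1 - t * \<xi>) ^ card zero_pairs = (1 - t * \<xi>) ^ (card zero_pairs - card pole_pairs) * (1 - t *
          \<xi>) ^ card pole_pairs"
        using less by (simp flip: power_add)
      then show ?case unfolding prod_dividef prod.distrib Z P split_def using elim by simp
    qed
    show ?thesis unfolding tendsto_cong[OF ev] using lim unfolding zero mult_zero_right .
  qed
  then show ?thesis using False by simp
qed

end

theorem theorem4p3:
  fixes q t q4 t4 y :: complex
    and N M L k :: nat
    and cs :: "nat list"
    and u :: "nat \<Rightarrow> complex"
    and lam :: "nat \<Rightarrow> nat"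
  assumes "q \<noteq> 0" and "t \<noteq> 0"
    and generic: "\<And>a b :: int. q powi a * t powi b = 1 \<Longrightarrow> a = 0 \<and> b = 0"
    and roots: "q4 ^ 4 = q" "t4 ^ 4 = t"
    and cs: "cs = replicate N 3 @ replicate M 1 @ replicate L 2"
    and "inverse t ^ N * q ^ M * (inverse q * t) ^ L \<noteq> 1"
    and "\<And>i. i \<in> {1..N+M+L} \<Longrightarrow> u i \<noteq> 0"
    and "is_partition lam" and "psize lam = k"
    and "y \<noteq> 0"
  shows "((\<lambda>\<xi>. rf_eval2
            (Psi_tilde q lam (Norm_factor q4 t4 lam * rational_of (corr_series q4 t4 cs u k))) \<xi> y)
          \<longlongrightarrow> QC_poly N M L lam u
                (\<lambda>i. inverse (q4 ^ 2) * inverse (t4 ^ 2) * u (N + i))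
                (\<lambda>i. q4 ^ 2 * inverse t * u (N + M + i)) q t) (at (inverse t))"
proof -
  note part = \<open>is_partition lam\<close>
  have len: "length cs = N + M + L" by (simp add: cs)
  have col: "colour cs j = entry_colour N M j" if "j \<in> {1..N+M+L}" for j
    using that by (auto simp: colour_def entry_colour_def cs nth_append)
  have q40: "q4 \<noteq> 0" and t40: "t4 \<noteq> 0" using roots \<open>q \<noteq> 0\<close> \<open>t \<noteq> 0\<close> by auto
  have q4: "qpow q4 t4 1 4 = q" "qpow q4 t4 2 4 = inverse q * t" "qpow q4 t4 3 4 = inverse t"
    using roots by (auto simp: qpow_def power_mult_distrib power_inverse)
  have qc: "qc_pow q4 t4 cs 2 = inverse t ^ N * q ^ M * (inverse q * t) ^ L"
  proof -
    have "qc_pow q4 t4 cs 2 = (\<Prod>i<length cs. qpow q4 t4 (cs ! i) 4)"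
      unfolding qc_pow_def colour_def by (simp add: prod.atLeast1_atMost_eq)
    also have "\<dots> = prod_list (map (\<lambda>c. qpow q4 t4 c 4) cs)"
      by (simp add: prod.list_conv_set_nth atLeast0LessThan)
    also have "\<dots> = inverse t ^ N * q ^ M * (inverse q * t) ^ L"
      unfolding cs by (simp add: q4 q4(1)[simplified])
    finally show ?thesis .
  qed
  interpret generic_qt q t by unfold_locales (use assms in auto)
  interpret cor: corner q t q4 t4 cs
  proof unfold_locales
    fix j assume "j \<in> {1..length cs}"
    then show "colour cs j \<in> {1, 2, 3}" using col[of j] unfolding len by (auto simp: entry_colour_def)
  qed (use assms qc in auto)
  define E where "E = diagram lam \<rightarrow>\<^sub>E {1..N+M+L}"
  have finE: "finite E" unfolding E_def by (intro finite_PiE finite_diagram[OF part]) simp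
  have fill: "filling q t N M L lam T" if "T \<in> E" for T
    using that part unfolding E_def by unfold_locales
  \<comment> \<open>The variables of the polynomial, including the powers of q and t split off from
    the coefficients of the currents.\<close>
  define X where "X = (\<lambda>j. if j \<le> N then u j else if j \<le> N + M then inverse (q4 ^ 2) * inverse (t4 ^ 2) * u (N + (j - N))
     else q4 ^ 2 * inverse t * u (N + M + (j - (N + M))))"
  have weight: "cor.colour_weight j * u j = box_factor (entry_colour N M j) * X j" if j: "j \<in> {1..N+M+L}" for j
  proof -
    have t1: "t \<noteq> 1" using generic_powi[of 0 1] by auto
    have den: "qpow q4 t4 3 2 - qpow q4 t4 3 (- 2) = t4\<^sup>2 * (inverse t - 1)"
      using t40 roots(2)[symmetric] by (simp add: qpow_def power_int_minus field_simps)
    have nz: "t4\<^sup>2 * (inverse t - 1) \<noteq> 0" using t40 t1 by simp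
    have num1: "qpow q4 t4 1 2 - qpow q4 t4 1 (- 2) = inverse (q4\<^sup>2) * (q - 1)"
      using q40 roots(1)[symmetric] by (simp add: qpow_def power_int_minus field_simps)
    have num2: "qpow q4 t4 2 2 - qpow q4 t4 2 (- 2) = q4\<^sup>2 * inverse (t4\<^sup>2) * (t / q - 1)"
    proof -
      define a b where "a = q4\<^sup>2" and "b = t4\<^sup>2"
      have nz: "a \<noteq> 0" "b \<noteq> 0" and sq: "q = a * a" "t = b * b"
        using q40 t40 roots[symmetric] by (simp_all add: a_def b_def flip: power_add)
      have "qpow q4 t4 2 2 = inverse a * b" "qpow q4 t4 2 (- 2) = a * inverse b"
        by (simp_all add: qpow_def power_int_minus power_mult_distrib power_inverse a_def b_def)
      then show ?thesis unfolding a_def[symmetric] b_def[symmetric] sq using nz by (simp add: field_simps)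
    qed
    have it: "inverse t = inverse (t4\<^sup>2) * inverse (t4\<^sup>2)" unfolding roots(2)[symmetric] inverse_mult_distrib[symmetric] power_add[symmetric] by simp
    consider "j \<le> N" | "N < j" "j \<le> N + M" | "N + M < j" by linarith
    then show ?thesis
    proof cases
      case 1
      then have "entry_colour N M j = 3" by (simp add: entry_colour_def)
      then show ?thesis unfolding cor.colour_weight_def col[OF j] den using 1 nz by (simp add: den box_factor_def X_def)
    next
      case 2
      then have "entry_colour N M j = 1" by (simp add: entry_colour_def)
      then show ?thesis unfolding cor.colour_weight_def col[OF j] den using 2 by (simp add: num1[simplified] box_factor_def X_def divide_inverse mult_ac)
    next
      case 3
      then have "entry_colour N M j = 2" by (simp add: entry_colour_def)
      then show ?thesis unfolding cor.colour_weight_def col[OF j] den using 3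
        by (simp add: num2 box_factor_def X_def divide_inverse mult_ac) (simp add: it mult_ac)
    qed
  qed
  \<comment> \<open>The hypothesis q_c \<noteq> 1 excludes the empty colour vector, so that a
    filling exists for every shape.\<close>
  have "N + M + L \<noteq> 0"
  proof (rule notI)
    assume "N + M + L = 0"
    then have "N = 0" "M = 0" "L = 0" by auto
    with \<open>inverse t ^ N * q ^ M * (inverse q * t) ^ L \<noteq> 1\<close> show False by simp
  qed
  then have "(\<lambda>b\<in>diagram lam. 1) \<in> E" unfolding E_def by auto
  \<comment> \<open>A sample filling gives access to the facts about \<open>regular\<close>, which
    depend on the shape only and are used for all T in E.\<close>
  then interpret f0: filling q t N M L lam "\<lambda>b\<in>diagram lam. 1" by (rule fill)
  let ?w = "\<lambda>T \<xi>. \<Prod>(b, c)\<in>box_pairs lam. filling.weight q t N M T y b c \<xi>"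
  have ev: "eventually (\<lambda>\<xi>. rf_eval2 (Psi_tilde q lam (Norm_factor q4 t4 lam * rational_of (corr_series q4 t4 cs u k))) \<xi> y =
     (\<Sum>T\<in>E. (\<Prod>b\<in>diagram lam. box_factor (entry_colour N M (T b)) * X (T b)) * ?w T \<xi>)) (at (inverse t))"
    using f0.eventually_regular
  proof eventually_elim
    case (elim \<xi>)
    note reg = f0.regular_conditions[OF elim \<open>y \<noteq> 0\<close>]
    have corr: "rf_eval2 (Psi_tilde q lam (Norm_factor q4 t4 lam * rational_of (corr_series q4 t4 cs u (psize lam)))) \<xi> y =
      (\<Sum>T\<in>E. (\<Prod>b\<in>diagram lam. cor.colour_weight (T b) * u (T b)) *
        (\<Prod>(b, c)\<in>box_pairs lam. pair_value q t (colour cs) (T b) (T c) (box_value q \<xi> y c / box_value q \<xi> y b) *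
          (if fst b < fst c then inverse (norm_value q t (box_value q \<xi> y c / box_value q \<xi> y b)) else 1)))"
      unfolding E_def len[symmetric]
      by (rule cor.rf_eval2_correlation[OF part f0.regular_nonzero(1)[OF elim] \<open>y \<noteq> 0\<close>]) (fact reg)+
    show ?case unfolding \<open>psize lam = k\<close>[symmetric] corr
    proof (rule sum.cong[OF refl], rule arg_cong2[where f = "(*)"])
      fix T assume T: "T \<in> E"
      then have range: "T b \<in> {1..N+M+L}" if "b \<in> diagram lam" for b using that unfolding E_def by blast
      show "(\<Prod>b\<in>diagram lam. cor.colour_weight (T b) * u (T b)) =
          (\<Prod>b\<in>diagram lam. box_factor (entry_colour N M (T b)) * X (T b))"
        by (rule prod.cong[OF refl]) (rule weight[OF range])
      show "(\<Prod>(b, c)\<in>box_pairs lam. pair_value q t (colour cs) (T b) (T c) (box_value q \<xi> y c / box_value q \<xi> y b) *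
         (if fst b < fst c then inverse (norm_value q t (box_value q \<xi> y c / box_value q \<xi> y b)) else 1)) = ?w T \<xi>"
      proof (rule prod.cong[OF refl])
        fix p assume p: "p \<in> box_pairs lam"
        obtain b c where bc: "p = (b, c)" by (cases p)
        have "b \<in> diagram lam" using p bc by (simp add: box_pairs_def)
        then have "colour cs (T b) = entry_colour N M (T b)" by (intro col range)
        \<comment> \<open>\<open>pair_num\<close> consults the colour only for equal indices, and
          then only that of its first index, so agreement at T b is enough.\<close>
        then have "pair_value q t (colour cs) (T b) (T c) x = pair_value q t (entry_colour N M) (T b) (T c) x" for x
          by (simp add: pair_value_def pair_num_def)
        then show "(case p of (b, c) \<Rightarrow> pair_value q t (colour cs) (T b) (T c) (box_value q \<xi> y c / box_value q \<xi> y b) *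
           (if fst b < fst c then inverse (norm_value q t (box_value q \<xi> y c / box_value q \<xi> y b)) else 1)) =
           (case p of (b, c) \<Rightarrow> filling.weight q t N M T y b c \<xi>)"
          unfolding bc filling.weight_def[OF fill[OF T]] by simp
      qed
    qed
  qed
  have "((\<lambda>\<xi>. \<Sum>T\<in>E. (\<Prod>b\<in>diagram lam. box_factor (entry_colour N M (T b)) * X (T b)) * ?w T \<xi>) \<longlongrightarrow>
    (\<Sum>T\<in>E. (\<Prod>b\<in>diagram lam. box_factor (entry_colour N M (T b)) * X (T b)) *
      (if T \<in> RSSYTT N M L lam then \<Prod>(b, c)\<in>box_pairs lam. filling.limit_weight q t N M T b c else 0))) (at (inverse t))"
    by (intro tendsto_sum tendsto_mult tendsto_const filling.weight_product_tendsto[OF fill \<open>y \<noteq> 0\<close>])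
  also have "(\<Sum>T\<in>E. (\<Prod>b\<in>diagram lam. box_factor (entry_colour N M (T b)) * X (T b)) *
      (if T \<in> RSSYTT N M L lam then \<Prod>(b, c)\<in>box_pairs lam. filling.limit_weight q t N M T b c else 0)) =
    (\<Sum>T\<in>RSSYTT N M L lam. R_weight q t N M L lam T * (\<Prod>b\<in>diagram lam. X (T b)))"
  proof (rule sum.mono_neutral_cong_right[OF finE])
    show "RSSYTT N M L lam \<subseteq> E" unfolding RSSYTT_def E_def by blast
    fix T assume T: "T \<in> RSSYTT N M L lam"
    then have TE: "T \<in> E" unfolding RSSYTT_def E_def by blast
    have "tritableau q t N M L lam T"
      unfolding tritableau_def tritableau_axioms_def using fill[OF TE] T by blast
    note eq = tritableau.limit_product[OF this]
    show "(\<Prod>b\<in>diagram lam. box_factor (entry_colour N M (T b)) * X (T b)) *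
      (if T \<in> RSSYTT N M L lam then \<Prod>(b, c)\<in>box_pairs lam. filling.limit_weight q t N M T b c else 0) =
      R_weight q t N M L lam T * (\<Prod>b\<in>diagram lam. X (T b))"
      unfolding if_P[OF T] prod.distrib eq[symmetric] by (simp only: mult_ac)
  qed auto
  also have "\<dots> = QC_poly N M L lam u (\<lambda>i. inverse (q4 ^ 2) * inverse (t4 ^ 2) * u (N + i))
                (\<lambda>i. q4 ^ 2 * inverse t * u (N + M + i)) q t"
    unfolding QC_poly_def X_def by (rule refl)
  finally show ?thesis unfolding tendsto_cong[OF ev] .
qed

end
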